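(* Let $(X,\nu)$ be a standard Borel space with a continuous finite measure $\nu$, let $\Pi$ be a Borel measure on $\mathbb R$ with $\Pi(\{0\})=0$ and $\int_{\mathbb R}\frac{t^2}{1+t^2}\,d\Pi(t)<\infty$, and let $\eta_\Pi$ be the homogeneous Lévy process on $(X,\nu)$ with Lévy–Khintchin measure $\Pi$, without Gaussian component and drift. Let $\alpha^{L^2(\mathbb R,\Pi)}$ be the $L^2(\mathbb R,\Pi)$-valued Gaussian white noise on $(X,\nu)$, i.e. the Gaussian white noise on $(X\times\mathbb R,\nu\times\Pi)$. Then there exists a unity-preserving isometry (which is an isomorphism of Hilbert factorizations over $(X,\nu)$) $$\Phi:L^2(\alpha^{L^2(\mathbb R,\Pi)})\to L^2(\eta_\Pi).$$ On the set of multiplicative functionals it is given by the following formula: for each real-valued $h\in L^2(X\times\mathbb R,\nu\times\Pi)\cap L^1(X\times\mathbb R,\nu\times\Pi)$, $$\Phi:\quad e^{\langle h,\cdot\rangle-\frac{\|h\|^2}{2}}\ \mapsto\ \prod_i(1+h(x_i,t_i))\cdot e^{-\int_X\int_{\mathbb R}h(x,t)\,d\nu(x)\,d\Pi(t)},\qquad \eta=\sum_it_i\delta_{x_i}.$$ This is the unique real special vacuum-preserving isomorphism of Hilbert factorizations that acts identically on the space of values $L^2(\mathbb R,\Pi)$, i.e. that is an isomorphism of factorizations over $(X\times\mathbb R,\nu\times\Pi)$.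
   Context: Lévy process (process with independent values) on $(X,\nu)$: a generalized random process $a\mapsto\langle a,\cdot\rangle$ on the space of bounded measurable functions on $X$ such that $\langle a_1,\cdot\rangle$, $\langle a_2,\cdot\rangle$ are independent whenever $a_1a_2=0$ a.e. A homogeneous one has $\mathbb E e^{i\langle a,\cdot\rangle}=\exp\int_X\log\phi(a(x))\,d\nu(x)$ with $\log\phi(y)=icy-\frac{\sigma^2y^2}2+\int_{\mathbb R}\big(e^{ity}-1-\frac{ity}{1+t^2}\big)d\Pi(t)$; $\Pi$ is the Lévy–Khintchin measure, $\sigma^2$ the Gaussian variance, $c$ the drift; here $\sigma^2=0$, $c=0$. The process is recovered from its measure of jumps, which is the Poisson process on $X\times\mathbb R$ with mean measure $\nu\times\Pi$: a realization is encoded by the configuration $\{(x_i,t_i)\}$ of jumps $t_i$ at points $x_i$, symbolically $\eta=\sum_it_i\delta_{x_i}$. In this way $L^2(\eta_\Pi)$ is identified with the $L^2$ space over this Poisson process. Gaussian white noise on a measure space $(Y,\mu)$: the generalized random process on real $L^2(Y,\mu)$ with $\mathbb E e^{i\langle h,\cdot\rangle}=e^{-\|h\|^2/2}$. All $L^2$ spaces of functionals are complex; "unity-preserving" and "vacuum-preserving" mean $1\mapsto1$. Hilbert factorization over a measure space $(Y,\mu)$: a map $\xi$ from the Boolean algebra of mod 0 classes of measurable subsets of $Y$ to von Neumann algebras on a Hilbert space $\mathcal H$ such that each $\xi(A)$ is a type I factor, $\xi(A_1\cap A_2)=\xi(A_1)\cap\xi(A_2)$, $\xi(A_1\cup A_2)=(\xi(A_1)\cup\xi(A_2))''$,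 $\xi(Y\setminus A)=\xi(A)'$, $\xi(\emptyset)=\mathbb C\cdot\mathrm{Id}$, $\xi(Y)=\mathcal B(\mathcal H)$. For the $L^2$ space over a process with independent values on $Y$, the generated factorization is $\xi(A)=\mathcal B(H_A)\otimes 1_{H_{Y\setminus A}}$, where $H_A$ is the subspace of functionals depending only on the restriction of the process to $A$ and $1_H$ is the algebra of scalar operators on $H$. Both spaces above carry such factorizations over $(X\times\mathbb R,\nu\times\Pi)$ and, by restricting to sets of the form $A\times\mathbb R$, over $(X,\nu)$. A special isomorphism of Hilbert factorizations over the same base is a surjective linear isometry $T$ with $T\xi_1(A)T^{-1}=\xi_2(A)$ for all $A$; it is real if it sends real-valued functionals onto real-valued functionals. A functional is multiplicative if for every finite measurable partition of the base it is a product of functionals depending only on the restrictions of the process to the parts.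
   Formalization: Uniqueness is among isomorphisms over X acting identically on values in the first chaos (each 1_A⊗f goes to its centred jump sum); being an isomorphism over X×R alone does not give uniqueness, since composing Φ with the sign change h→−h gives another one. *)

theory Defs
  imports "HOL-Probability.Probability"
begin

section \<open>Base spaces and square-integrable functions\<close>

definition standard_borel :: "'x measure \<Rightarrow> bool" where
  "standard_borel M \<longleftrightarrow>
     (\<exists>T. completely_metrizable_space T \<and> second_countable T \<and> topspace T = space M
        \<and> sets M = sigma_sets (topspace T) {U. openin T U})"

definition continuous_measure :: "'x measure \<Rightarrow> bool" where
  "continuous_measure M \<longleftrightarrow> (\<forall>x\<in>space M. {x} \<in> sets M \<and> emeasure M {x} = 0)"

text \<open>
  Elements of an $L^2$ space are represented by functions. Two functions represent the same
  element when they are related by \<open>aeq\<close>, and all identities between elements of $L^2$ spaces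
  below are identities modulo \<open>aeq\<close>.
\<close>

definition aeq :: "'w measure \<Rightarrow> ('w \<Rightarrow> 'b) \<Rightarrow> ('w \<Rightarrow> 'b) \<Rightarrow> bool" where
  "aeq M f g \<longleftrightarrow> (AE \<omega> in M. f \<omega> = g \<omega>)"

definition L2 :: "'w measure \<Rightarrow> ('w \<Rightarrow> 'b::real_normed_vector) set" where
  "L2 M = {f \<in> borel_measurable M. integrable M (\<lambda>\<omega>. (norm (f \<omega>))\<^sup>2)}"

definition L2_norm :: "'w measure \<Rightarrow> ('w \<Rightarrow> 'b::real_normed_vector) \<Rightarrow> real" where
  "L2_norm M f = sqrt (LINT \<omega>|M. (norm (f \<omega>))\<^sup>2)"

definition L2_inner :: "'w measure \<Rightarrow> ('w \<Rightarrow> complex) \<Rightarrow> ('w \<Rightarrow> complex) \<Rightarrow> complex" where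
  "L2_inner M f g = (LINT \<omega>|M. cnj (f \<omega>) * g \<omega>)"

section \<open>Operator algebras on spaces of functionals\<close>

text \<open>
  Below, \<open>H\<close> is a space of complex functionals on the probability space \<open>M\<close>, namely a closed
  subspace of $L^2(M)$ that is stable under \<open>aeq\<close>. An operator is constrained on \<open>H\<close> only, up to
  \<open>aeq\<close>, so the sets of operators defined here contain with an operator every other
  representative of it. In particular equality of such sets is equality of algebras.
\<close>

definition linear_on :: "'v measure \<Rightarrow> ('w \<Rightarrow> complex) set \<Rightarrow> (('w \<Rightarrow> complex) \<Rightarrow> ('v \<Rightarrow> complex)) \<Rightarrow> bool" where
  "linear_on M H S \<longleftrightarrow>
     (\<forall>f\<in>H. \<forall>g\<in>H. \<forall>a b. aeq M (S (\<lambda>\<omega>. a * f \<omega> + b * g \<omega>)) (\<lambda>\<omega>. a * S f \<omega> + b * S g \<omega>))"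

definition op_eq :: "'w measure \<Rightarrow> ('w \<Rightarrow> complex) set \<Rightarrow> (('w \<Rightarrow> complex) \<Rightarrow> ('w \<Rightarrow> complex))
    \<Rightarrow> (('w \<Rightarrow> complex) \<Rightarrow> ('w \<Rightarrow> complex)) \<Rightarrow> bool" where
  "op_eq M H S T \<longleftrightarrow> (\<forall>f\<in>H. aeq M (S f) (T f))"

definition bounded_ops :: "'w measure \<Rightarrow> ('w \<Rightarrow> complex) set \<Rightarrow> (('w \<Rightarrow> complex) \<Rightarrow> ('w \<Rightarrow> complex)) set" where
  "bounded_ops M H =
     {S. (\<forall>f\<in>H. S f \<in> H) \<and> linear_on M H S \<and> (\<exists>C. \<forall>f\<in>H. L2_norm M (S f) \<le> C * L2_norm M f)}"

definition scalar_ops :: "'w measure \<Rightarrow> ('w \<Rightarrow> complex) set \<Rightarrow> (('w \<Rightarrow> complex) \<Rightarrow> ('w \<Rightarrow> complex)) set" where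
  "scalar_ops M H = {S \<in> bounded_ops M H. \<exists>c. op_eq M H S (\<lambda>f \<omega>. c * f \<omega>)}"

definition commutant :: "'w measure \<Rightarrow> ('w \<Rightarrow> complex) set \<Rightarrow> (('w \<Rightarrow> complex) \<Rightarrow> ('w \<Rightarrow> complex)) set
    \<Rightarrow> (('w \<Rightarrow> complex) \<Rightarrow> ('w \<Rightarrow> complex)) set" where
  "commutant M H \<A> = {T \<in> bounded_ops M H. \<forall>S\<in>\<A>. op_eq M H (S \<circ> T) (T \<circ> S)}"

definition adjoint_ops :: "'w measure \<Rightarrow> ('w \<Rightarrow> complex) set \<Rightarrow> (('w \<Rightarrow> complex) \<Rightarrow> ('w \<Rightarrow> complex))
    \<Rightarrow> (('w \<Rightarrow> complex) \<Rightarrow> ('w \<Rightarrow> complex)) \<Rightarrow> bool" where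
  "adjoint_ops M H S T \<longleftrightarrow> (\<forall>f\<in>H. \<forall>g\<in>H. L2_inner M (S f) g = L2_inner M f (T g))"

definition von_neumann_algebra :: "'w measure \<Rightarrow> ('w \<Rightarrow> complex) set
    \<Rightarrow> (('w \<Rightarrow> complex) \<Rightarrow> ('w \<Rightarrow> complex)) set \<Rightarrow> bool" where
  "von_neumann_algebra M H \<A> \<longleftrightarrow>
     \<A> \<subseteq> bounded_ops M H
     \<and> (\<forall>S\<in>\<A>. \<forall>T\<in>bounded_ops M H. adjoint_ops M H S T \<longrightarrow> T \<in> \<A>)
     \<and> commutant M H (commutant M H \<A>) = \<A>"

definition projection_op :: "'w measure \<Rightarrow> ('w \<Rightarrow> complex) set \<Rightarrow> (('w \<Rightarrow> complex) \<Rightarrow> ('w \<Rightarrow> complex)) \<Rightarrow> bool" where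
  "projection_op M H p \<longleftrightarrow> p \<in> bounded_ops M H \<and> adjoint_ops M H p p \<and> op_eq M H (p \<circ> p) p"

definition minimal_projection :: "'w measure \<Rightarrow> ('w \<Rightarrow> complex) set
    \<Rightarrow> (('w \<Rightarrow> complex) \<Rightarrow> ('w \<Rightarrow> complex)) set \<Rightarrow> (('w \<Rightarrow> complex) \<Rightarrow> ('w \<Rightarrow> complex)) \<Rightarrow> bool" where
  "minimal_projection M H \<A> p \<longleftrightarrow>
     p \<in> \<A> \<and> projection_op M H p \<and> \<not> op_eq M H p (\<lambda>f \<omega>. 0)
     \<and> (\<forall>q\<in>\<A>. projection_op M H q \<and> op_eq M H (p \<circ> q) q
           \<longrightarrow> op_eq M H q (\<lambda>f \<omega>. 0) \<or> op_eq M H q p)"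

text \<open>A factor is of type I if and only if it contains a minimal projection.\<close>

definition type_I_factor :: "'w measure \<Rightarrow> ('w \<Rightarrow> complex) set
    \<Rightarrow> (('w \<Rightarrow> complex) \<Rightarrow> ('w \<Rightarrow> complex)) set \<Rightarrow> bool" where
  "type_I_factor M H \<A> \<longleftrightarrow>
     von_neumann_algebra M H \<A>
     \<and> \<A> \<inter> commutant M H \<A> = scalar_ops M H
     \<and> (\<exists>p. minimal_projection M H \<A> p)"

section \<open>Hilbert factorizations and their isomorphisms\<close>

text \<open>
  The second clause says that \<open>\<xi>\<close> is defined on the Boolean algebra of mod 0 classes of
  measurable subsets of the base \<open>\<mu>\<close>.
\<close>

definition Hilbert_factorization :: "'y measure \<Rightarrow> 'w measure \<Rightarrow> ('w \<Rightarrow> complex) set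
    \<Rightarrow> ('y set \<Rightarrow> (('w \<Rightarrow> complex) \<Rightarrow> ('w \<Rightarrow> complex)) set) \<Rightarrow> bool" where
  "Hilbert_factorization \<mu> M H \<xi> \<longleftrightarrow>
     (\<forall>A\<in>sets \<mu>. type_I_factor M H (\<xi> A))
     \<and> (\<forall>A\<in>sets \<mu>. \<forall>B\<in>sets \<mu>. emeasure \<mu> ((A - B) \<union> (B - A)) = 0 \<longrightarrow> \<xi> A = \<xi> B)
     \<and> (\<forall>A\<in>sets \<mu>. \<forall>B\<in>sets \<mu>. \<xi> (A \<inter> B) = \<xi> A \<inter> \<xi> B)
     \<and> (\<forall>A\<in>sets \<mu>. \<forall>B\<in>sets \<mu>. \<xi> (A \<union> B) = commutant M H (commutant M H (\<xi> A \<union> \<xi> B)))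
     \<and> (\<forall>A\<in>sets \<mu>. \<xi> (space \<mu> - A) = commutant M H (\<xi> A))
     \<and> \<xi> {} = scalar_ops M H
     \<and> \<xi> (space \<mu>) = bounded_ops M H"

definition surjective_isometry :: "'w measure \<Rightarrow> ('w \<Rightarrow> complex) set \<Rightarrow> 'v measure \<Rightarrow> ('v \<Rightarrow> complex) set
    \<Rightarrow> (('w \<Rightarrow> complex) \<Rightarrow> ('v \<Rightarrow> complex)) \<Rightarrow> bool" where
  "surjective_isometry M\<^sub>1 H\<^sub>1 M\<^sub>2 H\<^sub>2 T \<longleftrightarrow>
     (\<forall>f\<in>H\<^sub>1. T f \<in> H\<^sub>2) \<and> linear_on M\<^sub>2 H\<^sub>1 T
     \<and> (\<forall>f\<in>H\<^sub>1. L2_norm M\<^sub>2 (T f) = L2_norm M\<^sub>1 f)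
     \<and> (\<forall>g\<in>H\<^sub>2. \<exists>f\<in>H\<^sub>1. aeq M\<^sub>2 (T f) g)"

text \<open>The set $T \mathcal{A} T^{-1}$ for a surjective isometry \<open>T\<close>.\<close>

definition conjugate_algebra :: "('w \<Rightarrow> complex) set \<Rightarrow> 'v measure \<Rightarrow> ('v \<Rightarrow> complex) set
    \<Rightarrow> (('w \<Rightarrow> complex) \<Rightarrow> ('v \<Rightarrow> complex)) \<Rightarrow> (('w \<Rightarrow> complex) \<Rightarrow> ('w \<Rightarrow> complex)) set
    \<Rightarrow> (('v \<Rightarrow> complex) \<Rightarrow> ('v \<Rightarrow> complex)) set" where
  "conjugate_algebra H\<^sub>1 M\<^sub>2 H\<^sub>2 T \<A> =
     {S' \<in> bounded_ops M\<^sub>2 H\<^sub>2. \<exists>S\<in>\<A>. \<forall>f\<in>H\<^sub>1. aeq M\<^sub>2 (S' (T f)) (T (S f))}"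

definition special_isomorphism :: "'y measure
    \<Rightarrow> 'w measure \<Rightarrow> ('w \<Rightarrow> complex) set \<Rightarrow> ('y set \<Rightarrow> (('w \<Rightarrow> complex) \<Rightarrow> ('w \<Rightarrow> complex)) set)
    \<Rightarrow> 'v measure \<Rightarrow> ('v \<Rightarrow> complex) set \<Rightarrow> ('y set \<Rightarrow> (('v \<Rightarrow> complex) \<Rightarrow> ('v \<Rightarrow> complex)) set)
    \<Rightarrow> (('w \<Rightarrow> complex) \<Rightarrow> ('v \<Rightarrow> complex)) \<Rightarrow> bool" where
  "special_isomorphism \<mu> M\<^sub>1 H\<^sub>1 \<xi>\<^sub>1 M\<^sub>2 H\<^sub>2 \<xi>\<^sub>2 T \<longleftrightarrow>
     Hilbert_factorization \<mu> M\<^sub>1 H\<^sub>1 \<xi>\<^sub>1 \<and> Hilbert_factorization \<mu> M\<^sub>2 H\<^sub>2 \<xi>\<^sub>2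
     \<and> surjective_isometry M\<^sub>1 H\<^sub>1 M\<^sub>2 H\<^sub>2 T
     \<and> (\<forall>A\<in>sets \<mu>. conjugate_algebra H\<^sub>1 M\<^sub>2 H\<^sub>2 T (\<xi>\<^sub>1 A) = \<xi>\<^sub>2 A)"

definition unity_preserving :: "'v measure \<Rightarrow> (('w \<Rightarrow> complex) \<Rightarrow> ('v \<Rightarrow> complex)) \<Rightarrow> bool" where
  "unity_preserving M\<^sub>2 T \<longleftrightarrow> aeq M\<^sub>2 (T (\<lambda>\<omega>. 1)) (\<lambda>\<omega>. 1)"

definition real_valued :: "'w measure \<Rightarrow> ('w \<Rightarrow> complex) \<Rightarrow> bool" where
  "real_valued M f \<longleftrightarrow> (AE \<omega> in M. f \<omega> \<in> \<real>)"

definition real_isomorphism :: "'w measure \<Rightarrow> ('w \<Rightarrow> complex) set \<Rightarrow> 'v measure \<Rightarrow> ('v \<Rightarrow> complex) set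
    \<Rightarrow> (('w \<Rightarrow> complex) \<Rightarrow> ('v \<Rightarrow> complex)) \<Rightarrow> bool" where
  "real_isomorphism M\<^sub>1 H\<^sub>1 M\<^sub>2 H\<^sub>2 T \<longleftrightarrow>
     (\<forall>f\<in>H\<^sub>1. real_valued M\<^sub>1 f \<longrightarrow> real_valued M\<^sub>2 (T f))
     \<and> (\<forall>g\<in>H\<^sub>2. real_valued M\<^sub>2 g \<longrightarrow> (\<exists>f\<in>H\<^sub>1. real_valued M\<^sub>1 f \<and> aeq M\<^sub>2 (T f) g))"

section \<open>Functionals of a process and the generated factorization\<close>

text \<open>
  A process on a base with underlying set \<open>Y\<close> enters through the sigma-algebras \<open>loc A\<close>
  generated by its restrictions to the subsets \<open>A\<close> of \<open>Y\<close>.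
\<close>

definition local_functionals :: "'w measure \<Rightarrow> ('y set \<Rightarrow> 'w measure) \<Rightarrow> 'y set \<Rightarrow> ('w \<Rightarrow> complex) set" where
  "local_functionals M loc A =
     {f \<in> borel_measurable M. \<exists>g\<in>borel_measurable (loc A). aeq M f g}"

definition local_L2 :: "'w measure \<Rightarrow> ('y set \<Rightarrow> 'w measure) \<Rightarrow> 'y set \<Rightarrow> ('w \<Rightarrow> complex) set" where
  "local_L2 M loc A = L2 M \<inter> local_functionals M loc A"

text \<open>
  The algebra $\mathcal{B}(H_A) \otimes 1$, where the tensor product $F \otimes G$ of
  $F \in H_A$ and $G \in H_{Y \setminus A}$ is the product functional $F G$.
\<close>

definition generated_factorization :: "'y set \<Rightarrow> 'w measure \<Rightarrow> ('y set \<Rightarrow> 'w measure) \<Rightarrow> 'y set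
    \<Rightarrow> (('w \<Rightarrow> complex) \<Rightarrow> ('w \<Rightarrow> complex)) set" where
  "generated_factorization Y M loc A =
     {S \<in> bounded_ops M (local_L2 M loc Y). \<exists>R\<in>bounded_ops M (local_L2 M loc A).
        \<forall>F\<in>local_L2 M loc A. \<forall>G\<in>local_L2 M loc (Y - A).
          aeq M (S (\<lambda>\<omega>. F \<omega> * G \<omega>)) (\<lambda>\<omega>. R F \<omega> * G \<omega>)}"

definition multiplicative_functional :: "'y measure \<Rightarrow> 'w measure \<Rightarrow> ('y set \<Rightarrow> 'w measure)
    \<Rightarrow> ('w \<Rightarrow> complex) \<Rightarrow> bool" where
  "multiplicative_functional \<mu> M loc F \<longleftrightarrow>
     (\<forall>\<P>. finite \<P> \<and> \<P> \<subseteq> sets \<mu> \<and> partition_on (space \<mu>) \<P> \<longrightarrow>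
        (\<exists>K. (\<forall>A\<in>\<P>. K A \<in> local_functionals M loc A) \<and> aeq M F (\<lambda>\<omega>. \<Prod>A\<in>\<P>. K A \<omega>)))"

section \<open>Gaussian white noise\<close>

definition gaussian_white_noise :: "'y measure \<Rightarrow> 'w measure \<Rightarrow> (('y \<Rightarrow> real) \<Rightarrow> 'w \<Rightarrow> real) \<Rightarrow> bool" where
  "gaussian_white_noise \<mu> M W \<longleftrightarrow>
     prob_space M
     \<and> (\<forall>h\<in>L2 \<mu>. W h \<in> borel_measurable M)
     \<and> (\<forall>h\<in>L2 \<mu>. \<forall>k\<in>L2 \<mu>. \<forall>a b.
          aeq M (W (\<lambda>y. a * h y + b * k y)) (\<lambda>\<omega>. a * W h \<omega> + b * W k \<omega>))
     \<and> (\<forall>h\<in>L2 \<mu>. (LINT \<omega>|M. exp (\<i> * complex_of_real (W h \<omega>)))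
          = complex_of_real (exp (- (L2_norm \<mu> h)\<^sup>2 / 2)))"

definition gaussian_loc :: "'y measure \<Rightarrow> 'w measure \<Rightarrow> (('y \<Rightarrow> real) \<Rightarrow> 'w \<Rightarrow> real)
    \<Rightarrow> 'y set \<Rightarrow> 'w measure" where
  "gaussian_loc \<mu> M W A = sigma (space M)
     {W h -` B \<inter> space M | h B. h \<in> L2 \<mu> \<and> (\<forall>y\<in>space \<mu> - A. h y = 0) \<and> B \<in> sets borel}"

section \<open>Poisson and Levy processes\<close>

text \<open>
  A realization of a Poisson process with non-atomic mean measure is a set of points, \<open>N \<omega>\<close>;
  the number of its points in \<open>A\<close> has the Poisson distribution with parameter \<open>\<mu> A\<close>. The clause
  on finiteness is needed because \<open>card\<close> is 0 on infinite sets.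
\<close>

definition poisson_process :: "'y measure \<Rightarrow> 'w measure \<Rightarrow> ('w \<Rightarrow> 'y set) \<Rightarrow> bool" where
  "poisson_process \<mu> M N \<longleftrightarrow>
     prob_space M
     \<and> (\<forall>\<omega>\<in>space M. N \<omega> \<subseteq> space \<mu>)
     \<and> (\<forall>A\<in>sets \<mu>. emeasure \<mu> A < \<infinity> \<longrightarrow>
          (AE \<omega> in M. finite (N \<omega> \<inter> A))
          \<and> (\<lambda>\<omega>. card (N \<omega> \<inter> A)) \<in> measurable M (count_space UNIV)
          \<and> (\<forall>k. measure M {\<omega> \<in> space M. card (N \<omega> \<inter> A) = k}
               = exp (- measure \<mu> A) * measure \<mu> A ^ k / fact k))
     \<and> (\<forall>(A :: nat \<Rightarrow> 'y set) n. (\<forall>i<n. A i \<in> sets \<mu> \<and> emeasure \<mu> (A i) < \<infinity>)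
          \<and> disjoint_family_on A {..<n} \<longrightarrow>
          prob_space.indep_vars M (\<lambda>_. count_space UNIV) (\<lambda>i \<omega>. card (N \<omega> \<inter> A i)) {..<n})"

definition poisson_loc :: "'y measure \<Rightarrow> 'w measure \<Rightarrow> ('w \<Rightarrow> 'y set) \<Rightarrow> 'y set \<Rightarrow> 'w measure" where
  "poisson_loc \<mu> M N A = sigma (space M)
     {{\<omega> \<in> space M. card (N \<omega> \<inter> B) = k} | B k. B \<in> sets \<mu> \<and> B \<subseteq> A \<and> emeasure \<mu> B < \<infinity>}"

definition levy_exponent :: "real \<Rightarrow> real \<Rightarrow> real measure \<Rightarrow> real \<Rightarrow> complex" where
  "levy_exponent c v \<Lambda> y = \<i> * complex_of_real (c * y) - complex_of_real (v * y\<^sup>2 / 2)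
     + (LINT t|\<Lambda>. exp (\<i> * complex_of_real (t * y)) - 1
          - \<i> * complex_of_real (t * y / (1 + t\<^sup>2)))"

definition bounded_measurable :: "'x measure \<Rightarrow> ('x \<Rightarrow> real) set" where
  "bounded_measurable M = {a \<in> borel_measurable M. \<exists>C. \<forall>x\<in>space M. \<bar>a x\<bar> \<le> C}"

definition homogeneous_levy_process :: "real \<Rightarrow> real \<Rightarrow> real measure \<Rightarrow> 'x measure \<Rightarrow> 'w measure
    \<Rightarrow> (('x \<Rightarrow> real) \<Rightarrow> 'w \<Rightarrow> real) \<Rightarrow> bool" where
  "homogeneous_levy_process c v \<Lambda> \<nu> M \<eta> \<longleftrightarrow>
     prob_space M
     \<and> (\<forall>a\<in>bounded_measurable \<nu>. \<eta> a \<in> borel_measurable M)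
     \<and> (\<forall>a\<in>bounded_measurable \<nu>. \<forall>b\<in>bounded_measurable \<nu>. \<forall>r s.
          aeq M (\<eta> (\<lambda>x. r * a x + s * b x)) (\<lambda>\<omega>. r * \<eta> a \<omega> + s * \<eta> b \<omega>))
     \<and> (\<forall>a\<in>bounded_measurable \<nu>. \<forall>b\<in>bounded_measurable \<nu>.
          (AE x in \<nu>. a x * b x = 0) \<longrightarrow> prob_space.indep_var M borel (\<eta> a) borel (\<eta> b))
     \<and> (\<forall>a\<in>bounded_measurable \<nu>. (LINT \<omega>|M. exp (\<i> * complex_of_real (\<eta> a \<omega>)))
          = exp (LINT x|\<nu>. levy_exponent c v \<Lambda> (a x)))"

text \<open>
  \<open>N\<close> is the configuration of jumps of the process \<open>\<eta>\<close> with zero drift and no Gaussian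
  component: symbolically, \<open>\<eta>\<close> is the sum of \<open>t \<delta>\<^sub>x\<close> over the points \<open>(x, t)\<close> of \<open>N\<close>. For a
  general Levy measure the sum has to be compensated, and the compensator
  \<open>t / (1 + t\<^sup>2)\<close> is dictated by the normalization in \<open>levy_exponent\<close>. The limit is a limit
  in probability; the exceptional events \<open>E\<close> make it independent of the values on null sets.
\<close>

definition jump_configuration :: "real measure \<Rightarrow> 'x measure \<Rightarrow> 'w measure
    \<Rightarrow> (('x \<Rightarrow> real) \<Rightarrow> 'w \<Rightarrow> real) \<Rightarrow> ('w \<Rightarrow> ('x \<times> real) set) \<Rightarrow> bool" where
  "jump_configuration \<Lambda> \<nu> M \<eta> N \<longleftrightarrow>
     poisson_process (\<nu> \<Otimes>\<^sub>M \<Lambda>) M N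
     \<and> (\<forall>a\<in>bounded_measurable \<nu>. \<forall>\<epsilon>>0. \<forall>\<^sub>F \<delta> in at_right 0.
          \<exists>E\<in>sets M. measure M E < \<epsilon> \<and>
            (\<forall>\<omega>\<in>space M - E.
               \<bar>(\<Sum>(x, t)\<in>{(x, t) \<in> N \<omega>. \<bar>t\<bar> > \<delta>}. a x * t)
                - (LINT x|\<nu>. a x) * (LINT t|\<Lambda>. indicator {t. \<bar>t\<bar> > \<delta>} t * (t / (1 + t\<^sup>2)))
                - \<eta> a \<omega>\<bar> \<le> \<epsilon>))"

text \<open>The product of \<open>f\<close> over a possibly infinite set, as an unconditional limit.\<close>

definition config_prod :: "'y set \<Rightarrow> ('y \<Rightarrow> real) \<Rightarrow> real" where
  "config_prod S f = Lim (finite_subsets_at_top S) (\<lambda>F. \<Prod>y\<in>F. f y)"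

section \<open>The Gaussian and Poisson exponentials; the space of values\<close>

definition gaussian_exponential :: "'y measure \<Rightarrow> (('y \<Rightarrow> real) \<Rightarrow> 'w \<Rightarrow> real) \<Rightarrow> ('y \<Rightarrow> real) \<Rightarrow> 'w \<Rightarrow> complex" where
  "gaussian_exponential \<mu> W h = (\<lambda>\<omega>. complex_of_real (exp (W h \<omega> - (L2_norm \<mu> h)\<^sup>2 / 2)))"

definition poisson_exponential :: "'x measure \<Rightarrow> real measure \<Rightarrow> ('w \<Rightarrow> ('x \<times> real) set)
    \<Rightarrow> ('x \<times> real \<Rightarrow> real) \<Rightarrow> 'w \<Rightarrow> complex" where
  "poisson_exponential \<nu> \<Lambda> N h = (\<lambda>\<omega>. complex_of_real
     (config_prod (N \<omega>) (\<lambda>(x, t). 1 + h (x, t)) * exp (- (LINT x|\<nu>. LINT t|\<Lambda>. h (x, t)))))"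

text \<open>
  Both processes have the one-particle space $L^2(X, \nu; L^2(\mathbb{R}, \Lambda))$: a real
  one-particle vector \<open>h\<close> corresponds to \<open>W h\<close> on the Gaussian side and to the sum of \<open>h\<close> over the
  configuration minus its expectation on the Poisson side. \<open>T\<close> acts identically on the space of
  values $L^2(\mathbb{R}, \Lambda)$ if it preserves the value \<open>f\<close> of the vector function that
  is \<open>f\<close> on \<open>A\<close> and 0 elsewhere. Integrability of \<open>f\<close> lets the centred sum be written
  without an $L^2$ limit; such \<open>f\<close> are dense in $L^2(\mathbb{R}, \Lambda)$.
\<close>

definition identical_on_values :: "'x measure \<Rightarrow> real measure \<Rightarrow> (('x \<times> real \<Rightarrow> real) \<Rightarrow> 'w \<Rightarrow> real)
    \<Rightarrow> 'v measure \<Rightarrow> ('v \<Rightarrow> ('x \<times> real) set) \<Rightarrow> (('w \<Rightarrow> complex) \<Rightarrow> ('v \<Rightarrow> complex)) \<Rightarrow> bool" where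
  "identical_on_values \<nu> \<Lambda> W M\<^sub>2 N T \<longleftrightarrow>
     (\<forall>f\<in>L2 \<Lambda>. \<forall>A\<in>sets \<nu>. integrable \<Lambda> f \<longrightarrow>
        aeq M\<^sub>2 (T (\<lambda>\<omega>. complex_of_real (W (\<lambda>(x, t). indicator A x * f t) \<omega>)))
          (\<lambda>\<omega>. complex_of_real
             ((\<Sum>\<^sub>\<infinity>(x, t)\<in>N \<omega>. indicator A x * f t) - measure \<nu> A * (LINT t|\<Lambda>. f t))))"

end

theory Submission
  imports Defs
begin

text \<open>
  On both sides the exponentials \<open>e h\<close> of the step functions \<open>h\<close> on the base are total in the space
  of functionals, have the inner products \<open>exp (\<integral> h k)\<close>, and turn sums of functions with disjoint
  supports into products of independent local functionals. Hence \<open>e h \<mapsto> e' h\<close> extends to a unitary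
  operator \<open>\<Phi>\<close> that is multiplicative on local functionals with disjoint supports, and so conjugates
  the two algebras over each set \<open>A\<close> into each other.

  Uniqueness: a special isomorphism \<open>T\<close> over \<open>\<nu>\<close> that preserves the unity is multiplicative along
  every partition of the base into sets \<open>A \<times> \<real>\<close>, and the values determine \<open>T\<close> on the first chaos.
  Therefore the inner product of \<open>T (e h)\<close> and \<open>\<Phi> (e h)\<close> is a product over such a partition whose
  factors are \<open>exp (\<parallel>h\<^sub>A\<parallel>\<^sup>2)\<close> up to an error of fourth order in \<open>\<parallel>h\<^sub>A\<parallel>\<close>, where \<open>h\<^sub>A\<close> is the part of
  \<open>h\<close> over \<open>A\<close>. As \<open>\<nu>\<close> has no atoms, the errors vanish along fine partitions, and the inner product
  is \<open>exp (\<parallel>h\<parallel>\<^sup>2)\<close>, which is the squared norm of both functionals.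
\<close>

section \<open>Functions modulo null sets\<close>

text \<open>No tensor product of Hilbert spaces is built. Pointwise multiplication stands in for it:
  by independence \<open>F * G\<close> behaves like a pure tensor when \<open>F\<close> lives on
  \<open>A\<close> and \<open>G\<close> on its complement. Statements about operators are tested on
  such products, or on exponentials, by showing that the functionals satisfying them form a closed
  subspace.

  The obstacle is totality. Products of square-integrable functionals may leave L2, so one studies
  the bounded functions whose multiplication preserves the closed span of the exponentials. The sets
  whose indicators have this property form a sigma-algebra, which is shown to contain the events
  generated by the process.

  For step functions the Poisson exponential is a finite product. A general \<open>h\<close> lies in
  L1 for the sake of the infinite product and in L2 for the sake of the Gaussian side.

  The values enter the uniqueness proof because sets \<open>A \<times> UNIV\<close> never separate
  points of the second coordinate: an orthogonal transformation of the space of values, acting in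
  each fibre, could otherwise produce a further real isomorphism.\<close>

lemma L2_I: "f \<in> borel_measurable M \<Longrightarrow> integrable M (\<lambda>\<omega>. (norm (f \<omega>))\<^sup>2) \<Longrightarrow> f \<in> L2 M"
  by (simp add: L2_def)

lemma L2_measurable [measurable_dest]: "f \<in> L2 M \<Longrightarrow> f \<in> borel_measurable M"
  by (simp add: L2_def)

lemma L2_integrable_sq: "f \<in> L2 M \<Longrightarrow> integrable M (\<lambda>\<omega>. (norm (f \<omega>))\<^sup>2)"
  by (simp add: L2_def)

lemma aeq_refl [simp]: "aeq M f f"
  by (simp add: aeq_def)

lemma aeq_sym: "aeq M f g \<Longrightarrow> aeq M g f"
  by (auto simp: aeq_def)

lemma aeq_trans [trans]: "aeq M f g \<Longrightarrow> aeq M g h \<Longrightarrow> aeq M f h"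
  unfolding aeq_def by (erule (1) eventually_elim2) simp

lemma aeq_mult: "aeq M f f' \<Longrightarrow> aeq M g g' \<Longrightarrow> aeq M (\<lambda>\<omega>. f \<omega> * g \<omega>) (\<lambda>\<omega>. f' \<omega> * g' \<omega>)"
  unfolding aeq_def by (erule (1) eventually_elim2) simp

lemma aeq_lin:
  "aeq M f f' \<Longrightarrow> aeq M g g' \<Longrightarrow> aeq M (\<lambda>\<omega>. a * f \<omega> + b * g \<omega>) (\<lambda>\<omega>. a * f' \<omega> + b * g' \<omega>)"
  unfolding aeq_def by (erule (1) eventually_elim2) simp

lemma aeq_diff: "aeq M f f' \<Longrightarrow> aeq M g g' \<Longrightarrow> aeq M (\<lambda>\<omega>. f \<omega> - g \<omega>) (\<lambda>\<omega>. f' \<omega> - g' \<omega>)"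
  unfolding aeq_def by (erule (1) eventually_elim2) simp

lemma aeq_cmult: "aeq M f f' \<Longrightarrow> aeq M (\<lambda>\<omega>. a * f \<omega>) (\<lambda>\<omega>. a * f' \<omega>)"
  unfolding aeq_def by (erule eventually_mono) simp

lemma borel_measurable_cnj [measurable (raw)]:
  "f \<in> borel_measurable M \<Longrightarrow> (\<lambda>\<omega>. cnj (f \<omega>)) \<in> borel_measurable M"
  by (rule borel_measurable_continuous_on[OF _ ]) (auto intro: continuous_intros)

lemma L2_norm_cong: "aeq M f g \<Longrightarrow> f \<in> borel_measurable M \<Longrightarrow> g \<in> borel_measurable M \<Longrightarrow> L2_norm M f = L2_norm M g"
  unfolding L2_norm_def aeq_def
  by (rule arg_cong[where f=sqrt], rule integral_cong_AE) auto

lemma L2_inner_cong: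
  assumes "aeq M f f'" "aeq M g g'" 
    and [measurable]: "f \<in> borel_measurable M" "f' \<in> borel_measurable M" "g \<in> borel_measurable M" "g' \<in> borel_measurable M"
  shows "L2_inner M f g = L2_inner M f' g'"
  unfolding L2_inner_def
  by (rule integral_cong_AE) (use assms in \<open>auto simp: aeq_def\<close>)

lemma L2_cong:
  assumes "aeq M f g" "f \<in> L2 M" and [measurable]: "g \<in> borel_measurable M"
  shows "g \<in> L2 M"
proof (rule L2_I)
  have [measurable]: "f \<in> borel_measurable M" using assms(2) by (rule L2_measurable)
  show "integrable M (\<lambda>\<omega>. (norm (g \<omega>))\<^sup>2)"
    by (subst integrable_cong_AE[of _ _ "\<lambda>\<omega>. (norm (f \<omega>))\<^sup>2"])
       (use assms L2_integrable_sq in \<open>auto simp: aeq_def\<close>)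
qed auto

lemma L2_lin:
  fixes f g :: "'w \<Rightarrow> 'b::{real_normed_algebra, second_countable_topology}"
  assumes f: "f \<in> L2 M" and g: "g \<in> L2 M"
  shows "(\<lambda>\<omega>. a * f \<omega> + b * g \<omega>) \<in> L2 M"
proof (rule L2_I)
  note [measurable] = L2_measurable[OF f] L2_measurable[OF g]
  show "(\<lambda>\<omega>. a * f \<omega> + b * g \<omega>) \<in> borel_measurable M" by measurable
  show "integrable M (\<lambda>\<omega>. (norm (a * f \<omega> + b * g \<omega>))\<^sup>2)"
  proof (rule Bochner_Integration.integrable_bound)
    show "integrable M (\<lambda>\<omega>. 2 * (norm a)\<^sup>2 * (norm (f \<omega>))\<^sup>2 + 2 * (norm b)\<^sup>2 * (norm (g \<omega>))\<^sup>2)"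
      using L2_integrable_sq[OF f] L2_integrable_sq[OF g] by auto
    have "(norm (a * x + b * y))\<^sup>2 \<le> 2 * (norm a)\<^sup>2 * (norm x)\<^sup>2 + 2 * (norm b)\<^sup>2 * (norm y)\<^sup>2" for x y
    proof -
      have "norm (a * x + b * y) \<le> norm a * norm x + norm b * norm y"
        by (meson add_mono norm_mult_ineq norm_triangle_le)
      then have "(norm (a * x + b * y))\<^sup>2 \<le> (norm a * norm x + norm b * norm y)\<^sup>2"
        by (intro power_mono) auto
      also have "\<dots> \<le> 2 * (norm a * norm x)\<^sup>2 + 2 * (norm b * norm y)\<^sup>2"
        using sum_squares_bound[of "norm a * norm x" "norm b * norm y"] by (simp add: power2_sum)
      finally show ?thesis by (simp add: power_mult_distrib)
    qed
    then show "AE x in M. norm ((norm (a * f x + b * g x))\<^sup>2)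
        \<le> norm (2 * (norm a)\<^sup>2 * (norm (f x))\<^sup>2 + 2 * (norm b)\<^sup>2 * (norm (g x))\<^sup>2)"
      by auto
  qed auto
qed

lemma L2_zero [simp]: "(\<lambda>\<omega>. 0) \<in> L2 M"
  by (rule L2_I) auto

lemma L2_cmult:
  fixes f :: "'w \<Rightarrow> 'b::{real_normed_algebra, second_countable_topology}"
  shows "f \<in> L2 M \<Longrightarrow> (\<lambda>\<omega>. a * f \<omega>) \<in> L2 M"
  using L2_lin[of f M f a 0] by simp

lemma L2_add:
  fixes f :: "'w \<Rightarrow> 'b::{real_normed_algebra_1, second_countable_topology}"
  shows "f \<in> L2 M \<Longrightarrow> g \<in> L2 M \<Longrightarrow> (\<lambda>\<omega>. f \<omega> + g \<omega>) \<in> L2 M"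
  using L2_lin[of f M g 1 1] by simp

lemma L2_diff:
  fixes f :: "'w \<Rightarrow> 'b::{real_normed_algebra_1, second_countable_topology}"
  shows "f \<in> L2 M \<Longrightarrow> g \<in> L2 M \<Longrightarrow> (\<lambda>\<omega>. f \<omega> - g \<omega>) \<in> L2 M"
  using L2_lin[of f M g 1 "-1"] by simp

lemma L2_cnj: "f \<in> L2 M \<Longrightarrow> (\<lambda>\<omega>. cnj (f \<omega>)) \<in> L2 M"
  by (auto simp: L2_def)

lemma L2_of_real:
  fixes f :: "'w \<Rightarrow> real"
  shows "f \<in> L2 M \<Longrightarrow> (\<lambda>\<omega>. complex_of_real (f \<omega>)) \<in> L2 M"
  by (auto simp: L2_def)

lemma L2_integrable_mult:
  fixes f g :: "'w \<Rightarrow> 'b::{banach, real_normed_algebra, second_countable_topology}"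
  assumes f: "f \<in> L2 M" and g: "g \<in> L2 M"
  shows "integrable M (\<lambda>\<omega>. f \<omega> * g \<omega>)"
proof (rule Bochner_Integration.integrable_bound)
  note [measurable] = L2_measurable[OF f] L2_measurable[OF g]
  show "(\<lambda>\<omega>. f \<omega> * g \<omega>) \<in> borel_measurable M" by measurable
  show "integrable M (\<lambda>\<omega>. (norm (f \<omega>))\<^sup>2 + (norm (g \<omega>))\<^sup>2)"
    using L2_integrable_sq[OF f] L2_integrable_sq[OF g] by auto
  have "norm (x * y) \<le> (norm x)\<^sup>2 + (norm y)\<^sup>2" for x y :: 'b
  proof -
    have "norm (x * y) \<le> norm x * norm y" by (rule norm_mult_ineq)
    also have "2 * (norm x * norm y) \<le> (norm x)\<^sup>2 + (norm y)\<^sup>2"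
      using sum_squares_bound[of "norm x" "norm y"] by simp
    then have "norm x * norm y \<le> (norm x)\<^sup>2 + (norm y)\<^sup>2"
      using mult_nonneg_nonneg[OF norm_ge_zero norm_ge_zero, of x y] by linarith
    finally show ?thesis .
  qed
  then show "AE x in M. norm (f x * g x) \<le> norm ((norm (f x))\<^sup>2 + (norm (g x))\<^sup>2)" by auto
qed

section \<open>Norms and inner products\<close>

lemma L2_norm_nonneg [simp]: "0 \<le> L2_norm M f"
  by (simp add: L2_norm_def)

lemma L2_norm_sq: "(L2_norm M f)\<^sup>2 = (LINT \<omega>|M. (norm (f \<omega>))\<^sup>2)"
  by (simp add: L2_norm_def)

lemma L2_inner_self: "L2_inner M f f = complex_of_real ((L2_norm M f)\<^sup>2)"
proof -
  have "L2_inner M f f = (LINT \<omega>|M. complex_of_real ((norm (f \<omega>))\<^sup>2))"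
    unfolding L2_inner_def
    by (rule Bochner_Integration.integral_cong)
       (simp_all add: complex_norm_square mult.commute del: of_real_power)
  then show ?thesis by (simp add: L2_norm_sq del: of_real_power)
qed

lemma L2_inner_cnj: "cnj (L2_inner M f g) = L2_inner M g f"
  using Bochner_Integration.integral_cnj[of M "\<lambda>\<omega>. cnj (f \<omega>) * g \<omega>"] unfolding L2_inner_def by (simp add: mult.commute del: Bochner_Integration.integral_cnj)

lemma L2_inner_integrable:
  "f \<in> L2 M \<Longrightarrow> g \<in> L2 M \<Longrightarrow> integrable M (\<lambda>\<omega>. cnj (f \<omega>) * g \<omega>)"
  by (intro L2_integrable_mult L2_cnj)

lemma L2_inner_lin_right:
  assumes "f \<in> L2 M" "g \<in> L2 M" "k \<in> L2 M"
  shows "L2_inner M f (\<lambda>\<omega>. a * g \<omega> + b * k \<omega>) = a * L2_inner M f g + b * L2_inner M f k"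
proof -
  have "L2_inner M f (\<lambda>\<omega>. a * g \<omega> + b * k \<omega>)
      = (LINT \<omega>|M. a * (cnj (f \<omega>) * g \<omega>) + b * (cnj (f \<omega>) * k \<omega>))"
    unfolding L2_inner_def by (simp add: algebra_simps)
  then show ?thesis unfolding L2_inner_def using L2_inner_integrable assms
    by (simp add: L2_inner_integrable)
qed

lemma L2_inner_lin_left:
  assumes "f \<in> L2 M" "g \<in> L2 M" "k \<in> L2 M"
  shows "L2_inner M (\<lambda>\<omega>. a * g \<omega> + b * k \<omega>) f = cnj a * L2_inner M g f + cnj b * L2_inner M k f"
  using arg_cong[OF L2_inner_lin_right[OF assms, of a b], of cnj] by (simp add: L2_inner_cnj)

lemma L2_inner_diff_right:
  assumes "f \<in> L2 M" "g \<in> L2 M" "k \<in> L2 M"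
  shows "L2_inner M f (\<lambda>\<omega>. g \<omega> - k \<omega>) = L2_inner M f g - L2_inner M f k"
  using L2_inner_lin_right[OF assms, of 1 "-1"] by simp

lemma L2_inner_diff_left:
  assumes "f \<in> L2 M" "g \<in> L2 M" "k \<in> L2 M"
  shows "L2_inner M (\<lambda>\<omega>. g \<omega> - k \<omega>) f = L2_inner M g f - L2_inner M k f"
  using L2_inner_lin_left[OF assms, of 1 "-1"] by simp

lemma L2_norm_cmult:
  fixes f :: "'w \<Rightarrow> 'b::real_normed_div_algebra"
  shows "L2_norm M (\<lambda>\<omega>. c * f \<omega>) = norm c * L2_norm M f"
  unfolding L2_norm_def by (simp add: norm_mult power_mult_distrib real_sqrt_mult)

lemma L2_norm_eq_0_iff:
  assumes "f \<in> L2 M"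
  shows "L2_norm M f = 0 \<longleftrightarrow> aeq M f (\<lambda>\<omega>. 0)"
proof -
  have "L2_norm M f = 0 \<longleftrightarrow> (LINT \<omega>|M. (norm (f \<omega>))\<^sup>2) = 0" by (simp add: L2_norm_def)
  also have "\<dots> \<longleftrightarrow> (AE \<omega> in M. (norm (f \<omega>))\<^sup>2 = 0)"
    using L2_integrable_sq[OF assms] by (intro integral_nonneg_eq_0_iff_AE) auto
  finally show ?thesis by (simp add: aeq_def)
qed

lemma L2_CS_real:
  fixes f g :: "'w \<Rightarrow> real"
  assumes f: "f \<in> L2 M" and g: "g \<in> L2 M"
  shows "\<bar>LINT \<omega>|M. f \<omega> * g \<omega>\<bar> \<le> L2_norm M f * L2_norm M g"
proof -
  define A where "A = (LINT \<omega>|M. (f \<omega>)\<^sup>2)"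
  define B where "B = (LINT \<omega>|M. f \<omega> * g \<omega>)"
  define C where "C = (LINT \<omega>|M. (g \<omega>)\<^sup>2)"
  have i: "integrable M (\<lambda>\<omega>. (f \<omega>)\<^sup>2)" "integrable M (\<lambda>\<omega>. (g \<omega>)\<^sup>2)" "integrable M (\<lambda>\<omega>. f \<omega> * g \<omega>)"
    using L2_integrable_sq[OF f] L2_integrable_sq[OF g] L2_integrable_mult[OF f g] by auto
  have *: "0 \<le> s\<^sup>2 * A + 2 * s * t * B + t\<^sup>2 * C" for s t :: real
  proof -
    have "0 \<le> (LINT \<omega>|M. (s * f \<omega> + t * g \<omega>)\<^sup>2)" by simp
    also have "\<dots> = (LINT \<omega>|M. s\<^sup>2 * (f \<omega>)\<^sup>2 + 2 * s * t * (f \<omega> * g \<omega>) + t\<^sup>2 * (g \<omega>)\<^sup>2)"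
      by (rule Bochner_Integration.integral_cong) (auto simp: power2_eq_square algebra_simps)
    also have "\<dots> = s\<^sup>2 * A + 2 * s * t * B + t\<^sup>2 * C"
      unfolding A_def B_def C_def using i by simp
    finally show ?thesis .
  qed
  have "A \<ge> 0" "C \<ge> 0" by (simp_all add: A_def C_def)
  have "B\<^sup>2 \<le> A * C"
  proof (cases "A = 0")
    case True
    have "B = 0"
    proof (rule ccontr)
      assume "B \<noteq> 0"
      \<comment> \<open>With \<open>A = 0\<close> the form is linear in its first argument, and this
        value makes it equal to -1.\<close>
      then show False using *[of "- (C + 1) / (2 * B)" 1] True by (simp add: field_simps)
    qed
    then show ?thesis using True by simp
  next
    case False
    have "0 \<le> A * (A * C - B\<^sup>2)" using *[of "-B" A] by (simp add: power2_eq_square algebra_simps)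
    then show ?thesis using False \<open>A \<ge> 0\<close> by (simp add: zero_le_mult_iff)
  qed
  then have "sqrt (B\<^sup>2) \<le> sqrt (A * C)" by (rule real_sqrt_le_mono)
  then show ?thesis by (simp add: L2_norm_def A_def B_def C_def real_sqrt_mult)
qed

lemma L2_norm_fun:
  fixes f :: "'w \<Rightarrow> 'b::{real_normed_vector, second_countable_topology}"
  shows "f \<in> L2 M \<Longrightarrow> (\<lambda>\<omega>. norm (f \<omega>)) \<in> L2 M"
  by (auto simp: L2_def)

lemma L2_CS:
  assumes f: "f \<in> L2 M" and g: "g \<in> L2 M"
  shows "norm (L2_inner M f g) \<le> L2_norm M f * L2_norm M g"
proof -
  have "norm (L2_inner M f g) \<le> (LINT \<omega>|M. norm (f \<omega>) * norm (g \<omega>))"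
    unfolding L2_inner_def using integral_norm_bound[of M "\<lambda>\<omega>. cnj (f \<omega>) * g \<omega>"] by (simp add: norm_mult)
  also have "\<dots> \<le> L2_norm M (\<lambda>\<omega>. norm (f \<omega>)) * L2_norm M (\<lambda>\<omega>. norm (g \<omega>))"
    using L2_CS_real[OF L2_norm_fun[OF f] L2_norm_fun[OF g]] by simp
  also have "\<dots> = L2_norm M f * L2_norm M g" by (simp add: L2_norm_def)
  finally show ?thesis .
qed

lemma L2_norm_triangle:
  fixes f g :: "'w \<Rightarrow> 'b::{real_normed_algebra_1, second_countable_topology}"
  assumes f: "f \<in> L2 M" and g: "g \<in> L2 M"
  shows "L2_norm M (\<lambda>\<omega>. f \<omega> + g \<omega>) \<le> L2_norm M f + L2_norm M g"
proof (rule power2_le_imp_le)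
  note i = L2_integrable_sq[OF f] L2_integrable_sq[OF g] L2_integrable_sq[OF L2_add[OF f g]]
    L2_integrable_mult[OF L2_norm_fun[OF f] L2_norm_fun[OF g]]
  have "(L2_norm M (\<lambda>\<omega>. f \<omega> + g \<omega>))\<^sup>2 \<le> (LINT \<omega>|M. (norm (f \<omega>))\<^sup>2 + 2 * (norm (f \<omega>) * norm (g \<omega>)) + (norm (g \<omega>))\<^sup>2)"
    unfolding L2_norm_sq
  proof (rule integral_mono)
    fix \<omega>
    have "(norm (f \<omega> + g \<omega>))\<^sup>2 \<le> (norm (f \<omega>) + norm (g \<omega>))\<^sup>2"
      by (intro power_mono norm_triangle_ineq norm_ge_zero)
    then show "(norm (f \<omega> + g \<omega>))\<^sup>2 \<le> (norm (f \<omega>))\<^sup>2 + 2 * (norm (f \<omega>) * norm (g \<omega>)) + (norm (g \<omega>))\<^sup>2"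
      by (simp add: power2_sum)
  qed (use i in auto)
  also have "\<dots> = (L2_norm M f)\<^sup>2 + 2 * (LINT \<omega>|M. norm (f \<omega>) * norm (g \<omega>)) + (L2_norm M g)\<^sup>2"
    using i by (simp add: L2_norm_sq)
  also have "\<dots> \<le> (L2_norm M f + L2_norm M g)\<^sup>2"
    using L2_CS_real[OF L2_norm_fun[OF f] L2_norm_fun[OF g]] by (simp add: power2_sum L2_norm_def)
  finally show "(L2_norm M (\<lambda>\<omega>. f \<omega> + g \<omega>))\<^sup>2 \<le> (L2_norm M f + L2_norm M g)\<^sup>2" .
qed (simp add: add_nonneg_nonneg)

lemma L2_norm_minus_commute: "L2_norm M (\<lambda>\<omega>. f \<omega> - g \<omega>) = L2_norm M (\<lambda>\<omega>. g \<omega> - f \<omega>)"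
  by (simp add: L2_norm_def norm_minus_commute)

lemma L2_norm_triangle3:
  fixes f g k :: "'w \<Rightarrow> 'b::{real_normed_algebra_1, second_countable_topology}"
  assumes "f \<in> L2 M" "g \<in> L2 M" "k \<in> L2 M"
  shows "L2_norm M (\<lambda>\<omega>. f \<omega> - k \<omega>) \<le> L2_norm M (\<lambda>\<omega>. f \<omega> - g \<omega>) + L2_norm M (\<lambda>\<omega>. g \<omega> - k \<omega>)"
  using L2_norm_triangle[OF L2_diff[OF assms(1,2)] L2_diff[OF assms(2,3)]] by simp

lemma L2_norm_diff_le:
  fixes f g :: "'w \<Rightarrow> 'b::{real_normed_algebra_1, second_countable_topology}"
  assumes "f \<in> L2 M" "g \<in> L2 M"
  shows "\<bar>L2_norm M f - L2_norm M g\<bar> \<le> L2_norm M (\<lambda>\<omega>. f \<omega> - g \<omega>)"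
  using L2_norm_triangle[OF L2_diff[OF assms] assms(2)] L2_norm_triangle[OF L2_diff[OF assms(2,1)] assms(1)]
    L2_norm_minus_commute[of M f g] by simp

lemma L2_norm_lin_le:
  fixes f g :: "'w \<Rightarrow> 'b::{real_normed_field, second_countable_topology}"
  assumes "f \<in> L2 M" "g \<in> L2 M"
  shows "L2_norm M (\<lambda>\<omega>. a * f \<omega> + b * g \<omega>) \<le> norm a * L2_norm M f + norm b * L2_norm M g"
  using L2_norm_triangle[OF L2_cmult[OF assms(1), of a] L2_cmult[OF assms(2), of b]]
  by (simp add: L2_norm_cmult)

text \<open>Turns equality in L2 into a question about inner products: two functionals coincide once
  their squared norms and the real part of their inner product are the same number. The continuity
  of the exponentials and the uniqueness of the isometry are read off from it.\<close>

lemma L2_norm_diff_sq: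
  assumes "f \<in> L2 M" "g \<in> L2 M"
  shows "(L2_norm M (\<lambda>\<omega>. f \<omega> - g \<omega>))\<^sup>2 = (L2_norm M f)\<^sup>2 - 2 * Re (L2_inner M f g) + (L2_norm M g)\<^sup>2"
proof -
  have d: "(\<lambda>\<omega>. f \<omega> - g \<omega>) \<in> L2 M" by (rule L2_diff[OF assms])
  have "complex_of_real ((L2_norm M (\<lambda>\<omega>. f \<omega> - g \<omega>))\<^sup>2)
      = L2_inner M f f - L2_inner M f g - (L2_inner M g f - L2_inner M g g)"
    unfolding L2_inner_self[symmetric]
    by (simp add: L2_inner_diff_left[OF d assms] L2_inner_diff_right assms)
  moreover have "Re (L2_inner M g f) = Re (L2_inner M f g)"
    using arg_cong[OF L2_inner_cnj[of M f g], of Re] by simp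
  ultimately show ?thesis
    by (subst Re_complex_of_real[symmetric]) (simp add: L2_inner_self del: of_real_power)
qed

section \<open>Convergence in L2\<close>

definition L2_lim :: "'w measure \<Rightarrow> (nat \<Rightarrow> 'w \<Rightarrow> 'b::real_normed_vector) \<Rightarrow> ('w \<Rightarrow> 'b) \<Rightarrow> bool" where
  "L2_lim M F f \<longleftrightarrow> (\<forall>n. F n \<in> L2 M) \<and> f \<in> L2 M \<and> (\<lambda>n. L2_norm M (\<lambda>\<omega>. F n \<omega> - f \<omega>)) \<longlonglongrightarrow> 0"

lemma L2_limD:
  assumes "L2_lim M F f"
  shows "F n \<in> L2 M" "f \<in> L2 M" "(\<lambda>n. L2_norm M (\<lambda>\<omega>. F n \<omega> - f \<omega>)) \<longlonglongrightarrow> 0"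
  using assms by (auto simp: L2_lim_def)

lemma L2_limI_le:
  fixes F :: "nat \<Rightarrow> 'w \<Rightarrow> 'b::real_normed_vector"
  assumes "\<And>n. F n \<in> L2 M" "f \<in> L2 M" "\<And>n. L2_norm M (\<lambda>\<omega>. F n \<omega> - f \<omega>) \<le> e n" "e \<longlonglongrightarrow> 0"
  shows "L2_lim M F f"
  unfolding L2_lim_def
proof (intro conjI allI)
  show "(\<lambda>n. L2_norm M (\<lambda>\<omega>. F n \<omega> - f \<omega>)) \<longlonglongrightarrow> 0"
    by (rule tendsto_sandwich[of "\<lambda>_. 0" _ _ e]) (use assms in simp_all)
qed (rule assms(1) assms(2))+

lemma L2_lim_const: "f \<in> L2 M \<Longrightarrow> L2_lim M (\<lambda>_. f) f"
  by (simp add: L2_lim_def L2_norm_def)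

lemma L2_lim_lin:
  fixes F K :: "nat \<Rightarrow> 'w \<Rightarrow> 'b::{real_normed_field, second_countable_topology}"
  assumes F: "L2_lim M F f" and K: "L2_lim M K k"
  shows "L2_lim M (\<lambda>n \<omega>. a * F n \<omega> + b * K n \<omega>) (\<lambda>\<omega>. a * f \<omega> + b * k \<omega>)"
proof (rule L2_limI_le)
  show "(\<lambda>n. norm a * L2_norm M (\<lambda>\<omega>. F n \<omega> - f \<omega>) + norm b * L2_norm M (\<lambda>\<omega>. K n \<omega> - k \<omega>)) \<longlonglongrightarrow> 0"
    using L2_limD(3)[OF F] L2_limD(3)[OF K] by (auto intro!: tendsto_eq_intros)
  show "L2_norm M (\<lambda>\<omega>. a * F n \<omega> + b * K n \<omega> - (a * f \<omega> + b * k \<omega>))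
      \<le> norm a * L2_norm M (\<lambda>\<omega>. F n \<omega> - f \<omega>) + norm b * L2_norm M (\<lambda>\<omega>. K n \<omega> - k \<omega>)" for n
    using L2_norm_lin_le[OF L2_diff[OF L2_limD(1,2)[OF F]] L2_diff[OF L2_limD(1,2)[OF K]], of a n b n]
    by (simp add: algebra_simps)
qed (rule L2_lin L2_limD(1,2)[OF F] L2_limD(1,2)[OF K])+

lemma L2_lim_diff:
  fixes F K :: "nat \<Rightarrow> 'w \<Rightarrow> 'b::{real_normed_field, second_countable_topology}"
  assumes "L2_lim M F f" "L2_lim M K k"
  shows "L2_lim M (\<lambda>n \<omega>. F n \<omega> - K n \<omega>) (\<lambda>\<omega>. f \<omega> - k \<omega>)"
  using L2_lim_lin[OF assms, of 1 "-1"] by simp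

lemma L2_lim_norm:
  fixes F :: "nat \<Rightarrow> 'w \<Rightarrow> 'b::{real_normed_field, second_countable_topology}"
  assumes "L2_lim M F f"
  shows "(\<lambda>n. L2_norm M (F n)) \<longlonglongrightarrow> L2_norm M f"
proof (rule Lim_transform2)
  show "(\<lambda>n. L2_norm M f) \<longlonglongrightarrow> L2_norm M f" by simp
  have "(\<lambda>n. L2_norm M (F n) - L2_norm M f) \<longlonglongrightarrow> 0"
  proof (rule Lim_null_comparison)
    show "\<forall>\<^sub>F n in sequentially. norm (L2_norm M (F n) - L2_norm M f) \<le> L2_norm M (\<lambda>\<omega>. F n \<omega> - f \<omega>)"
      using L2_norm_diff_le[OF L2_limD(1,2)[OF assms]] by simp
  qed (rule L2_limD(3)[OF assms])
  then show "(\<lambda>n. L2_norm M f - L2_norm M (F n)) \<longlonglongrightarrow> 0"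
    using tendsto_minus by fastforce
qed

lemma L2_lim_inner:
  assumes F: "L2_lim M F f" and K: "L2_lim M K k"
  shows "(\<lambda>n. L2_inner M (F n) (K n)) \<longlonglongrightarrow> L2_inner M f k"
proof -
  note f = L2_limD[OF F] and k = L2_limD[OF K]
  have "L2_inner M (F n) (K n) - L2_inner M f k
      = L2_inner M (\<lambda>\<omega>. F n \<omega> - f \<omega>) (K n) + L2_inner M f (\<lambda>\<omega>. K n \<omega> - k \<omega>)" for n
    using f k by (simp add: L2_inner_diff_left L2_inner_diff_right)
  then have "norm (L2_inner M (F n) (K n) - L2_inner M f k)
      \<le> L2_norm M (\<lambda>\<omega>. F n \<omega> - f \<omega>) * L2_norm M (K n) + L2_norm M f * L2_norm M (\<lambda>\<omega>. K n \<omega> - k \<omega>)" for n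
    using norm_triangle_le[OF add_mono[OF L2_CS[OF L2_diff[OF f(1)[of n] f(2)] k(1)[of n]]
      L2_CS[OF f(2) L2_diff[OF k(1)[of n] k(2)]]]] by (simp only:)
  moreover have "(\<lambda>n. L2_norm M (\<lambda>\<omega>. F n \<omega> - f \<omega>) * L2_norm M (K n) + L2_norm M f * L2_norm M (\<lambda>\<omega>. K n \<omega> - k \<omega>)) \<longlonglongrightarrow> 0"
    using f(3) k(3) L2_lim_norm[OF K] by (auto intro!: tendsto_eq_intros)
  ultimately have "(\<lambda>n. L2_inner M (F n) (K n) - L2_inner M f k) \<longlonglongrightarrow> 0"
    by (intro Lim_null_comparison[of "\<lambda>n. L2_inner M (F n) (K n) - L2_inner M f k"]) auto
  then show ?thesis by (rule LIM_zero_cancel)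
qed

lemma L2_lim_AE_subseq:
  fixes F :: "nat \<Rightarrow> 'w \<Rightarrow> 'b::{real_normed_field, second_countable_topology}"
  assumes "L2_lim M F f"
  obtains r :: "nat \<Rightarrow> nat" where "strict_mono r" "AE \<omega> in M. (\<lambda>n. F (r n) \<omega>) \<longlonglongrightarrow> f \<omega>"
proof -
  note f = L2_limD[OF assms]
  have "(\<lambda>n. (L2_norm M (\<lambda>\<omega>. F n \<omega> - f \<omega>))\<^sup>2) \<longlonglongrightarrow> 0"
    using tendsto_power[OF f(3), of 2] by simp
  then have "\<exists>r. strict_mono r \<and> (AE \<omega> in M. (\<lambda>n. (norm (F (r n) \<omega> - f \<omega>))\<^sup>2) \<longlonglongrightarrow> 0)"
    using L2_integrable_sq[OF L2_diff[OF f(1,2)]]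
    by (intro tendsto_L1_AE_subseq) (auto simp: L2_norm_sq)
  then obtain r where r: "strict_mono r" "AE \<omega> in M. (\<lambda>n. (norm (F (r n) \<omega> - f \<omega>))\<^sup>2) \<longlonglongrightarrow> 0" by blast
  have "(\<lambda>n. F (r n) \<omega>) \<longlonglongrightarrow> f \<omega>" if "(\<lambda>n. (norm (F (r n) \<omega> - f \<omega>))\<^sup>2) \<longlonglongrightarrow> 0" for \<omega>
  proof -
    have "(\<lambda>n. sqrt ((norm (F (r n) \<omega> - f \<omega>))\<^sup>2)) \<longlonglongrightarrow> sqrt 0"
      using that by (rule tendsto_real_sqrt)
    then have "(\<lambda>n. F (r n) \<omega> - f \<omega>) \<longlonglongrightarrow> 0" by (simp add: tendsto_norm_zero_iff)
    then show ?thesis by (rule LIM_zero_cancel)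
  qed
  with r(2) have "AE \<omega> in M. (\<lambda>n. F (r n) \<omega>) \<longlonglongrightarrow> f \<omega>" by (auto elim: eventually_mono)
  with r(1) that show ?thesis by blast
qed

text \<open>Identifies an abstract L2 limit with an explicit pointwise one. The formulas for the
  images of exponentials and of first-chaos vectors are obtained in this way.\<close>

lemma L2_lim_AE_unique:
  fixes F :: "nat \<Rightarrow> 'w \<Rightarrow> 'b::{real_normed_field, second_countable_topology}"
  assumes "L2_lim M F f" and "AE \<omega> in M. (\<lambda>n. F n \<omega>) \<longlonglongrightarrow> g \<omega>"
  shows "aeq M f g"
proof -
  obtain r :: "nat \<Rightarrow> nat" where r: "strict_mono r" "AE \<omega> in M. (\<lambda>n. F (r n) \<omega>) \<longlonglongrightarrow> f \<omega>"
    using L2_lim_AE_subseq[OF assms(1)] by blast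
  show ?thesis unfolding aeq_def using r(2) assms(2)
  proof eventually_elim
    case (elim \<omega>)
    then show ?case using LIMSEQ_subseq_LIMSEQ[OF elim(2) r(1)] LIMSEQ_unique by (auto simp: o_def)
  qed
qed

lemma aeqI_L2_norm:
  fixes f g :: "'w \<Rightarrow> 'b::{real_normed_algebra_1, second_countable_topology}"
  assumes "f \<in> L2 M" "g \<in> L2 M" "L2_norm M (\<lambda>\<omega>. f \<omega> - g \<omega>) = 0"
  shows "aeq M f g"
proof -
  have "AE \<omega> in M. (norm (f \<omega> - g \<omega>))\<^sup>2 = 0"
    using assms L2_integrable_sq[OF L2_diff[OF assms(1,2)]]
    by (subst integral_nonneg_eq_0_iff_AE[symmetric]) (auto simp: L2_norm_def)
  then show ?thesis by (simp add: aeq_def)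
qed

lemma L2_norm_diff_aeq:
  fixes f g :: "'w \<Rightarrow> 'b::{real_normed_algebra_1, second_countable_topology}"
  assumes "aeq M f g"
  shows "L2_norm M (\<lambda>\<omega>. f \<omega> - g \<omega>) = 0"
proof -
  have "(LINT \<omega>|M. (norm (f \<omega> - g \<omega>))\<^sup>2) = 0"
    by (rule integral_eq_zero_AE) (use assms in \<open>auto simp: aeq_def elim: eventually_mono\<close>)
  then show ?thesis by (simp add: L2_norm_def)
qed

lemma L2_lim_unique:
  fixes F :: "nat \<Rightarrow> 'w \<Rightarrow> 'b::{real_normed_field, second_countable_topology}"
  assumes "L2_lim M F f" "L2_lim M F g"
  shows "aeq M f g"
proof (rule aeqI_L2_norm)
  have "L2_lim M (\<lambda>n \<omega>. F n \<omega> - F n \<omega>) (\<lambda>\<omega>. f \<omega> - g \<omega>)" by (rule L2_lim_diff[OF assms])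
  from L2_lim_norm[OF this] show "L2_norm M (\<lambda>\<omega>. f \<omega> - g \<omega>) = 0"
    by (simp add: L2_norm_def LIMSEQ_const_iff)
qed (rule L2_limD[OF assms(1)] L2_limD[OF assms(2)])+

lemma L2_lim_cong:
  fixes F :: "nat \<Rightarrow> 'w \<Rightarrow> 'b::{real_normed_field, second_countable_topology}"
  assumes F: "L2_lim M F f" and "\<And>n. aeq M (F n) (F' n)" "aeq M f f'"
    and "\<And>n. F' n \<in> borel_measurable M" "f' \<in> borel_measurable M"
  shows "L2_lim M F' f'"
proof -
  have m: "F' n \<in> L2 M" "f' \<in> L2 M" for n
    using L2_cong[OF assms(2)] L2_cong[OF assms(3)] assms L2_limD[OF F] by auto
  have "L2_norm M (\<lambda>\<omega>. F' n \<omega> - f' \<omega>) = L2_norm M (\<lambda>\<omega>. F n \<omega> - f \<omega>)" for n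
    using L2_norm_cong[OF aeq_diff[OF assms(2,3)], of n] L2_diff[OF m, THEN L2_measurable]
      L2_diff[OF L2_limD(1,2)[OF F], THEN L2_measurable] by metis
  then show ?thesis using L2_limD[OF F] m by (simp add: L2_lim_def)
qed

lemma L2_lim_dominated:
  fixes F :: "nat \<Rightarrow> 'w \<Rightarrow> 'b::{real_normed_field, second_countable_topology}"
  assumes m: "\<And>n. F n \<in> borel_measurable M" "f \<in> borel_measurable M"
    and w: "w \<in> L2 M" and lim: "AE \<omega> in M. (\<lambda>n. F n \<omega>) \<longlonglongrightarrow> f \<omega>"
    and b: "\<And>n. AE \<omega> in M. norm (F n \<omega>) \<le> (w \<omega> :: real)"
  shows "L2_lim M F f"
proof -
  note [measurable] = m L2_measurable[OF w]
  have w0: "AE \<omega> in M. 0 \<le> w \<omega>" using b[of 0] by eventually_elim (meson norm_ge_zero order_trans)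
  have bf: "AE \<omega> in M. norm (f \<omega>) \<le> w \<omega>"
  proof -
    have "AE \<omega> in M. \<forall>n. norm (F n \<omega>) \<le> w \<omega>" using b by (simp add: AE_all_countable)
    with lim show ?thesis
      by eventually_elim (auto intro: LIMSEQ_le_const2[OF tendsto_norm])
  qed
  have wi: "integrable M (\<lambda>\<omega>. (w \<omega>)\<^sup>2)" using L2_integrable_sq[OF w] by simp
  have L: "k \<in> L2 M" if [measurable]: "k \<in> borel_measurable M" and k: "AE \<omega> in M. norm (k \<omega>) \<le> w \<omega>" for k :: "'w \<Rightarrow> 'b"
  proof (rule L2_I)
    show "integrable M (\<lambda>\<omega>. (norm (k \<omega>))\<^sup>2)"
    proof (rule Bochner_Integration.integrable_bound[OF wi])
      show "AE x in M. norm ((norm (k x))\<^sup>2) \<le> norm ((w x)\<^sup>2)"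
        using k by eventually_elim (auto intro: power_mono)
    qed auto
  qed auto
  have "(\<lambda>n. LINT \<omega>|M. (norm (F n \<omega> - f \<omega>))\<^sup>2) \<longlonglongrightarrow> (LINT \<omega>|M. 0)"
  proof (rule integral_dominated_convergence[where w="\<lambda>\<omega>. 4 * (w \<omega>)\<^sup>2"])
    show "AE x in M. (\<lambda>n. (norm (F n x - f x))\<^sup>2) \<longlonglongrightarrow> 0"
      using lim by eventually_elim (auto intro!: tendsto_eq_intros)
    show "AE x in M. norm ((norm (F n x - f x))\<^sup>2) \<le> 4 * (w x)\<^sup>2" for n
      using b[of n] bf
    proof eventually_elim
      case (elim x)
      have "norm (F n x - f x) \<le> 2 * w x" using elim norm_triangle_ineq4[of "F n x" "f x"] by linarith
      then have "(norm (F n x - f x))\<^sup>2 \<le> (2 * w x)\<^sup>2" by (rule power_mono) simp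
      then show ?case by (simp add: power_mult_distrib)
    qed
    show "integrable M (\<lambda>\<omega>. 4 * (w \<omega>)\<^sup>2)" using wi by simp
  qed measurable
  then have "(\<lambda>n. sqrt (LINT \<omega>|M. (norm (F n \<omega> - f \<omega>))\<^sup>2)) \<longlonglongrightarrow> sqrt 0"
    by (intro tendsto_real_sqrt) simp
  then show ?thesis unfolding L2_lim_def L2_norm_def using L[OF m(1) b] L[OF m(2) bf] by simp
qed

text \<open>Riesz-Fischer. A subsequence whose increments have geometrically small norms converges
  almost everywhere, and Fatou's lemma along it bounds the distance to the limit for all late terms,
  not only for those of the subsequence.\<close>

lemma L2_complete:
  fixes F :: "nat \<Rightarrow> 'w \<Rightarrow> complex"
  assumes F: "\<And>n. F n \<in> L2 M"
    and cauchy: "\<And>\<epsilon>. \<epsilon> > 0 \<Longrightarrow> \<exists>n0. \<forall>m\<ge>n0. \<forall>n\<ge>n0. L2_norm M (\<lambda>\<omega>. F m \<omega> - F n \<omega>) < \<epsilon>"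
  obtains f where "L2_lim M F f"
proof -
  note [measurable] = L2_measurable[OF F]
  have "\<exists>n0. \<forall>m\<ge>n0. \<forall>n\<ge>n0. L2_norm M (\<lambda>\<omega>. F m \<omega> - F n \<omega>) < (1/4)^k" for k :: nat
    by (rule cauchy) simp
  then obtain n0 where n0: "\<And>k m n. m \<ge> n0 k \<Longrightarrow> n \<ge> n0 k \<Longrightarrow> L2_norm M (\<lambda>\<omega>. F m \<omega> - F n \<omega>) < (1/4)^k"
    by metis
  \<comment> \<open>Partial sums of \<open>Suc (n0 i)\<close> increase strictly and stay above
    \<open>n0 k\<close>.\<close>
  define r where "r k = (\<Sum>i\<le>k. Suc (n0 i))" for k
  have r_Suc: "r (Suc k) = r k + Suc (n0 (Suc k))" for k by (simp add: r_def)
  have r_ge: "n0 k \<le> r k" for k by (cases k) (auto simp: r_def)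
  have sm: "strict_mono r" by (rule strict_monoI_Suc) (simp add: r_Suc)
  define d where "d k \<omega> = F (r (Suc k)) \<omega> - F (r k) \<omega>" for k \<omega>
  have d2: "d k \<in> L2 M" for k unfolding d_def by (intro L2_diff F)
  note [measurable] = L2_measurable[OF d2]
  have dn: "L2_norm M (d k) \<le> (1/4)^k" for k
    unfolding d_def using n0[of k "r (Suc k)" "r k"] r_ge[of k] r_Suc[of k] by simp
  \<comment> \<open>The weights \<open>2 ^ k\<close> turn the summable norms into a summable series of integrals of squares.\<close>
  have "(\<Sum>k. \<integral>\<^sup>+\<omega>. ennreal (2 ^ k * (norm (d k \<omega>))\<^sup>2) \<partial>M) \<le> (\<Sum>k. ennreal ((1/2)^k))"
  proof (rule suminf_le)
    fix k
    have "(\<integral>\<^sup>+\<omega>. ennreal (2 ^ k * (norm (d k \<omega>))\<^sup>2) \<partial>M) = ennreal (LINT \<omega>|M. 2 ^ k * (norm (d k \<omega>))\<^sup>2)"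
      by (rule nn_integral_eq_integral) (use L2_integrable_sq[OF d2] in auto)
    also have "(LINT \<omega>|M. 2 ^ k * (norm (d k \<omega>))\<^sup>2) = 2 ^ k * (L2_norm M (d k))\<^sup>2" by (simp add: L2_norm_sq)
    also have "\<dots> \<le> 2 ^ k * ((1/4)^k)\<^sup>2" using dn[of k] by (intro mult_left_mono power_mono) auto
    also have "\<dots> = (1/8)^k" by (simp add: power2_eq_square power_mult_distrib[symmetric])
    also have "\<dots> \<le> (1/2)^k" by (rule power_mono) auto
    finally show "(\<integral>\<^sup>+\<omega>. ennreal (2 ^ k * (norm (d k \<omega>))\<^sup>2) \<partial>M) \<le> ennreal ((1/2)^k)"
      by (auto intro: ennreal_leI)
  qed auto
  also have "\<dots> = ennreal (\<Sum>k. (1/2)^k)"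
    by (rule suminf_ennreal2) (auto intro: summable_geometric)
  also have "\<dots> < \<infinity>" by simp
  finally have "(\<integral>\<^sup>+\<omega>. (\<Sum>k. ennreal (2 ^ k * (norm (d k \<omega>))\<^sup>2)) \<partial>M) < \<infinity>"
    by (subst nn_integral_suminf) auto
  then have "AE \<omega> in M. (\<Sum>k. ennreal (2 ^ k * (norm (d k \<omega>))\<^sup>2)) \<noteq> \<infinity>"
    by (intro nn_integral_PInf_AE) auto
  then have conv: "AE \<omega> in M. convergent (\<lambda>k. F (r k) \<omega>)"
  proof eventually_elim
    case (elim \<omega>)
    then have s: "summable (\<lambda>k. 2 ^ k * (norm (d k \<omega>))\<^sup>2)" by (intro summable_suminf_not_top) simp_all
    have "summable (\<lambda>k. (1/2)^k + 2 ^ k * (norm (d k \<omega>))\<^sup>2)"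
      by (intro summable_add s summable_geometric) auto
    then have "summable (\<lambda>k. norm (d k \<omega>))"
    proof (rule summable_comparison_test')
      fix k :: nat assume "k \<ge> 0"
      \<comment> \<open>Arithmetic-geometric mean: the product of the two summable terms is the
        square of the increment, hence the increments themselves are summable.\<close>
      have "2 * ((1/2)^k * (2 ^ k * norm (d k \<omega>))) \<le> (1/2)^k + 2 ^ k * (norm (d k \<omega>))\<^sup>2"
      proof -
        have "0 \<le> (1/2)^k * (1 - 2 ^ k * norm (d k \<omega>))\<^sup>2" by simp
        also have "\<dots> = (1/2)^k - 2 * ((1/2)^k * (2 ^ k * norm (d k \<omega>))) + ((1/2)^k * 2^k) * 2 ^ k * (norm (d k \<omega>))\<^sup>2"
          by (simp add: power2_eq_square algebra_simps)
        also have "(1/2)^k * 2^k = (1::real)" by (simp add: power_mult_distrib[symmetric])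
        finally show ?thesis by simp
      qed
      also have "2 * ((1/2)^k * (2 ^ k * norm (d k \<omega>))) = 2 * norm (d k \<omega>)"
        by (simp add: mult.assoc[symmetric] power_mult_distrib[symmetric])
      finally show "norm (norm (d k \<omega>)) \<le> (1/2)^k + 2 ^ k * (norm (d k \<omega>))\<^sup>2"
        using norm_ge_zero[of "d k \<omega>"] by (simp only: real_norm_def abs_norm_cancel)
    qed
    then have "summable (\<lambda>k. d k \<omega>)" by (rule summable_norm_cancel)
    then have "convergent (\<lambda>n. (\<Sum>k<n. d k \<omega>))" by (simp add: summable_iff_convergent)
    moreover have "(\<Sum>k<n. d k \<omega>) = F (r n) \<omega> - F (r 0) \<omega>" for n
      unfolding d_def by (rule sum_lessThan_telescope)
    ultimately show ?case
      using convergent_add_const_iff[of "- F (r 0) \<omega>" "\<lambda>n. F (r n) \<omega>"] by simp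
  qed
  define f where "f \<omega> = lim (\<lambda>k. F (r k) \<omega>)" for \<omega>
  have [measurable]: "f \<in> borel_measurable M" unfolding f_def by measurable
  have lim: "AE \<omega> in M. (\<lambda>k. F (r k) \<omega>) \<longlonglongrightarrow> f \<omega>"
    using conv unfolding f_def by (simp add: convergent_LIMSEQ_iff)
  have fatou: "(\<integral>\<^sup>+\<omega>. ennreal ((norm (F m \<omega> - f \<omega>))\<^sup>2) \<partial>M) \<le> ennreal (((1/4)^k)\<^sup>2)" if "m \<ge> n0 k" for m k
  proof -
    have "(\<integral>\<^sup>+\<omega>. ennreal ((norm (F m \<omega> - f \<omega>))\<^sup>2) \<partial>M)
        = (\<integral>\<^sup>+\<omega>. liminf (\<lambda>j. ennreal ((norm (F m \<omega> - F (r j) \<omega>))\<^sup>2)) \<partial>M)"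
    proof (rule nn_integral_cong_AE, use lim in eventually_elim)
      case (elim \<omega>)
      have L: "(\<lambda>j. ennreal ((norm (F m \<omega> - F (r j) \<omega>))\<^sup>2)) \<longlonglongrightarrow> ennreal ((norm (F m \<omega> - f \<omega>))\<^sup>2)"
        by (intro tendsto_intros elim)
      show ?case by (rule lim_imp_Liminf[OF _ L, symmetric]) simp
    qed
    also have "\<dots> \<le> liminf (\<lambda>j. \<integral>\<^sup>+\<omega>. ennreal ((norm (F m \<omega> - F (r j) \<omega>))\<^sup>2) \<partial>M)"
      by (rule nn_integral_liminf) auto
    also have "\<dots> \<le> ennreal (((1/4)^k)\<^sup>2)"
    proof (rule Liminf_le)
      show "eventually (\<lambda>j. (\<integral>\<^sup>+\<omega>. ennreal ((norm (F m \<omega> - F (r j) \<omega>))\<^sup>2) \<partial>M) \<le> ennreal (((1/4)^k)\<^sup>2)) sequentially"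
        using eventually_ge_at_top[of k]
      proof eventually_elim
        case (elim j)
        have "r k \<le> r j" using elim sm by (simp add: strict_mono_less_eq)
        then have "n0 k \<le> r j" using r_ge[of k] by simp
        have "(\<integral>\<^sup>+\<omega>. ennreal ((norm (F m \<omega> - F (r j) \<omega>))\<^sup>2) \<partial>M) = ennreal ((L2_norm M (\<lambda>\<omega>. F m \<omega> - F (r j) \<omega>))\<^sup>2)"
          unfolding L2_norm_sq by (rule nn_integral_eq_integral[OF L2_integrable_sq[OF L2_diff[OF F F]]]) simp
        also have "\<dots> \<le> ennreal (((1/4)^k)\<^sup>2)"
          using n0[OF that \<open>n0 k \<le> r j\<close>] by (intro ennreal_leI power_mono) auto
        finally show ?case .
      qed
    qed simp
    finally show ?thesis .
  qed
  have Fm: "(\<lambda>\<omega>. F m \<omega> - f \<omega>) \<in> L2 M" if "m \<ge> n0 k" for m k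
  proof (rule L2_I)
    show "integrable M (\<lambda>\<omega>. (norm (F m \<omega> - f \<omega>))\<^sup>2)"
    proof (rule integrableI_bounded)
      show "(\<integral>\<^sup>+\<omega>. ennreal (norm ((norm (F m \<omega> - f \<omega>))\<^sup>2)) \<partial>M) < \<infinity>"
        using le_less_trans[OF fatou[OF that] ennreal_less_top] by simp
    qed measurable
  qed measurable
  have f2: "f \<in> L2 M" using L2_diff[OF F[of "n0 0"] Fm[of 0 "n0 0"]] by simp
  have "L2_norm M (\<lambda>\<omega>. F m \<omega> - f \<omega>) \<le> (1/4)^k" if "m \<ge> n0 k" for m k
  proof (rule power2_le_imp_le)
    have "ennreal ((L2_norm M (\<lambda>\<omega>. F m \<omega> - f \<omega>))\<^sup>2) \<le> ennreal (((1/4)^k)\<^sup>2)"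
      using fatou[OF that] unfolding L2_norm_sq
      by (subst nn_integral_eq_integral[OF L2_integrable_sq[OF Fm[OF that]], symmetric]) auto
    then show "(L2_norm M (\<lambda>\<omega>. F m \<omega> - f \<omega>))\<^sup>2 \<le> ((1/4)^k)\<^sup>2" by (simp add: ennreal_le_iff)
  qed auto
  then have "(\<lambda>n. L2_norm M (\<lambda>\<omega>. F n \<omega> - f \<omega>)) \<longlonglongrightarrow> 0"
  proof -
    assume *: "\<And>k m. n0 k \<le> m \<Longrightarrow> L2_norm M (\<lambda>\<omega>. F m \<omega> - f \<omega>) \<le> (1/4)^k"
    show ?thesis
    proof (rule LIMSEQ_I)
      fix \<epsilon> :: real assume "\<epsilon> > 0"
      then obtain k where "(1/4)^k < \<epsilon>" using real_arch_pow_inv[of \<epsilon> "1/4"] by auto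
      then show "\<exists>no. \<forall>n\<ge>no. norm (L2_norm M (\<lambda>\<omega>. F n \<omega> - f \<omega>) - 0) < \<epsilon>"
        using le_less_trans[OF *[of k]] by (intro exI[of _ "n0 k"]) simp
    qed
  qed
  with F f2 that show ?thesis by (auto simp: L2_lim_def)
qed

section \<open>Closed subspaces and bounded operators\<close>

text \<open>Sequential closure also covers a change of representative, because a constant sequence
  converges in L2 to every function almost everywhere equal to its value.\<close>

definition closed_subspace :: "'w measure \<Rightarrow> ('w \<Rightarrow> complex) set \<Rightarrow> bool" where
  "closed_subspace M V \<longleftrightarrow> V \<subseteq> L2 M \<and> (\<lambda>_. 0) \<in> V
     \<and> (\<forall>f\<in>V. \<forall>g\<in>V. \<forall>a b. (\<lambda>\<omega>. a * f \<omega> + b * g \<omega>) \<in> V)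
     \<and> (\<forall>F f. (\<forall>n. F n \<in> V) \<longrightarrow> L2_lim M F f \<longrightarrow> f \<in> V)"

context
  fixes M :: "'w measure" and V
  assumes V: "closed_subspace M V"
begin

lemma closed_subspace_L2: "f \<in> V \<Longrightarrow> f \<in> L2 M"
  using V by (auto simp: closed_subspace_def)

lemma closed_subspace_zero: "(\<lambda>_. 0) \<in> V"
  using V by (auto simp: closed_subspace_def)

lemma closed_subspace_lin: "f \<in> V \<Longrightarrow> g \<in> V \<Longrightarrow> (\<lambda>\<omega>. a * f \<omega> + b * g \<omega>) \<in> V"
  using V by (auto simp: closed_subspace_def)

lemma closed_subspace_lim: "(\<And>n. F n \<in> V) \<Longrightarrow> L2_lim M F f \<Longrightarrow> f \<in> V"
  using V unfolding closed_subspace_def by blast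

lemma closed_subspace_cmult: "f \<in> V \<Longrightarrow> (\<lambda>\<omega>. a * f \<omega>) \<in> V"
  using closed_subspace_lin[of f f a 0] by simp

lemma closed_subspace_add: "f \<in> V \<Longrightarrow> g \<in> V \<Longrightarrow> (\<lambda>\<omega>. f \<omega> + g \<omega>) \<in> V"
  using closed_subspace_lin[of f g 1 1] by simp

lemma closed_subspace_diff: "f \<in> V \<Longrightarrow> g \<in> V \<Longrightarrow> (\<lambda>\<omega>. f \<omega> - g \<omega>) \<in> V"
  using closed_subspace_lin[of f g 1 "-1"] by simp

lemma closed_subspace_aeq:
  assumes "f \<in> V" "aeq M f g" "g \<in> borel_measurable M"
  shows "g \<in> V"
proof (rule closed_subspace_lim)
  show "L2_lim M (\<lambda>_. f) g"
    unfolding L2_lim_def using L2_cong[OF assms(2) closed_subspace_L2[OF assms(1)] assms(3)]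
      closed_subspace_L2[OF assms(1)] by (simp add: L2_norm_diff_aeq[OF assms(2)])
qed (rule assms)

lemma closed_subspace_sum:
  "(\<And>i. i \<in> S \<Longrightarrow> f i \<in> V) \<Longrightarrow> (\<lambda>\<omega>. \<Sum>i\<in>S. c i * f i \<omega>) \<in> V"
proof (induction S rule: infinite_finite_induct)
  case (insert i S)
  then show ?case using closed_subspace_lin[of "f i" "\<lambda>\<omega>. \<Sum>i\<in>S. c i * f i \<omega>" "c i" 1] by simp
qed (simp_all add: closed_subspace_zero)

end

lemma closed_subspaceI:
  assumes "\<And>f. f \<in> V \<Longrightarrow> f \<in> L2 M" "(\<lambda>_. 0) \<in> V"
    and "\<And>f g a b. f \<in> V \<Longrightarrow> g \<in> V \<Longrightarrow> (\<lambda>\<omega>. a * f \<omega> + b * g \<omega>) \<in> V"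
    and "\<And>F f. (\<And>n. F n \<in> V) \<Longrightarrow> L2_lim M F f \<Longrightarrow> f \<in> V"
  shows "closed_subspace M V"
  unfolding closed_subspace_def
proof (intro conjI subsetI ballI allI impI)
  show "f \<in> V" if "\<forall>n. F n \<in> V" "L2_lim M F f" for F f by (rule assms(4)[OF _ that(2)]) (use that(1) in simp)
qed (rule assms; assumption)+

lemma closed_subspace_L2_self: "closed_subspace M (L2 M)"
  by (rule closed_subspaceI) (auto intro: L2_lin L2_limD)

definition cspan :: "'w measure \<Rightarrow> ('w \<Rightarrow> complex) set \<Rightarrow> ('w \<Rightarrow> complex) set" where
  "cspan M D = \<Inter>{V. closed_subspace M V \<and> D \<subseteq> V}"

lemma cspan_closed: "D \<subseteq> L2 M \<Longrightarrow> closed_subspace M (cspan M D)"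
  unfolding cspan_def
  by (rule closed_subspaceI)
     (auto intro: closed_subspace_L2_self closed_subspace_zero closed_subspace_lin closed_subspace_lim)

lemma cspan_superset: "D \<subseteq> cspan M D"
  by (auto simp: cspan_def)

lemma cspan_minimal: "closed_subspace M V \<Longrightarrow> D \<subseteq> V \<Longrightarrow> cspan M D \<subseteq> V"
  by (auto simp: cspan_def)

section \<open>Bounded linear maps between spaces of functionals\<close>

definition bounded_map :: "'w measure \<Rightarrow> ('w \<Rightarrow> complex) set \<Rightarrow> 'v measure \<Rightarrow> (('w \<Rightarrow> complex) \<Rightarrow> ('v \<Rightarrow> complex)) \<Rightarrow> bool" where
  "bounded_map M V M' S \<longleftrightarrow> (\<forall>f\<in>V. S f \<in> L2 M') \<and> linear_on M' V S
     \<and> (\<exists>C. \<forall>f\<in>V. L2_norm M' (S f) \<le> C * L2_norm M f)"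

lemma bounded_mapI:
  assumes "\<And>f. f \<in> V \<Longrightarrow> S f \<in> L2 M'"
    "\<And>f g a b. f \<in> V \<Longrightarrow> g \<in> V \<Longrightarrow> aeq M' (S (\<lambda>\<omega>. a * f \<omega> + b * g \<omega>)) (\<lambda>\<omega>. a * S f \<omega> + b * S g \<omega>)"
    "\<And>f. f \<in> V \<Longrightarrow> L2_norm M' (S f) \<le> C * L2_norm M f"
  shows "bounded_map M V M' S"
  unfolding bounded_map_def linear_on_def
  by (intro conjI ballI allI exI[of _ C]) (rule assms; assumption)+

lemma bounded_map_L2: "bounded_map M V M' S \<Longrightarrow> f \<in> V \<Longrightarrow> S f \<in> L2 M'"
  by (auto simp: bounded_map_def)

lemma bounded_map_lin: "bounded_map M V M' S \<Longrightarrow> f \<in> V \<Longrightarrow> g \<in> V \<Longrightarrow>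
   aeq M' (S (\<lambda>\<omega>. a * f \<omega> + b * g \<omega>)) (\<lambda>\<omega>. a * S f \<omega> + b * S g \<omega>)"
  by (auto simp: bounded_map_def linear_on_def)

lemma bounded_map_lim:
  assumes S: "bounded_map M V M' S" and V: "closed_subspace M V"
    and F: "\<And>n. F n \<in> V" "L2_lim M F f"
  shows "L2_lim M' (\<lambda>n. S (F n)) (S f)"
proof -
  have f: "f \<in> V" by (rule closed_subspace_lim[OF V F])
  obtain C where C: "\<And>f. f \<in> V \<Longrightarrow> L2_norm M' (S f) \<le> C * L2_norm M f"
    using S by (auto simp: bounded_map_def)
  note L = bounded_map_L2[OF S]
  show ?thesis
  proof (rule L2_limI_le)
    fix n
    have "aeq M' (S (\<lambda>\<omega>. F n \<omega> - f \<omega>)) (\<lambda>\<omega>. S (F n) \<omega> - S f \<omega>)"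
      using bounded_map_lin[OF S F(1)[of n] f, of 1 "-1"] by simp
    then have "L2_norm M' (\<lambda>\<omega>. S (F n) \<omega> - S f \<omega>) = L2_norm M' (S (\<lambda>\<omega>. F n \<omega> - f \<omega>))"
      by (intro L2_norm_cong[symmetric] L2_measurable L2_diff L closed_subspace_diff[OF V] F f)
    also have "\<dots> \<le> C * L2_norm M (\<lambda>\<omega>. F n \<omega> - f \<omega>)"
      by (intro C closed_subspace_diff[OF V] F f)
    finally show "L2_norm M' (\<lambda>\<omega>. S (F n) \<omega> - S f \<omega>) \<le> C * L2_norm M (\<lambda>\<omega>. F n \<omega> - f \<omega>)" .
  next
    show "(\<lambda>n. C * L2_norm M (\<lambda>\<omega>. F n \<omega> - f \<omega>)) \<longlonglongrightarrow> 0"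
      using tendsto_mult_left[OF L2_limD(3)[OF F(2)], of C] by simp
  qed (intro L F f)+
qed

text \<open>Operators act on functions, and respect for null sets is not part of the definition. It
  follows from boundedness, since a constant sequence converges to each of its
  representatives.\<close>

lemma bounded_map_aeq:
  assumes S: "bounded_map M V M' S" and V: "closed_subspace M V" and f: "f \<in> V" "g \<in> V" "aeq M f g"
  shows "aeq M' (S f) (S g)"
proof -
  have "L2_lim M (\<lambda>_. f) g"
    using L2_norm_diff_aeq[OF f(3)] closed_subspace_L2[OF V] f(1,2) by (simp add: L2_lim_def)
  from L2_lim_unique[OF bounded_map_lim[OF S V f(1) this] L2_lim_const[OF bounded_map_L2[OF S f(1)]]]
  show ?thesis by (rule aeq_sym)
qed

lemma closed_subspace_preimage:
  assumes S: "bounded_map M V M' S" and V: "closed_subspace M V" and V': "closed_subspace M' V'"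
  shows "closed_subspace M {f \<in> V. S f \<in> V'}"
proof (rule closed_subspaceI)
  have z: "(\<lambda>_. 0) \<in> V" by (rule closed_subspace_zero[OF V])
  note L = L2_measurable[OF bounded_map_L2[OF S]]
  have "aeq M' (\<lambda>_. 0) (S (\<lambda>_. 0))" using bounded_map_lin[OF S z z, of 0 0] by (simp add: aeq_sym)
  then show "(\<lambda>_. 0) \<in> {f \<in> V. S f \<in> V'}"
    using closed_subspace_aeq[OF V' closed_subspace_zero[OF V']] z L by auto
  show "(\<lambda>\<omega>. a * f \<omega> + b * g \<omega>) \<in> {f \<in> V. S f \<in> V'}"
    if "f \<in> {f \<in> V. S f \<in> V'}" "g \<in> {f \<in> V. S f \<in> V'}" for f g a b
    using that closed_subspace_lin[OF V] L
      closed_subspace_aeq[OF V' closed_subspace_lin[OF V'] aeq_sym[OF bounded_map_lin[OF S]]] by auto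
  show "f \<in> {f \<in> V. S f \<in> V'}" if "\<And>n. F n \<in> {f \<in> V. S f \<in> V'}" "L2_lim M F f" for F f
    using that closed_subspace_lim[OF V] closed_subspace_lim[OF V' _ bounded_map_lim[OF S V _ that(2)]] by auto
qed (auto intro: closed_subspace_L2[OF V])

text \<open>The principle behind most identities below: two bounded maps that agree on a total
  family agree everywhere.\<close>

lemma closed_subspace_equalizer:
  assumes S: "bounded_map M V M' S" and T: "bounded_map M V M' T" and V: "closed_subspace M V"
  shows "closed_subspace M {f \<in> V. aeq M' (S f) (T f)}"
proof (rule closed_subspaceI)
  have z: "(\<lambda>_. 0) \<in> V" by (rule closed_subspace_zero[OF V])
  show "(\<lambda>_. 0) \<in> {f \<in> V. aeq M' (S f) (T f)}"
    using bounded_map_lin[OF S z z, of 0 0] bounded_map_lin[OF T z z, of 0 0] z aeq_trans aeq_sym by fastforce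
  show "(\<lambda>\<omega>. a * f \<omega> + b * g \<omega>) \<in> {f \<in> V. aeq M' (S f) (T f)}"
    if "f \<in> {f \<in> V. aeq M' (S f) (T f)}" "g \<in> {f \<in> V. aeq M' (S f) (T f)}" for f g a b
    using that closed_subspace_lin[OF V]
      aeq_trans[OF bounded_map_lin[OF S] aeq_trans[OF aeq_lin aeq_sym[OF bounded_map_lin[OF T]]]] by auto
  show "f \<in> {f \<in> V. aeq M' (S f) (T f)}" if "\<And>n. F n \<in> {f \<in> V. aeq M' (S f) (T f)}" and Ff: "L2_lim M F f" for F f
  proof -
    have F: "F n \<in> V" "aeq M' (S (F n)) (T (F n))" for n using that by auto
    have f: "f \<in> V" by (rule closed_subspace_lim[OF V F(1) Ff])
    have "L2_lim M' (\<lambda>n. T (F n)) (S f)"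
      by (rule L2_lim_cong[OF bounded_map_lim[OF S V F(1) Ff] F(2) aeq_refl])
         (intro L2_measurable bounded_map_L2[OF S] bounded_map_L2[OF T] F f)+
    from L2_lim_unique[OF this bounded_map_lim[OF T V F(1) Ff]] f show ?thesis by auto
  qed
qed (auto intro: closed_subspace_L2[OF V])

lemma bounded_map_compose:
  assumes S: "bounded_map M V M' S" and T: "bounded_map M' V' M'' T" and V': "closed_subspace M' V'"
    and m: "\<And>f. f \<in> V \<Longrightarrow> S f \<in> V'" and V: "closed_subspace M V"
  shows "bounded_map M V M'' (\<lambda>f. T (S f))"
proof -
  obtain C where C: "\<And>f. f \<in> V \<Longrightarrow> L2_norm M' (S f) \<le> C * L2_norm M f"
    using S by (auto simp: bounded_map_def)
  obtain B where B: "\<And>f. f \<in> V' \<Longrightarrow> L2_norm M'' (T f) \<le> B * L2_norm M' f"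
    using T by (auto simp: bounded_map_def)
  show ?thesis
  proof (rule bounded_mapI)
    fix f g a b assume fg: "f \<in> V" "g \<in> V"
    have "aeq M'' (T (S (\<lambda>\<omega>. a * f \<omega> + b * g \<omega>))) (T (\<lambda>\<omega>. a * S f \<omega> + b * S g \<omega>))"
      by (rule bounded_map_aeq[OF T V' _ _ bounded_map_lin[OF S]])
         (intro m closed_subspace_lin[OF V] closed_subspace_lin[OF V'] fg)+
    also have "aeq M'' \<dots> (\<lambda>\<omega>. a * T (S f) \<omega> + b * T (S g) \<omega>)"
      by (rule bounded_map_lin[OF T m m]) fact+
    finally show "aeq M'' (T (S (\<lambda>\<omega>. a * f \<omega> + b * g \<omega>))) (\<lambda>\<omega>. a * T (S f) \<omega> + b * T (S g) \<omega>)" .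
  next
    fix f assume f: "f \<in> V"
    have "L2_norm M'' (T (S f)) \<le> B * L2_norm M' (S f)" by (intro B m f)
    also have "\<dots> \<le> \<bar>B\<bar> * L2_norm M' (S f)" by (simp add: mult_right_mono)
    also have "\<dots> \<le> \<bar>B\<bar> * (C * L2_norm M f)" by (intro mult_left_mono C f) auto
    finally show "L2_norm M'' (T (S f)) \<le> (\<bar>B\<bar> * C) * L2_norm M f" by (simp add: mult.assoc)
  qed (intro bounded_map_L2[OF T] m)
qed

text \<open>Nearest point: the parallelogram law makes a minimizing sequence Cauchy, and the first
  variation at its limit gives orthogonality.\<close>

lemma L2_projection:
  assumes V: "closed_subspace M V" and f: "f \<in> L2 M"
  obtains p where "p \<in> V" "\<And>g. g \<in> V \<Longrightarrow> L2_inner M g (\<lambda>\<omega>. f \<omega> - p \<omega>) = 0"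
proof -
  note VL = closed_subspace_L2[OF V]
  let ?n = "\<lambda>v. L2_norm M (\<lambda>\<omega>. f \<omega> - v \<omega>)"
  define d where "d = (INF v\<in>V. ?n v)"
  have bdd: "bdd_below (?n ` V)" by (rule bdd_belowI[of _ 0]) auto
  have d_le: "d \<le> ?n v" if "v \<in> V" for v unfolding d_def by (rule cINF_lower[OF bdd that])
  have d0: "0 \<le> d" unfolding d_def
    by (rule cINF_greatest) (use closed_subspace_zero[OF V] in auto)
  have "\<exists>v\<in>V. ?n v < d + 1 / real (Suc n)" for n
  proof -
    have "d < d + 1 / real (Suc n)" by simp
    then show ?thesis unfolding d_def
      using cINF_less_iff[OF _ bdd] closed_subspace_zero[OF V] by blast
  qed
  then obtain v where v: "\<And>n. v n \<in> V" "\<And>n. ?n (v n) < d + 1 / real (Suc n)" by metis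
  have lim: "(\<lambda>n. ?n (v n)) \<longlonglongrightarrow> d"
  proof (rule tendsto_sandwich[of "\<lambda>_. d"])
    show "(\<lambda>n. d + 1 / real (Suc n)) \<longlonglongrightarrow> d"
      using LIMSEQ_inverse_real_of_nat_add[of d] by (simp add: inverse_eq_divide)
  qed (use d_le v in \<open>auto intro!: always_eventually less_imp_le\<close>)
  \<comment> \<open>Parallelogram law for \<open>f - v m\<close> and \<open>f - v n\<close>: the
    midpoint of \<open>v m\<close> and \<open>v n\<close> lies in \<open>V\<close>, hence at
    distance at least \<open>d\<close> from \<open>f\<close>.\<close>
  have par: "(L2_norm M (\<lambda>\<omega>. v m \<omega> - v n \<omega>))\<^sup>2 \<le> 2 * (?n (v m))\<^sup>2 + 2 * (?n (v n))\<^sup>2 - 4 * d\<^sup>2" for m n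
  proof -
    let ?u = "\<lambda>\<omega>. f \<omega> - v m \<omega>" and ?w = "\<lambda>\<omega>. f \<omega> - v n \<omega>"
    have L: "?u \<in> L2 M" "?w \<in> L2 M" "(\<lambda>\<omega>. - ?w \<omega>) \<in> L2 M"
      using f VL[OF v(1)] L2_diff[OF f VL[OF v(1)]] L2_cmult[of ?w M "-1"] by auto
    have mid: "(\<lambda>\<omega>. (1/2) * v m \<omega> + (1/2) * v n \<omega>) \<in> V"
      by (rule closed_subspace_lin[OF V v(1) v(1)])
    have i: "L2_inner M ?u (\<lambda>\<omega>. - ?w \<omega>) = - L2_inner M ?u ?w"
      using L2_inner_lin_right[OF L(1) L(2) L(2), of "-1" 0] by simp
    have n: "L2_norm M (\<lambda>\<omega>. - ?w \<omega>) = L2_norm M ?w" by (simp add: L2_norm_def norm_minus_commute)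
    have "(\<lambda>\<omega>. ?u \<omega> - - ?w \<omega>) = (\<lambda>\<omega>. 2 * (f \<omega> - ((1/2) * v m \<omega> + (1/2) * v n \<omega>)))"
      by (auto simp: algebra_simps)
    then have "L2_norm M (\<lambda>\<omega>. ?u \<omega> - - ?w \<omega>) = 2 * ?n (\<lambda>\<omega>. (1/2) * v m \<omega> + (1/2) * v n \<omega>)"
      by (simp only: L2_norm_cmult) simp
    then have "2 * d \<le> L2_norm M (\<lambda>\<omega>. ?u \<omega> - - ?w \<omega>)" using d_le[OF mid] by simp
    then have "(2 * d)\<^sup>2 \<le> (L2_norm M (\<lambda>\<omega>. ?u \<omega> - - ?w \<omega>))\<^sup>2" using d0 by (intro power_mono) auto
    also have "\<dots> = (L2_norm M ?u)\<^sup>2 + 2 * Re (L2_inner M ?u ?w) + (L2_norm M ?w)\<^sup>2"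
      unfolding L2_norm_diff_sq[OF L(1,3)] i n by simp
    also have "2 * Re (L2_inner M ?u ?w) = (L2_norm M ?u)\<^sup>2 + (L2_norm M ?w)\<^sup>2 - (L2_norm M (\<lambda>\<omega>. ?u \<omega> - ?w \<omega>))\<^sup>2"
      unfolding L2_norm_diff_sq[OF L(1,2)] by simp
    also have "L2_norm M (\<lambda>\<omega>. ?u \<omega> - ?w \<omega>) = L2_norm M (\<lambda>\<omega>. v m \<omega> - v n \<omega>)"
      by (simp add: L2_norm_def norm_minus_commute)
    finally show ?thesis by (simp add: power_mult_distrib)
  qed
  have "\<exists>n0. \<forall>m\<ge>n0. \<forall>n\<ge>n0. L2_norm M (\<lambda>\<omega>. v m \<omega> - v n \<omega>) < \<epsilon>" if "\<epsilon> > 0" for \<epsilon>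
  proof -
    have "(\<lambda>n. (?n (v n))\<^sup>2) \<longlonglongrightarrow> d\<^sup>2" by (intro tendsto_power lim)
    then have "eventually (\<lambda>n. (?n (v n))\<^sup>2 < d\<^sup>2 + \<epsilon>\<^sup>2 / 4) sequentially"
      by (rule order_tendstoD) (use that in auto)
    then obtain n0 where n0: "\<And>n. n \<ge> n0 \<Longrightarrow> (?n (v n))\<^sup>2 < d\<^sup>2 + \<epsilon>\<^sup>2 / 4"
      by (auto simp: eventually_sequentially)
    have "L2_norm M (\<lambda>\<omega>. v m \<omega> - v n \<omega>) < \<epsilon>" if "m \<ge> n0" "n \<ge> n0" for m n
    proof (rule power2_less_imp_less)
      show "(L2_norm M (\<lambda>\<omega>. v m \<omega> - v n \<omega>))\<^sup>2 < \<epsilon>\<^sup>2"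
        using par[of m n] n0[OF that(1)] n0[OF that(2)] by simp
    qed (use \<open>\<epsilon> > 0\<close> in simp)
    then show ?thesis by (intro exI[of _ n0]) simp
  qed
  from L2_complete[OF VL[OF v(1)] this] obtain p where p: "L2_lim M v p" .
  have pV: "p \<in> V" by (rule closed_subspace_lim[OF V v(1) p])
  have "L2_lim M (\<lambda>n \<omega>. f \<omega> - v n \<omega>) (\<lambda>\<omega>. f \<omega> - p \<omega>)" by (rule L2_lim_diff[OF L2_lim_const[OF f] p])
  from L2_lim_norm[OF this] have dp: "?n p = d" using lim by (rule LIMSEQ_unique)
  have "L2_inner M g (\<lambda>\<omega>. f \<omega> - p \<omega>) = 0" if g: "g \<in> V" for g
  proof -
    let ?u = "\<lambda>\<omega>. f \<omega> - p \<omega>"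
    define c where "c = L2_inner M g ?u"
    have u: "?u \<in> L2 M" by (intro L2_diff f VL pV)
    \<comment> \<open>Compare \<open>p\<close> with its perturbation by \<open>t * c * g\<close>;
      the factor \<open>c\<close> makes the linear term real.\<close>
    have "0 \<le> - 2 * t * (norm c)\<^sup>2 + t\<^sup>2 * ((norm c)\<^sup>2 * (L2_norm M g)\<^sup>2)" for t :: real
    proof -
      have w: "(\<lambda>\<omega>. (t * c) * g \<omega>) \<in> L2 M" by (intro L2_cmult VL g)
      have "d \<le> ?n (\<lambda>\<omega>. p \<omega> + (t * c) * g \<omega>)"
        by (intro d_le closed_subspace_add[OF V] closed_subspace_cmult[OF V] pV g)
      then have "d\<^sup>2 \<le> (?n (\<lambda>\<omega>. p \<omega> + (t * c) * g \<omega>))\<^sup>2" by (intro power_mono d0)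
      also have "(\<lambda>\<omega>. f \<omega> - (p \<omega> + (t * c) * g \<omega>)) = (\<lambda>\<omega>. ?u \<omega> - (t * c) * g \<omega>)" by (auto simp: algebra_simps)
      also have "(L2_norm M (\<lambda>\<omega>. ?u \<omega> - (t * c) * g \<omega>))\<^sup>2
          = d\<^sup>2 - 2 * Re (L2_inner M ?u (\<lambda>\<omega>. (t * c) * g \<omega>)) + (L2_norm M (\<lambda>\<omega>. (t * c) * g \<omega>))\<^sup>2"
        unfolding L2_norm_diff_sq[OF u w] dp by simp
      also have "L2_inner M ?u (\<lambda>\<omega>. (t * c) * g \<omega>) = (t * c) * cnj c"
        using L2_inner_lin_right[OF u VL[OF g] VL[OF g], of "t * c" 0]
        by (simp add: c_def L2_inner_cnj)
      also have "Re ((t * c) * cnj c) = t * (norm c)\<^sup>2"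
        by (simp add: mult.assoc complex_norm_square[symmetric] del: of_real_power)
      also have "L2_norm M (\<lambda>\<omega>. (t * c) * g \<omega>) = \<bar>t\<bar> * norm c * L2_norm M g"
        by (simp only: L2_norm_cmult) (simp add: norm_mult)
      finally show ?thesis by (simp add: power_mult_distrib)
    qed
    \<comment> \<open>For small positive \<open>t\<close> the linear term dominates. This
      \<open>t\<close> is small enough, and the added 1 covers a \<open>g\<close> of norm 0.\<close>
    from this[of "1 / ((L2_norm M g)\<^sup>2 + 1)"] have "(norm c)\<^sup>2 \<le> 0"
    proof -
      define s where "s = (L2_norm M g)\<^sup>2"
      have s: "s \<ge> 0" by (simp add: s_def)
      assume "0 \<le> - 2 * (1 / ((L2_norm M g)\<^sup>2 + 1)) * (norm c)\<^sup>2 + (1 / ((L2_norm M g)\<^sup>2 + 1))\<^sup>2 * ((norm c)\<^sup>2 * (L2_norm M g)\<^sup>2)"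
      then have "0 \<le> (norm c)\<^sup>2 * (- 2 * (1 / (s + 1)) + (1 / (s + 1))\<^sup>2 * s)"
        unfolding s_def[symmetric] by (simp add: algebra_simps)
      moreover have "- 2 * (1 / (s + 1)) + (1 / (s + 1))\<^sup>2 * s < 0"
      proof -
        define r where "r = 1 / (s + 1)"
        have r: "r > 0" "r * s = 1 - r" using s by (auto simp: r_def field_simps)
        have "- 2 * r + r\<^sup>2 * s = r * (- 2 + r * s)" by (simp add: power2_eq_square algebra_simps)
        also have "\<dots> < 0" unfolding r(2) using r(1) by (intro mult_pos_neg) auto
        finally show ?thesis unfolding r_def .
      qed
      ultimately show ?thesis by (simp add: zero_le_mult_iff)
    qed
    then show ?thesis by (simp add: c_def)
  qed
  with pV that show ?thesis by blast
qed

section \<open>Multipliers of a closed subspace\<close>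

text \<open>Boundedness makes these multiplications bounded operators. For a closed subspace
  \<open>V\<close> the class is stable under linear combinations, products and uniformly bounded
  pointwise limits, which is rich enough to reach indicators.\<close>

definition multipliers :: "'w measure \<Rightarrow> ('w \<Rightarrow> complex) set \<Rightarrow> ('w \<Rightarrow> real) set" where
  "multipliers M V = {f \<in> borel_measurable M. (\<exists>C. \<forall>\<omega>\<in>space M. \<bar>f \<omega>\<bar> \<le> C)
     \<and> (\<forall>g\<in>V. (\<lambda>\<omega>. complex_of_real (f \<omega>) * g \<omega>) \<in> V)}"

lemma multipliersD:
  assumes "f \<in> multipliers M V"
  shows "f \<in> borel_measurable M" "\<exists>C. \<forall>\<omega>\<in>space M. \<bar>f \<omega>\<bar> \<le> C"
    "g \<in> V \<Longrightarrow> (\<lambda>\<omega>. complex_of_real (f \<omega>) * g \<omega>) \<in> V"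
  using assms by (auto simp: multipliers_def)

context
  fixes M :: "'w measure" and V
  assumes V: "closed_subspace M V"
begin

lemma multipliers_const: "(\<lambda>_. c) \<in> multipliers M V"
  using closed_subspace_cmult[OF V] by (auto simp: multipliers_def intro!: exI[of _ "\<bar>c\<bar>"])

lemma multipliers_mult:
  assumes f: "f \<in> multipliers M V" and g: "g \<in> multipliers M V"
  shows "(\<lambda>\<omega>. f \<omega> * g \<omega>) \<in> multipliers M V"
proof -
  note [measurable] = multipliersD(1)[OF f] multipliersD(1)[OF g]
  obtain B C where B: "\<And>\<omega>. \<omega> \<in> space M \<Longrightarrow> \<bar>f \<omega>\<bar> \<le> B" and C: "\<And>\<omega>. \<omega> \<in> space M \<Longrightarrow> \<bar>g \<omega>\<bar> \<le> C"
    using multipliersD(2)[OF f] multipliersD(2)[OF g] by blast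
  have "\<bar>f \<omega> * g \<omega>\<bar> \<le> \<bar>B\<bar> * \<bar>C\<bar>" if "\<omega> \<in> space M" for \<omega>
    unfolding abs_mult using B[OF that] C[OF that] by (intro mult_mono) auto
  moreover have "(\<lambda>\<omega>. complex_of_real (f \<omega> * g \<omega>) * k \<omega>) \<in> V" if "k \<in> V" for k
    using multipliersD(3)[OF f multipliersD(3)[OF g that]] by (simp add: mult.assoc)
  ultimately show ?thesis unfolding multipliers_def by auto
qed

lemma multipliers_lin:
  assumes f: "f \<in> multipliers M V" and g: "g \<in> multipliers M V"
  shows "(\<lambda>\<omega>. a * f \<omega> + b * g \<omega>) \<in> multipliers M V"
proof -
  note [measurable] = multipliersD(1)[OF f] multipliersD(1)[OF g]
  obtain B C where B: "\<And>\<omega>. \<omega> \<in> space M \<Longrightarrow> \<bar>f \<omega>\<bar> \<le> B" and C: "\<And>\<omega>. \<omega> \<in> space M \<Longrightarrow> \<bar>g \<omega>\<bar> \<le> C"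
    using multipliersD(2)[OF f] multipliersD(2)[OF g] by blast
  have "\<bar>a * f \<omega> + b * g \<omega>\<bar> \<le> \<bar>a\<bar> * B + \<bar>b\<bar> * C" if "\<omega> \<in> space M" for \<omega>
    using abs_triangle_ineq[of "a * f \<omega>" "b * g \<omega>"]
      mult_left_mono[OF B[OF that], of "\<bar>a\<bar>"] mult_left_mono[OF C[OF that], of "\<bar>b\<bar>"]
    by (simp add: abs_mult)
  moreover have "(\<lambda>\<omega>. complex_of_real (a * f \<omega> + b * g \<omega>) * k \<omega>) \<in> V" if "k \<in> V" for k
    using closed_subspace_lin[OF V multipliersD(3)[OF f that] multipliersD(3)[OF g that], of a b]
    by (simp add: algebra_simps)
  ultimately show ?thesis unfolding multipliers_def by auto
qed

lemma multipliers_power: "f \<in> multipliers M V \<Longrightarrow> (\<lambda>\<omega>. f \<omega> ^ n) \<in> multipliers M V"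
  by (induction n) (simp_all add: multipliers_const multipliers_mult)

text \<open>The uniform bound supplies the majorant \<open>C * norm (k \<omega>)\<close>, so the
  products with a fixed element of \<open>V\<close> converge in L2.\<close>

lemma multipliers_limit:
  assumes f: "\<And>n. f n \<in> multipliers M V"
    and b: "\<And>n \<omega>. \<omega> \<in> space M \<Longrightarrow> \<bar>f n \<omega>\<bar> \<le> C"
    and lim: "\<And>\<omega>. \<omega> \<in> space M \<Longrightarrow> (\<lambda>n. f n \<omega>) \<longlonglongrightarrow> g \<omega>"
  shows "g \<in> multipliers M V"
proof -
  note m[measurable] = multipliersD(1)[OF f]
  have [measurable]: "g \<in> borel_measurable M" by (rule borel_measurable_LIMSEQ_metric[OF m lim])
  have "\<bar>g \<omega>\<bar> \<le> C" if "\<omega> \<in> space M" for \<omega>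
    by (rule LIMSEQ_le_const2[OF tendsto_rabs[OF lim[OF that]]]) (use b[OF that] in auto)
  moreover have "(\<lambda>\<omega>. complex_of_real (g \<omega>) * k \<omega>) \<in> V" if k: "k \<in> V" for k
  proof (rule closed_subspace_lim[OF V])
    note [measurable] = L2_measurable[OF closed_subspace_L2[OF V k]]
    show "(\<lambda>\<omega>. complex_of_real (f n \<omega>) * k \<omega>) \<in> V" for n by (rule multipliersD(3)[OF f k])
    show "L2_lim M (\<lambda>n \<omega>. complex_of_real (f n \<omega>) * k \<omega>) (\<lambda>\<omega>. complex_of_real (g \<omega>) * k \<omega>)"
    proof (rule L2_lim_dominated[where w="\<lambda>\<omega>. C * norm (k \<omega>)"])
      show "(\<lambda>\<omega>. C * norm (k \<omega>)) \<in> L2 M"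
        by (intro L2_cmult L2_norm_fun closed_subspace_L2[OF V] k)
      show "AE \<omega> in M. (\<lambda>n. complex_of_real (f n \<omega>) * k \<omega>) \<longlonglongrightarrow> complex_of_real (g \<omega>) * k \<omega>"
        by (intro AE_I2 tendsto_intros lim)
      show "AE \<omega> in M. norm (complex_of_real (f n \<omega>) * k \<omega>) \<le> C * norm (k \<omega>)" for n
        by (intro AE_I2) (simp add: norm_mult mult_right_mono b)
    qed measurable
  qed
  ultimately show ?thesis unfolding multipliers_def by auto
qed

lemma multipliers_exp:
  assumes f: "f \<in> multipliers M V"
  shows "(\<lambda>\<omega>. exp (f \<omega>)) \<in> multipliers M V"
proof -
  obtain B where B: "\<And>\<omega>. \<omega> \<in> space M \<Longrightarrow> \<bar>f \<omega>\<bar> \<le> B" using multipliersD(2)[OF f] by blast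
  have sum: "(\<lambda>\<omega>. \<Sum>k<n. f \<omega> ^ k /\<^sub>R fact k) \<in> multipliers M V" for n
  proof (induction n)
    case (Suc n)
    then show ?case
      using multipliers_lin[OF Suc multipliers_power[OF f, of n], of 1 "inverse (fact n)"] by simp
  qed (simp add: multipliers_const)
  show ?thesis
  proof (rule multipliers_limit[OF sum])
    fix \<omega> assume \<omega>: "\<omega> \<in> space M"
    show "(\<lambda>n. \<Sum>k<n. f \<omega> ^ k /\<^sub>R fact k) \<longlonglongrightarrow> exp (f \<omega>)"
      using exp_converges[of "f \<omega>"] by (simp add: sums_def)
    fix n
    have "\<bar>\<Sum>k<n. f \<omega> ^ k /\<^sub>R fact k\<bar> \<le> (\<Sum>k<n. \<bar>f \<omega>\<bar> ^ k /\<^sub>R fact k)"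
      by (rule order_trans[OF sum_abs]) (simp add: abs_mult power_abs)
    also have "\<dots> \<le> (\<Sum>k. \<bar>f \<omega>\<bar> ^ k /\<^sub>R fact k)"
      by (rule sum_le_suminf[OF summable_exp_generic]) auto
    also have "\<dots> = exp \<bar>f \<omega>\<bar>" by (simp add: exp_def)
    also have "\<dots> \<le> exp B" using B[OF \<omega>] by simp
    finally show "\<bar>\<Sum>k<n. f \<omega> ^ k /\<^sub>R fact k\<bar> \<le> exp B" .
  qed
qed

definition multiplier_sets :: "'w set set" where
  "multiplier_sets = {E \<in> sets M. indicator E \<in> multipliers M V}"

lemma sigma_algebra_multiplier_sets: "sigma_algebra (space M) multiplier_sets"
proof -
  have compl: "space M - E \<in> multiplier_sets" if E: "E \<in> multiplier_sets" for E
  proof -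
    have "(\<lambda>\<omega>. 1 * 1 + (-1) * indicator E \<omega> :: real) \<in> multipliers M V"
      using E by (intro multipliers_lin multipliers_const) (auto simp: multiplier_sets_def)
    \<comment> \<open>A constant sequence serves to replace \<open>1 - indicator E\<close> by a
      function that agrees with it on \<open>space M\<close> only.\<close>
    from multipliers_limit[of "\<lambda>_. (\<lambda>\<omega>. 1 * 1 + (-1) * indicator E \<omega>)" 1 "indicator (space M - E)", OF this]
    have "indicator (space M - E) \<in> multipliers M V" by (auto simp: indicator_def)
    then show ?thesis using E by (auto simp: multiplier_sets_def)
  qed
  have int: "E \<inter> F \<in> multiplier_sets" if "E \<in> multiplier_sets" "F \<in> multiplier_sets" for E F
    using multipliers_mult[of "indicator E" "indicator F"] that
    by (auto simp: multiplier_sets_def indicator_inter_arith[abs_def])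
  have sub: "E \<subseteq> space M" if "E \<in> multiplier_sets" for E
    using that sets.sets_into_space by (auto simp: multiplier_sets_def)
  have un: "E \<union> F \<in> multiplier_sets" if "E \<in> multiplier_sets" "F \<in> multiplier_sets" for E F
  proof -
    have "E \<union> F = space M - ((space M - E) \<inter> (space M - F))" using sub that by blast
    then show ?thesis using compl int that by metis
  qed
  have empty: "{} \<in> multiplier_sets"
    using multipliers_const[of 0] by (simp add: multiplier_sets_def indicator_def[abs_def])
  show ?thesis
    unfolding sigma_algebra_iff2
  proof (intro conjI ballI allI impI)
    fix A :: "nat \<Rightarrow> 'w set" assume A: "range A \<subseteq> multiplier_sets"
    have fin: "(\<Union>i<n. A i) \<in> multiplier_sets" for n
    proof (induction n)
      case (Suc n)
      then show ?case using un[OF _ Suc, of "A n"] A by (simp add: lessThan_Suc image_subset_iff)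
    qed (simp add: empty)
    have "indicator (\<Union>i. A i) \<in> multipliers M V"
    proof (rule multipliers_limit)
      show "indicator (\<Union>i<n. A i) \<in> multipliers M V" for n using fin by (simp add: multiplier_sets_def)
      show "\<bar>indicator (\<Union>i<n. A i) \<omega> :: real\<bar> \<le> 1" for n \<omega> by (simp add: indicator_def)
      show "(\<lambda>n. indicator (\<Union>i<n. A i) \<omega> :: real) \<longlonglongrightarrow> indicator (\<Union>i. A i) \<omega>" for \<omega>
        by (rule LIMSEQ_indicator_UN)
    qed
    then show "(\<Union>i. A i) \<in> multiplier_sets" using A by (auto simp: multiplier_sets_def)
  qed (use sub compl empty in auto)
qed

text \<open>
  For bounded \<open>f\<close> the functions \<open>exp (- exp (n * (f - c)))\<close> are uniform limits of polynomials in
  \<open>f\<close>, and they converge to the indicator of \<open>f < c\<close>, up to the value on \<open>f = c\<close>.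
\<close>

lemma multiplier_sets_less:
  assumes f: "f \<in> multipliers M V"
  shows "{\<omega> \<in> space M. f \<omega> < c} \<in> multiplier_sets"
proof -
  note [measurable] = multipliersD(1)[OF f]
  define v where "v \<omega> = (if f \<omega> < c then 1 else if f \<omega> = c then exp (-1) else 0 :: real)" for \<omega>
  have v: "v \<in> multipliers M V"
  proof (rule multipliers_limit)
    have *: "(\<lambda>\<omega>. real n * (f \<omega> - c)) \<in> multipliers M V" for n
      using multipliers_lin[OF f multipliers_const[of 1], of "real n" "- real n * c"]
      by (simp add: algebra_simps)
    show "(\<lambda>\<omega>. exp (- exp (real n * (f \<omega> - c)))) \<in> multipliers M V" for n
      using multipliers_exp[OF multipliers_lin[OF multipliers_exp[OF *[of n]] multipliers_exp[OF *[of n]], of "-1" 0]] by simp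
    show "\<bar>exp (- exp (real n * (f \<omega> - c)))\<bar> \<le> 1" for n \<omega> by simp
    fix \<omega>
    consider "f \<omega> < c" | "f \<omega> = c" | "f \<omega> > c" by linarith
    then show "(\<lambda>n. exp (- exp (real n * (f \<omega> - c)))) \<longlonglongrightarrow> v \<omega>"
    proof cases
      case 1
      have "filterlim (\<lambda>n. real n * (f \<omega> - c)) at_bot sequentially"
        using filterlim_tendsto_neg_mult_at_bot[OF tendsto_const _ filterlim_real_sequentially, of "f \<omega> - c"] 1
        by (simp add: mult.commute)
      then have "(\<lambda>n. exp (real n * (f \<omega> - c))) \<longlonglongrightarrow> 0"
        by (rule filterlim_compose[OF exp_at_bot])
      then have "(\<lambda>n. exp (- exp (real n * (f \<omega> - c)))) \<longlonglongrightarrow> exp (- 0)"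
        by (intro tendsto_intros)
      then show ?thesis using 1 by (simp add: v_def)
    next
      case 2
      then show ?thesis by (simp add: v_def)
    next
      case 3
      have "filterlim (\<lambda>n. real n * (f \<omega> - c)) at_top sequentially"
        using 3 by (intro filterlim_at_top_mult_tendsto_pos[OF tendsto_const] filterlim_real_sequentially) auto
      then have "filterlim (\<lambda>n. exp (real n * (f \<omega> - c))) at_top sequentially"
        by (rule filterlim_compose[OF exp_at_top])
      then have "filterlim (\<lambda>n. - exp (real n * (f \<omega> - c))) at_bot sequentially"
        by (simp add: filterlim_uminus_at_top)
      then have "(\<lambda>n. exp (- exp (real n * (f \<omega> - c)))) \<longlonglongrightarrow> 0"
        by (rule filterlim_compose[OF exp_at_bot])
      then show ?thesis using 3 by (simp add: v_def)
    qed
  qed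
  \<comment> \<open>Powers of \<open>v\<close> keep the values 0 and 1 and send the remaining value
    \<open>exp (-1)\<close> to 0.\<close>
  have "indicator {\<omega> \<in> space M. f \<omega> < c} \<in> multipliers M V"
  proof (rule multipliers_limit)
    show "(\<lambda>\<omega>. v \<omega> ^ n) \<in> multipliers M V" for n by (rule multipliers_power[OF v])
    show "\<bar>v \<omega> ^ n\<bar> \<le> 1" for n \<omega> by (simp add: v_def power_abs[symmetric] power_le_one)
    have "(\<lambda>n. exp (-1) ^ n :: real) \<longlonglongrightarrow> 0" by (rule LIMSEQ_realpow_zero) auto
    moreover have "(\<lambda>n. 0 ^ n :: real) \<longlonglongrightarrow> 0" by (rule LIMSEQ_power_zero) auto
    ultimately show "(\<lambda>n. v \<omega> ^ n) \<longlonglongrightarrow> indicator {\<omega> \<in> space M. f \<omega> < c} \<omega>" if "\<omega> \<in> space M" for \<omega>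
      using that by (auto simp: v_def indicator_def)
  qed
  moreover have "{\<omega> \<in> space M. f \<omega> < c} \<in> sets M" by measurable
  ultimately show ?thesis by (simp add: multiplier_sets_def)
qed

lemma multiplier_measurable:
  assumes f: "f \<in> multipliers M V"
  shows "f \<in> borel_measurable (sigma (space M) multiplier_sets)"
proof -
  interpret S: sigma_algebra "space M" multiplier_sets by (rule sigma_algebra_multiplier_sets)
  show ?thesis
    by (rule borel_measurableI_less)
       (use multiplier_sets_less[OF f] S.space_closed in \<open>simp add: space_measure_of_conv\<close>)
qed

text \<open>An indicator times the constant 1 lies in \<open>V\<close>. Hence so do the simple
  functions over \<open>F\<close>, and dominated approximation by them reaches
  \<open>g\<close>.\<close>

lemma L2_multiplier_sets:
  assumes one: "(\<lambda>_. 1) \<in> V" and F: "space F = space M" "sets F \<subseteq> multiplier_sets"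
    and g: "g \<in> L2 M" "g \<in> borel_measurable F"
  shows "g \<in> V"
proof -
  have FM: "sets F \<subseteq> sets M" using F by (auto simp: multiplier_sets_def)
  obtain s where s: "\<And>i. simple_function F (s i)"
      "\<And>\<omega>. \<omega> \<in> space M \<Longrightarrow> (\<lambda>i. s i \<omega>) \<longlonglongrightarrow> g \<omega>"
      "\<And>i \<omega>. \<omega> \<in> space M \<Longrightarrow> norm (s i \<omega>) \<le> 2 * norm (g \<omega>)"
    using borel_measurable_implies_sequence_metric[OF g(2), of 0] F(1) by (simp add: dist_norm) blast
  have sm: "s i \<in> borel_measurable M" for i
    using borel_measurable_simple_function[OF s(1)] F(1) FM 
    by (intro measurable_from_subalg[of M F]) (auto simp: subalgebra_def)
  have sV: "s i \<in> V" for i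
  proof (rule closed_subspace_aeq[OF V _ _ sm])
    let ?E = "\<lambda>y. s i -` {y} \<inter> space M"
    have fin: "finite (s i ` space M)" using s(1)[of i] F by (simp add: simple_function_def)
    have "?E y \<in> sets F" if "y \<in> s i ` space M" for y using s(1)[of i] that F(1) by (auto simp: simple_function_def)
    then have "indicator (?E y) \<in> multipliers M V" if "y \<in> s i ` space M" for y
      using that F by (auto simp: multiplier_sets_def)
    from multipliersD(3)[OF this one]
    have "(\<lambda>\<omega>. complex_of_real (indicator (?E y) \<omega>)) \<in> V" if "y \<in> s i ` space M" for y
      using that by simp
    then show "(\<lambda>\<omega>. \<Sum>y\<in>s i ` space M. y * complex_of_real (indicator (?E y) \<omega>)) \<in> V"
      by (rule closed_subspace_sum[OF V])
    show "aeq M (\<lambda>\<omega>. \<Sum>y\<in>s i ` space M. y * complex_of_real (indicator (?E y) \<omega>)) (s i)"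
      unfolding aeq_def
    proof (rule AE_I2)
      fix \<omega> assume \<omega>: "\<omega> \<in> space M"
      have "(\<Sum>y\<in>s i ` space M. y * complex_of_real (indicator (?E y) \<omega>)) = (\<Sum>y\<in>s i ` space M. if y = s i \<omega> then s i \<omega> else 0)"
        using \<omega> by (intro sum.cong) (auto simp: indicator_def)
      also have "\<dots> = s i \<omega>" using fin \<omega> by simp
      finally show "(\<Sum>y\<in>s i ` space M. y * complex_of_real (indicator (?E y) \<omega>)) = s i \<omega>" .
    qed
  qed
  show ?thesis
  proof (rule closed_subspace_lim[OF V sV])
    show "L2_lim M s g"
    proof (rule L2_lim_dominated[where w="\<lambda>\<omega>. 2 * norm (g \<omega>)"])
      show "(\<lambda>\<omega>. 2 * norm (g \<omega>)) \<in> L2 M" by (intro L2_cmult L2_norm_fun g)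
    qed (use s sm L2_measurable[OF g(1)] in auto)
  qed
qed

end

text \<open>An L2 limit agrees almost everywhere with the pointwise limit of the
  \<open>F\<close>-measurable representatives along a subsequence, and that limit is again
  \<open>F\<close>-measurable.\<close>

lemma closed_subspace_subalgebra:
  fixes M :: "'w measure"
  assumes F: "subalgebra M F"
  shows "closed_subspace M {f \<in> L2 M. \<exists>g\<in>borel_measurable F. aeq M f g}"
proof (rule closed_subspaceI)
  show "(\<lambda>\<omega>. a * f \<omega> + b * g \<omega>) \<in> {f \<in> L2 M. \<exists>g\<in>borel_measurable F. aeq M f g}"
    if fg: "f \<in> {f \<in> L2 M. \<exists>g\<in>borel_measurable F. aeq M f g}" "g \<in> {f \<in> L2 M. \<exists>g\<in>borel_measurable F. aeq M f g}"
    for f g :: "'w \<Rightarrow> complex" and a b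
  proof -
    obtain f' g' where m: "f' \<in> borel_measurable F" "g' \<in> borel_measurable F"
      and "aeq M f f'" "aeq M g g'" using fg by blast
    note [measurable] = m
    have "aeq M (\<lambda>\<omega>. a * f \<omega> + b * g \<omega>) (\<lambda>\<omega>. a * f' \<omega> + b * g' \<omega>)" by (intro aeq_lin) fact+
    moreover have "(\<lambda>\<omega>. a * f' \<omega> + b * g' \<omega>) \<in> borel_measurable F"
      by (intro borel_measurable_add borel_measurable_times borel_measurable_const m)
    ultimately show ?thesis using fg L2_lin by blast
  qed
next
  fix K and f :: "'w \<Rightarrow> complex" assume K: "\<And>n::nat. K n \<in> {f \<in> L2 M. \<exists>g\<in>borel_measurable F. aeq M f g}" and l: "L2_lim M K f"
  then obtain k where k[measurable]: "\<And>n. k n \<in> borel_measurable F" and ka: "\<And>n. aeq M (K n) (k n)" by simp metis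
  obtain r where r: "strict_mono r" "AE \<omega> in M. (\<lambda>n. K (r n) \<omega>) \<longlonglongrightarrow> f \<omega>" by (rule L2_lim_AE_subseq[OF l])
  have "AE \<omega> in M. \<forall>n. K n \<omega> = k n \<omega>" using ka by (simp add: AE_all_countable aeq_def)
  with r(2) have "aeq M f (\<lambda>\<omega>. lim (\<lambda>n. k (r n) \<omega>))"
    unfolding aeq_def by eventually_elim (simp add: limI)
  moreover have "(\<lambda>\<omega>. lim (\<lambda>n. k (r n) \<omega>)) \<in> borel_measurable F" by measurable
  ultimately show "f \<in> {f \<in> L2 M. \<exists>g\<in>borel_measurable F. aeq M f g}" using L2_limD(2)[OF l] by blast
qed (auto intro!: bexI[of _ "\<lambda>_. 0"])

lemma local_L2_eq: "local_L2 M loc A = {f \<in> L2 M. \<exists>g\<in>borel_measurable (loc A). aeq M f g}"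
  by (auto simp: local_L2_def local_functionals_def L2_def)

lemma closed_subspace_local_L2: "subalgebra M (loc A) \<Longrightarrow> closed_subspace M (local_L2 M loc A)"
  unfolding local_L2_eq by (rule closed_subspace_subalgebra)

text \<open>
  Multiplication by bounded functions generating the sigma-algebra is a cheap substitute for a
  multiplicative system: no closure under products has to be checked.
\<close>

lemma local_L2_subset_multiplier:
  assumes V: "closed_subspace M V" and one: "(\<lambda>_. 1) \<in> V"
    and F: "loc A = sigma (space M) \<G>" "\<G> \<subseteq> multiplier_sets M V"
  shows "local_L2 M loc A \<subseteq> V"
proof
  interpret S: sigma_algebra "space M" "multiplier_sets M V" by (rule sigma_algebra_multiplier_sets[OF V])
  have G: "\<G> \<subseteq> Pow (space M)" using F S.space_closed by blast
  have sub: "space (loc A) = space M" "sets (loc A) \<subseteq> multiplier_sets M V"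
    using F G S.sigma_sets_subset by (auto simp: space_measure_of_conv)
  then have "subalgebra M (loc A)" by (auto simp: subalgebra_def multiplier_sets_def[OF V])
  fix f assume f: "f \<in> local_L2 M loc A"
  then obtain g where g: "g \<in> borel_measurable (loc A)" "aeq M f g" by (auto simp: local_L2_eq)
  have gM: "g \<in> borel_measurable M" by (rule measurable_from_subalg) fact+
  have "g \<in> L2 M" by (rule L2_cong[OF g(2) _ gM]) (use f in \<open>auto simp: local_L2_eq\<close>)
  then have "g \<in> V" by (rule L2_multiplier_sets[OF V one sub _ g(1)])
  then show "f \<in> V"
    using aeq_sym[OF g(2)] by (rule closed_subspace_aeq[OF V]) (use f in \<open>auto simp: local_L2_eq L2_measurable\<close>)
qed

section \<open>Exponential systems\<close>

text \<open>The finite support puts \<open>h\<close> into both L1 and L2 and makes a Poisson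
  configuration meet the support in almost surely finitely many points.\<close>

definition step_fun :: "'y measure \<Rightarrow> ('y \<Rightarrow> real) \<Rightarrow> bool" where
  "step_fun M h \<longleftrightarrow> simple_function M h \<and> emeasure M {y \<in> space M. h y \<noteq> 0} < \<infinity>"

lemma step_fun_simple: "step_fun M h \<Longrightarrow> simple_function M h"
  by (simp add: step_fun_def)

lemma step_fun_measurable [measurable_dest]: "step_fun M h \<Longrightarrow> h \<in> borel_measurable M"
  by (rule borel_measurable_simple_function[OF step_fun_simple])

lemma step_fun_supp: "step_fun M h \<Longrightarrow> emeasure M {y \<in> space M. h y \<noteq> 0} < \<infinity>"
  by (simp add: step_fun_def)

lemma step_funI_le:
  assumes h: "step_fun M h" and k: "simple_function M k" and "\<And>y. y \<in> space M \<Longrightarrow> h y = 0 \<Longrightarrow> k y = 0"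
  shows "step_fun M k"
proof -
  note [measurable] = step_fun_measurable[OF h]
  have "emeasure M {y \<in> space M. k y \<noteq> 0} \<le> emeasure M {y \<in> space M. h y \<noteq> 0}"
    using assms(3) by (intro emeasure_mono) auto
  then show ?thesis using k step_fun_supp[OF h] by (auto simp: step_fun_def)
qed

lemma step_fun_zero: "step_fun M (\<lambda>_. 0)"
  by (simp add: step_fun_def)

lemma step_fun_compose:
  assumes h: "step_fun M h" and k: "step_fun M k" and p: "p 0 0 = 0"
  shows "step_fun M (\<lambda>y. p (h y) (k y))"
proof -
  note [measurable] = step_fun_measurable[OF h] step_fun_measurable[OF k]
  have s: "simple_function M (\<lambda>y. p (h y) (k y))"
    using simple_function_compose[OF simple_function_Pair[OF step_fun_simple[OF h] step_fun_simple[OF k]], of "case_prod p"]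
    by (simp add: comp_def)
  note [measurable] = borel_measurable_simple_function[OF s]
  have "emeasure M {y \<in> space M. p (h y) (k y) \<noteq> 0}
      \<le> emeasure M ({y \<in> space M. h y \<noteq> 0} \<union> {y \<in> space M. k y \<noteq> 0})"
    using p by (intro emeasure_mono) auto
  also have "\<dots> \<le> emeasure M {y \<in> space M. h y \<noteq> 0} + emeasure M {y \<in> space M. k y \<noteq> 0}"
    by (intro emeasure_subadditive) auto
  also have "\<dots> < \<infinity>" using step_fun_supp[OF h] step_fun_supp[OF k] by simp
  finally show ?thesis using s by (simp add: step_fun_def)
qed

lemma step_fun_restrict:
  assumes h: "step_fun M h" and A: "A \<in> sets M"
  shows "step_fun M (\<lambda>y. if y \<in> A then h y else 0)"
proof (rule step_funI_le[OF h])
  have "A \<inter> space M \<in> sets M" using A by simp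
  then show "simple_function M (\<lambda>y. if y \<in> A then h y else 0)"
    using simple_function_If_set[OF step_fun_simple[OF h] simple_function_const[of M 0]] by blast
qed auto

text \<open>With \<open>g'\<close> the constant 1 this expresses that an expectation factorizes,
  \<open>c\<close> being the expectation of the other factor; with \<open>c = 0\<close> it is
  orthogonality to \<open>g\<close>.\<close>

lemma closed_subspace_inner_eq:
  assumes V: "closed_subspace M V" and g: "g \<in> L2 M" "g' \<in> L2 M"
  shows "closed_subspace M {f \<in> V. L2_inner M g f = c * L2_inner M g' f}"
proof (rule closed_subspaceI)
  note L = closed_subspace_L2[OF V]
  show "(\<lambda>_. 0) \<in> {f \<in> V. L2_inner M g f = c * L2_inner M g' f}"
    by (simp add: closed_subspace_zero[OF V] L2_inner_def)
  show "(\<lambda>\<omega>. a * f \<omega> + b * k \<omega>) \<in> {f \<in> V. L2_inner M g f = c * L2_inner M g' f}"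
    if "f \<in> {f \<in> V. L2_inner M g f = c * L2_inner M g' f}" "k \<in> {f \<in> V. L2_inner M g f = c * L2_inner M g' f}" for f k a b
    using that L g closed_subspace_lin[OF V] by (auto simp: L2_inner_lin_right algebra_simps)
  show "f \<in> {f \<in> V. L2_inner M g f = c * L2_inner M g' f}"
    if F: "\<And>n. F n \<in> {f \<in> V. L2_inner M g f = c * L2_inner M g' f}" and l: "L2_lim M F f" for F f
  proof -
    have "(\<lambda>n. L2_inner M g (F n)) \<longlonglongrightarrow> L2_inner M g f" by (rule L2_lim_inner[OF L2_lim_const[OF g(1)] l])
    moreover have "(\<lambda>n. c * L2_inner M g' (F n)) \<longlonglongrightarrow> c * L2_inner M g' f"
      by (intro tendsto_intros L2_lim_inner[OF L2_lim_const[OF g(2)] l])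
    ultimately show ?thesis
      using F closed_subspace_lim[OF V _ l] LIMSEQ_unique by fastforce
  qed
qed (use closed_subspace_L2[OF V] in auto)

lemma bounded_opsD:
  assumes "S \<in> bounded_ops M V" and V: "closed_subspace M V"
  shows "bounded_map M V M S" "\<And>f. f \<in> V \<Longrightarrow> S f \<in> V"
  using assms closed_subspace_L2[OF V] by (auto simp: bounded_ops_def bounded_map_def)

lemma bounded_opsI:
  assumes "bounded_map M V M S" "\<And>f. f \<in> V \<Longrightarrow> S f \<in> V"
  shows "S \<in> bounded_ops M V"
  using assms by (auto simp: bounded_ops_def bounded_map_def)

lemma bounded_map_subset: "bounded_map M V M' S \<Longrightarrow> U \<subseteq> V \<Longrightarrow> bounded_map M U M' S"
  unfolding bounded_map_def linear_on_def by (meson subsetD)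

lemma bounded_map_cmult_right:
  assumes "\<And>f. f \<in> V \<Longrightarrow> (\<lambda>\<omega>. f \<omega> * G \<omega>) \<in> L2 M" "\<And>f. f \<in> V \<Longrightarrow> L2_norm M (\<lambda>\<omega>. f \<omega> * G \<omega>) = L2_norm M f * L2_norm M G"
  shows "bounded_map M V M (\<lambda>f \<omega>. f \<omega> * G \<omega>)"
  by (rule bounded_mapI[where C="L2_norm M G"]) (use assms in \<open>simp_all add: algebra_simps\<close>)

text \<open>Axioms for the exponential vectors of the Fock space over L2 of \<mu>, indexed by step
  functions. Gaussian and Poisson functionals are two realizations. All properties of the generated
  factorization are derived from these axioms once, and so is the independence of the restrictions
  to complementary sets.\<close>

locale exp_system = prob_space M
  for M :: "'w measure" +
  fixes \<mu> :: "'y measure" and loc :: "'y set \<Rightarrow> 'w measure" and e :: "('y \<Rightarrow> real) \<Rightarrow> 'w \<Rightarrow> complex"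
  assumes subalg: "A \<in> sets \<mu> \<Longrightarrow> subalgebra M (loc A)"
    and loc_mono: "A \<subseteq> B \<Longrightarrow> sets (loc A) \<subseteq> sets (loc B)"
    and e_local: "step_fun \<mu> h \<Longrightarrow> A \<in> sets \<mu> \<Longrightarrow> (\<And>y. y \<in> space \<mu> - A \<Longrightarrow> h y = 0)
      \<Longrightarrow> e h \<in> local_L2 M loc A"
    and e_real: "step_fun \<mu> h \<Longrightarrow> real_valued M (e h)"
    and e_zero: "aeq M (e (\<lambda>_. 0)) (\<lambda>_. 1)"
    and e_mult: "step_fun \<mu> h \<Longrightarrow> step_fun \<mu> k
      \<Longrightarrow> (\<And>y. y \<in> space \<mu> \<Longrightarrow> h y * k y = 0) \<Longrightarrow> aeq M (e (\<lambda>y. h y + k y)) (\<lambda>\<omega>. e h \<omega> * e k \<omega>)"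
    and e_inner: "step_fun \<mu> h \<Longrightarrow> step_fun \<mu> k
      \<Longrightarrow> L2_inner M (e h) (e k) = complex_of_real (exp (LINT y|\<mu>. h y * k y))"
    and total: "A \<in> sets \<mu> \<Longrightarrow> closed_subspace M V
      \<Longrightarrow> (\<And>h. step_fun \<mu> h \<Longrightarrow> (\<And>y. y \<in> space \<mu> - A \<Longrightarrow> h y = 0) \<Longrightarrow> e h \<in> V)
      \<Longrightarrow> local_L2 M loc A \<subseteq> V"
begin

abbreviation H where "H \<equiv> local_L2 M loc"

lemma sets_compl: "A \<in> sets \<mu> \<Longrightarrow> space \<mu> - A \<in> sets \<mu>"
  by auto

lemma H_closed: "A \<in> sets \<mu> \<Longrightarrow> closed_subspace M (H A)"
  by (rule closed_subspace_local_L2[OF subalg])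

lemma H_L2: "f \<in> H A \<Longrightarrow> f \<in> L2 M"
  by (simp add: local_L2_def)

lemma H_meas [measurable_dest]: "f \<in> H A \<Longrightarrow> f \<in> borel_measurable M"
  by (rule L2_measurable[OF H_L2])

lemma measurable_loc_mono:
  assumes "A \<subseteq> B" "A \<in> sets \<mu>" "B \<in> sets \<mu>" "f \<in> borel_measurable (loc A)"
  shows "f \<in> borel_measurable (loc B)"
  using assms(4) measurable_mono[OF order_refl, of borel "loc A" "loc B"] loc_mono[OF assms(1)]
    subalg[OF assms(2)] subalg[OF assms(3)] by (auto simp: subalgebra_def)

lemma H_mono: "A \<subseteq> B \<Longrightarrow> A \<in> sets \<mu> \<Longrightarrow> B \<in> sets \<mu> \<Longrightarrow> H A \<subseteq> H B"
  unfolding local_L2_eq using measurable_loc_mono by blast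

lemma H_top: "A \<in> sets \<mu> \<Longrightarrow> H A \<subseteq> H (space \<mu>)"
  by (rule H_mono) (auto dest: sets.sets_into_space)

lemma const_H: "(\<lambda>_. c) \<in> H A"
  unfolding local_L2_eq by (auto simp: L2_def intro!: bexI[of _ "\<lambda>_. c"])

lemma H_aeq: "A \<in> sets \<mu> \<Longrightarrow> f \<in> H A \<Longrightarrow> aeq M f g \<Longrightarrow> g \<in> borel_measurable M \<Longrightarrow> g \<in> H A"
  by (rule closed_subspace_aeq[OF H_closed])

lemma e_L2: "step_fun \<mu> h \<Longrightarrow> e h \<in> L2 M"
  using e_local[of h "space \<mu>"] by (auto intro: H_L2)

lemma inner_one_eq: "L2_inner M (\<lambda>_. 1) f = expectation f"
  by (simp add: L2_inner_def)

lemma e_mean: 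
  assumes h: "step_fun \<mu> h"
  shows "expectation (e h) = 1"
proof -
  have "L2_inner M (\<lambda>_. 1) (e h) = L2_inner M (e (\<lambda>_. 0)) (e h)"
    by (rule L2_inner_cong[OF aeq_sym[OF e_zero]]) (auto intro: L2_measurable e_L2 h step_fun_zero)
  then show ?thesis by (simp add: e_inner[OF step_fun_zero h] inner_one_eq)
qed

text \<open>Independence is contained in the inner products: for disjoint supports
  \<open>e h\<close> and \<open>e k\<close> have inner product 1, the product of their means.
  Totality is applied first in \<open>F\<close>, then in \<open>G\<close>.\<close>

lemma expect_mult_aux:
  assumes A: "A \<in> sets \<mu>" and F: "F \<in> H A" and G: "G \<in> H (space \<mu> - A)"
  shows "expectation (\<lambda>\<omega>. F \<omega> * G \<omega>) = expectation F * expectation G"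
proof -
  have one: "(\<lambda>_. 1 :: complex) \<in> L2 M" by (rule H_L2[OF const_H])
  have 1: "L2_inner M (e k) F' = 1 * L2_inner M (\<lambda>_. 1) F'" if F': "F' \<in> H A"
    and k: "step_fun \<mu> k" "\<And>y. y \<in> space \<mu> - (space \<mu> - A) \<Longrightarrow> k y = 0" for k F'
  proof -
    have "H A \<subseteq> {f \<in> H A. L2_inner M (e k) f = 1 * L2_inner M (\<lambda>_. 1) f}"
    proof (rule total[OF A closed_subspace_inner_eq[OF H_closed[OF A] e_L2[OF k(1)] one]])
      fix h assume h: "step_fun \<mu> h" "\<And>y. y \<in> space \<mu> - A \<Longrightarrow> h y = 0"
      have "(LINT y|\<mu>. k y * h y) = (LINT y|\<mu>. 0)"
        by (rule Bochner_Integration.integral_cong) (use h(2) k(2) in auto)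
      then show "e h \<in> {f \<in> H A. L2_inner M (e k) f = 1 * L2_inner M (\<lambda>_. 1) f}"
        using e_local[OF h(1) A h(2)] by (simp add: e_inner k h inner_one_eq e_mean)
    qed
    then show ?thesis using F' by blast
  qed
  have Fc: "(\<lambda>\<omega>. cnj (F \<omega>)) \<in> L2 M" by (intro L2_cnj H_L2[OF F])
  have "H (space \<mu> - A) \<subseteq> {f \<in> H (space \<mu> - A). L2_inner M (\<lambda>\<omega>. cnj (F \<omega>)) f = expectation F * L2_inner M (\<lambda>_. 1) f}"
  proof (rule total[OF sets_compl[OF A] closed_subspace_inner_eq[OF H_closed[OF sets_compl[OF A]] Fc one]])
    fix k assume k: "step_fun \<mu> k" "\<And>y. y \<in> space \<mu> - (space \<mu> - A) \<Longrightarrow> k y = 0"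
    \<comment> \<open>\<open>e k\<close> is real, so the conjugation can be moved onto it.\<close>
    have "L2_inner M (\<lambda>\<omega>. cnj (F \<omega>)) (e k) = L2_inner M (e k) F"
      unfolding L2_inner_def using F e_L2[OF k(1)] e_real[OF k(1)]
      by (intro integral_cong_AE) (auto simp: real_valued_def Reals_cnj_iff elim!: eventually_mono intro: L2_measurable)
    then show "e k \<in> {f \<in> H (space \<mu> - A). L2_inner M (\<lambda>\<omega>. cnj (F \<omega>)) f = expectation F * L2_inner M (\<lambda>_. 1) f}"
      using 1[OF F k] e_local[OF k(1) sets_compl[OF A] k(2)] by (simp add: inner_one_eq e_mean k)
  qed
  with G show ?thesis by (auto simp: L2_inner_def)
qed

lemma indep_loc:
  assumes A: "A \<in> sets \<mu>"
  shows "indep_set (sets (loc A)) (sets (loc (space \<mu> - A)))"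
proof (rule indep_setI)
  show "sets (loc A) \<subseteq> events" "sets (loc (space \<mu> - A)) \<subseteq> events"
    using subalg A by (auto simp: subalgebra_def)
  fix a b assume a: "a \<in> sets (loc A)" and b: "b \<in> sets (loc (space \<mu> - A))"
  have [measurable]: "a \<in> events" "b \<in> events" using a b subalg A by (auto simp: subalgebra_def)
  have ind: "(\<lambda>\<omega>. indicator a \<omega> :: complex) \<in> H A" "(\<lambda>\<omega>. indicator b \<omega> :: complex) \<in> H (space \<mu> - A)"
  proof -
    have L: "(\<lambda>\<omega>. indicator c \<omega> :: complex) \<in> L2 M" if [measurable]: "c \<in> events" for c
      by (rule L2_I, measurable) (auto simp: indicator_def intro!: integrable_const_bound[where B=1])
    have "(\<lambda>\<omega>. indicator c \<omega> :: complex) \<in> H C" if "c \<in> sets (loc C)" "c \<in> events" for c C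
      unfolding local_L2_eq using L[OF that(2)] that(1) by (auto intro: bexI[where x="indicator c"])
    then show "(\<lambda>\<omega>. indicator a \<omega> :: complex) \<in> H A" "(\<lambda>\<omega>. indicator b \<omega> :: complex) \<in> H (space \<mu> - A)"
      using a b by simp_all
  qed
  have ci: "expectation (\<lambda>\<omega>. indicator c \<omega>) = complex_of_real (prob c)" if "c \<in> events" for c
  proof -
    have "expectation (\<lambda>\<omega>. indicator c \<omega>) = expectation (\<lambda>\<omega>. complex_of_real (indicator c \<omega>))"
      by (rule Bochner_Integration.integral_cong) (auto simp: indicator_def)
    then show ?thesis using that by simp
  qed
  have "complex_of_real (prob (a \<inter> b)) = expectation (\<lambda>\<omega>. indicator a \<omega> * indicator b \<omega>)"
    by (simp add: ci indicator_inter_arith[symmetric])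
  also have "\<dots> = expectation (\<lambda>\<omega>. indicator a \<omega>) * expectation (\<lambda>\<omega>. indicator b \<omega>)"
    by (rule expect_mult_aux[OF A ind])
  also have "\<dots> = complex_of_real (prob a * prob b)" by (simp add: ci)
  finally show "prob (a \<inter> b) = prob a * prob b" by (simp only: of_real_eq_iff)
qed

text \<open>Elements of \<open>H A\<close> are measurable for \<open>loc A\<close> only up to a null
  set, so independence is applied to the representatives \<open>f'\<close> and
  \<open>g'\<close>.\<close>

lemma indep_integral:
  fixes f g :: "'w \<Rightarrow> 'b::{real_normed_field, banach, second_countable_topology}"
  assumes A: "A \<in> sets \<mu>"
    and f: "integrable M f" "f' \<in> borel_measurable (loc A)" "aeq M f f'"
    and g: "integrable M g" "g' \<in> borel_measurable (loc (space \<mu> - A))" "aeq M g g'"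
  shows "integrable M (\<lambda>\<omega>. f \<omega> * g \<omega>)" "expectation (\<lambda>\<omega>. f \<omega> * g \<omega>) = expectation f * expectation g"
proof -
  note [measurable] = borel_measurable_integrable[OF f(1)] borel_measurable_integrable[OF g(1)]
  have [measurable]: "f' \<in> borel_measurable M" "g' \<in> borel_measurable M"
    using measurable_from_subalg[OF subalg f(2)] measurable_from_subalg[OF subalg g(2)] A by auto
  have "indep_var borel f' borel g'"
    unfolding indep_var_eq indep_set_def
  proof (intro conjI)
    show "indep_sets (case_bool (sigma_sets (space M) {f' -` A \<inter> space M |A. A \<in> sets borel})
        (sigma_sets (space M) {g' -` A \<inter> space M |A. A \<in> sets borel})) UNIV"
    proof (rule indep_sets_mono_sets[OF indep_loc[OF A, unfolded indep_set_def]])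
      have 1: "sigma_sets (space M) {f' -` A \<inter> space M |A. A \<in> sets borel} \<subseteq> sets (loc A)"
        using subalg[OF A] measurable_sets[OF f(2)]
        by (subst subalgebra_def[THEN iffD1, THEN conjunct1, symmetric]) (auto intro!: sets.sigma_sets_subset simp: subalgebra_def)
      have 2: "sigma_sets (space M) {g' -` A \<inter> space M |A. A \<in> sets borel} \<subseteq> sets (loc (space \<mu> - A))"
        using subalg[OF sets_compl[OF A]] measurable_sets[OF g(2)]
        by (subst subalgebra_def[THEN iffD1, THEN conjunct1, symmetric]) (auto intro!: sets.sigma_sets_subset simp: subalgebra_def)
      show "case_bool (sigma_sets (space M) {f' -` A \<inter> space M |A. A \<in> sets borel})
        (sigma_sets (space M) {g' -` A \<inter> space M |A. A \<in> sets borel}) i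
        \<subseteq> case_bool (sets (loc A)) (sets (loc (space \<mu> - A))) i" for i
        using 1 2 by (cases i) auto
    qed
  qed measurable
  moreover have "integrable M f'" "integrable M g'"
    using integrable_cong_AE_imp[OF f(1) _ f(3)[unfolded aeq_def]] integrable_cong_AE_imp[OF g(1) _ g(3)[unfolded aeq_def]]
    by (auto simp: eq_commute)
  ultimately have "integrable M (\<lambda>\<omega>. f' \<omega> * g' \<omega>)" "expectation (\<lambda>\<omega>. f' \<omega> * g' \<omega>) = expectation f' * expectation g'"
    using indep_var_integrable[of f' g'] indep_var_lebesgue_integral[of f' g'] by simp_all
  moreover have ae: "AE \<omega> in M. f \<omega> * g \<omega> = f' \<omega> * g' \<omega>"
    using f(3) g(3) unfolding aeq_def by eventually_elim simp
  moreover have "expectation f = expectation f'" "expectation g = expectation g'"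
    using integral_cong_AE[OF _ _ f(3)[unfolded aeq_def]] integral_cong_AE[OF _ _ g(3)[unfolded aeq_def]] by simp_all
  ultimately show "integrable M (\<lambda>\<omega>. f \<omega> * g \<omega>)" "expectation (\<lambda>\<omega>. f \<omega> * g \<omega>) = expectation f * expectation g"
    using integral_cong_AE[OF _ _ ae] integrable_cong_AE[OF _ _ ae] by auto
qed

lemma HD: "F \<in> H A \<Longrightarrow> \<exists>F'\<in>borel_measurable (loc A). aeq M F F'"
  by (auto simp: local_L2_eq)

text \<open>This is what makes multiplication a model of the Hilbert tensor product of
  \<open>H A\<close> and \<open>H (space \<mu> - A)\<close>.\<close>

lemma prod_inner:
  assumes A: "A \<in> sets \<mu>" and F: "F \<in> H A" "F' \<in> H A" and G: "G \<in> H (space \<mu> - A)" "G' \<in> H (space \<mu> - A)"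
  shows "L2_inner M (\<lambda>\<omega>. F \<omega> * G \<omega>) (\<lambda>\<omega>. F' \<omega> * G' \<omega>) = L2_inner M F F' * L2_inner M G G'"
proof -
  obtain f f' where f: "f \<in> borel_measurable (loc A)" "aeq M F f" "f' \<in> borel_measurable (loc A)" "aeq M F' f'"
    using HD[OF F(1)] HD[OF F(2)] by blast
  obtain g g' where g: "g \<in> borel_measurable (loc (space \<mu> - A))" "aeq M G g" "g' \<in> borel_measurable (loc (space \<mu> - A))" "aeq M G' g'"
    using HD[OF G(1)] HD[OF G(2)] by blast
  have "expectation (\<lambda>\<omega>. (cnj (F \<omega>) * F' \<omega>) * (cnj (G \<omega>) * G' \<omega>))
      = expectation (\<lambda>\<omega>. cnj (F \<omega>) * F' \<omega>) * expectation (\<lambda>\<omega>. cnj (G \<omega>) * G' \<omega>)"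
  proof (rule indep_integral(2)[OF A])
    show "aeq M (\<lambda>\<omega>. cnj (F \<omega>) * F' \<omega>) (\<lambda>\<omega>. cnj (f \<omega>) * f' \<omega>)" "aeq M (\<lambda>\<omega>. cnj (G \<omega>) * G' \<omega>) (\<lambda>\<omega>. cnj (g \<omega>) * g' \<omega>)"
      using f(2,4) g(2,4) unfolding aeq_def by (auto elim!: eventually_elim2)
  qed (use f g in \<open>auto intro!: L2_inner_integrable H_L2 F G\<close>)
  then show ?thesis unfolding L2_inner_def by (simp add: mult_ac)
qed

lemma prod_L2:
  assumes A: "A \<in> sets \<mu>" and F: "F \<in> H A" and G: "G \<in> H (space \<mu> - A)"
  shows "(\<lambda>\<omega>. F \<omega> * G \<omega>) \<in> L2 M" "L2_norm M (\<lambda>\<omega>. F \<omega> * G \<omega>) = L2_norm M F * L2_norm M G"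
proof -
  note [measurable] = H_meas[OF F] H_meas[OF G]
  obtain f where f: "f \<in> borel_measurable (loc A)" "aeq M F f" using HD[OF F(1)] by blast
  obtain g where g: "g \<in> borel_measurable (loc (space \<mu> - A))" "aeq M G g" using HD[OF G] by blast
  have 1: "integrable M (\<lambda>\<omega>. (norm (F \<omega>))\<^sup>2 * (norm (G \<omega>))\<^sup>2)"
     "expectation (\<lambda>\<omega>. (norm (F \<omega>))\<^sup>2 * (norm (G \<omega>))\<^sup>2) = expectation (\<lambda>\<omega>. (norm (F \<omega>))\<^sup>2) * expectation (\<lambda>\<omega>. (norm (G \<omega>))\<^sup>2)"
  proof -
    have ae: "aeq M (\<lambda>\<omega>. (norm (F \<omega>))\<^sup>2) (\<lambda>\<omega>. (norm (f \<omega>))\<^sup>2)" "aeq M (\<lambda>\<omega>. (norm (G \<omega>))\<^sup>2) (\<lambda>\<omega>. (norm (g \<omega>))\<^sup>2)"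
      using f(2) g(2) unfolding aeq_def by (auto elim: eventually_mono)
    have "(\<lambda>\<omega>. (norm (f \<omega>))\<^sup>2) \<in> borel_measurable (loc A)" "(\<lambda>\<omega>. (norm (g \<omega>))\<^sup>2) \<in> borel_measurable (loc (space \<mu> - A))"
      using f(1) g(1) by auto
    note indep_integral[OF A L2_integrable_sq[OF H_L2[OF F]] this(1) ae(1) L2_integrable_sq[OF H_L2[OF G]] this(2) ae(2)]
    then show "integrable M (\<lambda>\<omega>. (norm (F \<omega>))\<^sup>2 * (norm (G \<omega>))\<^sup>2)"
     "expectation (\<lambda>\<omega>. (norm (F \<omega>))\<^sup>2 * (norm (G \<omega>))\<^sup>2) = expectation (\<lambda>\<omega>. (norm (F \<omega>))\<^sup>2) * expectation (\<lambda>\<omega>. (norm (G \<omega>))\<^sup>2)"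
      by blast+
  qed
  then show "(\<lambda>\<omega>. F \<omega> * G \<omega>) \<in> L2 M" by (intro L2_I) (auto simp: norm_mult power_mult_distrib)
  show "L2_norm M (\<lambda>\<omega>. F \<omega> * G \<omega>) = L2_norm M F * L2_norm M G"
    unfolding L2_norm_def using 1(2) by (simp add: norm_mult power_mult_distrib real_sqrt_mult)
qed

lemma prod_H:
  assumes "A \<in> sets \<mu>" "B \<in> sets \<mu>" "A \<inter> B = {}" and F: "F \<in> H A" and G: "G \<in> H B"
  shows "(\<lambda>\<omega>. F \<omega> * G \<omega>) \<in> H (A \<union> B)"
proof -
  have "B \<subseteq> space \<mu> - A" using assms sets.sets_into_space by blast
  then have G': "G \<in> H (space \<mu> - A)" using H_mono[of B "space \<mu> - A"] assms by auto
  obtain f where f: "f \<in> borel_measurable (loc A)" "aeq M F f" using HD[OF F(1)] by blast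
  obtain g where g: "g \<in> borel_measurable (loc B)" "aeq M G g" using HD[OF G] by blast
  have "f \<in> borel_measurable (loc (A \<union> B))" "g \<in> borel_measurable (loc (A \<union> B))"
    using measurable_loc_mono[OF _ _ _ f(1), of "A \<union> B"] measurable_loc_mono[OF _ _ _ g(1), of "A \<union> B"] assms by auto
  then have "(\<lambda>\<omega>. f \<omega> * g \<omega>) \<in> borel_measurable (loc (A \<union> B))" by measurable
  with aeq_mult[OF f(2) g(2)] prod_L2(1)[OF assms(1) F G'] show ?thesis unfolding local_L2_eq by blast
qed

lemma prod_H_compl:
  assumes "A \<in> sets \<mu>" "F \<in> H A" "G \<in> H (space \<mu> - A)"
  shows "(\<lambda>\<omega>. F \<omega> * G \<omega>) \<in> H (space \<mu>)"
  using prod_H[OF assms(1) sets_compl[OF assms(1)] _ assms(2,3)] assms(1)[THEN sets.sets_into_space]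
  by (simp add: Un_absorb1)

text \<open>That \<open>e\<close> respects null sets of \<mu> is not an axiom. It holds because the
  squared distance of \<open>e h\<close> and \<open>e k\<close> is a combination of exponentials of
  integrals that all coincide.\<close>

lemma e_aeq:
  assumes h: "step_fun \<mu> h" and k: "step_fun \<mu> k" and hk: "AE y in \<mu>. h y = k y"
  shows "aeq M (e h) (e k)"
proof -
  note m = step_fun_measurable[OF h] step_fun_measurable[OF k]
  have "(LINT y|\<mu>. a y * b y) = (LINT y|\<mu>. h y * h y)" if "a \<in> {h, k}" "b \<in> {h, k}" for a b
    using that m hk by (intro integral_cong_AE) (auto elim!: eventually_mono)
  then have eq: "(LINT y|\<mu>. h y * k y) = (LINT y|\<mu>. h y * h y)" "(LINT y|\<mu>. k y * k y) = (LINT y|\<mu>. h y * h y)" by blast+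
  have "(L2_norm M (\<lambda>\<omega>. e h \<omega> - e k \<omega>))\<^sup>2 = 0"
    unfolding L2_norm_diff_sq[OF e_L2[OF h] e_L2[OF k]] e_inner[OF h k]
    using L2_inner_self[of M "e h"] L2_inner_self[of M "e k"] eq
    unfolding e_inner[OF k k] e_inner[OF h h]
    by (simp del: of_real_power of_real_exp add: of_real_eq_iff)
  then show ?thesis by (intro aeqI_L2_norm e_L2 k h) simp
qed

text \<open>An exponential over \<open>A \<union> B\<close> splits into a product of exponentials
  over \<open>A\<close> and over \<open>B\<close>, so the products inherit totality.\<close>

lemma total_prod:
  assumes A: "A \<in> sets \<mu>" and B: "B \<in> sets \<mu>" and d: "A \<inter> B = {}" and V: "closed_subspace M V"
    and VFG: "\<And>F G. F \<in> H A \<Longrightarrow> G \<in> H B \<Longrightarrow> (\<lambda>\<omega>. F \<omega> * G \<omega>) \<in> V"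
  shows "H (A \<union> B) \<subseteq> V"
proof (rule total[OF _ V])
  fix h assume h: "step_fun \<mu> h" "\<And>y. y \<in> space \<mu> - (A \<union> B) \<Longrightarrow> h y = 0"
  let ?h = "\<lambda>A y. if y \<in> A then h y else 0"
  have s: "step_fun \<mu> (?h A)" "step_fun \<mu> (?h B)"
    by (intro step_fun_restrict h A B)+
  let ?k = "\<lambda>y. ?h A y + ?h B y"
  have k: "step_fun \<mu> ?k" by (rule step_fun_compose[OF s]) simp
  have hk: "h y = ?k y" if "y \<in> space \<mu>" for y using h(2)[of y] d that by auto
  have "aeq M (e ?k) (e h)" by (rule e_aeq[OF k h(1)]) (use hk in auto)
  moreover have "aeq M (e ?k) (\<lambda>\<omega>. e (?h A) \<omega> * e (?h B) \<omega>)"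
    by (rule e_mult[OF s]) (use d in auto)
  ultimately have ae: "aeq M (\<lambda>\<omega>. e (?h A) \<omega> * e (?h B) \<omega>) (e h)" using aeq_sym aeq_trans by blast
  have "(\<lambda>\<omega>. e (?h A) \<omega> * e (?h B) \<omega>) \<in> V" by (intro VFG e_local s A B) auto
  then show "e h \<in> V" using ae by (rule closed_subspace_aeq[OF V]) (intro L2_measurable e_L2 h)
qed (use A B in auto)

end

section \<open>The factorization generated by an exponential system\<close>

context exp_system
begin

lemma H_disjoint: "A \<in> sets \<mu> \<Longrightarrow> B \<in> sets \<mu> \<Longrightarrow> A \<inter> B = {} \<Longrightarrow> G \<in> H B \<Longrightarrow> G \<in> H (space \<mu> - A)"
  using H_mono[of B "space \<mu> - A"] sets.sets_into_space[of B \<mu>] by blast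

lemma compl_compl: "A \<in> sets \<mu> \<Longrightarrow> space \<mu> - (space \<mu> - A) = A"
  using sets.sets_into_space by blast

text \<open>A representative of the conditional expectation given the restriction of the process to
  \<open>A\<close>, obtained as an orthogonal projection.\<close>

definition cond :: "'y set \<Rightarrow> ('w \<Rightarrow> complex) \<Rightarrow> 'w \<Rightarrow> complex" where
  "cond A f = (SOME p. p \<in> H A \<and> (\<forall>g\<in>H A. L2_inner M g (\<lambda>\<omega>. f \<omega> - p \<omega>) = 0))"

lemma cond_spec:
  assumes A: "A \<in> sets \<mu>" and f: "f \<in> L2 M"
  shows "cond A f \<in> H A" "g \<in> H A \<Longrightarrow> L2_inner M g (cond A f) = L2_inner M g f"
proof -
  obtain p where "p \<in> H A" "\<And>g. g \<in> H A \<Longrightarrow> L2_inner M g (\<lambda>\<omega>. f \<omega> - p \<omega>) = 0"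
    using L2_projection[OF H_closed[OF A] f] by blast
  then have "\<exists>p. p \<in> H A \<and> (\<forall>g\<in>H A. L2_inner M g (\<lambda>\<omega>. f \<omega> - p \<omega>) = 0)" by blast
  from someI_ex[OF this, folded cond_def]
  have c: "cond A f \<in> H A" "\<And>g. g \<in> H A \<Longrightarrow> L2_inner M g (\<lambda>\<omega>. f \<omega> - cond A f \<omega>) = 0" by auto
  then show "cond A f \<in> H A" by blast
  show "L2_inner M g (cond A f) = L2_inner M g f" if "g \<in> H A"
    using c(2)[OF that] L2_inner_diff_right[OF H_L2[OF that] f H_L2[OF c(1)]] by simp
qed

lemma cond_unique:
  assumes A: "A \<in> sets \<mu>" and f: "f \<in> L2 M" and p: "p \<in> H A" "\<And>g. g \<in> H A \<Longrightarrow> L2_inner M g p = L2_inner M g f"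
  shows "aeq M (cond A f) p"
proof (rule aeqI_L2_norm)
  note c = cond_spec[OF A f]
  let ?d = "\<lambda>\<omega>. cond A f \<omega> - p \<omega>"
  have d: "?d \<in> H A" by (rule closed_subspace_diff[OF H_closed[OF A] c(1) p(1)])
  have "L2_inner M ?d ?d = 0"
    using L2_inner_diff_right[OF H_L2[OF d] H_L2[OF c(1)] H_L2[OF p(1)]] c(2)[OF d] p(2)[OF d] by simp
  then show "L2_norm M ?d = 0" by (simp add: L2_inner_self)
qed (rule H_L2, rule cond_spec[OF A f] p)+

lemma cond_norm_le:
  assumes A: "A \<in> sets \<mu>" and f: "f \<in> L2 M"
  shows "L2_norm M (cond A f) \<le> L2_norm M f"
proof -
  note c = cond_spec[OF A f]
  have "(L2_norm M (cond A f))\<^sup>2 = norm (L2_inner M (cond A f) (cond A f))"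
    by (simp add: L2_inner_self norm_power del: of_real_power)
  also have "\<dots> = norm (L2_inner M (cond A f) f)" by (simp only: c(2)[OF c(1)])
  also have "\<dots> \<le> L2_norm M (cond A f) * L2_norm M f" by (rule L2_CS[OF H_L2[OF c(1)] f])
  finally have "L2_norm M (cond A f) * L2_norm M (cond A f) \<le> L2_norm M (cond A f) * L2_norm M f"
    by (simp add: power2_eq_square)
  then show ?thesis using L2_norm_nonneg[of M "cond A f"] L2_norm_nonneg[of M f]
    by (cases "L2_norm M (cond A f) = 0") auto
qed

lemma cond_bounded_L2:
  assumes A: "A \<in> sets \<mu>"
  shows "bounded_map M (L2 M) M (cond A)"
proof (rule bounded_mapI[where C=1])
  fix f g :: "'w \<Rightarrow> complex" and a b assume fg: "f \<in> L2 M" "g \<in> L2 M"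
  note c = cond_spec[OF A fg(1)] cond_spec[OF A fg(2)]
  show "aeq M (cond A (\<lambda>\<omega>. a * f \<omega> + b * g \<omega>)) (\<lambda>\<omega>. a * cond A f \<omega> + b * cond A g \<omega>)"
  proof (rule cond_unique[OF A L2_lin[OF fg] closed_subspace_lin[OF H_closed[OF A] c(1,3)]])
    fix k assume k: "k \<in> H A"
    show "L2_inner M k (\<lambda>\<omega>. a * cond A f \<omega> + b * cond A g \<omega>) = L2_inner M k (\<lambda>\<omega>. a * f \<omega> + b * g \<omega>)"
      by (simp add: L2_inner_lin_right[OF H_L2[OF k] H_L2[OF c(1)] H_L2[OF c(3)]] L2_inner_lin_right[OF H_L2[OF k] fg] c(2,4)[OF k])
  qed
qed (use cond_spec(1)[OF A] cond_norm_le[OF A] H_L2 in auto)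

lemma cond_bounded: "A \<in> sets \<mu> \<Longrightarrow> bounded_map M (H B) M (cond A)"
  by (rule bounded_map_subset[OF cond_bounded_L2]) (auto intro: H_L2)

lemma cond_id: "A \<in> sets \<mu> \<Longrightarrow> f \<in> H A \<Longrightarrow> aeq M (cond A f) f"
  by (rule cond_unique) (auto intro: H_L2)

text \<open>In tensor form: \<open>cond A\<close> is the identity on \<open>H A\<close> tensored
  with the projection onto the constants in the other factor.\<close>

lemma cond_prod:
  assumes A: "A \<in> sets \<mu>" and F: "F \<in> H A" and G: "G \<in> H (space \<mu> - A)"
  shows "aeq M (cond A (\<lambda>\<omega>. F \<omega> * G \<omega>)) (\<lambda>\<omega>. expectation G * F \<omega>)"
proof (rule cond_unique[OF A prod_L2(1)[OF A F G] closed_subspace_cmult[OF H_closed[OF A] F]])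
  fix k assume k: "k \<in> H A"
  have "L2_inner M (\<lambda>\<omega>. k \<omega> * 1) (\<lambda>\<omega>. F \<omega> * G \<omega>) = L2_inner M k F * L2_inner M (\<lambda>_. 1) G"
    by (rule prod_inner[OF A k F const_H G])
  then show "L2_inner M k (\<lambda>\<omega>. expectation G * F \<omega>) = L2_inner M k (\<lambda>\<omega>. F \<omega> * G \<omega>)"
    using L2_inner_lin_right[OF H_L2[OF k] H_L2[OF F] H_L2[OF F], of "expectation G" 0] by (simp add: inner_one_eq)
qed

lemma cond_inner:
  assumes A: "A \<in> sets \<mu>" and f: "f \<in> L2 M" and g: "g \<in> L2 M"
  shows "L2_inner M (cond A f) g = L2_inner M f (cond A g)"
proof -
  note c = cond_spec[OF A f] cond_spec[OF A g]
  have "L2_inner M (cond A f) g = L2_inner M (cond A f) (cond A g)" using c(4)[OF c(1)] by simp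
  also have "\<dots> = cnj (L2_inner M (cond A g) (cond A f))" by (simp add: L2_inner_cnj)
  also have "\<dots> = cnj (L2_inner M (cond A g) f)" using c(2)[OF c(3)] by simp
  finally show ?thesis by (simp add: L2_inner_cnj)
qed

lemma mult_bounded:
  assumes A: "A \<in> sets \<mu>" and G: "G \<in> H (space \<mu> - A)"
  shows "bounded_map M (H A) M (\<lambda>F \<omega>. F \<omega> * G \<omega>)"
  by (rule bounded_map_cmult_right) (use prod_L2[OF A _ G] in auto)

lemma mult_bounded_left:
  assumes A: "A \<in> sets \<mu>" and F: "F \<in> H A"
  shows "bounded_map M (H (space \<mu> - A)) M (\<lambda>G \<omega>. F \<omega> * G \<omega>)"
  using mult_bounded[OF sets_compl[OF A], of F] F by (simp add: compl_compl[OF A] mult.commute)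

abbreviation HT where "HT \<equiv> H (space \<mu>)"
abbreviation \<xi> where "\<xi> \<equiv> generated_factorization (space \<mu>) M loc"

lemma HT_closed: "closed_subspace M HT"
  by (rule H_closed) simp

lemma \<xi>_I:
  assumes A: "A \<in> sets \<mu>" and S: "S \<in> bounded_ops M HT" and SA: "\<And>F. F \<in> H A \<Longrightarrow> S F \<in> H A"
    and SFG: "\<And>F G. F \<in> H A \<Longrightarrow> G \<in> H (space \<mu> - A) \<Longrightarrow> aeq M (S (\<lambda>\<omega>. F \<omega> * G \<omega>)) (\<lambda>\<omega>. S F \<omega> * G \<omega>)"
  shows "S \<in> \<xi> A"
proof -
  have "S \<in> bounded_ops M (H A)"
    by (intro bounded_opsI SA bounded_map_subset[OF bounded_opsD(1)[OF S HT_closed] H_top[OF A]])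
  then show ?thesis unfolding generated_factorization_def using S SFG by blast
qed

lemma \<xi>_bounded: "S \<in> \<xi> A \<Longrightarrow> S \<in> bounded_ops M HT"
  by (simp add: generated_factorization_def)

text \<open>The choice \<open>G = 1\<close> shows that the operator \<open>R\<close> in the
  definition is the restriction of \<open>S\<close> itself, so membership can be handled without
  it.\<close>

lemma \<xi>_D:
  assumes S: "S \<in> \<xi> A" and A: "A \<in> sets \<mu>"
  shows "F \<in> H A \<Longrightarrow> S F \<in> H A"
    "F \<in> H A \<Longrightarrow> G \<in> H (space \<mu> - A) \<Longrightarrow> aeq M (S (\<lambda>\<omega>. F \<omega> * G \<omega>)) (\<lambda>\<omega>. S F \<omega> * G \<omega>)"
proof -
  obtain R where R: "R \<in> bounded_ops M (H A)"
    "\<And>F G. F \<in> H A \<Longrightarrow> G \<in> H (space \<mu> - A) \<Longrightarrow> aeq M (S (\<lambda>\<omega>. F \<omega> * G \<omega>)) (\<lambda>\<omega>. R F \<omega> * G \<omega>)"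
    using S unfolding generated_factorization_def by blast
  have RF: "aeq M (S F) (R F)" if "F \<in> H A" for F using R(2)[OF that const_H, of 1] by simp
  show SF: "S F \<in> H A" if F: "F \<in> H A" for F
    using bounded_opsD(2)[OF R(1) H_closed[OF A] F] aeq_sym[OF RF[OF F]]
    by (rule H_aeq[OF A]) (use bounded_opsD(2)[OF \<xi>_bounded[OF S] HT_closed, of F] F H_top[OF A] in \<open>auto intro: H_meas\<close>)
  show "aeq M (S (\<lambda>\<omega>. F \<omega> * G \<omega>)) (\<lambda>\<omega>. S F \<omega> * G \<omega>)" if "F \<in> H A" "G \<in> H (space \<mu> - A)"
    using R(2)[OF that] aeq_mult[OF aeq_sym[OF RF[OF that(1)]] aeq_refl, of G] aeq_trans by blast
qed

lemma op_lin_cmult: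
  assumes "bounded_map M V M' S" "f \<in> V"
  shows "aeq M' (S (\<lambda>\<omega>. a * f \<omega>)) (\<lambda>\<omega>. a * S f \<omega>)"
  using bounded_map_lin[OF assms(1,2,2), of a 0] by simp

text \<open>The operators \<open>1 \<otimes> |K><1|\<close>.\<close>

definition rank_one :: "'y set \<Rightarrow> ('w \<Rightarrow> complex) \<Rightarrow> ('w \<Rightarrow> complex) \<Rightarrow> 'w \<Rightarrow> complex" where
  "rank_one A K f = (\<lambda>\<omega>. cond A f \<omega> * K \<omega>)"

lemma rank_one_\<xi>:
  assumes A: "A \<in> sets \<mu>" and K: "K \<in> H (space \<mu> - A)"
  shows "rank_one A K \<in> \<xi> (space \<mu> - A)"
proof (rule \<xi>_I[OF sets_compl[OF A]])
  have bm: "bounded_map M HT M (rank_one A K)" unfolding rank_one_def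
    by (rule bounded_map_compose[OF cond_bounded[OF A] mult_bounded[OF A K] H_closed[OF A] _ HT_closed])
       (rule cond_spec(1)[OF A H_L2])
  show b: "rank_one A K \<in> bounded_ops M HT"
    by (rule bounded_opsI[OF bm]) (simp add: rank_one_def prod_H_compl[OF A cond_spec(1)[OF A H_L2] K])
  have 1: "aeq M (rank_one A K (\<lambda>\<omega>. F \<omega> * G \<omega>)) (\<lambda>\<omega>. (expectation F * K \<omega>) * G \<omega>)"
    if F: "F \<in> H (space \<mu> - A)" and G: "G \<in> H A" for F G
    using aeq_mult[OF cond_prod[OF A G F] aeq_refl, of K] by (simp add: rank_one_def mult_ac)
  have 2: "aeq M (rank_one A K F) (\<lambda>\<omega>. expectation F * K \<omega>)" if F: "F \<in> H (space \<mu> - A)" for F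
    using 1[OF F const_H[of 1]] by simp
  show "rank_one A K F \<in> H (space \<mu> - A)" if F: "F \<in> H (space \<mu> - A)" for F
    using closed_subspace_cmult[OF H_closed[OF sets_compl[OF A]] K, of "expectation F"] aeq_sym[OF 2[OF F]]
    by (rule H_aeq[OF sets_compl[OF A]])
       (use F H_top[OF sets_compl[OF A]] bounded_opsD(2)[OF b HT_closed] in \<open>blast intro: H_meas\<close>)
  show "aeq M (rank_one A K (\<lambda>\<omega>. F \<omega> * G \<omega>)) (\<lambda>\<omega>. rank_one A K F \<omega> * G \<omega>)"
    if F: "F \<in> H (space \<mu> - A)" and G: "G \<in> H (space \<mu> - (space \<mu> - A))" for F G
    using aeq_trans[OF 1[OF F] aeq_mult[OF aeq_sym[OF 2[OF F]] aeq_refl]] G by (simp add: compl_compl[OF A])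
qed

lemma HT_Un: "A \<in> sets \<mu> \<Longrightarrow> A \<union> (space \<mu> - A) = space \<mu>"
  using sets.sets_into_space by blast

lemma total_prod_compl:
  assumes A: "A \<in> sets \<mu>" and V: "closed_subspace M V"
    and VFG: "\<And>F G. F \<in> H A \<Longrightarrow> G \<in> H (space \<mu> - A) \<Longrightarrow> (\<lambda>\<omega>. F \<omega> * G \<omega>) \<in> V"
  shows "HT \<subseteq> V"
  using total_prod[OF A sets_compl[OF A] _ V VFG] unfolding HT_Un[OF A] by auto

text \<open>The two operators act on different factors of \<open>F * G\<close>, and such products
  are total.\<close>

lemma \<xi>_commute:
  assumes A: "A \<in> sets \<mu>" and S: "S \<in> \<xi> A" and T: "T \<in> \<xi> (space \<mu> - A)" and f: "f \<in> HT"
  shows "aeq M (S (T f)) (T (S f))"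
proof -
  note Sb = bounded_opsD[OF \<xi>_bounded[OF S] HT_closed] and Tb = bounded_opsD[OF \<xi>_bounded[OF T] HT_closed]
  note SD = \<xi>_D[OF S A] and TD = \<xi>_D[OF T sets_compl[OF A], unfolded compl_compl[OF A]]
  let ?V = "{f \<in> HT. aeq M (S (T f)) (T (S f))}"
  have "closed_subspace M ?V"
    by (rule closed_subspace_equalizer[OF
          bounded_map_compose[OF Tb(1) Sb(1) HT_closed Tb(2) HT_closed]
          bounded_map_compose[OF Sb(1) Tb(1) HT_closed Sb(2) HT_closed] HT_closed])
  then have "HT \<subseteq> ?V"
  proof (rule total_prod_compl[OF A])
    fix F G assume F: "F \<in> H A" and G: "G \<in> H (space \<mu> - A)"
    note p = prod_H_compl[OF A]
    have "aeq M (T (\<lambda>\<omega>. F \<omega> * G \<omega>)) (\<lambda>\<omega>. F \<omega> * T G \<omega>)" if F: "F \<in> H A" for F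
      using TD(2)[OF G F] by (simp add: mult.commute)
    note 1 = this
    have "aeq M (S (T (\<lambda>\<omega>. F \<omega> * G \<omega>))) (S (\<lambda>\<omega>. F \<omega> * T G \<omega>))"
      by (rule bounded_map_aeq[OF Sb(1) HT_closed Tb(2)[OF p[OF F G]] p[OF F TD(1)[OF G]] 1[OF F]])
    also have "aeq M \<dots> (\<lambda>\<omega>. S F \<omega> * T G \<omega>)" by (rule SD(2)[OF F TD(1)[OF G]])
    also have "aeq M \<dots> (T (\<lambda>\<omega>. S F \<omega> * G \<omega>))" by (rule aeq_sym[OF 1[OF SD(1)[OF F]]])
    also have "aeq M \<dots> (T (S (\<lambda>\<omega>. F \<omega> * G \<omega>)))"
      by (rule bounded_map_aeq[OF Tb(1) HT_closed p[OF SD(1)[OF F] G] Sb(2)[OF p[OF F G]] aeq_sym[OF SD(2)[OF F G]]])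
    finally show "(\<lambda>\<omega>. F \<omega> * G \<omega>) \<in> ?V" using p[OF F G] by simp
  qed
  with f show ?thesis by blast
qed

text \<open>For \<open>F\<close> in \<open>H A\<close> one has
  \<open>rank_one A K F = F * K\<close>, so commutation moves \<open>S\<close> past the creation of
  \<open>K\<close>. The case \<open>K = 1\<close> then shows that \<open>S F\<close> lies in
  \<open>H A\<close>.\<close>

lemma commutes_\<xi>:
  assumes A: "A \<in> sets \<mu>" and S: "S \<in> bounded_ops M HT"
    and comm: "\<And>K f. K \<in> H (space \<mu> - A) \<Longrightarrow> f \<in> HT \<Longrightarrow> aeq M (S (rank_one A K f)) (rank_one A K (S f))"
  shows "S \<in> \<xi> A"
proof -
  note Sb = bounded_opsD[OF S HT_closed]
  have 1: "aeq M (S (\<lambda>\<omega>. F \<omega> * K \<omega>)) (\<lambda>\<omega>. cond A (S F) \<omega> * K \<omega>)"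
    if F: "F \<in> H A" and K: "K \<in> H (space \<mu> - A)" for F K
  proof -
    have FT: "F \<in> HT" using F H_top[OF A] by blast
    have "aeq M (S (\<lambda>\<omega>. F \<omega> * K \<omega>)) (S (rank_one A K F))"
    proof (rule bounded_map_aeq[OF Sb(1) HT_closed prod_H_compl[OF A F K]])
      show "rank_one A K F \<in> HT" by (rule bounded_opsD(2)[OF \<xi>_bounded[OF rank_one_\<xi>[OF A K]] HT_closed FT])
      show "aeq M (\<lambda>\<omega>. F \<omega> * K \<omega>) (rank_one A K F)"
        unfolding rank_one_def by (rule aeq_mult[OF aeq_sym[OF cond_id[OF A F]] aeq_refl])
    qed
    also have "aeq M \<dots> (rank_one A K (S F))" by (rule comm[OF K FT])
    finally show ?thesis unfolding rank_one_def .
  qed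
  have 2: "aeq M (S F) (cond A (S F))" if "F \<in> H A" for F using 1[OF that const_H[of 1]] by simp
  show ?thesis
  proof (rule \<xi>_I[OF A S])
    fix F assume F: "F \<in> H A"
    have SF: "S F \<in> HT" using Sb(2) F H_top[OF A] by blast
    show "S F \<in> H A"
      by (rule H_aeq[OF A cond_spec(1)[OF A H_L2[OF SF]] aeq_sym[OF 2[OF F]] H_meas[OF SF]])
    fix G assume G: "G \<in> H (space \<mu> - A)"
    show "aeq M (S (\<lambda>\<omega>. F \<omega> * G \<omega>)) (\<lambda>\<omega>. S F \<omega> * G \<omega>)"
      using aeq_trans[OF 1[OF F G] aeq_mult[OF aeq_sym[OF 2[OF F]] aeq_refl]] .
  qed
qed

lemma commutant_\<xi>:
  assumes A: "A \<in> sets \<mu>"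
  shows "commutant M HT (\<xi> A) = \<xi> (space \<mu> - A)"
proof (intro equalityI subsetI)
  fix T assume T: "T \<in> commutant M HT (\<xi> A)"
  show "T \<in> \<xi> (space \<mu> - A)"
  proof (rule commutes_\<xi>[OF sets_compl[OF A]])
    show "T \<in> bounded_ops M HT" using T by (simp add: commutant_def)
    fix K f assume K: "K \<in> H (space \<mu> - (space \<mu> - A))" and f: "f \<in> HT"
    have "rank_one (space \<mu> - A) K \<in> \<xi> A"
      using rank_one_\<xi>[OF sets_compl[OF A] K] by (simp add: compl_compl[OF A])
    then show "aeq M (T (rank_one (space \<mu> - A) K f)) (rank_one (space \<mu> - A) K (T f))"
      using T f by (auto simp: commutant_def op_eq_def intro: aeq_sym)
  qed
next
  fix T assume T: "T \<in> \<xi> (space \<mu> - A)"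
  then show "T \<in> commutant M HT (\<xi> A)"
    using \<xi>_commute[OF A _ T] \<xi>_bounded[OF T] by (auto simp: commutant_def op_eq_def)
qed

lemma HT_prod3:
  assumes A: "A \<in> sets \<mu>" "C \<in> sets \<mu>" "C \<subseteq> A"
  shows "F \<in> H C \<Longrightarrow> G \<in> H (A - C) \<Longrightarrow> (\<lambda>\<omega>. F \<omega> * G \<omega>) \<in> H A"
    "F \<in> H (A - C) \<Longrightarrow> G \<in> H (space \<mu> - A) \<Longrightarrow> (\<lambda>\<omega>. F \<omega> * G \<omega>) \<in> H (space \<mu> - C)"
proof -
  have eq: "C \<union> (A - C) = A" "(A - C) \<union> (space \<mu> - A) = space \<mu> - C"
    using assms sets.sets_into_space[OF A(1)] by auto
  show "F \<in> H C \<Longrightarrow> G \<in> H (A - C) \<Longrightarrow> (\<lambda>\<omega>. F \<omega> * G \<omega>) \<in> H A"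
    using prod_H[of C "A - C" F G] assms unfolding eq by auto
  show "F \<in> H (A - C) \<Longrightarrow> G \<in> H (space \<mu> - A) \<Longrightarrow> (\<lambda>\<omega>. F \<omega> * G \<omega>) \<in> H (space \<mu> - C)"
    using prod_H[of "A - C" "space \<mu> - A" F G] assms unfolding eq by auto
qed

lemma total_prod_diff:
  assumes A: "A \<in> sets \<mu>" "C \<in> sets \<mu>" "C \<subseteq> A" and V: "closed_subspace M V"
    and VFG: "\<And>F G. F \<in> H C \<Longrightarrow> G \<in> H (A - C) \<Longrightarrow> (\<lambda>\<omega>. F \<omega> * G \<omega>) \<in> V"
  shows "H A \<subseteq> V"
proof -
  have "C \<union> (A - C) = A" using assms by auto
  with total_prod[OF A(2) _ _ V VFG, of "A - C"] A show ?thesis by auto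
qed

text \<open>Products over \<open>C\<close> and \<open>A - C\<close> are total in \<open>H A\<close>.
  On them \<open>S\<close> acts on the first factor only, and a functional living outside
  \<open>A\<close> is absorbed into the factor outside \<open>C\<close>.\<close>

lemma \<xi>_mono:
  assumes A: "A \<in> sets \<mu>" "C \<in> sets \<mu>" "C \<subseteq> A"
  shows "\<xi> C \<subseteq> \<xi> A"
proof
  fix S assume S: "S \<in> \<xi> C"
  note Sb = bounded_opsD[OF \<xi>_bounded[OF S] HT_closed] and SD = \<xi>_D[OF S A(2)]
  have SA: "bounded_map M (H A) M S" by (rule bounded_map_subset[OF Sb(1) H_top[OF A(1)]])
  have dis: "v \<in> H (space \<mu> - C)" if "v \<in> H (A - C)" for v
    using H_disjoint[OF A(2) _ _ that] A by auto
  show "S \<in> \<xi> A"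
  proof (rule \<xi>_I[OF A(1) \<xi>_bounded[OF S]])
    have "H A \<subseteq> {f \<in> H A. S f \<in> H A}"
    proof (rule total_prod_diff[OF A closed_subspace_preimage[OF SA H_closed[OF A(1)] H_closed[OF A(1)]]])
      fix u v assume uv: "u \<in> H C" "v \<in> H (A - C)"
      have "(\<lambda>\<omega>. S u \<omega> * v \<omega>) \<in> H A" by (rule HT_prod3(1)[OF A SD(1)[OF uv(1)] uv(2)])
      then have "S (\<lambda>\<omega>. u \<omega> * v \<omega>) \<in> H A"
        using aeq_sym[OF SD(2)[OF uv(1) dis[OF uv(2)]]]
        by (rule H_aeq[OF A(1)]) (intro L2_measurable bounded_map_L2[OF SA] HT_prod3(1)[OF A uv])
      then show "(\<lambda>\<omega>. u \<omega> * v \<omega>) \<in> {f \<in> H A. S f \<in> H A}" using HT_prod3(1)[OF A uv] by simp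
    qed
    then show SFA: "S F \<in> H A" if "F \<in> H A" for F using that by blast
    fix F G assume F: "F \<in> H A" and G: "G \<in> H (space \<mu> - A)"
    have bm: "bounded_map M (H A) M (\<lambda>F. S (\<lambda>\<omega>. F \<omega> * G \<omega>))" "bounded_map M (H A) M (\<lambda>F \<omega>. S F \<omega> * G \<omega>)"
      by (rule bounded_map_compose[OF mult_bounded[OF A(1) G] Sb(1) HT_closed prod_H_compl[OF A(1) _ G] H_closed[OF A(1)]],
          assumption)
         (rule bounded_map_compose[OF SA mult_bounded[OF A(1) G] H_closed[OF A(1)] SFA H_closed[OF A(1)]])
    have "H A \<subseteq> {f \<in> H A. aeq M (S (\<lambda>\<omega>. f \<omega> * G \<omega>)) (\<lambda>\<omega>. S f \<omega> * G \<omega>)}"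
    proof (rule total_prod_diff[OF A closed_subspace_equalizer[OF bm H_closed[OF A(1)]]])
      fix u v assume uv: "u \<in> H C" "v \<in> H (A - C)"
      have "aeq M (S (\<lambda>\<omega>. u \<omega> * (v \<omega> * G \<omega>))) (\<lambda>\<omega>. S u \<omega> * (v \<omega> * G \<omega>))"
        by (rule SD(2)[OF uv(1) HT_prod3(2)[OF A uv(2) G]])
      moreover have "aeq M (\<lambda>\<omega>. (S u \<omega> * v \<omega>) * G \<omega>) (\<lambda>\<omega>. S (\<lambda>\<omega>. u \<omega> * v \<omega>) \<omega> * G \<omega>)"
        by (rule aeq_mult[OF aeq_sym[OF SD(2)[OF uv(1) dis[OF uv(2)]]] aeq_refl])
      ultimately have "aeq M (S (\<lambda>\<omega>. (u \<omega> * v \<omega>) * G \<omega>)) (\<lambda>\<omega>. S (\<lambda>\<omega>. u \<omega> * v \<omega>) \<omega> * G \<omega>)"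
        by (simp only: mult.assoc) (rule aeq_trans)
      then show "(\<lambda>\<omega>. u \<omega> * v \<omega>) \<in> {f \<in> H A. aeq M (S (\<lambda>\<omega>. f \<omega> * G \<omega>)) (\<lambda>\<omega>. S f \<omega> * G \<omega>)}"
        using HT_prod3(1)[OF A uv] by simp
    qed
    with F show "aeq M (S (\<lambda>\<omega>. F \<omega> * G \<omega>)) (\<lambda>\<omega>. S F \<omega> * G \<omega>)" by blast
  qed
qed

text \<open>By independence \<open>cond B\<close> maps \<open>H A\<close> into
  \<open>H (A \<inter> B)\<close>: a product over \<open>A \<inter> B\<close> and
  \<open>A - B\<close> is sent to a multiple of its first factor. An element of \<open>H B\<close>
  is fixed by \<open>cond B\<close>.\<close>

lemma H_Int:
  assumes A: "A \<in> sets \<mu>" and B: "B \<in> sets \<mu>" and f: "f \<in> H A" "f \<in> H B"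
  shows "f \<in> H (A \<inter> B)"
proof -
  have C: "A \<inter> B \<in> sets \<mu>" using A B by simp
  have "H A \<subseteq> {f \<in> H A. cond B f \<in> H (A \<inter> B)}"
  proof (rule total_prod_diff[OF A C _ closed_subspace_preimage[OF cond_bounded[OF B] H_closed[OF A] H_closed[OF C]]])
    fix u v assume uv: "u \<in> H (A \<inter> B)" "v \<in> H (A - A \<inter> B)"
    have uB: "u \<in> H B" using uv(1) H_mono[OF _ C B] by blast
    have vB: "v \<in> H (space \<mu> - B)" by (rule H_disjoint[OF B _ _ uv(2)]) (use A B in auto)
    have uvA: "(\<lambda>\<omega>. u \<omega> * v \<omega>) \<in> H A" by (rule HT_prod3(1)[OF A C _ uv]) simp
    have "cond B (\<lambda>\<omega>. u \<omega> * v \<omega>) \<in> H (A \<inter> B)"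
      using closed_subspace_cmult[OF H_closed[OF C] uv(1), of "expectation v"] aeq_sym[OF cond_prod[OF B uB vB]]
      by (rule H_aeq[OF C]) (rule H_meas[OF cond_spec(1)[OF B H_L2[OF uvA]]])
    with uvA show "(\<lambda>\<omega>. u \<omega> * v \<omega>) \<in> {f \<in> H A. cond B f \<in> H (A \<inter> B)}" by simp
  qed simp
  then have "cond B f \<in> H (A \<inter> B)" using f by blast
  then show ?thesis using cond_id[OF B f(2)] by (rule H_aeq[OF C]) (rule H_meas[OF f(1)])
qed

lemma \<xi>_Int:
  assumes A: "A \<in> sets \<mu>" and B: "B \<in> sets \<mu>"
  shows "\<xi> (A \<inter> B) = \<xi> A \<inter> \<xi> B"
proof (intro equalityI subsetI)
  have C: "A \<inter> B \<in> sets \<mu>" using A B by simp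
  fix S assume "S \<in> \<xi> (A \<inter> B)"
  then show "S \<in> \<xi> A \<inter> \<xi> B" using \<xi>_mono[OF A C] \<xi>_mono[OF B C] by auto
next
  have C: "A \<inter> B \<in> sets \<mu>" using A B by simp
  fix S assume S: "S \<in> \<xi> A \<inter> \<xi> B"
  then have SA: "S \<in> \<xi> A" and SB: "S \<in> \<xi> B" by auto
  note Sb = bounded_opsD[OF \<xi>_bounded[OF SA] HT_closed]
  show "S \<in> \<xi> (A \<inter> B)"
  proof (rule \<xi>_I[OF C \<xi>_bounded[OF SA]])
    fix F assume F: "F \<in> H (A \<inter> B)"
    have FA: "F \<in> H A" and FB: "F \<in> H B" using F H_mono[OF _ C A] H_mono[OF _ C B] by auto
    show SF: "S F \<in> H (A \<inter> B)" by (rule H_Int[OF A B \<xi>_D(1)[OF SA A FA] \<xi>_D(1)[OF SB B FB]])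
    fix G assume G: "G \<in> H (space \<mu> - A \<inter> B)"
    have Cc: "space \<mu> - A \<inter> B \<in> sets \<mu>" using C by auto
    have V: "closed_subspace M {G \<in> H (space \<mu> - A \<inter> B). aeq M (S (\<lambda>\<omega>. F \<omega> * G \<omega>)) (\<lambda>\<omega>. S F \<omega> * G \<omega>)}"
      by (rule closed_subspace_equalizer[OF
            bounded_map_compose[OF mult_bounded_left[OF C F] Sb(1) HT_closed prod_H_compl[OF C F] H_closed[OF Cc]]
            mult_bounded_left[OF C SF] H_closed[OF Cc]])
    have "H (space \<mu> - A \<inter> B) \<subseteq> {G \<in> H (space \<mu> - A \<inter> B). aeq M (S (\<lambda>\<omega>. F \<omega> * G \<omega>)) (\<lambda>\<omega>. S F \<omega> * G \<omega>)}"
    proof (rule total_prod_diff[OF Cc sets_compl[OF A] _ V])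
      \<comment> \<open>The complement of \<open>A \<inter> B\<close> splits into the complement of
        \<open>A\<close> and \<open>A - B\<close>. The factor over the former is pulled out because
        \<open>S\<close> belongs to the algebra over \<open>A\<close>, the one over the latter
        because \<open>S\<close> belongs to the algebra over \<open>B\<close>.\<close>
      fix G1 G2 assume G1: "G1 \<in> H (space \<mu> - A)" and "G2 \<in> H (space \<mu> - A \<inter> B - (space \<mu> - A))"
      moreover have [simp]: "space \<mu> - A \<inter> B - (space \<mu> - A) = A - A \<inter> B" using sets.sets_into_space[OF A] by auto
      ultimately have G2: "G2 \<in> H (A - A \<inter> B)" by simp
      have G2B: "G2 \<in> H (space \<mu> - B)" by (rule H_disjoint[OF B _ _ G2]) (use A B in auto)
      have FG: "(\<lambda>\<omega>. F \<omega> * G2 \<omega>) \<in> H A" by (rule HT_prod3(1)[OF A C _ F G2]) simp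
      have "aeq M (S (\<lambda>\<omega>. (F \<omega> * G2 \<omega>) * G1 \<omega>)) (\<lambda>\<omega>. S (\<lambda>\<omega>. F \<omega> * G2 \<omega>) \<omega> * G1 \<omega>)"
        by (rule \<xi>_D(2)[OF SA A FG G1])
      also have "aeq M \<dots> (\<lambda>\<omega>. (S F \<omega> * G2 \<omega>) * G1 \<omega>)"
        by (rule aeq_mult[OF \<xi>_D(2)[OF SB B FB G2B] aeq_refl])
      finally have "aeq M (S (\<lambda>\<omega>. F \<omega> * (G1 \<omega> * G2 \<omega>))) (\<lambda>\<omega>. S F \<omega> * (G1 \<omega> * G2 \<omega>))"
        by (simp only: mult_ac)
      moreover have "(\<lambda>\<omega>. G1 \<omega> * G2 \<omega>) \<in> H (space \<mu> - A \<inter> B)"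
        using HT_prod3(2)[OF A C _ G2 G1] by (simp add: mult.commute)
      ultimately show "(\<lambda>\<omega>. G1 \<omega> * G2 \<omega>) \<in> {G \<in> H (space \<mu> - A \<inter> B). aeq M (S (\<lambda>\<omega>. F \<omega> * G \<omega>)) (\<lambda>\<omega>. S F \<omega> * G \<omega>)}"
        by simp
    qed auto
    with G show "aeq M (S (\<lambda>\<omega>. F \<omega> * G \<omega>)) (\<lambda>\<omega>. S F \<omega> * G \<omega>)" by blast
  qed
qed

text \<open>De Morgan: the commutant of a union is the intersection of the commutants, and these are
  the algebras over the complements.\<close>

lemma commutant_commutant_Un:
  assumes A: "A \<in> sets \<mu>" and B: "B \<in> sets \<mu>"
  shows "commutant M HT (commutant M HT (\<xi> A \<union> \<xi> B)) = \<xi> (A \<union> B)"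
proof -
  have "commutant M HT (\<xi> A \<union> \<xi> B) = commutant M HT (\<xi> A) \<inter> commutant M HT (\<xi> B)"
    by (auto simp: commutant_def)
  also have "\<dots> = \<xi> (space \<mu> - A) \<inter> \<xi> (space \<mu> - B)" by (simp only: commutant_\<xi> A B)
  also have "\<dots> = \<xi> ((space \<mu> - A) \<inter> (space \<mu> - B))" using A B by (intro \<xi>_Int[symmetric]) auto
  also have "(space \<mu> - A) \<inter> (space \<mu> - B) = space \<mu> - (A \<union> B)" by auto
  finally show ?thesis
    using commutant_\<xi>[of "space \<mu> - (A \<union> B)"] A B compl_compl[of "A \<union> B"] by auto
qed

text \<open>A function vanishing on the whole base has exponential 1, so the exponentials over the
  empty set span the constants.\<close>

lemma H_empty:
  assumes "f \<in> H {}"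
  shows "aeq M f (\<lambda>_. expectation f)"
proof -
  have "bounded_map M (H {}) M (\<lambda>f _. L2_inner M (\<lambda>_. 1) f)"
  proof (rule bounded_mapI[where C=1])
    have one: "(\<lambda>_. 1 :: complex) \<in> L2 M" by (rule H_L2[OF const_H])
    have n1: "L2_norm M (\<lambda>_. c) = norm c" for c :: complex by (simp add: L2_norm_def prob_space)
    show "L2_norm M (\<lambda>_. L2_inner M (\<lambda>_. 1) f) \<le> 1 * L2_norm M f" if "f \<in> H {}" for f
      using L2_CS[OF one H_L2[OF that]] by (simp add: n1)
    show "aeq M (\<lambda>_. L2_inner M (\<lambda>_. 1) (\<lambda>\<omega>. a * f \<omega> + b * g \<omega>))
       (\<lambda>\<omega>. a * L2_inner M (\<lambda>_. 1) f + b * L2_inner M (\<lambda>_. 1) g)" if "f \<in> H {}" "g \<in> H {}" for f g a b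
      by (simp add: L2_inner_lin_right[OF one H_L2[OF that(1)] H_L2[OF that(2)]])
    show "(\<lambda>_. L2_inner M (\<lambda>_. 1) f) \<in> L2 M" if "f \<in> H {}" for f by (rule H_L2[OF const_H])
  qed
  moreover have "bounded_map M (H {}) M (\<lambda>f. f)"
    by (rule bounded_mapI[where C=1]) (auto intro: H_L2)
  ultimately have V: "closed_subspace M {f \<in> H {}. aeq M ((\<lambda>f. f) f) ((\<lambda>f _. L2_inner M (\<lambda>_. 1) f) f)}"
    by (intro closed_subspace_equalizer H_closed) auto
  have "H {} \<subseteq> {f \<in> H {}. aeq M f (\<lambda>_. L2_inner M (\<lambda>_. 1) f)}"
  proof (rule total[OF sets.empty_sets V])
    fix h assume h: "step_fun \<mu> h" "\<And>y. y \<in> space \<mu> - {} \<Longrightarrow> h y = 0"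
    have "aeq M (e h) (e (\<lambda>_. 0))" by (rule e_aeq[OF h(1) step_fun_zero]) (use h in auto)
    then have "aeq M (e h) (\<lambda>_. 1)" using e_zero by (rule aeq_trans)
    then show "e h \<in> {f \<in> H {}. aeq M f (\<lambda>_. L2_inner M (\<lambda>_. 1) f)}"
      using e_local[OF h(1) sets.empty_sets h(2)] by (simp add: inner_one_eq e_mean h)
  qed
  then show ?thesis using assms by (auto simp: inner_one_eq)
qed

text \<open>Over the empty set the first factor consists of constants, so \<open>S\<close> is
  multiplication by the constant \<open>S 1\<close>.\<close>

lemma \<xi>_empty: "\<xi> {} = scalar_ops M HT"
proof (intro equalityI subsetI)
  fix S assume S: "S \<in> \<xi> {}"
  note SD = \<xi>_D[OF S sets.empty_sets]
  let ?c = "expectation (S (\<lambda>_. 1))"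
  have "aeq M (S f) (\<lambda>\<omega>. ?c * f \<omega>)" if "f \<in> HT" for f
  proof -
    have "aeq M (S (\<lambda>\<omega>. 1 * f \<omega>)) (\<lambda>\<omega>. S (\<lambda>_. 1) \<omega> * f \<omega>)" using SD(2)[OF const_H, of f 1] that by simp
    also have "aeq M \<dots> (\<lambda>\<omega>. ?c * f \<omega>)" by (rule aeq_mult[OF H_empty[OF SD(1)[OF const_H]] aeq_refl])
    finally show ?thesis by simp
  qed
  then show "S \<in> scalar_ops M HT" using \<xi>_bounded[OF S] by (auto simp: scalar_ops_def op_eq_def)
next
  fix S assume "S \<in> scalar_ops M HT"
  then obtain c where S: "S \<in> bounded_ops M HT" "\<And>f. f \<in> HT \<Longrightarrow> aeq M (S f) (\<lambda>\<omega>. c * f \<omega>)"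
    by (auto simp: scalar_ops_def op_eq_def)
  show "S \<in> \<xi> {}"
  proof (rule \<xi>_I[OF sets.empty_sets S(1)])
    fix F assume F: "F \<in> H {}"
    have FT: "F \<in> HT" using F H_top[OF sets.empty_sets] by blast
    show "S F \<in> H {}"
      by (rule H_aeq[OF sets.empty_sets closed_subspace_cmult[OF H_closed[OF sets.empty_sets] F] aeq_sym[OF S(2)[OF FT]]])
         (rule H_meas[OF bounded_opsD(2)[OF S(1) HT_closed FT]])
    fix G assume G: "G \<in> H (space \<mu> - {})"
    have "aeq M (S (\<lambda>\<omega>. F \<omega> * G \<omega>)) (\<lambda>\<omega>. (c * F \<omega>) * G \<omega>)"
      using S(2)[OF prod_H_compl[OF sets.empty_sets F G]] by (simp add: mult.assoc)
    also have "aeq M \<dots> (\<lambda>\<omega>. S F \<omega> * G \<omega>)" by (rule aeq_mult[OF aeq_sym[OF S(2)[OF FT]] aeq_refl])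
    finally show "aeq M (S (\<lambda>\<omega>. F \<omega> * G \<omega>)) (\<lambda>\<omega>. S F \<omega> * G \<omega>)" .
  qed
qed

lemma \<xi>_space: "\<xi> (space \<mu>) = bounded_ops M HT"
proof (intro equalityI subsetI)
  fix S assume S: "S \<in> bounded_ops M HT"
  note Sb = bounded_opsD[OF S HT_closed]
  show "S \<in> \<xi> (space \<mu>)"
  proof (rule \<xi>_I[OF sets.top S Sb(2)])
    fix F G assume F: "F \<in> HT" and "G \<in> H (space \<mu> - space \<mu>)"
    then have G: "aeq M G (\<lambda>_. expectation G)" and GH: "G \<in> H (space \<mu> - space \<mu>)" by (simp_all add: H_empty)
    have "aeq M (S (\<lambda>\<omega>. F \<omega> * G \<omega>)) (S (\<lambda>\<omega>. expectation G * F \<omega>))"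
    proof (rule bounded_map_aeq[OF Sb(1) HT_closed prod_H_compl[OF sets.top F GH] closed_subspace_cmult[OF HT_closed F]])
      show "aeq M (\<lambda>\<omega>. F \<omega> * G \<omega>) (\<lambda>\<omega>. expectation G * F \<omega>)"
        using aeq_mult[OF G aeq_refl, of F] by (simp add: mult.commute)
    qed
    also have "aeq M \<dots> (\<lambda>\<omega>. expectation G * S F \<omega>)" by (rule op_lin_cmult[OF Sb(1) F])
    also have "aeq M \<dots> (\<lambda>\<omega>. S F \<omega> * G \<omega>)"
      using aeq_mult[OF aeq_sym[OF G] aeq_refl, of "S F"] by (simp add: mult.commute)
    finally show "aeq M (S (\<lambda>\<omega>. F \<omega> * G \<omega>)) (\<lambda>\<omega>. S F \<omega> * G \<omega>)" .
  qed
qed (rule \<xi>_bounded)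

end

section \<open>The algebras are type I factors and depend on sets modulo null sets\<close>

context exp_system
begin

text \<open>With \<open>S\<close> moved to the other side of the inner product,
  \<open>T (F * G)\<close> and \<open>cond A (T F) * G\<close> have the same inner products with all
  product functionals.\<close>

lemma \<xi>_adjoint:
  assumes A: "A \<in> sets \<mu>" and S: "S \<in> \<xi> A" and T: "T \<in> bounded_ops M HT" and adj: "adjoint_ops M HT S T"
  shows "T \<in> \<xi> A"
proof -
  note Tb = bounded_opsD[OF T HT_closed] and SD = \<xi>_D[OF S A]
  have HT: "F \<in> HT" if "F \<in> H A" for F using that H_top[OF A] by blast
  have 1: "aeq M (T (\<lambda>\<omega>. F \<omega> * G \<omega>)) (\<lambda>\<omega>. cond A (T F) \<omega> * G \<omega>)"
    if F: "F \<in> H A" and G: "G \<in> H (space \<mu> - A)" for F G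
  proof (rule aeqI_L2_norm)
    note FG = prod_H_compl[OF A F G] and TF = Tb(2)[OF HT[OF F]]
    note c = cond_spec[OF A H_L2[OF TF]]
    note P = prod_H_compl[OF A c(1) G]
    let ?D = "\<lambda>\<omega>. T (\<lambda>\<omega>. F \<omega> * G \<omega>) \<omega> - cond A (T F) \<omega> * G \<omega>"
    have D: "?D \<in> HT" by (rule closed_subspace_diff[OF HT_closed Tb(2)[OF FG] P])
    have z: "(\<lambda>_. 0 :: complex) \<in> L2 M" by simp
    have "HT \<subseteq> {f \<in> HT. L2_inner M ?D f = 0 * L2_inner M (\<lambda>_. 0) f}"
    proof (rule total_prod_compl[OF A closed_subspace_inner_eq[OF HT_closed H_L2[OF D] z]])
      fix F' G' assume F': "F' \<in> H A" and G': "G' \<in> H (space \<mu> - A)"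
      note FG' = prod_H_compl[OF A F' G']
      have "L2_inner M (\<lambda>\<omega>. F' \<omega> * G' \<omega>) (T (\<lambda>\<omega>. F \<omega> * G \<omega>)) = L2_inner M (S (\<lambda>\<omega>. F' \<omega> * G' \<omega>)) (\<lambda>\<omega>. F \<omega> * G \<omega>)"
        using adj FG FG' by (simp add: adjoint_ops_def)
      also have "\<dots> = L2_inner M (\<lambda>\<omega>. S F' \<omega> * G' \<omega>) (\<lambda>\<omega>. F \<omega> * G \<omega>)"
        by (rule L2_inner_cong[OF SD(2)[OF F' G'] aeq_refl])
           (rule H_meas bounded_opsD(2)[OF \<xi>_bounded[OF S] HT_closed] FG FG' prod_H_compl[OF A SD(1)[OF F'] G'])+
      also have "\<dots> = L2_inner M (S F') F * L2_inner M G' G" by (rule prod_inner[OF A SD(1)[OF F'] F G' G])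
      also have "L2_inner M (S F') F = L2_inner M F' (T F)" using adj HT F F' by (simp add: adjoint_ops_def)
      also have "\<dots> = L2_inner M F' (cond A (T F))" using c(2)[OF F'] by simp
      also have "\<dots> * L2_inner M G' G = L2_inner M (\<lambda>\<omega>. F' \<omega> * G' \<omega>) (\<lambda>\<omega>. cond A (T F) \<omega> * G \<omega>)"
        by (rule prod_inner[OF A F' c(1) G' G, symmetric])
      finally have "L2_inner M (\<lambda>\<omega>. F' \<omega> * G' \<omega>) ?D = 0"
        using L2_inner_diff_right[OF H_L2[OF FG'] H_L2[OF Tb(2)[OF FG]] H_L2[OF P]] by simp
      from arg_cong[OF this, of cnj] have "L2_inner M ?D (\<lambda>\<omega>. F' \<omega> * G' \<omega>) = 0" by (simp add: L2_inner_cnj)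
      then show "(\<lambda>\<omega>. F' \<omega> * G' \<omega>) \<in> {f \<in> HT. L2_inner M ?D f = 0 * L2_inner M (\<lambda>_. 0) f}" using FG' by simp
    qed
    then have "L2_inner M ?D ?D = 0" using D by auto
    then show "L2_norm M ?D = 0" by (simp add: L2_inner_self)
    show "T (\<lambda>\<omega>. F \<omega> * G \<omega>) \<in> L2 M" by (rule H_L2[OF Tb(2)[OF FG]])
    show "(\<lambda>\<omega>. cond A (T F) \<omega> * G \<omega>) \<in> L2 M" by (rule H_L2[OF P])
  qed
  have 2: "aeq M (T F) (cond A (T F))" if "F \<in> H A" for F using 1[OF that const_H[of 1]] by simp
  show ?thesis
  proof (rule \<xi>_I[OF A T])
    fix F assume F: "F \<in> H A"
    show "T F \<in> H A"
      by (rule H_aeq[OF A cond_spec(1)[OF A H_L2[OF Tb(2)[OF HT[OF F]]]] aeq_sym[OF 2[OF F]] H_meas[OF Tb(2)[OF HT[OF F]]]])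
    fix G assume G: "G \<in> H (space \<mu> - A)"
    show "aeq M (T (\<lambda>\<omega>. F \<omega> * G \<omega>)) (\<lambda>\<omega>. T F \<omega> * G \<omega>)"
      using aeq_trans[OF 1[OF F G] aeq_mult[OF aeq_sym[OF 2[OF F]] aeq_refl]] .
  qed
qed

lemma aeq_const_iff: "aeq M (\<lambda>_. c) (\<lambda>_. d) \<longleftrightarrow> c = d"
  by (auto simp: aeq_def)

text \<open>The projection onto \<open>H (space \<mu> - A)\<close> has rank one on the factor
  \<open>H A\<close>, where it projects onto the constants. A projection below it is a multiple
  \<open>c\<close> of it, and idempotence leaves \<open>c = 0\<close> or
  \<open>c = 1\<close>.\<close>

lemma minimal_projection_cond:
  assumes A: "A \<in> sets \<mu>"
  shows "minimal_projection M HT (\<xi> A) (cond (space \<mu> - A))"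
proof -
  let ?B = "space \<mu> - A"
  let ?p = "cond ?B"
  note B = sets_compl[OF A]
  have p: "?p \<in> \<xi> A"
    using rank_one_\<xi>[OF B, of "\<lambda>_. 1"] const_H by (simp add: compl_compl[OF A] rank_one_def[abs_def])
  have pT: "?p f \<in> HT" if "f \<in> HT" for f using cond_spec(1)[OF B H_L2[OF that]] H_top[OF B] by blast
  have proj: "projection_op M HT ?p"
    unfolding projection_op_def adjoint_ops_def op_eq_def o_def
  proof (intro conjI ballI)
    show "?p \<in> bounded_ops M HT" by (rule \<xi>_bounded[OF p])
    show "L2_inner M (?p f) g = L2_inner M f (?p g)" if "f \<in> HT" "g \<in> HT" for f g
      by (rule cond_inner[OF B H_L2[OF that(1)] H_L2[OF that(2)]])
    show "aeq M (?p (?p f)) (?p f)" if "f \<in> HT" for f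
      by (rule cond_id[OF B cond_spec(1)[OF B H_L2[OF that]]])
  qed
  have p1: "aeq M (?p (\<lambda>_. 1)) (\<lambda>_. 1)" by (rule cond_id[OF B const_H])
  have nz: "\<not> op_eq M HT ?p (\<lambda>f \<omega>. 0)"
  proof
    assume "op_eq M HT ?p (\<lambda>f \<omega>. 0)"
    then have "aeq M (?p (\<lambda>_. 1)) (\<lambda>_. 0)" using const_H by (auto simp: op_eq_def)
    with p1 have "aeq M (\<lambda>_. 1 :: complex) (\<lambda>_. 0)" using aeq_sym aeq_trans by blast
    then show False by (simp add: aeq_const_iff)
  qed
  have min: "op_eq M HT q (\<lambda>f \<omega>. 0) \<or> op_eq M HT q ?p"
    if q: "q \<in> \<xi> A" and qp: "projection_op M HT q" and pq: "op_eq M HT (?p \<circ> q) q" for q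
  proof -
    note qD = \<xi>_D[OF q A] and qb = bounded_opsD[OF \<xi>_bounded[OF q] HT_closed]
    \<comment> \<open>Adjoint of the relation \<open>p q = q\<close>: both operators are
      self-adjoint, so \<open>q p = q\<close> as well.\<close>
    have q1: "aeq M (q (?p f)) (q f)" if f: "f \<in> HT" for f
    proof (rule aeqI_L2_norm)
      let ?D = "\<lambda>\<omega>. q (?p f) \<omega> - q f \<omega>"
      note m = qb(2)[OF pT[OF f]] qb(2)[OF f]
      have D: "?D \<in> HT" by (rule closed_subspace_diff[OF HT_closed m])
      have "L2_inner M ?D (q (?p f)) = L2_inner M (q ?D) (?p f)" using qp D pT[OF f] by (simp add: projection_op_def adjoint_ops_def)
      also have "\<dots> = L2_inner M (?p (q ?D)) f" by (rule cond_inner[OF B, symmetric]) (rule H_L2 qb(2) D f)+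
      also have "\<dots> = L2_inner M (q ?D) f"
        by (rule L2_inner_cong) (use pq D f qb(2) pT in \<open>auto simp: op_eq_def intro: H_meas\<close>)
      also have "\<dots> = L2_inner M ?D (q f)" using qp D f by (simp add: projection_op_def adjoint_ops_def)
      finally have "L2_inner M ?D ?D = 0"
        using L2_inner_diff_right[OF H_L2[OF D] H_L2[OF m(1)] H_L2[OF m(2)]] by simp
      then show "L2_norm M ?D = 0" by (simp add: L2_inner_self)
    qed (rule H_L2[OF qb(2)[OF pT[OF f]]] H_L2[OF qb(2)[OF f]])+
    define c where "c = expectation (q (\<lambda>_. 1))"
    have one: "(\<lambda>_. 1) \<in> H A" "(\<lambda>_. 1) \<in> HT" by (rule const_H)+
    \<comment> \<open>\<open>q 1\<close> lies in \<open>H A\<close> and is fixed by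
      \<open>p\<close>, which maps \<open>H A\<close> to constants.\<close>
    have qc: "aeq M (q (\<lambda>_. 1)) (\<lambda>_. c)"
    proof -
      have "aeq M (q (\<lambda>_. 1)) (?p (q (\<lambda>_. 1)))" using pq one by (auto simp: op_eq_def intro: aeq_sym)
      also have "aeq M \<dots> (\<lambda>_. c)"
        using cond_prod[OF B const_H[of 1], of "q (\<lambda>_. 1)"] qD(1)[OF one(1)] by (simp add: compl_compl[OF A] c_def)
      finally show ?thesis .
    qed
    have qf: "aeq M (q f) (\<lambda>\<omega>. c * ?p f \<omega>)" if f: "f \<in> HT" for f
    proof -
      have "aeq M (q f) (q (?p f))" by (rule aeq_sym[OF q1[OF f]])
      also have "aeq M \<dots> (\<lambda>\<omega>. q (\<lambda>_. 1) \<omega> * ?p f \<omega>)"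
        using qD(2)[OF one(1) cond_spec(1)[OF B H_L2[OF f]]] by simp
      also have "aeq M \<dots> (\<lambda>\<omega>. c * ?p f \<omega>)" by (rule aeq_mult[OF qc aeq_refl])
      finally show ?thesis .
    qed
    have "aeq M (\<lambda>_. c) (q (\<lambda>_. 1))" by (rule aeq_sym[OF qc])
    also have "aeq M \<dots> (q (q (\<lambda>_. 1)))" using qp one by (auto simp: projection_op_def op_eq_def intro: aeq_sym)
    also have "aeq M \<dots> (\<lambda>\<omega>. c * ?p (q (\<lambda>_. 1)) \<omega>)" by (rule qf[OF qb(2)[OF one(2)]])
    also have "aeq M \<dots> (\<lambda>\<omega>. c * q (\<lambda>_. 1) \<omega>)" by (rule aeq_cmult) (use pq one in \<open>auto simp: op_eq_def\<close>)
    also have "aeq M \<dots> (\<lambda>\<omega>. c * c)" by (rule aeq_cmult[OF qc])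
    finally have "c = c * c" by (simp add: aeq_const_iff)
    then consider "c = 0" | "c = 1" by auto
    then show ?thesis
    proof cases
      case 1
      then show ?thesis using qf by (auto simp: op_eq_def)
    next
      case 2
      then show ?thesis using qf by (auto simp: op_eq_def)
    qed
  qed
  show ?thesis unfolding minimal_projection_def using p proj nz min by blast
qed

lemma type_I_\<xi>: 
  assumes A: "A \<in> sets \<mu>"
  shows "type_I_factor M HT (\<xi> A)"
  unfolding type_I_factor_def von_neumann_algebra_def
proof (intro conjI exI)
  show "\<xi> A \<subseteq> bounded_ops M HT" using \<xi>_bounded by blast
  show "\<forall>S\<in>\<xi> A. \<forall>T\<in>bounded_ops M HT. adjoint_ops M HT S T \<longrightarrow> T \<in> \<xi> A" using \<xi>_adjoint[OF A] by blast
  show "commutant M HT (commutant M HT (\<xi> A)) = \<xi> A"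
    by (simp only: commutant_\<xi> A sets_compl compl_compl)
  have "\<xi> A \<inter> commutant M HT (\<xi> A) = \<xi> (A \<inter> (space \<mu> - A))"
    by (simp only: commutant_\<xi> A \<xi>_Int sets_compl)
  also have "A \<inter> (space \<mu> - A) = {}" by auto
  finally show "\<xi> A \<inter> commutant M HT (\<xi> A) = scalar_ops M HT" by (simp only: \<xi>_empty)
qed (rule minimal_projection_cond[OF A])

text \<open>An exponential over \<open>A\<close> is unchanged when its function is cut down to
  \<open>B\<close>, since this alters the function on a null set only.\<close>

lemma H_mod0_aux:
  assumes A: "A \<in> sets \<mu>" and B: "B \<in> sets \<mu>" and 0: "emeasure \<mu> ((A - B) \<union> (B - A)) = 0"
  shows "H A \<subseteq> H B"
proof (rule total[OF A H_closed[OF B]])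
  fix h assume h: "step_fun \<mu> h" "\<And>y. y \<in> space \<mu> - A \<Longrightarrow> h y = 0"
  let ?k = "\<lambda>y. if y \<in> B then h y else 0"
  have k: "step_fun \<mu> ?k" by (rule step_fun_restrict[OF h(1) B])
  have "(A - B) \<union> (B - A) \<in> null_sets \<mu>" using A B 0 by auto
  then have "AE y in \<mu>. y \<notin> (A - B) \<union> (B - A)" by (rule AE_not_in)
  with AE_space have "AE y in \<mu>. ?k y = h y" by eventually_elim (use h(2) in auto)
  then have "aeq M (e ?k) (e h)" by (rule e_aeq[OF k h(1)])
  moreover have "e ?k \<in> H B" by (rule e_local[OF k B]) auto
  ultimately show "e h \<in> H B" using H_aeq[OF B _ _ L2_measurable[OF e_L2[OF h(1)]]] by blast
qed

lemma \<xi>_mod0: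
  assumes A: "A \<in> sets \<mu>" and B: "B \<in> sets \<mu>" and 0: "emeasure \<mu> ((A - B) \<union> (B - A)) = 0"
  shows "\<xi> A = \<xi> B"
proof -
  have "H A = H B" using H_mod0_aux[OF A B 0] H_mod0_aux[OF B A] 0 by (auto simp: Un_commute)
  moreover have "(space \<mu> - A) - (space \<mu> - B) = B - A" "(space \<mu> - B) - (space \<mu> - A) = A - B"
    using A B sets.sets_into_space by blast+
  then have "H (space \<mu> - A) = H (space \<mu> - B)"
    using H_mod0_aux[OF sets_compl[OF A] sets_compl[OF B]] H_mod0_aux[OF sets_compl[OF B] sets_compl[OF A]] 0
    by (auto simp: Un_commute)
  ultimately show ?thesis unfolding generated_factorization_def by simp
qed

lemma Hilbert_factorization_\<xi>: "Hilbert_factorization \<mu> M HT \<xi>"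
  unfolding Hilbert_factorization_def
  by (intro conjI ballI impI) (simp_all add: type_I_\<xi> \<xi>_Int commutant_commutant_Un commutant_\<xi> \<xi>_empty \<xi>_space, rule \<xi>_mod0)

end

text \<open>Cylinders respect the Boolean operations, so only null sets require an argument:
  sigma-finiteness gives the product formula for the measure of a cylinder, where 0 times infinity
  is 0.\<close>

lemma Hilbert_factorization_fst:
  assumes F: "Hilbert_factorization (\<nu> \<Otimes>\<^sub>M \<Lambda>) M H \<xi>" and \<Lambda>: "sigma_finite_measure \<Lambda>" "space \<Lambda> = UNIV"
  shows "Hilbert_factorization \<nu> M H (\<lambda>A. \<xi> (A \<times> UNIV))"
proof -
  interpret sigma_finite_measure \<Lambda> by fact
  have top: "UNIV \<in> sets \<Lambda>" using \<Lambda>(2) sets.top[of \<Lambda>] by simp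
  have m: "A \<times> UNIV \<in> sets (\<nu> \<Otimes>\<^sub>M \<Lambda>)" if "A \<in> sets \<nu>" for A using that top by simp
  have 0: "emeasure (\<nu> \<Otimes>\<^sub>M \<Lambda>) ((A \<times> UNIV - B \<times> UNIV) \<union> (B \<times> UNIV - A \<times> UNIV)) = 0"
    if "A \<in> sets \<nu>" "B \<in> sets \<nu>" "emeasure \<nu> ((A - B) \<union> (B - A)) = 0" for A B
  proof -
    have "(A \<times> UNIV - B \<times> UNIV) \<union> (B \<times> UNIV - A \<times> UNIV) = ((A - B) \<union> (B - A)) \<times> (UNIV :: 'b set)" by auto
    then show ?thesis using that top by (simp add: emeasure_pair_measure_Times)
  qed
  have eq: "(A \<inter> B) \<times> (UNIV :: 'b set) = (A \<times> UNIV) \<inter> (B \<times> UNIV)"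
    "(A \<union> B) \<times> (UNIV :: 'b set) = (A \<times> UNIV) \<union> (B \<times> UNIV)"
    "(space \<nu> - A) \<times> (UNIV :: 'b set) = space (\<nu> \<Otimes>\<^sub>M \<Lambda>) - (A \<times> UNIV)"
    "{} \<times> (UNIV :: 'b set) = {}" "space \<nu> \<times> (UNIV :: 'b set) = space (\<nu> \<Otimes>\<^sub>M \<Lambda>)"
    for A B using \<Lambda>(2) by (auto simp: space_pair_measure)
  note F' = F[unfolded Hilbert_factorization_def]
  show ?thesis
    unfolding Hilbert_factorization_def eq
  proof (intro conjI ballI impI)
    fix A assume A: "A \<in> sets \<nu>"
    show "type_I_factor M H (\<xi> (A \<times> UNIV))" "\<xi> (space (\<nu> \<Otimes>\<^sub>M \<Lambda>) - A \<times> UNIV) = commutant M H (\<xi> (A \<times> UNIV))"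
      using F' m[OF A] by blast+
    fix B assume B: "B \<in> sets \<nu>"
    show "\<xi> (A \<times> UNIV) = \<xi> (B \<times> UNIV)" if "emeasure \<nu> ((A - B) \<union> (B - A)) = 0"
      using F' m[OF A] m[OF B] 0[OF A B that] by blast
    show "\<xi> ((A \<times> UNIV) \<inter> (B \<times> UNIV)) = \<xi> (A \<times> UNIV) \<inter> \<xi> (B \<times> UNIV)"
      "\<xi> ((A \<times> UNIV) \<union> (B \<times> UNIV)) = commutant M H (commutant M H (\<xi> (A \<times> UNIV) \<union> \<xi> (B \<times> UNIV)))"
      using F' m[OF A] m[OF B] by blast+
  qed (use F' in blast)+
qed

section \<open>The unitary operator between two exponential systems\<close>

context exp_system
begin

definition comb :: "('y \<Rightarrow> real) set \<Rightarrow> (('y \<Rightarrow> real) \<Rightarrow> complex) \<Rightarrow> 'w \<Rightarrow> complex" where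
  "comb S c = (\<lambda>\<omega>. \<Sum>h\<in>S. c h * e h \<omega>)"

definition step_set :: "('y \<Rightarrow> real) set \<Rightarrow> bool" where
  "step_set S \<longleftrightarrow> finite S \<and> (\<forall>h\<in>S. step_fun \<mu> h)"

lemma e_HT: "step_fun \<mu> h \<Longrightarrow> e h \<in> HT"
  by (rule e_local) auto

lemma comb_HT: "step_set S \<Longrightarrow> comb S c \<in> HT"
  unfolding comb_def step_set_def by (rule closed_subspace_sum[OF HT_closed]) (simp add: e_HT)

lemma comb_lin:
  assumes S: "finite S" and T: "finite T"
  shows "(\<lambda>\<omega>. a * comb S c \<omega> + b * comb T d \<omega>)
     = comb (S \<union> T) (\<lambda>h. a * (if h \<in> S then c h else 0) + b * (if h \<in> T then d h else 0))"
proof -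
  have 1: "(\<Sum>h\<in>S. c h * e h \<omega>) = (\<Sum>h\<in>S \<union> T. (if h \<in> S then c h else 0) * e h \<omega>)"
    and 2: "(\<Sum>h\<in>T. d h * e h \<omega>) = (\<Sum>h\<in>S \<union> T. (if h \<in> T then d h else 0) * e h \<omega>)" for \<omega>
    using S T by (auto intro!: sum.mono_neutral_cong_left)
  show ?thesis
    unfolding comb_def 1 2 by (simp add: sum_distrib_left sum.distrib[symmetric] algebra_simps)
qed

lemma inner_comb_right:
  assumes "f \<in> L2 M" and "step_set S"
  shows "L2_inner M f (comb S c) = (\<Sum>h\<in>S. c h * L2_inner M f (e h))"
proof -
  have "finite S" "\<And>h. h \<in> S \<Longrightarrow> step_fun \<mu> h" using assms by (auto simp: step_set_def)
  then show ?thesis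
  proof (induction S)
    case empty
    then show ?case by (simp add: comb_def L2_inner_def)
  next
    case (insert h S)
    then have "step_set S" by (auto simp: step_set_def)
    have "comb (insert h S) c = (\<lambda>\<omega>. c h * e h \<omega> + 1 * comb S c \<omega>)" using insert by (simp add: comb_def)
    then show ?case
      using L2_inner_lin_right[OF assms(1) e_L2 H_L2[OF comb_HT[OF \<open>step_set S\<close>]], of h "c h" 1 c] insert by simp
  qed
qed

text \<open>The Gram matrix of the exponentials depends on \<mu> alone, so the same coefficients
  give the same norm in any two exponential systems over \<mu>.\<close>

lemma comb_norm:
  assumes S: "step_set S"
  shows "complex_of_real ((L2_norm M (comb S c))\<^sup>2)
    = (\<Sum>h\<in>S. c h * (\<Sum>k\<in>S. cnj (c k) * complex_of_real (exp (LINT y|\<mu>. h y * k y))))"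
proof -
  have st: "\<And>h. h \<in> S \<Longrightarrow> step_fun \<mu> h" using S by (auto simp: step_set_def)
  have "L2_inner M (comb S c) (e h) = (\<Sum>k\<in>S. cnj (c k) * complex_of_real (exp (LINT y|\<mu>. h y * k y)))" if h: "h \<in> S" for h
  proof -
    have "L2_inner M (comb S c) (e h) = cnj (L2_inner M (e h) (comb S c))" by (simp add: L2_inner_cnj)
    also have "\<dots> = (\<Sum>k\<in>S. cnj (c k) * complex_of_real (exp (LINT y|\<mu>. h y * k y)))"
      unfolding inner_comb_right[OF e_L2[OF st[OF h]] S] using e_inner[OF st[OF h] st]
      by (simp add: cnj_sum)
    finally show ?thesis .
  qed
  then show ?thesis
    unfolding L2_inner_self[symmetric] inner_comb_right[OF H_L2[OF comb_HT[OF S]] S] by simp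
qed

lemma comb_dense:
  assumes "F \<in> HT" "\<epsilon> > 0"
  shows "\<exists>S c. step_set S \<and> L2_norm M (\<lambda>\<omega>. F \<omega> - comb S c \<omega>) < \<epsilon>"
proof -
  let ?V = "{F \<in> HT. \<forall>\<epsilon>>0. \<exists>S c. step_set S \<and> L2_norm M (\<lambda>\<omega>. F \<omega> - comb S c \<omega>) < \<epsilon>}"
  have V: "closed_subspace M ?V"
  proof (rule closed_subspaceI)
    show "f \<in> L2 M" if "f \<in> ?V" for f using that by (auto intro: H_L2)
    have "comb {} c = (\<lambda>_. 0)" for c by (simp add: comb_def)
    then show "(\<lambda>_. 0) \<in> ?V"
      using closed_subspace_zero[OF HT_closed]
      by (auto simp: step_set_def L2_norm_def intro!: exI[of _ "{}"])
  next
    fix f g a b assume f: "f \<in> ?V" and g: "g \<in> ?V"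
    show "(\<lambda>\<omega>. a * f \<omega> + b * g \<omega>) \<in> ?V"
    proof (intro CollectI conjI allI impI)
      show "(\<lambda>\<omega>. a * f \<omega> + b * g \<omega>) \<in> HT" using f g by (intro closed_subspace_lin[OF HT_closed]) auto
      fix \<epsilon> :: real assume "\<epsilon> > 0"
      define \<delta> where "\<delta> = \<epsilon> / (norm a + norm b + 1)"
      have p: "norm a + norm b + 1 > 0" by (simp add: add_nonneg_pos)
      then have \<delta>: "\<delta> > 0" using \<open>\<epsilon> > 0\<close> by (simp add: \<delta>_def)
      obtain S c where S: "step_set S" "L2_norm M (\<lambda>\<omega>. f \<omega> - comb S c \<omega>) < \<delta>" using f \<delta> by blast
      obtain T d where T: "step_set T" "L2_norm M (\<lambda>\<omega>. g \<omega> - comb T d \<omega>) < \<delta>" using g \<delta> by blast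
      let ?x = "\<lambda>h. a * (if h \<in> S then c h else 0) + b * (if h \<in> T then d h else 0)"
      have u: "step_set (S \<union> T)" using S T by (auto simp: step_set_def)
      have "(\<lambda>\<omega>. a * f \<omega> + b * g \<omega> - comb (S \<union> T) ?x \<omega>) = (\<lambda>\<omega>. a * (f \<omega> - comb S c \<omega>) + b * (g \<omega> - comb T d \<omega>))"
        using S T by (subst comb_lin[of S T a c b d, symmetric]) (auto simp: step_set_def algebra_simps)
      then have "L2_norm M (\<lambda>\<omega>. a * f \<omega> + b * g \<omega> - comb (S \<union> T) ?x \<omega>)
         \<le> norm a * L2_norm M (\<lambda>\<omega>. f \<omega> - comb S c \<omega>) + norm b * L2_norm M (\<lambda>\<omega>. g \<omega> - comb T d \<omega>)"
        using f g by (simp only:) (intro L2_norm_lin_le L2_diff H_L2[of _ "space \<mu>"] comb_HT S T; blast)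
      also have "\<dots> \<le> norm a * \<delta> + norm b * \<delta>" using S T by (intro add_mono mult_left_mono) auto
      also have "\<dots> < (norm a + norm b + 1) * \<delta>" using \<delta> by (simp add: algebra_simps)
      also have "\<dots> = \<epsilon>" using p by (simp add: \<delta>_def)
      finally show "\<exists>S c. step_set S \<and> L2_norm M (\<lambda>\<omega>. a * f \<omega> + b * g \<omega> - comb S c \<omega>) < \<epsilon>" using u by blast
    qed
  next
    fix F f assume F: "\<And>n::nat. F n \<in> ?V" and l: "L2_lim M F f"
    show "f \<in> ?V"
    proof (intro CollectI conjI allI impI)
      show "f \<in> HT" using F by (intro closed_subspace_lim[OF HT_closed _ l]) auto
      fix \<epsilon> :: real assume "\<epsilon> > 0"
      then have "eventually (\<lambda>n. L2_norm M (\<lambda>\<omega>. F n \<omega> - f \<omega>) < \<epsilon> / 2) sequentially"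
        using L2_limD(3)[OF l] by (intro order_tendstoD) auto
      then obtain n where n: "L2_norm M (\<lambda>\<omega>. F n \<omega> - f \<omega>) < \<epsilon> / 2" by (auto simp: eventually_sequentially)
      obtain S c where S: "step_set S" "L2_norm M (\<lambda>\<omega>. F n \<omega> - comb S c \<omega>) < \<epsilon> / 2"
        using F[of n] \<open>\<epsilon> > 0\<close> half_gt_zero by blast
      have "L2_norm M (\<lambda>\<omega>. f \<omega> - comb S c \<omega>) \<le> L2_norm M (\<lambda>\<omega>. f \<omega> - F n \<omega>) + L2_norm M (\<lambda>\<omega>. F n \<omega> - comb S c \<omega>)"
        by (intro L2_norm_triangle3 L2_limD[OF l] H_L2[OF comb_HT] S)
      also have "\<dots> < \<epsilon>" using n S by (simp add: L2_norm_minus_commute[of M f])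
      finally show "\<exists>S c. step_set S \<and> L2_norm M (\<lambda>\<omega>. f \<omega> - comb S c \<omega>) < \<epsilon>" using S by blast
    qed
  qed
  have "HT \<subseteq> ?V"
  proof (rule total[OF sets.top V])
    fix h assume h: "step_fun \<mu> h"
    have "comb {h} (\<lambda>_. 1) = e h" by (simp add: comb_def)
    then show "e h \<in> ?V" using h
      by (auto simp: e_HT L2_norm_def step_set_def intro!: exI[of _ "{h}"] exI[of _ "\<lambda>_. 1"])
  qed
  with assms show ?thesis by blast
qed

end

section \<open>The isometry that matches the two families of exponentials\<close>

locale exp_pair = E1: exp_system M \<mu> loc e + E2: exp_system M' \<mu> loc' e'
  for M :: "'w measure" and \<mu> :: "'y measure" and loc e and M' :: "'v measure" and loc' e'
begin

lemma comb_norm_eq: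
  assumes "E1.step_set S"
  shows "L2_norm M (E1.comb S c) = L2_norm M' (E2.comb S c)"
proof -
  have "complex_of_real ((L2_norm M (E1.comb S c))\<^sup>2) = complex_of_real ((L2_norm M' (E2.comb S c))\<^sup>2)"
    using E1.comb_norm[of S c] E2.comb_norm[of S c] assms by (simp add: E1.step_set_def)
  then have "(L2_norm M (E1.comb S c))\<^sup>2 = (L2_norm M' (E2.comb S c))\<^sup>2" by (simp only: of_real_eq_iff)
  then show ?thesis by (simp add: power2_eq_iff_nonneg)
qed

text \<open>The closure of the graph of the map that keeps the coefficients of a combination. Being
  single-valued modulo null sets is then a consequence of the equality of norms, and the symmetry of
  the relation in the two systems yields the inverse map.\<close>

definition rel :: "('w \<Rightarrow> complex) \<Rightarrow> ('v \<Rightarrow> complex) \<Rightarrow> bool" where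
  "rel F F' \<longleftrightarrow> F \<in> E1.HT \<and> F' \<in> E2.HT \<and> (\<forall>\<epsilon>>0. \<exists>S c. E1.step_set S
     \<and> L2_norm M (\<lambda>\<omega>. F \<omega> - E1.comb S c \<omega>) < \<epsilon> \<and> L2_norm M' (\<lambda>\<omega>. F' \<omega> - E2.comb S c \<omega>) < \<epsilon>)"

lemma relD:
  assumes "rel F F'"
  shows "F \<in> E1.HT" "F' \<in> E2.HT"
    "\<epsilon> > 0 \<Longrightarrow> \<exists>S c. E1.step_set S
     \<and> L2_norm M (\<lambda>\<omega>. F \<omega> - E1.comb S c \<omega>) < \<epsilon> \<and> L2_norm M' (\<lambda>\<omega>. F' \<omega> - E2.comb S c \<omega>) < \<epsilon>"
  using assms by (auto simp: rel_def)

lemma rel_lin: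
  assumes f: "rel f f'" and g: "rel g g'"
  shows "rel (\<lambda>\<omega>. a * f \<omega> + b * g \<omega>) (\<lambda>\<omega>. a * f' \<omega> + b * g' \<omega>)"
  unfolding rel_def
proof (intro conjI allI impI)
  note f1 = relD[OF f] and g1 = relD[OF g]
  show "(\<lambda>\<omega>. a * f \<omega> + b * g \<omega>) \<in> E1.HT" by (intro closed_subspace_lin[OF E1.HT_closed] f1 g1)
  show "(\<lambda>\<omega>. a * f' \<omega> + b * g' \<omega>) \<in> E2.HT" by (intro closed_subspace_lin[OF E2.HT_closed] f1 g1)
  fix \<epsilon> :: real assume "\<epsilon> > 0"
  define \<delta> where "\<delta> = \<epsilon> / (norm a + norm b + 1)"
  have p: "norm a + norm b + 1 > 0" by (simp add: add_nonneg_pos)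
  then have \<delta>: "\<delta> > 0" using \<open>\<epsilon> > 0\<close> by (simp add: \<delta>_def)
  obtain S c where S: "E1.step_set S" "L2_norm M (\<lambda>\<omega>. f \<omega> - E1.comb S c \<omega>) < \<delta>" "L2_norm M' (\<lambda>\<omega>. f' \<omega> - E2.comb S c \<omega>) < \<delta>"
    using f1(3)[OF \<delta>] by blast
  obtain T d where T: "E1.step_set T" "L2_norm M (\<lambda>\<omega>. g \<omega> - E1.comb T d \<omega>) < \<delta>" "L2_norm M' (\<lambda>\<omega>. g' \<omega> - E2.comb T d \<omega>) < \<delta>"
    using g1(3)[OF \<delta>] by blast
  have fin: "finite S" "finite T" using S T by (auto simp: E1.step_set_def)
  let ?x = "\<lambda>h. a * (if h \<in> S then c h else 0) + b * (if h \<in> T then d h else 0)"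
  have u: "E1.step_set (S \<union> T)" using S T by (auto simp: E1.step_set_def)
  have le: "norm a * r + norm b * s < \<epsilon>" if "r < \<delta>" "s < \<delta>" for r s
  proof -
    have "norm a * r + norm b * s \<le> norm a * \<delta> + norm b * \<delta>" using that by (intro add_mono mult_left_mono) auto
    also have "\<dots> < (norm a + norm b + 1) * \<delta>" using \<delta> by (simp add: algebra_simps)
    also have "\<dots> = \<epsilon>" using p by (simp add: \<delta>_def)
    finally show ?thesis .
  qed
  have "(\<lambda>\<omega>. a * f \<omega> + b * g \<omega> - E1.comb (S \<union> T) ?x \<omega>) = (\<lambda>\<omega>. a * (f \<omega> - E1.comb S c \<omega>) + b * (g \<omega> - E1.comb T d \<omega>))"
    unfolding E1.comb_lin[OF fin, of a c b d, symmetric] by (simp add: algebra_simps)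
  then have "L2_norm M (\<lambda>\<omega>. a * f \<omega> + b * g \<omega> - E1.comb (S \<union> T) ?x \<omega>)
         \<le> norm a * L2_norm M (\<lambda>\<omega>. f \<omega> - E1.comb S c \<omega>) + norm b * L2_norm M (\<lambda>\<omega>. g \<omega> - E1.comb T d \<omega>)"
    using L2_norm_lin_le[OF L2_diff[OF E1.H_L2[OF f1(1)] E1.H_L2[OF E1.comb_HT[OF S(1), of c]]]
       L2_diff[OF E1.H_L2[OF g1(1)] E1.H_L2[OF E1.comb_HT[OF T(1), of d]]]] by simp
  also have "\<dots> < \<epsilon>" by (rule le) fact+
  finally have 1: "L2_norm M (\<lambda>\<omega>. a * f \<omega> + b * g \<omega> - E1.comb (S \<union> T) ?x \<omega>) < \<epsilon>" .
  have "(\<lambda>\<omega>. a * f' \<omega> + b * g' \<omega> - E2.comb (S \<union> T) ?x \<omega>) = (\<lambda>\<omega>. a * (f' \<omega> - E2.comb S c \<omega>) + b * (g' \<omega> - E2.comb T d \<omega>))"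
    unfolding E2.comb_lin[OF fin, of a c b d, symmetric] by (simp add: algebra_simps)
  then have "L2_norm M' (\<lambda>\<omega>. a * f' \<omega> + b * g' \<omega> - E2.comb (S \<union> T) ?x \<omega>)
         \<le> norm a * L2_norm M' (\<lambda>\<omega>. f' \<omega> - E2.comb S c \<omega>) + norm b * L2_norm M' (\<lambda>\<omega>. g' \<omega> - E2.comb T d \<omega>)"
    using L2_norm_lin_le[OF L2_diff[OF E2.H_L2[OF f1(2)] E2.H_L2[OF E2.comb_HT[OF S(1), of c]]]
       L2_diff[OF E2.H_L2[OF g1(2)] E2.H_L2[OF E2.comb_HT[OF T(1), of d]]]] by simp
  also have "\<dots> < \<epsilon>" by (rule le) fact+
  finally show "\<exists>S c. E1.step_set S \<and> L2_norm M (\<lambda>\<omega>. a * f \<omega> + b * g \<omega> - E1.comb S c \<omega>) < \<epsilon>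
      \<and> L2_norm M' (\<lambda>\<omega>. a * f' \<omega> + b * g' \<omega> - E2.comb S c \<omega>) < \<epsilon>" using u 1 by blast
qed

lemma rel_norm:
  assumes "rel f f'"
  shows "L2_norm M f = L2_norm M' f'"
proof (rule ccontr)
  note f = relD[OF assms]
  assume "L2_norm M f \<noteq> L2_norm M' f'"
  then have "\<bar>L2_norm M f - L2_norm M' f'\<bar> / 2 > 0" by simp
  from f(3)[OF this] obtain S c where S: "E1.step_set S" "L2_norm M (\<lambda>\<omega>. f \<omega> - E1.comb S c \<omega>) < \<bar>L2_norm M f - L2_norm M' f'\<bar> / 2"
    "L2_norm M' (\<lambda>\<omega>. f' \<omega> - E2.comb S c \<omega>) < \<bar>L2_norm M f - L2_norm M' f'\<bar> / 2" by blast
  have "\<bar>L2_norm M f - L2_norm M (E1.comb S c)\<bar> \<le> L2_norm M (\<lambda>\<omega>. f \<omega> - E1.comb S c \<omega>)"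
    by (rule L2_norm_diff_le[OF E1.H_L2[OF f(1)] E1.H_L2[OF E1.comb_HT[OF S(1)]]])
  moreover have "\<bar>L2_norm M' f' - L2_norm M' (E2.comb S c)\<bar> \<le> L2_norm M' (\<lambda>\<omega>. f' \<omega> - E2.comb S c \<omega>)"
    by (rule L2_norm_diff_le[OF E2.H_L2[OF f(2)] E2.H_L2[OF E2.comb_HT[OF S(1)]]])
  ultimately have "\<bar>L2_norm M f - L2_norm M (E1.comb S c)\<bar> < \<bar>L2_norm M f - L2_norm M' f'\<bar> / 2"
    "\<bar>L2_norm M' f' - L2_norm M (E1.comb S c)\<bar> < \<bar>L2_norm M f - L2_norm M' f'\<bar> / 2"
    using S(2,3) comb_norm_eq[OF S(1), of c] by simp_all
  then show False by (simp add: abs_if split: if_splits)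
qed

lemma rel_unique:
  assumes "rel f f'" "rel g g'" "aeq M f g"
  shows "aeq M' f' g'"
proof (rule aeqI_L2_norm)
  have "rel (\<lambda>\<omega>. f \<omega> - g \<omega>) (\<lambda>\<omega>. f' \<omega> - g' \<omega>)" using rel_lin[OF assms(1,2), of 1 "-1"] by simp
  from rel_norm[OF this] show "L2_norm M' (\<lambda>\<omega>. f' \<omega> - g' \<omega>) = 0" using L2_norm_diff_aeq[OF assms(3)] by simp
qed (rule E2.H_L2[OF relD(2)[OF assms(1)]] E2.H_L2[OF relD(2)[OF assms(2)]])+

lemma rel_e: "step_fun \<mu> h \<Longrightarrow> rel (e h) (e' h)"
  unfolding rel_def
  by (intro conjI allI impI exI[of _ "{h}"] exI[of _ "\<lambda>_. 1"])
     (simp_all add: E1.e_HT E2.e_HT E1.step_set_def E1.comb_def E2.comb_def L2_norm_def)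

text \<open>Combinations converging to \<open>F\<close> have Cauchy counterparts, because the
  difference of two combinations has common coefficients, hence equal norms, on both sides.\<close>

lemma rel_total:
  assumes F: "F \<in> E1.HT"
  obtains F' where "rel F F'"
proof -
  have "\<exists>S c. E1.step_set S \<and> L2_norm M (\<lambda>\<omega>. F \<omega> - E1.comb S c \<omega>) < 1 / real (Suc n)" for n
    by (rule E1.comb_dense[OF F]) simp
  then obtain S c where S: "\<And>n. E1.step_set (S n)" "\<And>n. L2_norm M (\<lambda>\<omega>. F \<omega> - E1.comb (S n) (c n) \<omega>) < 1 / real (Suc n)"
    by metis
  let ?F = "\<lambda>n. E1.comb (S n) (c n)" and ?F' = "\<lambda>n. E2.comb (S n) (c n)"
  have L: "?F n \<in> L2 M" "?F' n \<in> L2 M'" for n by (rule E1.H_L2[OF E1.comb_HT[OF S(1)]] E2.H_L2[OF E2.comb_HT[OF S(1)]])+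
  have eq: "L2_norm M' (\<lambda>\<omega>. ?F' m \<omega> - ?F' n \<omega>) = L2_norm M (\<lambda>\<omega>. ?F m \<omega> - ?F n \<omega>)" for m n
  proof -
    have fin: "finite (S m)" "finite (S n)" using S by (auto simp: E1.step_set_def)
    have u: "E1.step_set (S m \<union> S n)" using S by (auto simp: E1.step_set_def)
    show ?thesis
      using E1.comb_lin[OF fin, of 1 "c m" "-1" "c n"] E2.comb_lin[OF fin, of 1 "c m" "-1" "c n"] comb_norm_eq[OF u] by simp
  qed
  have "\<exists>n0. \<forall>m\<ge>n0. \<forall>n\<ge>n0. L2_norm M' (\<lambda>\<omega>. ?F' m \<omega> - ?F' n \<omega>) < \<epsilon>" if eps: "\<epsilon> > 0" for \<epsilon>
  proof -
    obtain n0 where n0: "1 / real (Suc n0) < \<epsilon> / 2"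
      using reals_Archimedean[OF half_gt_zero[OF eps]] unfolding inverse_eq_divide by blast
    have half: "L2_norm M (\<lambda>\<omega>. F \<omega> - ?F n \<omega>) < \<epsilon> / 2" if "n \<ge> n0" for n
    proof -
      have "1 / real (Suc n) \<le> 1 / real (Suc n0)" using that by (simp add: frac_le)
      then show ?thesis using S(2)[of n] n0 by linarith
    qed
    have "L2_norm M (\<lambda>\<omega>. ?F m \<omega> - ?F n \<omega>) < \<epsilon>" if "m \<ge> n0" "n \<ge> n0" for m n
      using L2_norm_triangle3[OF L(1)[of m] E1.H_L2[OF F] L(1)[of n]] half[OF that(1)] half[OF that(2)]
      unfolding L2_norm_minus_commute[of M "?F m" F] by simp
    then show ?thesis unfolding eq by blast
  qed
  from L2_complete[OF L(2) this] obtain F' where F': "L2_lim M' ?F' F'" .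
  have "rel F F'" unfolding rel_def
  proof (intro conjI allI impI F)
    show "F' \<in> E2.HT" by (rule closed_subspace_lim[OF E2.HT_closed E2.comb_HT[OF S(1)] F'])
    fix \<epsilon> :: real assume "\<epsilon> > 0"
    then have "eventually (\<lambda>n. L2_norm M' (\<lambda>\<omega>. ?F' n \<omega> - F' \<omega>) < \<epsilon>) sequentially"
      by (intro order_tendstoD[OF L2_limD(3)[OF F']])
    moreover have "eventually (\<lambda>n. 1 / real (Suc n) < \<epsilon>) sequentially"
      using \<open>\<epsilon> > 0\<close> by (intro order_tendstoD[OF LIMSEQ_Suc[OF lim_1_over_n]])
    ultimately have "eventually (\<lambda>n. L2_norm M' (\<lambda>\<omega>. ?F' n \<omega> - F' \<omega>) < \<epsilon> \<and> 1 / real (Suc n) < \<epsilon>) sequentially"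
      by (rule eventually_conj)
    then obtain n where n: "L2_norm M' (\<lambda>\<omega>. ?F' n \<omega> - F' \<omega>) < \<epsilon>" "1 / real (Suc n) < \<epsilon>" by (auto simp: eventually_sequentially)
    then show "\<exists>S c. E1.step_set S \<and> L2_norm M (\<lambda>\<omega>. F \<omega> - E1.comb S c \<omega>) < \<epsilon> \<and> L2_norm M' (\<lambda>\<omega>. F' \<omega> - E2.comb S c \<omega>) < \<epsilon>"
      using S(1)[of n] S(2)[of n] L2_norm_minus_commute[of M' F'] by (intro exI[of _ "S n"] exI[of _ "c n"]) auto
  qed
  with that show ?thesis by blast
qed

definition \<Phi> :: "('w \<Rightarrow> complex) \<Rightarrow> 'v \<Rightarrow> complex" where
  "\<Phi> F = (SOME F'. rel F F')"

lemma \<Phi>_rel: "F \<in> E1.HT \<Longrightarrow> rel F (\<Phi> F)"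
  unfolding \<Phi>_def by (rule someI_ex[of "rel F"]) (blast elim: rel_total)

lemma \<Phi>_eqI: "rel F F' \<Longrightarrow> aeq M' (\<Phi> F) F'"
  using rel_unique[OF \<Phi>_rel _ aeq_refl] relD(1) by blast

lemma \<Phi>_HT: "F \<in> E1.HT \<Longrightarrow> \<Phi> F \<in> E2.HT"
  by (rule relD(2)[OF \<Phi>_rel])

lemma \<Phi>_norm: "F \<in> E1.HT \<Longrightarrow> L2_norm M' (\<Phi> F) = L2_norm M F"
  using rel_norm[OF \<Phi>_rel] by simp

lemma \<Phi>_bounded: "bounded_map M E1.HT M' \<Phi>"
  by (rule bounded_mapI[where C=1]) (auto simp: \<Phi>_norm intro: E2.H_L2 \<Phi>_HT \<Phi>_eqI rel_lin \<Phi>_rel)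

lemma \<Phi>_e: "step_fun \<mu> h \<Longrightarrow> aeq M' (\<Phi> (e h)) (e' h)"
  by (rule \<Phi>_eqI[OF rel_e])

lemma swap: "exp_pair M' \<mu> loc' e' M loc e"
  by (intro exp_pair.intro E1.exp_system_axioms E2.exp_system_axioms)

text \<open>Provides the inverse: the isometry built in the opposite direction comes from the same
  relation, so what is proved for \<Phi> holds for its inverse too.\<close>

lemma rel_swap: "exp_pair.rel M' \<mu> loc' e' M loc e F' F \<longleftrightarrow> rel F F'"
proof -
  interpret S: exp_pair M' \<mu> loc' e' M loc e by (rule swap)
  show ?thesis unfolding rel_def S.rel_def by blast
qed

lemma \<Phi>_loc:
  assumes A: "A \<in> sets \<mu>" and F: "F \<in> E1.H A"
  shows "\<Phi> F \<in> E2.H A"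
proof -
  note V = closed_subspace_preimage[OF bounded_map_subset[OF \<Phi>_bounded E1.H_top[OF A]] E1.H_closed[OF A] E2.H_closed[OF A]]
  have "E1.H A \<subseteq> {f \<in> E1.H A. \<Phi> f \<in> E2.H A}"
  proof (rule E1.total[OF A V])
    fix h assume h: "step_fun \<mu> h" "\<And>y. y \<in> space \<mu> - A \<Longrightarrow> h y = 0"
    have "e' h \<in> E2.H A" by (rule E2.e_local[OF h(1) A]) (rule h(2))
    from E2.H_aeq[OF A this aeq_sym[OF \<Phi>_e[OF h(1)]] E2.H_meas[OF \<Phi>_HT[OF E1.e_HT[OF h(1)]]]]
    have "\<Phi> (e h) \<in> E2.H A" .
    then show "e h \<in> {f \<in> E1.H A. \<Phi> f \<in> E2.H A}" using E1.e_local[OF h(1) A h(2)] by simp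
  qed
  with F show ?thesis by blast
qed

text \<open>The preimage is the image under the opposite isometry, which respects the spaces over
  \<open>A\<close> for the same reason as \<Phi>.\<close>

lemma \<Phi>_onto_loc:
  assumes A: "A \<in> sets \<mu>" and F': "F' \<in> E2.H A"
  obtains F where "F \<in> E1.H A" "rel F F'" "aeq M' (\<Phi> F) F'"
proof -
  interpret S: exp_pair M' \<mu> loc' e' M loc e by (rule swap)
  have "F' \<in> E2.HT" using F' E2.H_top[OF A] by blast
  then have "rel (S.\<Phi> F') F'" using S.\<Phi>_rel rel_swap by blast
  with S.\<Phi>_loc[OF A F'] \<Phi>_eqI that show ?thesis by blast
qed

text \<open>Both sides are linear and bounded in each factor separately. It suffices to compare them
  on exponentials: first \<open>F\<close> varies with \<open>G\<close> an exponential, then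
  \<open>G\<close> varies.\<close>

lemma \<Phi>_mult:
  assumes A: "A \<in> sets \<mu>" and F: "F \<in> E1.H A" and G: "G \<in> E1.H (space \<mu> - A)"
  shows "aeq M' (\<Phi> (\<lambda>\<omega>. F \<omega> * G \<omega>)) (\<lambda>\<omega>. \<Phi> F \<omega> * \<Phi> G \<omega>)"
proof -
  let ?B = "space \<mu> - A"
  note B = E1.sets_compl[OF A]
  note p = E1.prod_H_compl[OF A]
  have 1: "aeq M' (\<Phi> (\<lambda>\<omega>. F \<omega> * e k \<omega>)) (\<lambda>\<omega>. \<Phi> F \<omega> * \<Phi> (e k) \<omega>)"
    if F: "F \<in> E1.H A" and k: "step_fun \<mu> k" "\<And>y. y \<in> space \<mu> - ?B \<Longrightarrow> k y = 0" for F k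
  proof -
    have ek: "e k \<in> E1.H ?B" by (rule E1.e_local[OF k(1) B k(2)])
    have V: "closed_subspace M {F \<in> E1.H A. aeq M' (\<Phi> (\<lambda>\<omega>. F \<omega> * e k \<omega>)) (\<lambda>\<omega>. \<Phi> F \<omega> * \<Phi> (e k) \<omega>)}"
      by (rule closed_subspace_equalizer[OF
            bounded_map_compose[OF E1.mult_bounded[OF A ek] \<Phi>_bounded E1.HT_closed p[OF _ ek] E1.H_closed[OF A]]
            bounded_map_compose[OF bounded_map_subset[OF \<Phi>_bounded E1.H_top[OF A]] E2.mult_bounded[OF A \<Phi>_loc[OF B ek]]
              E2.H_closed[OF A] \<Phi>_loc[OF A] E1.H_closed[OF A]] E1.H_closed[OF A]])
    have "E1.H A \<subseteq> {F \<in> E1.H A. aeq M' (\<Phi> (\<lambda>\<omega>. F \<omega> * e k \<omega>)) (\<lambda>\<omega>. \<Phi> F \<omega> * \<Phi> (e k) \<omega>)}"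
    proof (rule E1.total[OF A V])
      fix h assume h: "step_fun \<mu> h" "\<And>y. y \<in> space \<mu> - A \<Longrightarrow> h y = 0"
      have eh: "e h \<in> E1.H A" by (rule E1.e_local[OF h(1) A h(2)])
      have hk: "h y * k y = 0" if "y \<in> space \<mu>" for y using that h(2)[of y] k(2)[of y] by (cases "y \<in> A") auto
      have st: "step_fun \<mu> (\<lambda>y. h y + k y)" by (rule step_fun_compose[OF h(1) k(1)]) simp
      have "aeq M' (\<Phi> (\<lambda>\<omega>. e h \<omega> * e k \<omega>)) (\<Phi> (e (\<lambda>y. h y + k y)))"
        by (rule bounded_map_aeq[OF \<Phi>_bounded E1.HT_closed p[OF eh ek] E1.e_HT[OF st] aeq_sym[OF E1.e_mult[OF h(1) k(1) hk]]])
      also have "aeq M' \<dots> (e' (\<lambda>y. h y + k y))" by (rule \<Phi>_e[OF st])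
      also have "aeq M' \<dots> (\<lambda>\<omega>. e' h \<omega> * e' k \<omega>)" by (rule E2.e_mult[OF h(1) k(1) hk])
      also have "aeq M' \<dots> (\<lambda>\<omega>. \<Phi> (e h) \<omega> * \<Phi> (e k) \<omega>)"
        by (intro aeq_mult aeq_sym[OF \<Phi>_e] h k)
      finally show "e h \<in> {F \<in> E1.H A. aeq M' (\<Phi> (\<lambda>\<omega>. F \<omega> * e k \<omega>)) (\<lambda>\<omega>. \<Phi> F \<omega> * \<Phi> (e k) \<omega>)}"
        using eh by simp
    qed
    with F show ?thesis by blast
  qed
  have V: "closed_subspace M {G \<in> E1.H ?B. aeq M' (\<Phi> (\<lambda>\<omega>. F \<omega> * G \<omega>)) (\<lambda>\<omega>. \<Phi> F \<omega> * \<Phi> G \<omega>)}"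
    by (rule closed_subspace_equalizer[OF
          bounded_map_compose[OF E1.mult_bounded_left[OF A F] \<Phi>_bounded E1.HT_closed p[OF F] E1.H_closed[OF B]]
          bounded_map_compose[OF bounded_map_subset[OF \<Phi>_bounded E1.H_top[OF B]] E2.mult_bounded_left[OF A \<Phi>_loc[OF A F]]
            E2.H_closed[OF B] \<Phi>_loc[OF B] E1.H_closed[OF B]] E1.H_closed[OF B]])
  have "E1.H ?B \<subseteq> {G \<in> E1.H ?B. aeq M' (\<Phi> (\<lambda>\<omega>. F \<omega> * G \<omega>)) (\<lambda>\<omega>. \<Phi> F \<omega> * \<Phi> G \<omega>)}"
  proof (rule E1.total[OF B V])
    fix k assume k: "step_fun \<mu> k" "\<And>y. y \<in> space \<mu> - ?B \<Longrightarrow> k y = 0"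
    show "e k \<in> {G \<in> E1.H ?B. aeq M' (\<Phi> (\<lambda>\<omega>. F \<omega> * G \<omega>)) (\<lambda>\<omega>. \<Phi> F \<omega> * \<Phi> G \<omega>)}"
      using 1[OF F k(1) k(2)] E1.e_local[OF k(1) B k(2)] by blast
  qed
  with G show ?thesis by blast
qed

lemma \<Phi>_surj_isometry: "surjective_isometry M E1.HT M' E2.HT \<Phi>"
  unfolding surjective_isometry_def
proof (intro conjI ballI)
  show "linear_on M' E1.HT \<Phi>" using \<Phi>_bounded by (simp add: bounded_map_def)
  show "\<exists>f\<in>E1.HT. aeq M' (\<Phi> f) g" if "g \<in> E2.HT" for g
    by (rule \<Phi>_onto_loc[OF sets.top that]) blast
qed (simp_all add: \<Phi>_HT \<Phi>_norm)

text \<open>\<Phi> maps products over \<open>A\<close> and its complement to products of the same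
  kind, so an operator acting on the first factor is carried to one acting on the first
  factor.\<close>

lemma conjugate_\<Phi>_subset:
  assumes A: "A \<in> sets \<mu>"
  shows "conjugate_algebra E1.HT M' E2.HT \<Phi> (E1.\<xi> A) \<subseteq> E2.\<xi> A"
proof
  fix S' assume "S' \<in> conjugate_algebra E1.HT M' E2.HT \<Phi> (E1.\<xi> A)"
  then obtain S where S'b: "S' \<in> bounded_ops M' E2.HT" and S: "S \<in> E1.\<xi> A"
    and SS: "\<And>f. f \<in> E1.HT \<Longrightarrow> aeq M' (S' (\<Phi> f)) (\<Phi> (S f))" by (auto simp: conjugate_algebra_def)
  note b' = bounded_opsD[OF S'b E2.HT_closed] and SD = E1.\<xi>_D[OF S A]
  note b = bounded_opsD[OF E1.\<xi>_bounded[OF S] E1.HT_closed]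
  note top = subsetD[OF E1.H_top[OF A]]
  have 1: "aeq M' (S' F') (\<Phi> (S F))" if F: "F \<in> E1.HT" "aeq M' (\<Phi> F) F'" "F' \<in> E2.HT" for F F'
    using bounded_map_aeq[OF b'(1) E2.HT_closed that(3) \<Phi>_HT[OF F(1)] aeq_sym[OF F(2)]] SS[OF F(1)] by (rule aeq_trans)
  show "S' \<in> E2.\<xi> A"
  proof (rule E2.\<xi>_I[OF A S'b])
    fix F' assume F': "F' \<in> E2.H A"
    have F'T: "F' \<in> E2.HT" using F' E2.H_top[OF A] by blast
    obtain F where F: "F \<in> E1.H A" "aeq M' (\<Phi> F) F'" using \<Phi>_onto_loc[OF A F'] by blast
    note FF = 1[OF top[OF F(1)] F(2) F'T]
    show "S' F' \<in> E2.H A"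
      by (rule E2.H_aeq[OF A \<Phi>_loc[OF A SD(1)[OF F(1)]] aeq_sym[OF FF] E2.H_meas[OF b'(2)[OF F'T]]])
    fix G' assume G': "G' \<in> E2.H (space \<mu> - A)"
    obtain G where G: "G \<in> E1.H (space \<mu> - A)" "aeq M' (\<Phi> G) G'" using \<Phi>_onto_loc[OF E1.sets_compl[OF A] G'] by blast
    note FG = E1.prod_H_compl[OF A F(1) G(1)]
    have "aeq M' (S' (\<lambda>\<omega>. F' \<omega> * G' \<omega>)) (\<Phi> (S (\<lambda>\<omega>. F \<omega> * G \<omega>)))"
      by (rule 1[OF FG aeq_trans[OF \<Phi>_mult[OF A F(1) G(1)] aeq_mult[OF F(2) G(2)]] E2.prod_H_compl[OF A F' G']])
    also have "aeq M' \<dots> (\<Phi> (\<lambda>\<omega>. S F \<omega> * G \<omega>))"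
      by (rule bounded_map_aeq[OF \<Phi>_bounded E1.HT_closed b(2)[OF FG] E1.prod_H_compl[OF A SD(1)[OF F(1)] G(1)] SD(2)[OF F(1) G(1)]])
    also have "aeq M' \<dots> (\<lambda>\<omega>. \<Phi> (S F) \<omega> * \<Phi> G \<omega>)" by (rule \<Phi>_mult[OF A SD(1)[OF F(1)] G(1)])
    also have "aeq M' \<dots> (\<lambda>\<omega>. S' F' \<omega> * G' \<omega>)" by (rule aeq_mult[OF aeq_sym[OF FF] G(2)])
    finally show "aeq M' (S' (\<lambda>\<omega>. F' \<omega> * G' \<omega>)) (\<lambda>\<omega>. S' F' \<omega> * G' \<omega>)" .
  qed
qed

lemma conjugate_\<Phi>:
  assumes A: "A \<in> sets \<mu>"
  shows "conjugate_algebra E1.HT M' E2.HT \<Phi> (E1.\<xi> A) = E2.\<xi> A"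
proof (intro equalityI conjugate_\<Phi>_subset[OF A] subsetI)
  interpret S: exp_pair M' \<mu> loc' e' M loc e by (rule swap)
  have inv1: "aeq M' (\<Phi> (S.\<Phi> f')) f'" if "f' \<in> E2.HT" for f'
    using \<Phi>_eqI S.\<Phi>_rel[OF that] rel_swap by blast
  fix S' assume S': "S' \<in> E2.\<xi> A"
  note b' = bounded_opsD[OF E2.\<xi>_bounded[OF S'] E2.HT_closed]
  \<comment> \<open>The operator carried back; the inclusion already proved, applied to the inverse
    isometry, places it in the algebra over \<open>A\<close>.\<close>
  define S where "S f = S.\<Phi> (S' (\<Phi> f))" for f
  have "bounded_map M E1.HT M' (\<lambda>f. S' (\<Phi> f))"
    by (rule bounded_map_compose[OF \<Phi>_bounded b'(1) E2.HT_closed \<Phi>_HT E1.HT_closed])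
  then have "bounded_map M E1.HT M S" unfolding S_def
    by (rule bounded_map_compose[OF _ S.\<Phi>_bounded E2.HT_closed _ E1.HT_closed]) (intro b'(2) \<Phi>_HT)
  then have Sb: "S \<in> bounded_ops M E1.HT" 
    by (rule bounded_opsI) (simp add: S_def S.\<Phi>_HT b'(2) \<Phi>_HT)
  have "S \<in> conjugate_algebra E2.HT M E1.HT S.\<Phi> (E2.\<xi> A)"
    unfolding conjugate_algebra_def
  proof (intro CollectI conjI Sb bexI[OF _ S'] ballI)
    fix f' assume f': "f' \<in> E2.HT"
    have "aeq M' (S' (\<Phi> (S.\<Phi> f'))) (S' f')"
      by (rule bounded_map_aeq[OF b'(1) E2.HT_closed \<Phi>_HT[OF S.\<Phi>_HT[OF f']] f' inv1[OF f']])
    then show "aeq M (S (S.\<Phi> f')) (S.\<Phi> (S' f'))" unfolding S_def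
      by (rule bounded_map_aeq[OF S.\<Phi>_bounded E2.HT_closed b'(2)[OF \<Phi>_HT[OF S.\<Phi>_HT[OF f']]] b'(2)[OF f']])
  qed
  then have SA: "S \<in> E1.\<xi> A" using S.conjugate_\<Phi>_subset[OF A] by blast
  show "S' \<in> conjugate_algebra E1.HT M' E2.HT \<Phi> (E1.\<xi> A)"
    unfolding conjugate_algebra_def
  proof (intro CollectI conjI E2.\<xi>_bounded[OF S'] bexI[OF _ SA] ballI)
    fix f assume f: "f \<in> E1.HT"
    show "aeq M' (S' (\<Phi> f)) (\<Phi> (S f))" unfolding S_def by (rule aeq_sym[OF inv1[OF b'(2)[OF \<Phi>_HT[OF f]]]])
  qed
qed

lemma special_isomorphism_\<Phi>: "special_isomorphism \<mu> M E1.HT E1.\<xi> M' E2.HT E2.\<xi> \<Phi>"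
  unfolding special_isomorphism_def
  using E1.Hilbert_factorization_\<xi> E2.Hilbert_factorization_\<xi> \<Phi>_surj_isometry conjugate_\<Phi> by blast

lemma unity_\<Phi>: "unity_preserving M' \<Phi>"
  unfolding unity_preserving_def
proof -
  have "aeq M' (\<Phi> (\<lambda>_. 1)) (\<Phi> (e (\<lambda>_. 0)))"
    by (rule bounded_map_aeq[OF \<Phi>_bounded E1.HT_closed E1.const_H E1.e_HT[OF step_fun_zero] aeq_sym[OF E1.e_zero]])
  also have "aeq M' \<dots> (e' (\<lambda>_. 0))" by (rule \<Phi>_e[OF step_fun_zero])
  also have "aeq M' \<dots> (\<lambda>_. 1)" by (rule E2.e_zero)
  finally show "aeq M' (\<Phi> (\<lambda>_. 1)) (\<lambda>_. 1)" .
qed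

section \<open>Compatibility with complex conjugation\<close>

lemma cnj_comb:
  assumes "E1.step_set S"
  shows "aeq M (\<lambda>\<omega>. cnj (E1.comb S c \<omega>)) (E1.comb S (\<lambda>h. cnj (c h)))"
proof -
  have S: "finite S" "\<And>h. h \<in> S \<Longrightarrow> step_fun \<mu> h" using assms by (auto simp: E1.step_set_def)
  have "AE \<omega> in M. \<forall>h\<in>S. e h \<omega> \<in> \<real>"
    using E1.e_real[OF S(2)] by (intro AE_finite_allI S(1)) (auto simp: real_valued_def)
  then show ?thesis unfolding aeq_def E1.comb_def
    by eventually_elim (simp add: cnj_sum Reals_cnj_iff)
qed

lemma L2_norm_cnj: "L2_norm N (\<lambda>\<omega>. cnj (f \<omega>) - cnj (g \<omega>)) = L2_norm N (\<lambda>\<omega>. f \<omega> - g \<omega>)"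
  unfolding L2_norm_def by (simp flip: complex_cnj_diff)

end

lemma (in exp_system) cnj_H: "f \<in> H A \<Longrightarrow> (\<lambda>\<omega>. cnj (f \<omega>)) \<in> H A"
proof -
  assume f: "f \<in> H A"
  obtain f' where f': "f' \<in> borel_measurable (loc A)" "aeq M f f'" using HD[OF f] by blast
  have "aeq M (\<lambda>\<omega>. cnj (f \<omega>)) (\<lambda>\<omega>. cnj (f' \<omega>))" using f'(2) unfolding aeq_def by (rule eventually_mono) simp
  then show "(\<lambda>\<omega>. cnj (f \<omega>)) \<in> H A"
    unfolding local_L2_eq using L2_cnj[OF H_L2[OF f]] borel_measurable_cnj[OF f'(1)] by blast
qed

context exp_pair
begin

text \<open>The exponentials are real, so conjugating a combination conjugates its coefficients, on
  both sides alike.\<close>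

lemma rel_cnj:
  assumes "rel f f'"
  shows "rel (\<lambda>\<omega>. cnj (f \<omega>)) (\<lambda>\<omega>. cnj (f' \<omega>))"
  unfolding rel_def
proof (intro conjI allI impI E1.cnj_H E2.cnj_H relD[OF assms])
  interpret S: exp_pair M' \<mu> loc' e' M loc e by (rule swap)
  fix \<epsilon> :: real assume "\<epsilon> > 0"
  then obtain S c where S: "E1.step_set S" "L2_norm M (\<lambda>\<omega>. f \<omega> - E1.comb S c \<omega>) < \<epsilon>" "L2_norm M' (\<lambda>\<omega>. f' \<omega> - E2.comb S c \<omega>) < \<epsilon>"
    using relD(3)[OF assms] by blast
  note f = relD[OF assms]
  have "L2_norm M (\<lambda>\<omega>. cnj (f \<omega>) - E1.comb S (\<lambda>h. cnj (c h)) \<omega>) = L2_norm M (\<lambda>\<omega>. cnj (f \<omega>) - cnj (E1.comb S c \<omega>))"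
    by (rule L2_norm_cong[OF aeq_diff[OF aeq_refl aeq_sym[OF cnj_comb[OF S(1)]]]])
       (intro borel_measurable_diff borel_measurable_cnj E1.H_meas[OF f(1)] E1.H_meas[OF E1.comb_HT[OF S(1)]])+
  moreover have "L2_norm M' (\<lambda>\<omega>. cnj (f' \<omega>) - E2.comb S (\<lambda>h. cnj (c h)) \<omega>) = L2_norm M' (\<lambda>\<omega>. cnj (f' \<omega>) - cnj (E2.comb S c \<omega>))"
    by (rule L2_norm_cong[OF aeq_diff[OF aeq_refl aeq_sym[OF S.cnj_comb[OF S(1)]]]])
       (intro borel_measurable_diff borel_measurable_cnj E2.H_meas[OF f(2)] E2.H_meas[OF E2.comb_HT[OF S(1)]])+
  ultimately show "\<exists>S c. E1.step_set S \<and> L2_norm M (\<lambda>\<omega>. cnj (f \<omega>) - E1.comb S c \<omega>) < \<epsilon> \<and> L2_norm M' (\<lambda>\<omega>. cnj (f' \<omega>) - E2.comb S c \<omega>) < \<epsilon>"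
    using S by (intro exI[of _ S] exI[of _ "\<lambda>h. cnj (c h)"]) (simp add: L2_norm_cnj)
qed

lemma real_valued_iff: "real_valued N f \<longleftrightarrow> aeq N (\<lambda>\<omega>. cnj (f \<omega>)) f"
  unfolding real_valued_def aeq_def by (simp add: Reals_cnj_iff)

lemma \<Phi>_real:
  assumes "f \<in> E1.HT" "real_valued M f"
  shows "real_valued M' (\<Phi> f)"
  using rel_unique[OF rel_cnj[OF \<Phi>_rel[OF assms(1)]] \<Phi>_rel[OF assms(1)]] assms(2) by (simp add: real_valued_iff)

lemma real_isomorphism_\<Phi>: "real_isomorphism M E1.HT M' E2.HT \<Phi>"
  unfolding real_isomorphism_def
proof (intro conjI ballI impI \<Phi>_real)
  interpret S: exp_pair M' \<mu> loc' e' M loc e by (rule swap)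
  fix g assume g: "g \<in> E2.HT" "real_valued M' g"
  have "aeq M' (\<Phi> (S.\<Phi> g)) g" using \<Phi>_eqI S.\<Phi>_rel[OF g(1)] rel_swap by blast
  with S.\<Phi>_HT[OF g(1)] S.\<Phi>_real[OF g] show "\<exists>f\<in>E1.HT. real_valued M f \<and> aeq M' (\<Phi> f) g" by blast
qed

end

section \<open>Isometries agreeing on the first chaos\<close>

text \<open>Polarization: the norm of \<open>f - g\<close> gives the real part, and
  \<open>\<i> * g\<close> in place of \<open>g\<close> gives the imaginary part.\<close>

lemma isometry_inner:
  assumes T: "bounded_map M V M' T" and V: "closed_subspace M V"
    and iso: "\<And>f. f \<in> V \<Longrightarrow> L2_norm M' (T f) = L2_norm M f" and f: "f \<in> V" and g: "g \<in> V"
  shows "L2_inner M' (T f) (T g) = L2_inner M f g"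
proof -
  note L = closed_subspace_L2[OF V] and TL = bounded_map_L2[OF T]
  have re: "Re (L2_inner M' (T f) (T g)) = Re (L2_inner M f g)" if g: "g \<in> V" for g
  proof -
    have "aeq M' (T (\<lambda>\<omega>. f \<omega> - g \<omega>)) (\<lambda>\<omega>. T f \<omega> - T g \<omega>)" using bounded_map_lin[OF T f g, of 1 "-1"] by simp
    then have "L2_norm M' (\<lambda>\<omega>. T f \<omega> - T g \<omega>) = L2_norm M' (T (\<lambda>\<omega>. f \<omega> - g \<omega>))"
      by (intro L2_norm_cong[symmetric] L2_measurable L2_diff TL closed_subspace_diff[OF V] f g)
    also have "\<dots> = L2_norm M (\<lambda>\<omega>. f \<omega> - g \<omega>)" by (intro iso closed_subspace_diff[OF V] f g)
    finally have "(L2_norm M' (\<lambda>\<omega>. T f \<omega> - T g \<omega>))\<^sup>2 = (L2_norm M (\<lambda>\<omega>. f \<omega> - g \<omega>))\<^sup>2" by simp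
    then show ?thesis
      unfolding L2_norm_diff_sq[OF TL[OF f] TL[OF g]] L2_norm_diff_sq[OF L[OF f] L[OF g]] by (simp add: iso f g)
  qed
  have ig: "(\<lambda>\<omega>. \<i> * g \<omega>) \<in> V" by (rule closed_subspace_cmult[OF V g])
  have "aeq M' (T (\<lambda>\<omega>. \<i> * g \<omega>)) (\<lambda>\<omega>. \<i> * T g \<omega>)" using bounded_map_lin[OF T g g, of \<i> 0] by simp
  then have "L2_inner M' (T f) (T (\<lambda>\<omega>. \<i> * g \<omega>)) = L2_inner M' (T f) (\<lambda>\<omega>. \<i> * T g \<omega>)"
    by (intro L2_inner_cong L2_measurable L2_cmult TL ig f g) auto
  also have "\<dots> = \<i> * L2_inner M' (T f) (T g)"
    using L2_inner_lin_right[OF TL[OF f] TL[OF g] TL[OF g], of \<i> 0] by simp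
  finally have "Re (\<i> * L2_inner M' (T f) (T g)) = Re (L2_inner M f (\<lambda>\<omega>. \<i> * g \<omega>))" using re[OF ig] by simp
  also have "L2_inner M f (\<lambda>\<omega>. \<i> * g \<omega>) = \<i> * L2_inner M f g"
    using L2_inner_lin_right[OF L[OF f] L[OF g] L[OF g], of \<i> 0] by simp
  finally have "Im (L2_inner M' (T f) (T g)) = Im (L2_inner M f g)" by simp
  with re[OF g] show ?thesis by (simp add: complex_eq_iff)
qed

section \<open>Isometries compatible with the factorizations\<close>

context exp_pair
begin

context
  fixes T :: "('w \<Rightarrow> complex) \<Rightarrow> 'v \<Rightarrow> complex"
  assumes T: "surjective_isometry M E1.HT M' E2.HT T"
begin

lemma isometry_HT: "f \<in> E1.HT \<Longrightarrow> T f \<in> E2.HT"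
  using T by (auto simp: surjective_isometry_def)

lemma isometry_norm: "f \<in> E1.HT \<Longrightarrow> L2_norm M' (T f) = L2_norm M f"
  using T by (auto simp: surjective_isometry_def)

lemma isometry_bounded: "bounded_map M E1.HT M' T"
  using T by (auto simp: surjective_isometry_def bounded_map_def intro: E2.H_L2 exI[of _ 1])

text \<open>\<open>T\<close> is invertible only modulo null sets. A choice \<open>R\<close> of
  preimages is linear and norm-preserving in that sense, and composing with it conjugates
  \<open>S\<close>.\<close>

lemma conjugate_operator:
  assumes S: "S \<in> bounded_ops M E1.HT"
  obtains S' where "S' \<in> bounded_ops M' E2.HT" "\<And>f. f \<in> E1.HT \<Longrightarrow> aeq M' (S' (T f)) (T (S f))"
proof -
  note Sb = bounded_opsD[OF S E1.HT_closed] and Tb = isometry_bounded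
  have "\<exists>f. f \<in> E1.HT \<and> aeq M' (T f) g" if "g \<in> E2.HT" for g using T that by (auto simp: surjective_isometry_def)
  then obtain R where R: "\<And>g. g \<in> E2.HT \<Longrightarrow> R g \<in> E1.HT" "\<And>g. g \<in> E2.HT \<Longrightarrow> aeq M' (T (R g)) g" by metis
  have inj: "aeq M f g" if fg: "f \<in> E1.HT" "g \<in> E1.HT" "aeq M' (T f) (T g)" for f g
  proof (rule aeqI_L2_norm)
    have d: "(\<lambda>\<omega>. f \<omega> - g \<omega>) \<in> E1.HT" by (rule closed_subspace_diff[OF E1.HT_closed fg(1,2)])
    have "aeq M' (T (\<lambda>\<omega>. f \<omega> - g \<omega>)) (\<lambda>\<omega>. T f \<omega> - T g \<omega>)" using bounded_map_lin[OF Tb fg(1,2), of 1 "-1"] by simp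
    also have "aeq M' \<dots> (\<lambda>\<omega>. 0)" using fg(3) unfolding aeq_def by eventually_elim simp
    finally show "L2_norm M (\<lambda>\<omega>. f \<omega> - g \<omega>) = 0"
      using L2_norm_eq_0_iff[OF E2.H_L2[OF isometry_HT[OF d]]] by (simp add: isometry_norm d)
  qed (rule E1.H_L2[OF fg(1)] E1.H_L2[OF fg(2)])+
  have "bounded_map M' E2.HT M R"
  proof (rule bounded_mapI[where C=1])
    fix f g a b assume fg: "f \<in> E2.HT" "g \<in> E2.HT"
    have l: "(\<lambda>\<omega>. a * f \<omega> + b * g \<omega>) \<in> E2.HT" by (rule closed_subspace_lin[OF E2.HT_closed fg])
    show "aeq M (R (\<lambda>\<omega>. a * f \<omega> + b * g \<omega>)) (\<lambda>\<omega>. a * R f \<omega> + b * R g \<omega>)"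
    proof (rule inj[OF R(1)[OF l] closed_subspace_lin[OF E1.HT_closed R(1)[OF fg(1)] R(1)[OF fg(2)]]])
      have "aeq M' (\<lambda>\<omega>. a * f \<omega> + b * g \<omega>) (\<lambda>\<omega>. a * T (R f) \<omega> + b * T (R g) \<omega>)"
        by (rule aeq_lin[OF aeq_sym[OF R(2)[OF fg(1)]] aeq_sym[OF R(2)[OF fg(2)]]])
      also have "aeq M' \<dots> (T (\<lambda>\<omega>. a * R f \<omega> + b * R g \<omega>))"
        by (rule aeq_sym[OF bounded_map_lin[OF Tb R(1)[OF fg(1)] R(1)[OF fg(2)]]])
      finally show "aeq M' (T (R (\<lambda>\<omega>. a * f \<omega> + b * g \<omega>))) (T (\<lambda>\<omega>. a * R f \<omega> + b * R g \<omega>))"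
        by (rule aeq_trans[OF R(2)[OF l]])
    qed
  next
    fix f assume f: "f \<in> E2.HT"
    have "L2_norm M (R f) = L2_norm M' (T (R f))" by (simp add: isometry_norm R f)
    also have "\<dots> = L2_norm M' f" by (rule L2_norm_cong[OF R(2)[OF f]]) (intro E2.H_meas[OF isometry_HT] R f E2.H_meas[OF f])+
    finally show "L2_norm M (R f) \<le> 1 * L2_norm M' f" by simp
  qed (rule E1.H_L2, rule R)
  then have "bounded_map M' E2.HT M (\<lambda>f. S (R f))"
    by (rule bounded_map_compose[OF _ Sb(1) E1.HT_closed R(1) E2.HT_closed])
  then have "bounded_map M' E2.HT M' (\<lambda>f. T (S (R f)))"
    by (rule bounded_map_compose[OF _ Tb E1.HT_closed _ E2.HT_closed]) (intro Sb(2) R(1))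
  then have "(\<lambda>f. T (S (R f))) \<in> bounded_ops M' E2.HT"
    by (rule bounded_opsI) (intro isometry_HT Sb(2) R(1))
  moreover have "aeq M' (T (S (R (T f)))) (T (S f))" if f: "f \<in> E1.HT" for f
  proof -
    note Tf = isometry_HT[OF f]
    have "aeq M (R (T f)) f" by (rule inj[OF R(1)[OF Tf] f R(2)[OF Tf]])
    then have "aeq M (S (R (T f))) (S f)" by (rule bounded_map_aeq[OF Sb(1) E1.HT_closed R(1)[OF Tf] f])
    then show ?thesis by (rule bounded_map_aeq[OF Tb E1.HT_closed Sb(2)[OF R(1)[OF Tf]] Sb(2)[OF f]])
  qed
  ultimately show ?thesis using that by blast
qed

context
  assumes T1: "aeq M' (T (\<lambda>_. 1)) (\<lambda>_. 1)"
begin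

text \<open>
  \<open>T\<close> maps the operator \<open>|F><1| \<otimes> 1\<close>, which creates \<open>F\<close> from the vacuum, to an operator of the
  second factorization creating \<open>T F\<close>.
\<close>

lemma creation_operator:
  assumes A: "A \<in> sets \<mu>" and conj: "conjugate_algebra E1.HT M' E2.HT T (E1.\<xi> A) = E2.\<xi> A" and F: "F \<in> E1.H A"
  obtains S' where "S' \<in> E2.\<xi> A" "\<And>G. G \<in> E1.H (space \<mu> - A) \<Longrightarrow> aeq M' (S' (T G)) (T (\<lambda>\<omega>. F \<omega> * G \<omega>))" "aeq M' (S' (\<lambda>_. 1)) (T F)"
proof -
  let ?B = "space \<mu> - A"
  note B = E1.sets_compl[OF A]
  have FB: "F \<in> E1.H (space \<mu> - ?B)" using F by (simp add: E1.compl_compl[OF A])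
  have S: "E1.rank_one ?B F \<in> E1.\<xi> A" using E1.rank_one_\<xi>[OF B FB] by (simp add: E1.compl_compl[OF A])
  note Sb = bounded_opsD[OF E1.\<xi>_bounded[OF S] E1.HT_closed]
  obtain S' where S': "S' \<in> bounded_ops M' E2.HT" "\<And>f. f \<in> E1.HT \<Longrightarrow> aeq M' (S' (T f)) (T (E1.rank_one ?B F f))"
    using conjugate_operator[OF E1.\<xi>_bounded[OF S]] by blast
  note S'b = bounded_opsD[OF S'(1) E2.HT_closed]
  have S'\<xi>: "S' \<in> E2.\<xi> A" unfolding conj[symmetric] conjugate_algebra_def using S' S by blast
  have 1: "aeq M' (S' (T G)) (T (\<lambda>\<omega>. F \<omega> * G \<omega>))" if G: "G \<in> E1.H ?B" for G
  proof -
    have GT: "G \<in> E1.HT" using G E1.H_top[OF B] by blast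
    have "aeq M (E1.rank_one ?B F G) (\<lambda>\<omega>. F \<omega> * G \<omega>)"
      using aeq_mult[OF E1.cond_id[OF B G] aeq_refl, of F] by (simp add: E1.rank_one_def mult.commute)
    then have "aeq M' (T (E1.rank_one ?B F G)) (T (\<lambda>\<omega>. F \<omega> * G \<omega>))"
      by (rule bounded_map_aeq[OF isometry_bounded E1.HT_closed Sb(2)[OF GT] E1.prod_H_compl[OF A F G]])
    with S'(2)[OF GT] show ?thesis by (rule aeq_trans)
  qed
  have "aeq M' (S' (\<lambda>_. 1)) (S' (T (\<lambda>_. 1)))"
    by (rule bounded_map_aeq[OF S'b(1) E2.HT_closed E2.const_H isometry_HT[OF E1.const_H] aeq_sym[OF T1]])
  also have "aeq M' \<dots> (T (\<lambda>\<omega>. F \<omega> * 1))" by (rule 1[OF E1.const_H])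
  finally have "aeq M' (S' (\<lambda>_. 1)) (T F)" by simp
  with S'\<xi> 1 that show ?thesis by blast
qed

text \<open>\<open>T F\<close> is the value at 1 of an operator from the algebra over
  \<open>A\<close>, and such operators preserve the functionals over \<open>A\<close>, among them
  the constants.\<close>

lemma isometry_loc:
  assumes A: "A \<in> sets \<mu>" and conj: "conjugate_algebra E1.HT M' E2.HT T (E1.\<xi> A) = E2.\<xi> A" and F: "F \<in> E1.H A"
  shows "T F \<in> E2.H A"
proof -
  obtain S' where S': "S' \<in> E2.\<xi> A" "aeq M' (S' (\<lambda>_. 1)) (T F)" by (rule creation_operator[OF A conj F]) blast
  have "F \<in> E1.HT" using F E1.H_top[OF A] by blast
  from E2.H_aeq[OF A E2.\<xi>_D(1)[OF S'(1) A E2.const_H] S'(2) E2.H_meas[OF isometry_HT[OF this]]] show ?thesis .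
qed

text \<open>\<open>S'\<close> creates \<open>T F\<close> from 1 and passes over the factor
  \<open>T G\<close>, which lives on the complement of \<open>A\<close>.\<close>

lemma isometry_mult:
  assumes A: "A \<in> sets \<mu>" and conj: "conjugate_algebra E1.HT M' E2.HT T (E1.\<xi> A) = E2.\<xi> A"
    and conj': "conjugate_algebra E1.HT M' E2.HT T (E1.\<xi> (space \<mu> - A)) = E2.\<xi> (space \<mu> - A)"
    and F: "F \<in> E1.H A" and G: "G \<in> E1.H (space \<mu> - A)"
  shows "aeq M' (T (\<lambda>\<omega>. F \<omega> * G \<omega>)) (\<lambda>\<omega>. T F \<omega> * T G \<omega>)"
proof -
  obtain S' where S': "S' \<in> E2.\<xi> A" "\<And>G. G \<in> E1.H (space \<mu> - A) \<Longrightarrow> aeq M' (S' (T G)) (T (\<lambda>\<omega>. F \<omega> * G \<omega>))"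
    "aeq M' (S' (\<lambda>_. 1)) (T F)" by (rule creation_operator[OF A conj F]) blast
  have TG: "T G \<in> E2.H (space \<mu> - A)" by (rule isometry_loc[OF E1.sets_compl[OF A] conj' G])
  have "aeq M' (T (\<lambda>\<omega>. F \<omega> * G \<omega>)) (S' (\<lambda>\<omega>. 1 * T G \<omega>))" using aeq_sym[OF S'(2)[OF G]] by simp
  also have "aeq M' \<dots> (\<lambda>\<omega>. S' (\<lambda>_. 1) \<omega> * T G \<omega>)" by (rule E2.\<xi>_D(2)[OF S'(1) A E2.const_H TG])
  also have "aeq M' \<dots> (\<lambda>\<omega>. T F \<omega> * T G \<omega>)" by (rule aeq_mult[OF S'(3) aeq_refl])
  finally show ?thesis .
qed

end

end

end

abbreviation restr :: "('y \<Rightarrow> real) \<Rightarrow> 'y set \<Rightarrow> 'y \<Rightarrow> real" where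
  "restr h A \<equiv> (\<lambda>y. if y \<in> A then h y else 0)"

lemma step_fun_integrable_mult:
  assumes h: "step_fun M h" and k: "step_fun M k"
  shows "integrable M (\<lambda>y. h y * k y)"
proof -
  have s: "step_fun M (\<lambda>y. h y * k y)" by (rule step_fun_compose[OF h k]) simp
  show ?thesis
    by (rule integrableI_simple_bochner_integrable)
       (use s in \<open>auto simp: step_fun_def Bochner_Integration.simple_bochner_integrable.simps\<close>)
qed

text \<open>\<open>w h\<close> is the derivative of \<open>e\<close> at 0 in the direction
  \<open>h\<close>, that is, the first-chaos vector of \<open>h\<close>. Its inner products with the
  exponentials and with itself follow from this limit.\<close>

locale exp_pair_deriv = exp_pair M \<mu> loc e M' loc' e'
  for M :: "'w measure" and \<mu> :: "'y measure" and loc e and M' :: "'v measure" and loc' e' +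
  fixes w :: "('y \<Rightarrow> real) \<Rightarrow> 'w \<Rightarrow> complex"
  assumes w_lim: "step_fun \<mu> h \<Longrightarrow>
    L2_lim M (\<lambda>n \<omega>. complex_of_real (real (Suc n)) * (e (\<lambda>y. h y / real (Suc n)) \<omega> - 1)) (w h)"
begin

lemma step_fun_scale: "step_fun \<mu> h \<Longrightarrow> step_fun \<mu> (\<lambda>y. h y / c)"
  by (rule step_fun_compose[where p="\<lambda>a b. a / c"]) auto

lemma w_HT:
  assumes h: "step_fun \<mu> h"
  shows "w h \<in> E1.HT"
  by (rule closed_subspace_lim[OF E1.HT_closed _ w_lim[OF h]])
     (intro closed_subspace_cmult[OF E1.HT_closed] closed_subspace_diff[OF E1.HT_closed] E1.e_HT E1.const_H step_fun_scale h)

lemma inner_e_w: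
  assumes h: "step_fun \<mu> h" and k: "step_fun \<mu> k"
  shows "L2_inner M (e k) (w h) = complex_of_real (LINT y|\<mu>. k y * h y)"
proof -
  let ?c = "LINT y|\<mu>. k y * h y"
  have one: "(\<lambda>_. 1 :: complex) \<in> L2 M" by (rule E1.H_L2[OF E1.const_H])
  have one_e: "L2_inner M (e k) (\<lambda>_. 1) = 1"
    using L2_inner_cnj[of M "\<lambda>_. 1" "e k"] by (simp add: E1.inner_one_eq E1.e_mean k)
  have "L2_inner M (e k) (\<lambda>\<omega>. complex_of_real (real (Suc n)) * (e (\<lambda>y. h y / real (Suc n)) \<omega> - 1))
     = complex_of_real ((exp (?c * (1 / real (Suc n))) - exp 0) / (1 / real (Suc n)))" for n
  proof -
    note hn = step_fun_scale[OF h, of "real (Suc n)"]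
    have "L2_inner M (e k) (\<lambda>\<omega>. complex_of_real (real (Suc n)) * (e (\<lambda>y. h y / real (Suc n)) \<omega> - 1))
      = complex_of_real (real (Suc n)) * L2_inner M (e k) (\<lambda>\<omega>. e (\<lambda>y. h y / real (Suc n)) \<omega> - 1)"
      using L2_inner_lin_right[OF E1.e_L2[OF k] L2_diff[OF E1.e_L2[OF hn] one] one, of "complex_of_real (real (Suc n))" 0] by simp
    also have "L2_inner M (e k) (\<lambda>\<omega>. e (\<lambda>y. h y / real (Suc n)) \<omega> - 1) = complex_of_real (exp (LINT y|\<mu>. k y * (h y / real (Suc n)))) - 1"
      by (subst L2_inner_diff_right[OF E1.e_L2[OF k] E1.e_L2[OF hn] one]) (simp del: of_nat_Suc add: E1.e_inner[OF k hn] one_e)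
    also have "(LINT y|\<mu>. k y * (h y / real (Suc n))) = ?c * (1 / real (Suc n))"
      by (simp only: times_divide_eq_right mult_1_right integral_divide_zero)
    finally show ?thesis by (simp del: of_nat_Suc)
  qed
  moreover have "(\<lambda>n. complex_of_real ((exp (?c * (1 / real (Suc n))) - exp 0) / (1 / real (Suc n)))) \<longlonglongrightarrow> complex_of_real ?c"
  proof (rule tendsto_of_real)
    have "((\<lambda>x. exp (?c * x)) has_field_derivative ?c) (at 0)"
      by (auto intro!: derivative_eq_intros)
    then have "((\<lambda>x. (exp (?c * x) - exp 0) / x) \<longlongrightarrow> ?c) (at 0)"
      by (simp add: has_field_derivative_iff)
    moreover have "filterlim (\<lambda>n. 1 / real (Suc n)) (at 0) sequentially"
      unfolding filterlim_at using LIMSEQ_Suc[OF lim_1_over_n] by auto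
    ultimately show "(\<lambda>n. (exp (?c * (1 / real (Suc n))) - exp 0) / (1 / real (Suc n))) \<longlonglongrightarrow> ?c"
      by (rule filterlim_compose)
  qed
  ultimately show ?thesis
    using LIMSEQ_unique[OF L2_lim_inner[OF L2_lim_const[OF E1.e_L2[OF k]] w_lim[OF h]]] by simp
qed

lemma inner_one_w:
  assumes h: "step_fun \<mu> h"
  shows "L2_inner M (\<lambda>_. 1) (w h) = 0"
proof -
  have "L2_inner M (\<lambda>_. 1) (w h) = L2_inner M (e (\<lambda>_. 0)) (w h)"
    by (rule L2_inner_cong[OF aeq_sym[OF E1.e_zero]])
       (auto intro: L2_measurable E1.e_L2 step_fun_zero E1.H_meas w_HT h)
  then show ?thesis by (simp add: inner_e_w h step_fun_zero)
qed

lemma inner_w_w: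
  assumes h: "step_fun \<mu> h"
  shows "L2_inner M (w h) (w h) = complex_of_real (LINT y|\<mu>. h y * h y)"
proof -
  have one: "(\<lambda>_. 1 :: complex) \<in> L2 M" by (rule E1.H_L2[OF E1.const_H])
  have w: "w h \<in> L2 M" by (rule E1.H_L2[OF w_HT[OF h]])
  have "L2_inner M (\<lambda>\<omega>. complex_of_real (real (Suc n)) * (e (\<lambda>y. h y / real (Suc n)) \<omega> - 1)) (w h) = complex_of_real (LINT y|\<mu>. h y * h y)" for n
  proof -
    note hn = step_fun_scale[OF h, of "real (Suc n)"]
    have "L2_inner M (\<lambda>\<omega>. complex_of_real (real (Suc n)) * (e (\<lambda>y. h y / real (Suc n)) \<omega> - 1)) (w h)
      = complex_of_real (real (Suc n)) * L2_inner M (\<lambda>\<omega>. e (\<lambda>y. h y / real (Suc n)) \<omega> - 1) (w h)"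
      using L2_inner_lin_left[OF w L2_diff[OF E1.e_L2[OF hn] one] one, of "complex_of_real (real (Suc n))" 0] by simp
    also have "L2_inner M (\<lambda>\<omega>. e (\<lambda>y. h y / real (Suc n)) \<omega> - 1) (w h) = complex_of_real (LINT y|\<mu>. h y / real (Suc n) * h y)"
      by (simp del: of_nat_Suc add: L2_inner_diff_left[OF w E1.e_L2[OF hn] one] inner_e_w h hn inner_one_w)
    also have "(LINT y|\<mu>. h y / real (Suc n) * h y) = (LINT y|\<mu>. h y * h y) / real (Suc n)"
      by (simp only: times_divide_eq_left integral_divide_zero)
    finally show ?thesis by (simp del: of_nat_Suc)
  qed
  then show ?thesis
    using LIMSEQ_unique[OF L2_lim_inner[OF w_lim[OF h] L2_lim_const[OF w]], of "complex_of_real (LINT y|\<mu>. h y * h y)"] by simp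
qed

text \<open>
  An isometry that agrees with \<open>\<Phi>\<close> on the constants and on the first chaos can move \<open>e h\<close> only by
  the part of \<open>e h\<close> in the higher chaoses, whose squared norm is of second order in the norm of \<open>h\<close>.
\<close>

lemma inner_T_\<Phi>_e:
  assumes T: "surjective_isometry M E1.HT M' E2.HT T" and T1: "aeq M' (T (\<lambda>_. 1)) (\<lambda>_. 1)"
    and Tw: "aeq M' (T (w h)) (\<Phi> (w h))" and h: "step_fun \<mu> h" and a: "a = (LINT y|\<mu>. h y * h y)"
  shows "norm (L2_inner M' (T (e h)) (\<Phi> (e h)) - complex_of_real (1 + a)) \<le> exp a - 1 - a"
proof -
  note Tb = isometry_bounded[OF T] and Tn = isometry_norm[OF T] and TH = isometry_HT[OF T]
  have inT: "L2_inner M' (T f) (T g) = L2_inner M f g" and in\<Phi>: "L2_inner M' (\<Phi> f) (\<Phi> g) = L2_inner M f g"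
    if "f \<in> E1.HT" "g \<in> E1.HT" for f g
    using isometry_inner[OF Tb E1.HT_closed Tn that] isometry_inner[OF \<Phi>_bounded E1.HT_closed \<Phi>_norm that] by blast+
  have one: "(\<lambda>_. 1 :: complex) \<in> E1.HT" by (rule E1.const_H)
  define u where "u = (\<lambda>\<omega>. 1 + w h \<omega>)"
  \<comment> \<open>The part of \<open>e h\<close> in the chaoses of order two and higher. It is
    orthogonal to \<open>u\<close>, and its squared norm is the exponential series without its first
    two terms.\<close>
  define r where "r = (\<lambda>\<omega>. e h \<omega> - u \<omega>)"
  note w = w_HT[OF h] and eh = E1.e_HT[OF h]
  have u: "u \<in> E1.HT" unfolding u_def by (rule closed_subspace_add[OF E1.HT_closed one w])
  have r: "r \<in> E1.HT" unfolding r_def by (rule closed_subspace_diff[OF E1.HT_closed eh u])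
  note L = E1.H_L2[OF u] E1.H_L2[OF r] E1.H_L2[OF w] E1.H_L2[OF one] E1.H_L2[OF eh]
  have ue: "L2_inner M f u = L2_inner M f (\<lambda>_. 1) + L2_inner M f (w h)" if "f \<in> L2 M" for f
    using L2_inner_lin_right[OF that L(4,3), of 1 1] by (simp add: u_def)
  have w1: "L2_inner M (w h) (\<lambda>_. 1) = 0" using L2_inner_cnj[of M "\<lambda>_. 1" "w h"] by (simp add: inner_one_w[OF h])
  have e1: "L2_inner M (e h) (\<lambda>_. 1) = 1" using L2_inner_cnj[of M "\<lambda>_. 1" "e h"] by (simp add: E1.inner_one_eq E1.e_mean h)
  have 11: "L2_inner M (\<lambda>_. 1) (\<lambda>_. 1) = 1" using E1.prob_space by (simp add: L2_inner_def)
  have u1: "L2_inner M u (\<lambda>_. 1) = 1" using L2_inner_lin_left[OF L(4) L(4,3), of 1 1] by (simp add: u_def 11 w1)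
  have uw: "L2_inner M u (w h) = complex_of_real a"
    using L2_inner_lin_left[OF L(3) L(4,3), of 1 1] by (simp add: u_def inner_one_w[OF h] inner_w_w[OF h] a)
  have uu: "L2_inner M u u = complex_of_real (1 + a)" by (simp add: ue L u1 uw)
  have eu: "L2_inner M (e h) u = complex_of_real (1 + a)" by (simp add: ue L e1 inner_e_w[OF h h] a)
  have ru: "L2_inner M r u = 0" using L2_inner_diff_left[OF L(1) L(5,1)] by (simp add: r_def eu uu)
  have ur: "L2_inner M u r = 0" using L2_inner_cnj[of M r u] ru by simp
  have "L2_inner M r r = L2_inner M r (e h)" using L2_inner_diff_right[OF L(2) L(5,1)] by (simp add: r_def[symmetric] ru)
  also have "\<dots> = L2_inner M (e h) (e h) - L2_inner M u (e h)" unfolding r_def by (rule L2_inner_diff_left[OF L(5) L(5,1)])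
  also have "L2_inner M u (e h) = complex_of_real (1 + a)" using L2_inner_cnj[of M "e h" u] eu by simp
  finally have "complex_of_real ((L2_norm M r)\<^sup>2) = complex_of_real (exp a - 1 - a)"
    unfolding L2_inner_self[symmetric] by (simp add: E1.e_inner[OF h h] a)
  then have rr: "(L2_norm M r)\<^sup>2 = exp a - 1 - a" by (simp only: of_real_eq_iff)
  have split: "aeq M' (S (e h)) (\<lambda>\<omega>. S u \<omega> + S r \<omega>)" if "bounded_map M E1.HT M' S" for S
    using bounded_map_lin[OF that u r, of 1 1] by (simp add: r_def)
  have Tu: "aeq M' (T u) (\<Phi> u)"
  proof -
    have "aeq M' (T u) (\<lambda>\<omega>. 1 * T (\<lambda>_. 1) \<omega> + 1 * T (w h) \<omega>)" using bounded_map_lin[OF Tb one w, of 1 1] by (simp add: u_def)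
    also have "aeq M' \<dots> (\<lambda>\<omega>. 1 * \<Phi> (\<lambda>_. 1) \<omega> + 1 * \<Phi> (w h) \<omega>)"
      by (rule aeq_lin[OF aeq_trans[OF T1 aeq_sym] Tw]) (use unity_\<Phi> in \<open>simp add: unity_preserving_def\<close>)
    also have "aeq M' \<dots> (\<Phi> u)" using aeq_sym[OF bounded_map_lin[OF \<Phi>_bounded one w, of 1 1]] by (simp add: u_def)
    finally show ?thesis .
  qed
  note TL = E2.H_L2[OF TH[OF u]] E2.H_L2[OF TH[OF r]] E2.H_L2[OF \<Phi>_HT[OF u]] E2.H_L2[OF \<Phi>_HT[OF r]]
  note Tm = L2_measurable[OF TL(1)] L2_measurable[OF TL(2)] L2_measurable[OF TL(3)] L2_measurable[OF TL(4)]
  \<comment> \<open>Of the four terms only \<open>u\<close> with \<open>u\<close> and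
    \<open>r\<close> with \<open>r\<close> survive: \<open>T\<close> and \<Phi> agree on
    \<open>u\<close>, and each of them preserves the orthogonality of \<open>u\<close> and
    \<open>r\<close>.\<close>
  have "L2_inner M' (T (e h)) (\<Phi> (e h)) = L2_inner M' (\<lambda>\<omega>. 1 * T u \<omega> + 1 * T r \<omega>) (\<lambda>\<omega>. 1 * \<Phi> u \<omega> + 1 * \<Phi> r \<omega>)"
    using L2_inner_cong[OF split[OF Tb] split[OF \<Phi>_bounded] E2.H_meas[OF TH[OF eh]] borel_measurable_add[OF Tm(1,2)]
        E2.H_meas[OF \<Phi>_HT[OF eh]] borel_measurable_add[OF Tm(3,4)]] by simp
  also have "\<dots> = L2_inner M' (T u) (\<Phi> u) + L2_inner M' (T u) (\<Phi> r) + (L2_inner M' (T r) (\<Phi> u) + L2_inner M' (T r) (\<Phi> r))"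
    using L2_inner_lin_left[OF L2_lin[OF TL(3,4)] TL(1,2), of 1 1 1 1] L2_inner_lin_right[OF TL(1) TL(3,4), of 1 1]
      L2_inner_lin_right[OF TL(2) TL(3,4), of 1 1] by simp
  also have "L2_inner M' (T u) (\<Phi> u) = L2_inner M' (\<Phi> u) (\<Phi> u)" by (rule L2_inner_cong[OF Tu aeq_refl Tm(1,3,3,3)])
  also have "\<dots> = complex_of_real (1 + a)" unfolding in\<Phi>[OF u u] by (rule uu)
  also have "L2_inner M' (T u) (\<Phi> r) = L2_inner M' (\<Phi> u) (\<Phi> r)" by (rule L2_inner_cong[OF Tu aeq_refl Tm(1,3,4,4)])
  also have "\<dots> = 0" unfolding in\<Phi>[OF u r] by (rule ur)
  also have "L2_inner M' (T r) (\<Phi> u) = L2_inner M' (T r) (T u)" by (rule L2_inner_cong[OF aeq_refl aeq_sym[OF Tu] Tm(2,2,3,1)])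
  also have "\<dots> = 0" unfolding inT[OF r u] by (rule ru)
  finally have "norm (L2_inner M' (T (e h)) (\<Phi> (e h)) - complex_of_real (1 + a)) = norm (L2_inner M' (T r) (\<Phi> r))" by simp
  also have "\<dots> \<le> L2_norm M' (T r) * L2_norm M' (\<Phi> r)" by (rule L2_CS[OF TL(2,4)])
  also have "\<dots> = (L2_norm M r)\<^sup>2" by (simp add: Tn \<Phi>_norm r power2_eq_square)
  finally show ?thesis unfolding rr .
qed

text \<open>Telescoping: the factors are exchanged one at a time, while the others are bounded by
  the corresponding \<open>exp (a i)\<close>.\<close>

lemma prod_diff_bound:
  fixes \<beta> :: "nat \<Rightarrow> complex"
  assumes "\<And>i. i < n \<Longrightarrow> norm (\<beta> i) \<le> exp (a i)" "\<And>i. i < n \<Longrightarrow> 0 \<le> a i"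
  shows "norm ((\<Prod>i<n. \<beta> i) - complex_of_real (exp (\<Sum>i<n. a i)))
    \<le> exp (\<Sum>i<n. a i) * (\<Sum>i<n. norm (\<beta> i - complex_of_real (exp (a i))))"
  using assms
proof (induction n)
  case (Suc n)
  let ?B = "\<Prod>i<n. \<beta> i" and ?E = "exp (\<Sum>i<n. a i)" and ?d = "\<Sum>i<n. norm (\<beta> i - complex_of_real (exp (a i)))"
  have "(\<Prod>i<Suc n. \<beta> i) - complex_of_real (exp (\<Sum>i<Suc n. a i))
     = (?B - complex_of_real ?E) * \<beta> n + complex_of_real ?E * (\<beta> n - complex_of_real (exp (a n)))"
    by (simp add: exp_add algebra_simps)
  then have "norm ((\<Prod>i<Suc n. \<beta> i) - complex_of_real (exp (\<Sum>i<Suc n. a i)))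
     \<le> norm (?B - complex_of_real ?E) * norm (\<beta> n) + ?E * norm (\<beta> n - complex_of_real (exp (a n)))"
    using norm_triangle_ineq[of "(?B - complex_of_real ?E) * \<beta> n" "complex_of_real ?E * (\<beta> n - complex_of_real (exp (a n)))"]
    by (simp add: norm_mult)
  also have "\<dots> \<le> (?E * ?d) * exp (a n) + (?E * exp (a n)) * norm (\<beta> n - complex_of_real (exp (a n)))"
    using Suc by (intro add_mono mult_mono mult_right_mono) (auto intro!: mult_nonneg_nonneg sum_nonneg)
  also have "\<dots> = exp (\<Sum>i<Suc n. a i) * (\<Sum>i<Suc n. norm (\<beta> i - complex_of_real (exp (a i))))"
    by (simp add: exp_add algebra_simps)
  finally show ?case .
qed simp

text \<open>The algebra \<open>\<B>\<close> is kept abstract because \<open>T\<close> respects the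
  factorizations only along it; \<open>small\<close> says that \<open>\<B>\<close> still cuts every
  step function into pieces of small norm.\<close>

lemma \<Phi>_unique:
  assumes T: "surjective_isometry M E1.HT M' E2.HT T" and T1: "aeq M' (T (\<lambda>_. 1)) (\<lambda>_. 1)"
    and Tw: "\<And>h. step_fun \<mu> h \<Longrightarrow> aeq M' (T (w h)) (\<Phi> (w h))"
    and \<B>: "\<B> \<subseteq> sets \<mu>" "{} \<in> \<B>" "\<And>A. A \<in> \<B> \<Longrightarrow> space \<mu> - A \<in> \<B>" "\<And>A B. A \<in> \<B> \<Longrightarrow> B \<in> \<B> \<Longrightarrow> A \<union> B \<in> \<B>"
    and conj: "\<And>A. A \<in> \<B> \<Longrightarrow> conjugate_algebra E1.HT M' E2.HT T (E1.\<xi> A) = E2.\<xi> A"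
    and small: "\<And>h \<delta>. step_fun \<mu> h \<Longrightarrow> \<delta> > 0 \<Longrightarrow> \<exists>(A :: nat \<Rightarrow> 'y set) n. (\<forall>i<n. A i \<in> \<B>) \<and> disjoint_family_on A {..<n}
       \<and> (\<Union>i<n. A i) = space \<mu> \<and> (\<forall>i<n. (LINT y|\<mu>. restr h (A i) y * restr h (A i) y) \<le> \<delta>)"
    and F: "F \<in> E1.HT"
  shows "aeq M' (T F) (\<Phi> F)"
proof -
  note Tb = isometry_bounded[OF T] and Tn = isometry_norm[OF T] and TH = isometry_HT[OF T]
  have ae: "aeq M' (T (e h)) (\<Phi> (e h))" if h: "step_fun \<mu> h" for h
  proof -
    \<comment> \<open>Over disjoint members of \<open>\<B>\<close> the quantity \<open>a\<close> is
      additive and \<open>\<beta>\<close> is multiplicative, so \<open>\<beta> = exp a\<close> on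
      the whole space can be approached through small pieces.\<close>
    define a where "a A = (LINT y|\<mu>. restr h A y * restr h A y)" for A
    define \<beta> where "\<beta> A = L2_inner M' (T (e (restr h A))) (\<Phi> (e (restr h A)))" for A
    have hA: "step_fun \<mu> (restr h A)" if "A \<in> \<B>" for A using step_fun_restrict[OF h] that \<B>(1) by blast
    have eA: "e (restr h A) \<in> E1.H A" if "A \<in> \<B>" for A
      by (rule E1.e_local[OF hA[OF that]]) (use that \<B>(1) in auto)
    have Un: "\<beta> (A \<union> B) = \<beta> A * \<beta> B" "a (A \<union> B) = a A + a B" if A: "A \<in> \<B>" and B: "B \<in> \<B>" and d: "A \<inter> B = {}" for A B
    proof -
      have sA: "A \<in> sets \<mu>" and sB: "B \<in> sets \<mu>" using A B \<B>(1) by auto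
      have eB: "e (restr h B) \<in> E1.H (space \<mu> - A)" by (rule E1.H_disjoint[OF sA sB d eA[OF B]])
      note p = E1.prod_H_compl[OF sA eA[OF A] eB]
      have eq: "restr h (A \<union> B) = (\<lambda>y. restr h A y + restr h B y)" using d by (auto simp: fun_eq_iff)
      have m: "aeq M (e (restr h (A \<union> B))) (\<lambda>\<omega>. e (restr h A) \<omega> * e (restr h B) \<omega>)"
        unfolding eq by (rule E1.e_mult[OF hA[OF A] hA[OF B]]) (use d in auto)
      note AB = \<B>(4)[OF A B]
      have eAB: "e (restr h (A \<union> B)) \<in> E1.HT" by (rule E1.e_HT[OF hA[OF AB]])
      have t: "aeq M' (T (e (restr h (A \<union> B)))) (\<lambda>\<omega>. T (e (restr h A)) \<omega> * T (e (restr h B)) \<omega>)"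
        using bounded_map_aeq[OF Tb E1.HT_closed eAB p m]
          isometry_mult[OF T T1 sA conj[OF A] conj[OF \<B>(3)[OF A]] eA[OF A] eB] by (rule aeq_trans)
      have f: "aeq M' (\<Phi> (e (restr h (A \<union> B)))) (\<lambda>\<omega>. \<Phi> (e (restr h A)) \<omega> * \<Phi> (e (restr h B)) \<omega>)"
        using bounded_map_aeq[OF \<Phi>_bounded E1.HT_closed eAB p m] \<Phi>_mult[OF sA eA[OF A] eB] by (rule aeq_trans)
      note TA = isometry_loc[OF T T1 sA conj[OF A] eA[OF A]] and TB = isometry_loc[OF T T1 E1.sets_compl[OF sA] conj[OF \<B>(3)[OF A]] eB]
      note FA = \<Phi>_loc[OF sA eA[OF A]] and FB = \<Phi>_loc[OF E1.sets_compl[OF sA] eB]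
      show "\<beta> (A \<union> B) = \<beta> A * \<beta> B"
        unfolding \<beta>_def E2.prod_inner[OF sA TA FA TB FB, symmetric]
        by (rule L2_inner_cong[OF t f])
           (rule E2.H_meas TH \<Phi>_HT eAB E2.prod_H_compl[OF sA TA TB] E2.prod_H_compl[OF sA FA FB])+
      have "a (A \<union> B) = (LINT y|\<mu>. restr h A y * restr h A y + restr h B y * restr h B y)"
        unfolding a_def by (rule Bochner_Integration.integral_cong) (use d in auto)
      then show "a (A \<union> B) = a A + a B"
        unfolding a_def using step_fun_integrable_mult[OF hA[OF A] hA[OF A]] step_fun_integrable_mult[OF hA[OF B] hA[OF B]] by simp
    qed
    have b0: "\<beta> {} = 1" "a {} = 0"
    proof -
      have one: "(\<lambda>_. 1 :: complex) \<in> E1.HT" and one2: "(\<lambda>_. 1 :: complex) \<in> E2.HT" by (rule E1.const_H E2.const_H)+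
      have eq: "restr h {} = (\<lambda>_. 0)" by auto
      have "aeq M' (T (e (restr h {}))) (\<lambda>_. 1)" unfolding eq
        by (rule aeq_trans[OF bounded_map_aeq[OF Tb E1.HT_closed E1.e_HT[OF step_fun_zero] one E1.e_zero] T1])
      moreover have "aeq M' (\<Phi> (e (restr h {}))) (\<lambda>_. 1)" unfolding eq
        by (rule aeq_trans[OF \<Phi>_e[OF step_fun_zero] E2.e_zero])
      ultimately have "\<beta> {} = L2_inner M' (\<lambda>_. 1) (\<lambda>_. 1)" unfolding \<beta>_def
        by (rule L2_inner_cong) (rule E2.H_meas TH \<Phi>_HT E1.e_HT hA \<B>(2) one2)+
      then show "\<beta> {} = 1" using E2.prob_space by (simp add: L2_inner_def)
      show "a {} = 0" by (simp add: a_def)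
    qed
    have bound: "norm (\<beta> A) \<le> exp (a A)" "norm (\<beta> A - complex_of_real (1 + a A)) \<le> exp (a A) - 1 - a A" "0 \<le> a A"
      if A: "A \<in> \<B>" for A
    proof -
      note eT = E1.e_HT[OF hA[OF A]]
      have n: "(L2_norm M (e (restr h A)))\<^sup>2 = exp (a A)"
        using L2_inner_self[of M "e (restr h A)"] unfolding E1.e_inner[OF hA[OF A] hA[OF A]] a_def by (simp only: of_real_eq_iff)
      have "norm (\<beta> A) \<le> L2_norm M' (T (e (restr h A))) * L2_norm M' (\<Phi> (e (restr h A)))"
        unfolding \<beta>_def by (rule L2_CS[OF E2.H_L2[OF TH[OF eT]] E2.H_L2[OF \<Phi>_HT[OF eT]]])
      also have "\<dots> = exp (a A)" by (simp add: Tn \<Phi>_norm eT n[symmetric] power2_eq_square)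
      finally show "norm (\<beta> A) \<le> exp (a A)" .
      show "norm (\<beta> A - complex_of_real (1 + a A)) \<le> exp (a A) - 1 - a A"
        unfolding \<beta>_def by (rule inner_T_\<Phi>_e[OF T T1 Tw hA[OF A] a_def]) (rule hA[OF A])
      show "0 \<le> a A" unfolding a_def by simp
    qed
    have sp: "space \<mu> \<in> \<B>" using \<B>(3)[OF \<B>(2)] by simp
    have key: "norm (\<beta> (space \<mu>) - complex_of_real (exp (a (space \<mu>)))) \<le> 2 * exp (a (space \<mu>)) * a (space \<mu>) * \<delta>"
      if \<delta>: "0 < \<delta>" "\<delta> \<le> 1" for \<delta>
    proof -
      obtain A n where A: "\<forall>i<(n::nat). A i \<in> \<B>" "disjoint_family_on A {..<n}" "(\<Union>i<n. A i) = space \<mu>"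
        "\<forall>i<n. (LINT y|\<mu>. restr h (A i) y * restr h (A i) y) \<le> \<delta>" using small[OF h \<delta>(1)] by (elim exE conjE) (rule that; assumption)
      have "(\<Union>i<m. A i) \<in> \<B> \<and> \<beta> (\<Union>i<m. A i) = (\<Prod>i<m. \<beta> (A i)) \<and> a (\<Union>i<m. A i) = (\<Sum>i<m. a (A i))" if "m \<le> n" for m
        using that
      proof (induction m)
        case (Suc m)
        have "A i \<inter> A m = {}" if "i < m" for i using A(2) Suc.prems that by (auto simp: disjoint_family_on_def)
        then have d: "(\<Union>i<m. A i) \<inter> A m = {}" by blast
        have IH: "(\<Union>i<m. A i) \<in> \<B>" "\<beta> (\<Union>i<m. A i) = (\<Prod>i<m. \<beta> (A i))" "a (\<Union>i<m. A i) = (\<Sum>i<m. a (A i))" using Suc by auto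
        have Am: "A m \<in> \<B>" using A(1) Suc.prems by auto
        have "(\<Union>i<Suc m. A i) = (\<Union>i<m. A i) \<union> A m" by (auto simp: lessThan_Suc)
        then show ?case using Un[OF IH(1) Am d] IH \<B>(4)[OF IH(1) Am] by simp
      qed (simp add: b0 \<B>)
      from this[of n] have P: "\<beta> (space \<mu>) = (\<Prod>i<n. \<beta> (A i))" "a (space \<mu>) = (\<Sum>i<n. a (A i))" using A(3) by auto
      \<comment> \<open>One half of the factor 2 is the deviation of \<open>\<beta>\<close> from
        \<open>1 + a\<close>, the other that of \<open>1 + a\<close> from \<open>exp a\<close>. Each
        is at most the square of \<open>a\<close>, because
        \<open>a \<le> \<delta> \<le> 1\<close>.\<close>
      have "norm (\<beta> (A i) - complex_of_real (exp (a (A i)))) \<le> 2 * \<delta> * a (A i)" if i: "i < n" for i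
      proof -
        note b = bound[OF A(1)[rule_format, OF i]]
        have ai: "a (A i) \<le> \<delta>" using A(4) i by (simp add: a_def)
        have ex: "exp (a (A i)) - 1 - a (A i) \<le> (a (A i))\<^sup>2" using exp_bound[OF b(3)] ai \<delta> by simp
        have "norm (\<beta> (A i) - complex_of_real (exp (a (A i))))
          \<le> norm (\<beta> (A i) - complex_of_real (1 + a (A i))) + norm (complex_of_real (1 + a (A i)) - complex_of_real (exp (a (A i))))"
          using norm_triangle_ineq[of "\<beta> (A i) - complex_of_real (1 + a (A i))" "complex_of_real (1 + a (A i)) - complex_of_real (exp (a (A i)))"] by simp
        also have "norm (complex_of_real (1 + a (A i)) - complex_of_real (exp (a (A i)))) = exp (a (A i)) - 1 - a (A i)"
          unfolding of_real_diff[symmetric] norm_of_real using exp_ge_add_one_self[of "a (A i)"] by simp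
        finally have "norm (\<beta> (A i) - complex_of_real (exp (a (A i)))) \<le> 2 * (a (A i))\<^sup>2" using b(2) ex by linarith
        also have "\<dots> \<le> 2 * (\<delta> * a (A i))" using ai b(3) by (simp add: power2_eq_square mult_right_mono)
        finally show ?thesis by simp
      qed
      then have s: "(\<Sum>i<n. norm (\<beta> (A i) - complex_of_real (exp (a (A i))))) \<le> 2 * \<delta> * a (space \<mu>)"
        unfolding P sum_distrib_left by (intro sum_mono) simp
      have "norm (\<beta> (space \<mu>) - complex_of_real (exp (a (space \<mu>))))
        \<le> exp (a (space \<mu>)) * (\<Sum>i<n. norm (\<beta> (A i) - complex_of_real (exp (a (A i)))))"
        unfolding P by (rule prod_diff_bound) (use bound A(1) in auto)
      also have "\<dots> \<le> exp (a (space \<mu>)) * (2 * \<delta> * a (space \<mu>))" by (intro mult_left_mono s) simp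
      finally show ?thesis by (simp add: mult_ac)
    qed
    have "norm (\<beta> (space \<mu>) - complex_of_real (exp (a (space \<mu>)))) \<le> 0"
    proof (rule field_le_epsilon)
      fix \<epsilon> :: real assume "\<epsilon> > 0"
      define c where "c = 2 * exp (a (space \<mu>)) * a (space \<mu>)"
      have c: "c \<ge> 0" using bound(3)[OF sp] by (simp add: c_def)
      \<comment> \<open>The minimum keeps \<delta> at most 1, and \<open>c + 1\<close> in place of
        \<open>c\<close> avoids division by 0.\<close>
      have "norm (\<beta> (space \<mu>) - complex_of_real (exp (a (space \<mu>)))) \<le> c * min 1 (\<epsilon> / (c + 1))"
        using key[of "min 1 (\<epsilon> / (c + 1))"] c \<open>\<epsilon> > 0\<close> unfolding c_def[symmetric] by (simp add: add_nonneg_pos)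
      also have "\<dots> \<le> (c + 1) * (\<epsilon> / (c + 1))" using c \<open>\<epsilon> > 0\<close> by (intro mult_mono) auto
      also have "\<dots> = \<epsilon>" using c by simp
      finally show "norm (\<beta> (space \<mu>) - complex_of_real (exp (a (space \<mu>)))) \<le> 0 + \<epsilon>" by simp
    qed
    then have \<beta>: "\<beta> (space \<mu>) = complex_of_real (exp (a (space \<mu>)))" by simp
    \<comment> \<open>\<open>h\<close> may be nonzero outside \<open>space \<mu>\<close>, so it and
      its restriction are different functions, whose exponentials agree almost everywhere.\<close>
    let ?e = "e (restr h (space \<mu>))"
    note es = E1.e_HT[OF hA[OF sp]]
    have n: "(L2_norm M ?e)\<^sup>2 = exp (a (space \<mu>))"
      using L2_inner_self[of M ?e] unfolding E1.e_inner[OF hA[OF sp] hA[OF sp]] a_def by (simp only: of_real_eq_iff)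
    have "(L2_norm M' (\<lambda>\<omega>. T ?e \<omega> - \<Phi> ?e \<omega>))\<^sup>2 = 0"
      unfolding L2_norm_diff_sq[OF E2.H_L2[OF TH[OF es]] E2.H_L2[OF \<Phi>_HT[OF es]]] \<beta>_def[symmetric] \<beta>
      by (simp add: Tn \<Phi>_norm es n)
    then have "aeq M' (T ?e) (\<Phi> ?e)" by (intro aeqI_L2_norm E2.H_L2[OF TH[OF es]] E2.H_L2[OF \<Phi>_HT[OF es]]) simp
    moreover have eq: "aeq M ?e (e h)" by (rule E1.e_aeq[OF hA[OF sp] h]) auto
    note eh = E1.e_HT[OF h]
    have "aeq M' (T (e h)) (T ?e)" by (rule bounded_map_aeq[OF Tb E1.HT_closed eh es aeq_sym[OF eq]])
    moreover have "aeq M' (\<Phi> ?e) (\<Phi> (e h))" by (rule bounded_map_aeq[OF \<Phi>_bounded E1.HT_closed es eh eq])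
    ultimately show ?thesis using aeq_trans by blast
  qed
  have "E1.HT \<subseteq> {f \<in> E1.HT. aeq M' (T f) (\<Phi> f)}"
    by (rule E1.total[OF sets.top closed_subspace_equalizer[OF Tb \<Phi>_bounded E1.HT_closed]]) (simp add: ae E1.e_HT)
  with F show ?thesis by blast
qed

end

section \<open>Exponentials of Gaussian white noise\<close>

text \<open>An unbounded \<open>g\<close> is not a multiplier, yet its Borel preimages are
  multiplier sets as soon as it is a pointwise limit of scaled multipliers; the scalars
  \<open>c n\<close> may grow.\<close>

lemma multiplier_sets_limit:
  fixes u :: "nat \<Rightarrow> 'w \<Rightarrow> real" and g :: "'w \<Rightarrow> real"
  assumes V: "closed_subspace M V" and u: "\<And>n. u n \<in> multipliers M V"
    and lim: "\<And>\<omega>. \<omega> \<in> space M \<Longrightarrow> (\<lambda>n. c n * u n \<omega>) \<longlonglongrightarrow> g \<omega>" and B: "B \<in> sets borel"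
  shows "g -` B \<inter> space M \<in> multiplier_sets M V"
proof -
  interpret S: sigma_algebra "space M" "multiplier_sets M V" by (rule sigma_algebra_multiplier_sets[OF V])
  let ?N = "sigma (space M) (multiplier_sets M V)"
  have sp: "space ?N = space M" "sets ?N = multiplier_sets M V"
    using S.space_closed S.sigma_sets_eq by (simp_all add: space_measure_of_conv)
  have m: "(\<lambda>\<omega>. c n * u n \<omega>) \<in> borel_measurable ?N" for n
    using multiplier_measurable[OF V u] by simp
  have "g \<in> borel_measurable ?N"
    by (rule borel_measurable_LIMSEQ_real[OF lim m]) (simp only: sp)
  from measurable_sets[OF this B] show ?thesis by (simp add: sp)
qed

lemma multipliers_aeq:
  assumes V: "closed_subspace M V" and f: "f \<in> multipliers M V" and fg: "aeq M f g"
    and g: "g \<in> borel_measurable M" "\<And>\<omega>. \<omega> \<in> space M \<Longrightarrow> \<bar>g \<omega>\<bar> \<le> C"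
  shows "g \<in> multipliers M V"
  unfolding multipliers_def
proof (intro CollectI conjI ballI g exI[of _ C])
  fix k assume k: "k \<in> V"
  show "(\<lambda>\<omega>. complex_of_real (g \<omega>) * k \<omega>) \<in> V"
  proof (rule closed_subspace_aeq[OF V multipliersD(3)[OF f k]])
    show "aeq M (\<lambda>\<omega>. complex_of_real (f \<omega>) * k \<omega>) (\<lambda>\<omega>. complex_of_real (g \<omega>) * k \<omega>)"
      using fg unfolding aeq_def by eventually_elim simp
  qed (use g L2_measurable[OF closed_subspace_L2[OF V k]] in measurable)
qed

lemma bounded_map_mult_bounded:
  assumes V: "V \<subseteq> L2 M" and f: "f \<in> borel_measurable M" "\<And>\<omega>. \<omega> \<in> space M \<Longrightarrow> \<bar>f \<omega>\<bar> \<le> (C::real)" and C: "0 \<le> C"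
  shows "bounded_map M V M (\<lambda>g \<omega>. complex_of_real (f \<omega>) * g \<omega>)"
proof (rule bounded_mapI[where C=C])
  fix g assume "g \<in> V"
  then have g: "g \<in> L2 M" using V by blast
  note [measurable] = f(1) L2_measurable[OF g]
  have le: "(norm (complex_of_real (f \<omega>) * g \<omega>))\<^sup>2 \<le> C\<^sup>2 * (norm (g \<omega>))\<^sup>2" if "\<omega> \<in> space M" for \<omega>
    using f(2)[OF that] C by (simp add: norm_mult power_mult_distrib mult_right_mono abs_le_square_iff[symmetric])
  have i: "integrable M (\<lambda>\<omega>. C\<^sup>2 * (norm (g \<omega>))\<^sup>2)" using L2_integrable_sq[OF g] by simp
  show fg: "(\<lambda>\<omega>. complex_of_real (f \<omega>) * g \<omega>) \<in> L2 M"
  proof (rule L2_I)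
    show "integrable M (\<lambda>\<omega>. (norm (complex_of_real (f \<omega>) * g \<omega>))\<^sup>2)"
      by (rule Bochner_Integration.integrable_bound[OF i]) (use le in auto)
  qed measurable
  show "L2_norm M (\<lambda>\<omega>. complex_of_real (f \<omega>) * g \<omega>) \<le> C * L2_norm M g"
  proof (rule power2_le_imp_le)
    show "(L2_norm M (\<lambda>\<omega>. complex_of_real (f \<omega>) * g \<omega>))\<^sup>2 \<le> (C * L2_norm M g)\<^sup>2"
      unfolding power_mult_distrib L2_norm_sq
      using integral_mono[OF L2_integrable_sq[OF fg] i le] by simp
  qed (simp add: C)
qed (simp add: algebra_simps)

text \<open>For a closed span, invariance under a multiplication can be tested on the generators.
  This is the reason for passing from a given closed subspace to the span inside it.\<close>

lemma multipliersI_cspan: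
  assumes D: "D \<subseteq> L2 M" and f: "f \<in> borel_measurable M" "\<And>\<omega>. \<omega> \<in> space M \<Longrightarrow> \<bar>f \<omega>\<bar> \<le> C" and C: "0 \<le> C"
    and fD: "\<And>g. g \<in> D \<Longrightarrow> (\<lambda>\<omega>. complex_of_real (f \<omega>) * g \<omega>) \<in> cspan M D"
  shows "f \<in> multipliers M (cspan M D)"
proof -
  note U = cspan_closed[OF D]
  have "cspan M D \<subseteq> {g \<in> cspan M D. (\<lambda>\<omega>. complex_of_real (f \<omega>) * g \<omega>) \<in> cspan M D}"
  proof (rule cspan_minimal)
    show "closed_subspace M {g \<in> cspan M D. (\<lambda>\<omega>. complex_of_real (f \<omega>) * g \<omega>) \<in> cspan M D}"
      by (rule closed_subspace_preimage[OF bounded_map_mult_bounded[OF _ f C] U U]) (auto intro: closed_subspace_L2[OF U])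
  qed (use fD cspan_superset[of D M] in blast)
  then show ?thesis unfolding multipliers_def using f by blast
qed

text \<open>A simple function has a smallest nonzero absolute value, so Markov's inequality bounds
  the measure of its support.\<close>

lemma step_funI_integrable:
  assumes f: "simple_function M f" and g: "integrable M g" and fg: "\<And>y. y \<in> space M \<Longrightarrow> f y \<noteq> 0 \<Longrightarrow> (f y)\<^sup>2 \<le> g y \<or> \<bar>f y\<bar> \<le> g y"
  shows "step_fun M f"
proof -
  note [measurable] = borel_measurable_simple_function[OF f] borel_measurable_integrable[OF g]
  \<comment> \<open>The minimum of the square and the absolute value serves both alternatives of the
    hypothesis.\<close>
  define S where "S = (\<lambda>x. min (x\<^sup>2) \<bar>x\<bar>) ` (f ` space M - {0})"
  have fin: "finite S" unfolding S_def using f by (auto simp: simple_function_def)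
  \<comment> \<open>Inserting 1 keeps the minimum meaningful when \<open>f\<close> has no nonzero
    value.\<close>
  define c where "c = Min (insert 1 S)"
  have c: "c > 0" unfolding c_def using fin by (subst Min_gr_iff) (auto simp: S_def)
  have cg: "c \<le> g y" if "y \<in> space M" "f y \<noteq> 0" for y
  proof -
    have "c \<le> min ((f y)\<^sup>2) \<bar>f y\<bar>" unfolding c_def using fin that by (intro Min_le) (auto simp: S_def)
    then show ?thesis using fg[OF that] by linarith
  qed
  have "ennreal c * emeasure M {y \<in> space M. f y \<noteq> 0} = (\<integral>\<^sup>+y. ennreal c * indicator {y \<in> space M. f y \<noteq> 0} y \<partial>M)"
    by (subst nn_integral_cmult_indicator) auto
  also have "\<dots> \<le> (\<integral>\<^sup>+y. ennreal (norm (g y)) \<partial>M)"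
    by (intro nn_integral_mono) (auto split: split_indicator intro!: ennreal_leI order_trans[OF cg])
  also have "\<dots> < \<infinity>" using g by (simp add: integrable_iff_bounded)
  finally have "emeasure M {y \<in> space M. f y \<noteq> 0} < \<infinity>"
    using c by (auto simp: ennreal_mult_less_top ennreal_mult_eq_top_iff top_unique less_top)
  then show ?thesis using f by (simp add: step_fun_def)
qed

text \<open>The pointwise bound lets one and the same approximation converge in L1, in L2 and inside
  absolutely convergent sums over a configuration, whichever of these \<open>h\<close>
  admits.\<close>

lemma step_fun_approx:
  assumes h: "h \<in> borel_measurable M" and g: "integrable M (\<lambda>y. (h y)\<^sup>2) \<or> integrable M h"
  obtains f where "\<And>n. step_fun M (f n)" "\<And>y. y \<in> space M \<Longrightarrow> (\<lambda>n. f n y) \<longlonglongrightarrow> h y"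
    "\<And>n y. y \<in> space M \<Longrightarrow> \<bar>f n y\<bar> \<le> 2 * \<bar>h y :: real\<bar>"
proof -
  obtain f where f: "\<And>n. simple_function M (f n)" "\<And>y. y \<in> space M \<Longrightarrow> (\<lambda>n. f n y) \<longlonglongrightarrow> h y"
    "\<And>n y. y \<in> space M \<Longrightarrow> \<bar>f n y\<bar> \<le> 2 * \<bar>h y\<bar>"
    using borel_measurable_implies_sequence_metric[OF h, of 0] by (simp add: dist_norm) blast
  have "step_fun M (f n)" for n
    using g
  proof
    assume g: "integrable M (\<lambda>y. (h y)\<^sup>2)"
    have "(f n y)\<^sup>2 \<le> 4 * (h y)\<^sup>2" if "y \<in> space M" for y
      using power_mono[OF f(3)[OF that, of n], of 2] by (simp add: power_mult_distrib)
    then show ?thesis by (intro step_funI_integrable[OF f(1), of "\<lambda>y. 4 * (h y)\<^sup>2"]) (use g in auto)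
  next
    assume g: "integrable M h"
    show ?thesis by (rule step_funI_integrable[OF f(1), of "\<lambda>y. 2 * \<bar>h y\<bar>"]) (use g f(3) in auto)
  qed
  with f(2,3) that show ?thesis by blast
qed

lemma step_fun_L2: "step_fun M h \<Longrightarrow> h \<in> L2 M"
  using step_fun_integrable_mult[of M h h] by (auto simp: L2_def power2_eq_square)

lemma L2_lim_real_inner:
  fixes h :: "'y \<Rightarrow> real"
  assumes f: "L2_lim M f h" and k: "L2_lim M g k"
  shows "(\<lambda>n. LINT y|M. f n y * g n y) \<longlonglongrightarrow> (LINT y|M. h y * k y)"
proof -
  have c: "L2_lim M (\<lambda>n y. complex_of_real (f n y)) (\<lambda>y. complex_of_real (h y))" if "L2_lim M f h" for f h
    using L2_limD[OF that] by (simp add: L2_lim_def L2_of_real L2_norm_def flip: of_real_diff)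
  have "(\<lambda>n. Re (L2_inner M (\<lambda>y. complex_of_real (f n y)) (\<lambda>y. complex_of_real (g n y))))
     \<longlonglongrightarrow> Re (L2_inner M (\<lambda>y. complex_of_real (h y)) (\<lambda>y. complex_of_real (k y)))"
    by (intro tendsto_Re L2_lim_inner c f k)
  then show ?thesis by (simp add: L2_inner_def flip: of_real_mult)
qed

locale gaussian_noise = prob_space M
  for M :: "'w measure" and \<mu> :: "'y measure" and W :: "('y \<Rightarrow> real) \<Rightarrow> 'w \<Rightarrow> real" +
  assumes W_meas: "h \<in> L2 \<mu> \<Longrightarrow> W h \<in> borel_measurable M"
    and W_lin: "h \<in> L2 \<mu> \<Longrightarrow> k \<in> L2 \<mu> \<Longrightarrow> aeq M (W (\<lambda>y. a * h y + b * k y)) (\<lambda>\<omega>. a * W h \<omega> + b * W k \<omega>)"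
    and W_char: "h \<in> L2 \<mu> \<Longrightarrow> (CLINT \<omega>|M. iexp (W h \<omega>)) = complex_of_real (exp (- (L2_norm \<mu> h)\<^sup>2 / 2))"

lemma gaussian_noiseI: "gaussian_white_noise \<mu> M W \<Longrightarrow> gaussian_noise M \<mu> W"
  unfolding gaussian_white_noise_def gaussian_noise_def gaussian_noise_axioms_def by blast

section \<open>Laws and exponential moments of the noise\<close>

context gaussian_noise
begin

lemma W_cmult: "h \<in> L2 \<mu> \<Longrightarrow> aeq M (W (\<lambda>y. a * h y)) (\<lambda>\<omega>. a * W h \<omega>)"
  using W_lin[of h h a 0] by simp

lemma W_add: "h \<in> L2 \<mu> \<Longrightarrow> k \<in> L2 \<mu> \<Longrightarrow> aeq M (W (\<lambda>y. h y + k y)) (\<lambda>\<omega>. W h \<omega> + W k \<omega>)"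
  using W_lin[of h k 1 1] by simp

lemma W_char_scale:
  assumes h: "h \<in> L2 \<mu>"
  shows "(CLINT \<omega>|M. iexp (t * W h \<omega>)) = complex_of_real (exp (- (t * L2_norm \<mu> h)\<^sup>2 / 2))"
proof -
  note [measurable] = W_meas[OF h] W_meas[OF L2_cmult[OF h, of t]]
  have "(CLINT \<omega>|M. iexp (t * W h \<omega>)) = (CLINT \<omega>|M. iexp (W (\<lambda>y. t * h y) \<omega>))"
    by (rule integral_cong_AE) (use W_cmult[OF h, of t] in \<open>auto simp: aeq_def\<close>)
  also have "\<dots> = complex_of_real (exp (- (\<bar>t\<bar> * L2_norm \<mu> h)\<^sup>2 / 2))"
    using W_char[OF L2_cmult[OF h, of t]] by (simp add: L2_norm_cmult)
  finally show ?thesis by (simp add: power_mult_distrib)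
qed

lemma std_normal_exp:
  "integrable std_normal_distribution (\<lambda>x. exp (b * x))" "(LINT x|std_normal_distribution. exp (b * x)) = exp (b\<^sup>2 / 2)"
proof -
  \<comment> \<open>Completing the square: the tilted density is a multiple of the normal density
    centred at \<open>b\<close>.\<close>
  have eq: "std_normal_density x * exp (b * x) = exp (b\<^sup>2 / 2) * normal_density b 1 x" for x
    unfolding normal_density_def by (simp add: exp_add[symmetric] power2_eq_square field_simps)
  show "integrable std_normal_distribution (\<lambda>x. exp (b * x))"
    by (subst integrable_density) (auto simp: eq)
  show "(LINT x|std_normal_distribution. exp (b * x)) = exp (b\<^sup>2 / 2)"
    by (subst integral_density) (auto simp: eq)
qed

text \<open>The degenerate normal law has no density and is treated apart: its characteristic
  function is that of the point mass at 0.\<close>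

lemma W_null:
  assumes h: "h \<in> L2 \<mu>" and 0: "L2_norm \<mu> h = 0"
  shows "AE \<omega> in M. W h \<omega> = 0"
proof -
  note [measurable] = W_meas[OF h]
  have "distr M borel (W h) = return borel 0"
  proof (rule Levy_uniqueness)
    show "real_distribution (distr M borel (W h))" by simp
    show "real_distribution (return borel 0)"
      by (auto simp: real_distribution_def real_distribution_axioms_def intro: prob_space_return)
    show "char (distr M borel (W h)) = char (return borel 0)"
    proof
      fix t
      have "char (distr M borel (W h)) t = (CLINT \<omega>|M. iexp (t * W h \<omega>))"
        unfolding char_def by (subst integral_distr) auto
      also have "\<dots> = 1" unfolding W_char_scale[OF h] by (simp add: 0)
      also have "1 = char (return borel 0) t" unfolding char_def by (subst integral_return) auto
      finally show "char (distr M borel (W h)) t = char (return borel 0) t" .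
    qed
  qed
  then have "AE x in distr M borel (W h). x = 0" by (simp only:) (subst AE_return, auto)
  then show ?thesis by (simp add: AE_distr_iff)
qed

text \<open>The noise is given by characteristic functions. Levy's uniqueness theorem identifies the
  law of the normalized variable as standard normal, and the real exponential moments
  follow.\<close>

lemma W_exp:
  assumes h: "h \<in> L2 \<mu>"
  shows "integrable M (\<lambda>\<omega>. exp (W h \<omega>))" "expectation (\<lambda>\<omega>. exp (W h \<omega>)) = exp ((L2_norm \<mu> h)\<^sup>2 / 2)"
proof -
  note [measurable] = W_meas[OF h]
  define s where "s = L2_norm \<mu> h"
  have "integrable M (\<lambda>\<omega>. exp (W h \<omega>)) \<and> expectation (\<lambda>\<omega>. exp (W h \<omega>)) = exp (s\<^sup>2 / 2)"
  proof (cases "s = 0")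
    case True
    then have ae: "AE \<omega> in M. exp (W h \<omega>) = 1" using W_null[OF h] by (auto simp: s_def elim: eventually_mono)
    have "integrable M (\<lambda>\<omega>. exp (W h \<omega>))" by (subst integrable_cong_AE[OF _ _ ae]) auto
    moreover have "expectation (\<lambda>\<omega>. exp (W h \<omega>)) = expectation (\<lambda>\<omega>. 1)" by (rule integral_cong_AE[OF _ _ ae]) auto
    ultimately show ?thesis using True prob_space by simp
  next
    case False
    let ?X = "\<lambda>\<omega>. (1 / s) * W h \<omega>"
    have d: "distr M borel ?X = std_normal_distribution"
    proof (rule Levy_uniqueness)
      show "real_distribution (distr M borel ?X)" by simp
      have "char (distr M borel ?X) t = complex_of_real (exp (- t\<^sup>2 / 2))" for t
        using W_char_scale[OF h, of "t / s"] False unfolding char_def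
        by (subst integral_distr) (auto simp: s_def)
      then show "char (distr M borel ?X) = char std_normal_distribution"
        by (simp add: char_std_normal_distribution fun_eq_iff)
    qed (rule real_dist_normal_dist)
    have "integrable (distr M borel ?X) (\<lambda>x. exp (s * x))" "(LINT x|distr M borel ?X. exp (s * x)) = exp (s\<^sup>2 / 2)"
      unfolding d by (rule std_normal_exp)+
    then show ?thesis using False by (simp add: integrable_distr_eq integral_distr)
  qed
  then show "integrable M (\<lambda>\<omega>. exp (W h \<omega>))" "expectation (\<lambda>\<omega>. exp (W h \<omega>)) = exp ((L2_norm \<mu> h)\<^sup>2 / 2)"
    by (simp_all add: s_def)
qed

abbreviation e where "e \<equiv> gaussian_exponential \<mu> W"

lemma e_meas: "h \<in> L2 \<mu> \<Longrightarrow> e h \<in> borel_measurable M"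
  unfolding gaussian_exponential_def using W_meas[of h] by simp

lemma L2_inner_norm_real:
  assumes "h \<in> L2 \<mu>" "k \<in> L2 \<mu>"
  shows "(L2_norm \<mu> (\<lambda>y. h y + k y))\<^sup>2 = (L2_norm \<mu> h)\<^sup>2 + 2 * (LINT y|\<mu>. h y * k y) + (L2_norm \<mu> k)\<^sup>2"
proof -
  have "(LINT y|\<mu>. (h y + k y)\<^sup>2) = (LINT y|\<mu>. (h y)\<^sup>2 + 2 * (h y * k y) + (k y)\<^sup>2)"
    by (rule Bochner_Integration.integral_cong) (auto simp: power2_eq_square algebra_simps)
  also have "\<dots> = (LINT y|\<mu>. (h y)\<^sup>2) + 2 * (LINT y|\<mu>. h y * k y) + (LINT y|\<mu>. (k y)\<^sup>2)"
    using L2_integrable_sq[OF assms(1)] L2_integrable_sq[OF assms(2)] L2_integrable_mult[OF assms] by simp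
  finally show ?thesis by (simp add: L2_norm_sq)
qed

lemma e_L2_gen:
  assumes h: "h \<in> L2 \<mu>"
  shows "e h \<in> L2 M"
proof (rule L2_I[OF e_meas[OF h]])
  note [measurable] = W_meas[OF h] W_meas[OF L2_cmult[OF h, of 2]]
  have ae: "AE \<omega> in M. (norm (e h \<omega>))\<^sup>2 = exp (- (L2_norm \<mu> h)\<^sup>2) * exp (W (\<lambda>y. 2 * h y) \<omega>)"
    using W_cmult[OF h, of 2] unfolding aeq_def gaussian_exponential_def
    by eventually_elim (simp add: exp_add[symmetric] power2_eq_square exp_diff field_simps)
  show "integrable M (\<lambda>\<omega>. (norm (e h \<omega>))\<^sup>2)"
    by (subst integrable_cong_AE[OF _ _ ae]) (use W_exp(1)[OF L2_cmult[OF h, of 2]] in \<open>auto simp: gaussian_exponential_def\<close>)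
qed

lemma e_prod:
  assumes h: "h \<in> L2 \<mu>" and k: "k \<in> L2 \<mu>"
  shows "aeq M (\<lambda>\<omega>. e h \<omega> * e k \<omega>) (\<lambda>\<omega>. complex_of_real (exp (LINT y|\<mu>. h y * k y)) * e (\<lambda>y. h y + k y) \<omega>)"
  using W_add[OF h k] unfolding aeq_def gaussian_exponential_def L2_inner_norm_real[OF h k]
  by eventually_elim (simp add: exp_add[symmetric] field_simps flip: of_real_mult)

lemma e_inner_gen:
  assumes h: "h \<in> L2 \<mu>" and k: "k \<in> L2 \<mu>"
  shows "L2_inner M (e h) (e k) = complex_of_real (exp (LINT y|\<mu>. h y * k y))"
proof -
  note hk = L2_add[OF h k]
  note [measurable] = e_meas[OF h] e_meas[OF k] e_meas[OF hk]
  have "L2_inner M (e h) (e k) = (LINT \<omega>|M. e h \<omega> * e k \<omega>)"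
    by (simp add: L2_inner_def gaussian_exponential_def)
  also have "\<dots> = (LINT \<omega>|M. complex_of_real (exp (LINT y|\<mu>. h y * k y)) * e (\<lambda>y. h y + k y) \<omega>)"
    by (rule integral_cong_AE) (use e_prod[OF h k] in \<open>auto simp: aeq_def\<close>)
  also have "\<dots> = complex_of_real (exp (LINT y|\<mu>. h y * k y)) * (LINT \<omega>|M. e (\<lambda>y. h y + k y) \<omega>)" by simp
  also have "(LINT \<omega>|M. e (\<lambda>y. h y + k y) \<omega>) = 1"
    using W_exp[OF hk] by (simp add: gaussian_exponential_def exp_diff)
  finally show ?thesis by simp
qed

text \<open>The exponential is continuous on L2 because the norms and inner products of exponentials
  are continuous functions of the inner products of the exponents.\<close>

lemma e_lim:
  assumes f: "L2_lim \<mu> f h"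
  shows "L2_lim M (\<lambda>n. e (f n)) (e h)"
proof -
  note L = L2_limD[OF f]
  have n: "(L2_norm M (e k))\<^sup>2 = exp (LINT y|\<mu>. k y * k y)" if "k \<in> L2 \<mu>" for k
    using L2_inner_self[of M "e k"] unfolding e_inner_gen[OF that that] by (simp only: of_real_eq_iff)
  have "(\<lambda>n. (L2_norm M (\<lambda>\<omega>. e (f n) \<omega> - e h \<omega>))\<^sup>2) \<longlonglongrightarrow>
     exp (LINT y|\<mu>. h y * h y) - 2 * exp (LINT y|\<mu>. h y * h y) + exp (LINT y|\<mu>. h y * h y)"
    unfolding L2_norm_diff_sq[OF e_L2_gen[OF L(1)] e_L2_gen[OF L(2)]] n[OF L(1)] n[OF L(2)] e_inner_gen[OF L(1,2)] Re_complex_of_real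
    by (intro tendsto_intros L2_lim_real_inner f L2_lim_const L)
  then have "(\<lambda>n. sqrt ((L2_norm M (\<lambda>\<omega>. e (f n) \<omega> - e h \<omega>))\<^sup>2)) \<longlonglongrightarrow> sqrt 0"
    by (intro tendsto_real_sqrt) simp
  then show ?thesis using e_L2_gen L by (simp add: L2_lim_def)
qed

section \<open>Locality and totality of the Gaussian exponentials\<close>

abbreviation gloc where "gloc \<equiv> gaussian_loc \<mu> M W"

lemma gloc_gen: "{W h -` B \<inter> space M | h B. h \<in> L2 \<mu> \<and> (\<forall>y\<in>space \<mu> - A. h y = 0) \<and> B \<in> sets borel} \<subseteq> sets M"
  using W_meas by (auto intro: measurable_sets)

lemma space_gloc: "space (gloc A) = space M"
  by (simp add: gaussian_loc_def space_measure_of_conv)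

lemma sets_gloc: "sets (gloc A) = sigma_sets (space M) {W h -` B \<inter> space M | h B. h \<in> L2 \<mu> \<and> (\<forall>y\<in>space \<mu> - A. h y = 0) \<and> B \<in> sets borel}"
  unfolding gaussian_loc_def by (rule sets_measure_of) auto

lemma subalg_gloc: "subalgebra M (gloc A)"
  unfolding subalgebra_def sets_gloc using space_gloc sets.sigma_sets_subset[OF gloc_gen] by blast

lemma gloc_mono: "A \<subseteq> B \<Longrightarrow> sets (gloc A) \<subseteq> sets (gloc B)"
  unfolding sets_gloc by (rule sigma_sets_mono') blast

lemma W_gloc: "h \<in> L2 \<mu> \<Longrightarrow> (\<And>y. y \<in> space \<mu> - A \<Longrightarrow> h y = 0) \<Longrightarrow> W h \<in> borel_measurable (gloc A)"
  by (rule measurableI) (auto simp: space_gloc sets_gloc intro!: sigma_sets.Basic)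

lemma e_local_gen:
  assumes h: "h \<in> L2 \<mu>" and A: "\<And>y. y \<in> space \<mu> - A \<Longrightarrow> h y = 0"
  shows "e h \<in> local_L2 M gloc A"
proof -
  have "e h \<in> borel_measurable (gloc A)" unfolding gaussian_exponential_def using W_gloc[OF h A] by simp
  with e_L2_gen[OF h] show ?thesis unfolding local_L2_eq using aeq_refl by blast
qed

text \<open>The common majorant for the difference quotients and power series below.
  \<open>exp (c * W h) * e k\<close> is a multiple of an exponential, and the two signs of
  \<open>c\<close> cover the absolute value. Of the constant 2, one unit pays for the difference
  quotient and one for a power of \<open>W h\<close>.\<close>

lemma exp_abs_dominate:
  assumes h: "h \<in> L2 \<mu>" and k: "k \<in> L2 \<mu>"
  shows "(\<lambda>\<omega>. exp (2 * \<bar>W h \<omega>\<bar>) * norm (e k \<omega>)) \<in> L2 M"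
proof -
  note [measurable] = W_meas[OF h] e_meas[OF k]
  have L: "(\<lambda>\<omega>. complex_of_real (exp (c * W h \<omega>)) * e k \<omega>) \<in> L2 M" for c
  proof (rule L2_cong)
    let ?c = "complex_of_real (exp (LINT y|\<mu>. (c * h y) * k y) * exp ((L2_norm \<mu> (\<lambda>y. c * h y))\<^sup>2 / 2))"
    note ch = L2_cmult[OF h, of c]
    show "(\<lambda>\<omega>. ?c * e (\<lambda>y. c * h y + k y) \<omega>) \<in> L2 M"
      by (intro L2_cmult e_L2_gen L2_add ch k)
    show "aeq M (\<lambda>\<omega>. ?c * e (\<lambda>y. c * h y + k y) \<omega>) (\<lambda>\<omega>. complex_of_real (exp (c * W h \<omega>)) * e k \<omega>)"
      using e_prod[OF ch k] W_cmult[OF h, of c] unfolding aeq_def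
    proof eventually_elim
      case (elim \<omega>)
      have "e (\<lambda>y. c * h y) \<omega> * complex_of_real (exp ((L2_norm \<mu> (\<lambda>y. c * h y))\<^sup>2 / 2)) = complex_of_real (exp (c * W h \<omega>))"
        unfolding gaussian_exponential_def elim(2) by (simp add: exp_add[symmetric] flip: of_real_mult)
      with arg_cong[OF elim(1), of "\<lambda>x. x * complex_of_real (exp ((L2_norm \<mu> (\<lambda>y. c * h y))\<^sup>2 / 2))"]
      show ?case by (simp only: of_real_mult mult_ac)
    qed
  qed measurable
  have "(\<lambda>\<omega>. norm (complex_of_real (exp (2 * W h \<omega>)) * e k \<omega>) + norm (complex_of_real (exp ((-2) * W h \<omega>)) * e k \<omega>)) \<in> L2 M"
    by (intro L2_add L2_norm_fun L)
  then have w: "(\<lambda>\<omega>. (exp (2 * W h \<omega>) + exp (- 2 * W h \<omega>)) * norm (e k \<omega>)) \<in> L2 M"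
    by (simp add: norm_mult algebra_simps)
  show ?thesis
  proof (rule L2_I)
    show "integrable M (\<lambda>\<omega>. (norm (exp (2 * \<bar>W h \<omega>\<bar>) * norm (e k \<omega>)))\<^sup>2)"
    proof (rule Bochner_Integration.integrable_bound[OF L2_integrable_sq[OF w]])
      show "AE \<omega> in M. norm ((norm (exp (2 * \<bar>W h \<omega>\<bar>) * norm (e k \<omega>)))\<^sup>2) \<le> norm ((norm ((exp (2 * W h \<omega>) + exp (- 2 * W h \<omega>)) * norm (e k \<omega>)))\<^sup>2)"
      proof (rule AE_I2)
        fix \<omega>
        have "exp (2 * \<bar>W h \<omega>\<bar>) \<le> exp (2 * W h \<omega>) + exp (- 2 * W h \<omega>)" by (simp add: abs_if)
        then have "exp (2 * \<bar>W h \<omega>\<bar>) * norm (e k \<omega>) \<le> (exp (2 * W h \<omega>) + exp (- 2 * W h \<omega>)) * norm (e k \<omega>)"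
          by (rule mult_right_mono) simp
        then have "(exp (2 * \<bar>W h \<omega>\<bar>) * norm (e k \<omega>))\<^sup>2 \<le> ((exp (2 * W h \<omega>) + exp (- 2 * W h \<omega>)) * norm (e k \<omega>))\<^sup>2"
          by (rule power_mono) simp
        then show "norm ((norm (exp (2 * \<bar>W h \<omega>\<bar>) * norm (e k \<omega>)))\<^sup>2) \<le> norm ((norm ((exp (2 * W h \<omega>) + exp (- 2 * W h \<omega>)) * norm (e k \<omega>)))\<^sup>2)"
          by simp
      qed
    qed measurable
  qed measurable
qed

lemma exp_minus_1_bound: "\<bar>exp u - 1\<bar> \<le> \<bar>u\<bar> * exp \<bar>u :: real\<bar>"
proof (cases "u \<ge> 0")
  case True
  have "1 - u \<le> exp (- u)" using exp_ge_add_one_self[of "- u"] by simp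
  then have "(1 - u) * exp u \<le> exp (- u) * exp u" by (rule mult_right_mono) simp
  then have "exp u - 1 \<le> u * exp u" by (simp add: exp_minus algebra_simps)
  with True show ?thesis by simp
next
  case False
  have "1 - exp u \<le> - u" using exp_ge_add_one_self[of u] by linarith
  also have "\<dots> \<le> - u * exp (- u)" using False by simp
  finally show ?thesis using False by (simp add: abs_if)
qed

lemma power_le_fact_exp: "0 \<le> x \<Longrightarrow> x ^ n \<le> fact n * exp (x :: real)"
proof -
  assume x: "0 \<le> x"
  have "x ^ n /\<^sub>R fact n \<le> (\<Sum>k. x ^ k /\<^sub>R fact k)"
    using sum_le_suminf[OF summable_exp_generic[of x], of "{n}"] x by simp
  also have "\<dots> = exp x" by (simp add: exp_def)
  finally show ?thesis by (simp add: field_simps)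
qed

context
  fixes A U
  assumes U: "closed_subspace M U" and eU: "\<And>h. step_fun \<mu> h \<Longrightarrow> (\<And>y. y \<in> space \<mu> - A \<Longrightarrow> h y = 0) \<Longrightarrow> e h \<in> U"
begin

text \<open>The approximating step functions vanish wherever \<open>h\<close> does, by their bound
  \<open>2 * \<bar>h y\<bar>\<close>, so they stay supported in \<open>A\<close>.\<close>

lemma e_U:
  assumes h: "h \<in> L2 \<mu>" and A: "\<And>y. y \<in> space \<mu> - A \<Longrightarrow> h y = 0"
  shows "e h \<in> U"
proof -
  have i: "integrable \<mu> (\<lambda>y. (h y)\<^sup>2)" using L2_integrable_sq[OF h] by simp
  obtain f where f: "\<And>n. step_fun \<mu> (f n)" "\<And>y. y \<in> space \<mu> \<Longrightarrow> (\<lambda>n. f n y) \<longlonglongrightarrow> h y"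
    "\<And>n y. y \<in> space \<mu> \<Longrightarrow> \<bar>f n y\<bar> \<le> 2 * \<bar>h y\<bar>"
    using step_fun_approx[OF L2_measurable[OF h] disjI1[OF i]] by blast
  have "L2_lim \<mu> f h"
    by (rule L2_lim_dominated[where w="\<lambda>y. 2 * \<bar>h y\<bar>"])
       (use f step_fun_measurable[OF f(1)] L2_measurable[OF h] L2_cmult[OF L2_norm_fun[OF h], of 2] in auto)
  from e_lim[OF this] show ?thesis
  proof (rule closed_subspace_lim[OF U, rotated])
    have "f n y = 0" if "y \<in> space \<mu> - A" for n y using f(3)[of y n] A[OF that] that by auto
    then show "e (f n) \<in> U" for n by (intro eU f(1)) auto
  qed
qed

text \<open>Induction by differentiation: \<open>W h ^ Suc n * e k\<close> is the derivative at
  \<open>s = 0\<close> of \<open>W h ^ n * exp (s * W h) * e k\<close>, and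
  \<open>exp (s * W h) * e k\<close> is a multiple of the exponential of \<open>s * h + k\<close>.
  Hence the claim is carried along for all \<open>k\<close> at once.\<close>

lemma power_e_U:
  assumes h: "h \<in> L2 \<mu>" "\<And>y. y \<in> space \<mu> - A \<Longrightarrow> h y = 0" and k: "k \<in> L2 \<mu>" "\<And>y. y \<in> space \<mu> - A \<Longrightarrow> k y = 0"
  shows "(\<lambda>\<omega>. complex_of_real (W h \<omega> ^ n) * e k \<omega>) \<in> U"
  using k
proof (induction n arbitrary: k)
  case 0
  then show ?case using e_U by simp
next
  case (Suc n k)
  note k = Suc.prems
  note [measurable] = W_meas[OF h(1)] e_meas[OF k(1)]
  let ?s = "\<lambda>m. 1 / real (Suc m)"
  let ?F = "\<lambda>m \<omega>. complex_of_real (W h \<omega> ^ n * ((exp (?s m * W h \<omega>) - 1) / ?s m)) * e k \<omega>"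
  have "?F m \<in> U" for m
  proof -
    define s where "s = ?s m"
    note sh = L2_cmult[OF h(1), of s]
    let ?c = "exp (LINT y|\<mu>. (s * h y) * k y) * exp ((L2_norm \<mu> (\<lambda>y. s * h y))\<^sup>2 / 2)"
    have hk: "(\<lambda>y. s * h y + k y) \<in> L2 \<mu>" "\<And>y. y \<in> space \<mu> - A \<Longrightarrow> s * h y + k y = 0"
      using L2_add[OF sh k(1)] h(2) k(2) by auto
    note [measurable] = e_meas[OF hk(1)]
    have "(\<lambda>\<omega>. complex_of_real (?c / s) * (complex_of_real (W h \<omega> ^ n) * e (\<lambda>y. s * h y + k y) \<omega>)
        + complex_of_real (- 1 / s) * (complex_of_real (W h \<omega> ^ n) * e k \<omega>)) \<in> U"
      by (rule closed_subspace_lin[OF U Suc.IH[OF hk] Suc.IH[OF k]])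
    moreover have "aeq M (\<lambda>\<omega>. complex_of_real (?c / s) * (complex_of_real (W h \<omega> ^ n) * e (\<lambda>y. s * h y + k y) \<omega>)
        + complex_of_real (- 1 / s) * (complex_of_real (W h \<omega> ^ n) * e k \<omega>))
        (\<lambda>\<omega>. complex_of_real (W h \<omega> ^ n * ((exp (s * W h \<omega>) - 1) / s)) * e k \<omega>)"
      using e_prod[OF sh k(1)] W_cmult[OF h(1), of s] unfolding aeq_def
    proof eventually_elim
      case (elim \<omega>)
      have "e (\<lambda>y. s * h y) \<omega> * complex_of_real (exp ((L2_norm \<mu> (\<lambda>y. s * h y))\<^sup>2 / 2)) = complex_of_real (exp (s * W h \<omega>))"
        unfolding gaussian_exponential_def elim(2) by (simp add: exp_add[symmetric] flip: of_real_mult)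
      with arg_cong[OF elim(1), of "\<lambda>x. x * complex_of_real (exp ((L2_norm \<mu> (\<lambda>y. s * h y))\<^sup>2 / 2))"]
      have "complex_of_real (exp (s * W h \<omega>)) * e k \<omega> = complex_of_real ?c * e (\<lambda>y. s * h y + k y) \<omega>"
        by (simp only: of_real_mult mult_ac)
      moreover have "s \<noteq> 0" by (simp add: s_def)
      ultimately show ?case by (simp add: field_simps)
    qed
    ultimately have "(\<lambda>\<omega>. complex_of_real (W h \<omega> ^ n * ((exp (s * W h \<omega>) - 1) / s)) * e k \<omega>) \<in> U"
      by (rule closed_subspace_aeq[OF U]) measurable
    then show ?thesis unfolding s_def .
  qed
  moreover have "L2_lim M ?F (\<lambda>\<omega>. complex_of_real (W h \<omega> ^ Suc n) * e k \<omega>)"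
  proof (rule L2_lim_dominated[where w="\<lambda>\<omega>. fact (Suc n) * (exp (2 * \<bar>W h \<omega>\<bar>) * norm (e k \<omega>))"])
    show "(\<lambda>\<omega>. fact (Suc n) * (exp (2 * \<bar>W h \<omega>\<bar>) * norm (e k \<omega>))) \<in> L2 M"
      by (rule L2_cmult[OF exp_abs_dominate[OF h(1) k(1)]])
    show "AE \<omega> in M. (\<lambda>m. ?F m \<omega>) \<longlonglongrightarrow> complex_of_real (W h \<omega> ^ Suc n) * e k \<omega>"
    proof (rule AE_I2)
      fix \<omega>
      have "((\<lambda>x. exp (x * W h \<omega>)) has_field_derivative W h \<omega>) (at 0)" by (auto intro!: derivative_eq_intros)
      then have "((\<lambda>x. (exp (x * W h \<omega>) - 1) / x) \<longlongrightarrow> W h \<omega>) (at 0)" by (simp add: has_field_derivative_iff)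
      moreover have "filterlim ?s (at 0) sequentially"
        unfolding filterlim_at using LIMSEQ_Suc[OF lim_1_over_n] by auto
      ultimately have "(\<lambda>m. (exp (?s m * W h \<omega>) - 1) / ?s m) \<longlonglongrightarrow> W h \<omega>" by (rule filterlim_compose)
      then have "(\<lambda>m. ?F m \<omega>) \<longlonglongrightarrow> complex_of_real (W h \<omega> ^ n * W h \<omega>) * e k \<omega>" by (intro tendsto_intros)
      then show "(\<lambda>m. ?F m \<omega>) \<longlonglongrightarrow> complex_of_real (W h \<omega> ^ Suc n) * e k \<omega>" by (simp only: power_Suc2)
    qed
    show "AE \<omega> in M. norm (?F m \<omega>) \<le> fact (Suc n) * (exp (2 * \<bar>W h \<omega>\<bar>) * norm (e k \<omega>))" for m
    proof (rule AE_I2)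
      fix \<omega>
      define s Z where "s = ?s m" and "Z = W h \<omega>"
      have s: "0 < s" "s \<le> 1" by (simp_all add: s_def)
      have "\<bar>(exp (s * Z) - 1) / s\<bar> \<le> (\<bar>s * Z\<bar> * exp \<bar>s * Z\<bar>) / s"
        using exp_minus_1_bound[of "s * Z"] s by (simp add: divide_right_mono)
      also have "\<dots> = \<bar>Z\<bar> * exp (s * \<bar>Z\<bar>)" using s by (simp add: abs_mult)
      also have "\<dots> \<le> \<bar>Z\<bar> * exp \<bar>Z\<bar>" using s by (intro mult_left_mono) (auto intro: mult_left_le_one_le)
      finally have "\<bar>Z ^ n * ((exp (s * Z) - 1) / s)\<bar> \<le> \<bar>Z\<bar> ^ n * (\<bar>Z\<bar> * exp \<bar>Z\<bar>)"
        unfolding abs_mult power_abs by (intro mult_left_mono) auto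
      also have "\<dots> = \<bar>Z\<bar> ^ Suc n * exp \<bar>Z\<bar>" by simp
      also have "\<dots> \<le> (fact (Suc n) * exp \<bar>Z\<bar>) * exp \<bar>Z\<bar>" by (intro mult_right_mono power_le_fact_exp) auto
      also have "\<dots> = fact (Suc n) * exp (2 * \<bar>Z\<bar>)" by (simp add: exp_add[symmetric])
      finally have "\<bar>Z ^ n * ((exp (s * Z) - 1) / s)\<bar> * norm (e k \<omega>) \<le> (fact (Suc n) * exp (2 * \<bar>Z\<bar>)) * norm (e k \<omega>)"
        by (rule mult_right_mono) simp
      then show "norm (?F m \<omega>) \<le> fact (Suc n) * (exp (2 * \<bar>W h \<omega>\<bar>) * norm (e k \<omega>))"
        unfolding s_def Z_def norm_mult norm_of_real mult.assoc .
    qed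
  qed measurable
  ultimately show ?case by (rule closed_subspace_lim[OF U])
qed

lemma sin_e_U:
  assumes h: "h \<in> L2 \<mu>" "\<And>y. y \<in> space \<mu> - A \<Longrightarrow> h y = 0" and k: "k \<in> L2 \<mu>" "\<And>y. y \<in> space \<mu> - A \<Longrightarrow> k y = 0"
  shows "(\<lambda>\<omega>. complex_of_real (sin (W h \<omega>)) * e k \<omega>) \<in> U"
proof (rule closed_subspace_lim[OF U])
  note [measurable] = W_meas[OF h(1)] e_meas[OF k(1)]
  have "(\<lambda>\<omega>. \<Sum>j<n. complex_of_real (sin_coeff j) * (complex_of_real (W h \<omega> ^ j) * e k \<omega>)) \<in> U" for n
    by (rule closed_subspace_sum[OF U power_e_U[OF h k]])
  then show "(\<lambda>\<omega>. complex_of_real (\<Sum>j<n. sin_coeff j * W h \<omega> ^ j) * e k \<omega>) \<in> U" for n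
    by (simp add: sum_distrib_right mult.assoc)
  show "L2_lim M (\<lambda>n \<omega>. complex_of_real (\<Sum>j<n. sin_coeff j * W h \<omega> ^ j) * e k \<omega>) (\<lambda>\<omega>. complex_of_real (sin (W h \<omega>)) * e k \<omega>)"
  proof (rule L2_lim_dominated[OF _ _ exp_abs_dominate[OF h(1) k(1)]])
    show "AE \<omega> in M. (\<lambda>n. complex_of_real (\<Sum>j<n. sin_coeff j * W h \<omega> ^ j) * e k \<omega>) \<longlonglongrightarrow> complex_of_real (sin (W h \<omega>)) * e k \<omega>"
    proof (rule AE_I2)
      fix \<omega>
      have "(\<lambda>n. \<Sum>j<n. sin_coeff j * W h \<omega> ^ j) \<longlonglongrightarrow> sin (W h \<omega>)"
        using sin_converges[of "W h \<omega>"] by (simp add: sums_def)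
      then show "(\<lambda>n. complex_of_real (\<Sum>j<n. sin_coeff j * W h \<omega> ^ j) * e k \<omega>) \<longlonglongrightarrow> complex_of_real (sin (W h \<omega>)) * e k \<omega>"
        by (intro tendsto_intros)
    qed
    show "AE \<omega> in M. norm (complex_of_real (\<Sum>j<n. sin_coeff j * W h \<omega> ^ j) * e k \<omega>) \<le> exp (2 * \<bar>W h \<omega>\<bar>) * norm (e k \<omega>)" for n
    proof (rule AE_I2)
      fix \<omega>
      define Z where "Z = W h \<omega>"
      have "\<bar>\<Sum>j<n. sin_coeff j * Z ^ j\<bar> \<le> (\<Sum>j<n. \<bar>Z\<bar> ^ j /\<^sub>R fact j)"
        by (rule order_trans[OF sum_abs], rule sum_mono)
           (auto simp: sin_coeff_def abs_mult power_abs field_simps)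
      also have "\<dots> \<le> (\<Sum>j. \<bar>Z\<bar> ^ j /\<^sub>R fact j)" by (rule sum_le_suminf[OF summable_exp_generic]) auto
      also have "\<dots> = exp \<bar>Z\<bar>" by (simp add: exp_def)
      also have "\<dots> \<le> exp (2 * \<bar>Z\<bar>)" by simp
      finally have "\<bar>\<Sum>j<n. sin_coeff j * Z ^ j\<bar> * norm (e k \<omega>) \<le> exp (2 * \<bar>Z\<bar>) * norm (e k \<omega>)"
        by (rule mult_right_mono) simp
      then show "norm (complex_of_real (\<Sum>j<n. sin_coeff j * W h \<omega> ^ j) * e k \<omega>) \<le> exp (2 * \<bar>W h \<omega>\<bar>) * norm (e k \<omega>)"
        unfolding Z_def norm_mult norm_of_real .
    qed
  qed measurable
qed

end

text \<open>The sine is bounded, so it can be a multiplier, and its power series converges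
  everywhere, so powers of \<open>W h\<close> suffice to reach it. The rescaled sines of small
  multiples recover \<open>W h\<close> itself.\<close>

lemma e_total:
  assumes V: "closed_subspace M V"
    and eV: "\<And>h. step_fun \<mu> h \<Longrightarrow> (\<And>y. y \<in> space \<mu> - A \<Longrightarrow> h y = 0) \<Longrightarrow> e h \<in> V"
  shows "local_L2 M gloc A \<subseteq> V"
proof -
  define D where "D = {e h | h. step_fun \<mu> h \<and> (\<forall>y\<in>space \<mu> - A. h y = 0)}"
  let ?U = "cspan M D"
  have D: "D \<subseteq> L2 M" unfolding D_def using e_L2_gen[OF step_fun_L2] by blast
  note U = cspan_closed[OF D]
  have eU: "e h \<in> ?U" if "step_fun \<mu> h" "\<And>y. y \<in> space \<mu> - A \<Longrightarrow> h y = 0" for h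
    using subsetD[OF cspan_superset, of "e h" D M] that by (auto simp: D_def)
  have one: "(\<lambda>_. 1) \<in> ?U"
  proof (rule closed_subspace_aeq[OF U eU[OF step_fun_zero]])
    have "AE \<omega> in M. W (\<lambda>_. 0) \<omega> = 0" by (rule W_null) (auto simp: L2_norm_def)
    then show "aeq M (e (\<lambda>_. 0)) (\<lambda>_. 1)" unfolding aeq_def gaussian_exponential_def
      by eventually_elim (simp add: L2_norm_def)
  qed auto
  have mult: "(\<lambda>\<omega>. sin (W h \<omega>)) \<in> multipliers M ?U" if h: "h \<in> L2 \<mu>" "\<And>y. y \<in> space \<mu> - A \<Longrightarrow> h y = 0" for h
  proof (rule multipliersI_cspan[OF D, where C=1])
    show "(\<lambda>\<omega>. sin (W h \<omega>)) \<in> borel_measurable M" using W_meas[OF h(1)] by measurable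
    fix g assume "g \<in> D"
    then obtain k where k: "g = e k" "step_fun \<mu> k" "\<forall>y\<in>space \<mu> - A. k y = 0" by (auto simp: D_def)
    show "(\<lambda>\<omega>. complex_of_real (sin (W h \<omega>)) * g \<omega>) \<in> ?U"
      unfolding k(1) using sin_e_U[OF U eU h step_fun_L2[OF k(2)]] k(3) by blast
  qed auto
  have gen: "{W h -` B \<inter> space M | h B. h \<in> L2 \<mu> \<and> (\<forall>y\<in>space \<mu> - A. h y = 0) \<and> B \<in> sets borel} \<subseteq> multiplier_sets M ?U"
  proof clarify
    fix h :: "'y \<Rightarrow> real" and B :: "real set" assume h: "h \<in> L2 \<mu>" "\<forall>y\<in>space \<mu> - A. h y = 0" and B: "B \<in> sets borel"
    note [measurable] = W_meas[OF h(1)]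
    show "W h -` B \<inter> space M \<in> multiplier_sets M ?U"
    proof (rule multiplier_sets_limit[OF U _ _ B])
      let ?s = "\<lambda>m. 1 / real (Suc m)"
      show "(\<lambda>\<omega>. sin (?s m * W h \<omega>)) \<in> multipliers M ?U" for m
      proof (rule multipliers_aeq[OF U mult, where C=1])
        show "(\<lambda>y. ?s m * h y) \<in> L2 \<mu>" by (rule L2_cmult[OF h(1)])
        show "aeq M (\<lambda>\<omega>. sin (W (\<lambda>y. ?s m * h y) \<omega>)) (\<lambda>\<omega>. sin (?s m * W h \<omega>))"
          using W_cmult[OF h(1), of "?s m"] unfolding aeq_def by eventually_elim simp
      qed (use h in auto)
      fix \<omega>
      have "((\<lambda>x. sin (x * W h \<omega>)) has_field_derivative W h \<omega>) (at 0)" by (auto intro!: derivative_eq_intros)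
      then have "((\<lambda>x. sin (x * W h \<omega>) / x) \<longlongrightarrow> W h \<omega>) (at 0)" by (simp add: has_field_derivative_iff)
      moreover have "filterlim ?s (at 0) sequentially"
        unfolding filterlim_at using LIMSEQ_Suc[OF lim_1_over_n] by auto
      ultimately have "(\<lambda>m. sin (?s m * W h \<omega>) / ?s m) \<longlonglongrightarrow> W h \<omega>" by (rule filterlim_compose)
      then show "(\<lambda>m. real (Suc m) * sin (?s m * W h \<omega>)) \<longlonglongrightarrow> W h \<omega>" by (simp add: mult.commute del: of_nat_Suc)
    qed
  qed
  have "local_L2 M gloc A \<subseteq> ?U"
    by (rule local_L2_subset_multiplier[OF U one _ gen]) (simp add: gaussian_loc_def)
  also have "?U \<subseteq> V" by (rule cspan_minimal[OF V]) (use eV in \<open>auto simp: D_def\<close>)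
  finally show ?thesis .
qed

sublocale E: exp_system M \<mu> gloc e
proof
  fix A B :: "'y set" and h k :: "'y \<Rightarrow> real"
  show "subalgebra M (gloc A)" by (rule subalg_gloc)
  show "A \<subseteq> B \<Longrightarrow> sets (gloc A) \<subseteq> sets (gloc B)" by (rule gloc_mono)
  show "aeq M (e (\<lambda>_. 0)) (\<lambda>_. 1)"
  proof -
    have "AE \<omega> in M. W (\<lambda>_. 0) \<omega> = 0" by (rule W_null) (auto simp: L2_norm_def)
    then show ?thesis unfolding aeq_def gaussian_exponential_def by eventually_elim (simp add: L2_norm_def)
  qed
  show "e h \<in> local_L2 M gloc A" if "step_fun \<mu> h" "\<And>y. y \<in> space \<mu> - A \<Longrightarrow> h y = 0"
    by (rule e_local_gen[OF step_fun_L2[OF that(1)] that(2)])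
  show "real_valued M (e h)" by (simp add: real_valued_def gaussian_exponential_def)
  show "aeq M (e (\<lambda>y. h y + k y)) (\<lambda>\<omega>. e h \<omega> * e k \<omega>)" if "step_fun \<mu> h" "step_fun \<mu> k" "\<And>y. y \<in> space \<mu> \<Longrightarrow> h y * k y = 0"
  proof -
    have "(LINT y|\<mu>. h y * k y) = (LINT y|\<mu>. 0)" by (rule Bochner_Integration.integral_cong) (use that(3) in auto)
    then show ?thesis using aeq_sym[OF e_prod[OF step_fun_L2[OF that(1)] step_fun_L2[OF that(2)]]] by simp
  qed
  show "L2_inner M (e h) (e k) = complex_of_real (exp (LINT y|\<mu>. h y * k y))" if "step_fun \<mu> h" "step_fun \<mu> k"
    by (rule e_inner_gen[OF step_fun_L2[OF that(1)] step_fun_L2[OF that(2)]])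
  show "local_L2 M gloc A \<subseteq> V" if "closed_subspace M V" "\<And>h. step_fun \<mu> h \<Longrightarrow> (\<And>y. y \<in> space \<mu> - A \<Longrightarrow> h y = 0) \<Longrightarrow> e h \<in> V" for V
    by (rule e_total[OF that])
qed

lemma W_deriv:
  assumes h: "h \<in> L2 \<mu>"
  shows "L2_lim M (\<lambda>n \<omega>. complex_of_real (real (Suc n)) * (e (\<lambda>y. h y / real (Suc n)) \<omega> - 1)) (\<lambda>\<omega>. complex_of_real (W h \<omega>))"
proof -
  note [measurable] = W_meas[OF h]
  define c where "c = (L2_norm \<mu> h)\<^sup>2 / 2"
  have c: "0 \<le> c" by (simp add: c_def)
  let ?s = "\<lambda>n. 1 / real (Suc n)"
  let ?F = "\<lambda>n \<omega>. complex_of_real ((exp (?s n * W h \<omega> - (?s n)\<^sup>2 * c) - 1) / ?s n)"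
  have "L2_lim M ?F (\<lambda>\<omega>. complex_of_real (W h \<omega>))"
  proof (rule L2_lim_dominated[where w="\<lambda>\<omega>. exp (2 * c) * (exp (2 * \<bar>W h \<omega>\<bar>) * norm (e (\<lambda>_. 0) \<omega>))"])
    \<comment> \<open>The factor \<open>e (\<lambda>_. 0)\<close> is 1 almost everywhere; it brings
      the majorant into the form already known to be square-integrable.\<close>
    have e0: "AE \<omega> in M. e (\<lambda>_. 0) \<omega> = 1" using E.e_zero by (simp add: aeq_def)
    show "(\<lambda>\<omega>. exp (2 * c) * (exp (2 * \<bar>W h \<omega>\<bar>) * norm (e (\<lambda>_. 0) \<omega>))) \<in> L2 M"
      by (rule L2_cmult[OF exp_abs_dominate[OF h L2_zero]])
    show "AE \<omega> in M. (\<lambda>n. ?F n \<omega>) \<longlonglongrightarrow> complex_of_real (W h \<omega>)"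
    proof (rule AE_I2, rule tendsto_of_real)
      fix \<omega>
      have "((\<lambda>x. exp (x * W h \<omega> - x\<^sup>2 * c)) has_field_derivative W h \<omega>) (at 0)" by (auto intro!: derivative_eq_intros)
      then have "((\<lambda>x. (exp (x * W h \<omega> - x\<^sup>2 * c) - 1) / x) \<longlongrightarrow> W h \<omega>) (at 0)" by (simp add: has_field_derivative_iff)
      moreover have "filterlim ?s (at 0) sequentially"
        unfolding filterlim_at using LIMSEQ_Suc[OF lim_1_over_n] by auto
      ultimately show "(\<lambda>n. (exp (?s n * W h \<omega> - (?s n)\<^sup>2 * c) - 1) / ?s n) \<longlonglongrightarrow> W h \<omega>" by (rule filterlim_compose)
    qed
    show "AE \<omega> in M. norm (?F n \<omega>) \<le> exp (2 * c) * (exp (2 * \<bar>W h \<omega>\<bar>) * norm (e (\<lambda>_. 0) \<omega>))" for n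
      using e0
    proof eventually_elim
      case (elim \<omega>)
      define s Z where "s = ?s n" and "Z = W h \<omega>"
      have s: "0 < s" "s \<le> 1" by (simp_all add: s_def)
      have eq: "s * Z - s\<^sup>2 * c = s * (Z - s * c)" by (simp add: power2_eq_square algebra_simps)
      have sc: "\<bar>Z - s * c\<bar> \<le> \<bar>Z\<bar> + c" using s c mult_right_le_one_le[of c s] abs_triangle_ineq4[of Z "s * c"]
        by (simp add: abs_mult mult.commute)
      have "\<bar>(exp (s * (Z - s * c)) - 1) / s\<bar> \<le> (\<bar>s * (Z - s * c)\<bar> * exp \<bar>s * (Z - s * c)\<bar>) / s"
        using exp_minus_1_bound[of "s * (Z - s * c)"] s by (simp add: divide_right_mono)
      also have "\<dots> = \<bar>Z - s * c\<bar> * exp (s * \<bar>Z - s * c\<bar>)" using s by (simp add: abs_mult)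
      also have "\<dots> \<le> (\<bar>Z\<bar> + c) * exp (\<bar>Z\<bar> + c)"
        using s sc by (intro mult_mono) (auto intro: order_trans[OF mult_left_le_one_le])
      also have "\<dots> \<le> exp (\<bar>Z\<bar> + c) * exp (\<bar>Z\<bar> + c)"
        using power_le_fact_exp[of "\<bar>Z\<bar> + c" 1] c by (intro mult_right_mono) auto
      also have "\<dots> = exp (2 * c) * exp (2 * \<bar>Z\<bar>)" by (simp add: exp_add[symmetric])
      finally show ?case using elim unfolding s_def[symmetric] Z_def[symmetric] norm_of_real eq by simp
    qed
  qed measurable
  then show ?thesis
  proof (rule L2_lim_cong[OF _ _ aeq_refl])
    fix n
    have hn: "(\<lambda>y. h y / real (Suc n)) \<in> L2 \<mu>" using L2_cmult[OF h, of "?s n"] by simp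
    note [measurable] = e_meas[OF hn]
    have "AE \<omega> in M. W (\<lambda>y. h y / real (Suc n)) \<omega> = ?s n * W h \<omega>" using W_cmult[OF h, of "?s n"] by (simp add: aeq_def)
    then show "aeq M (?F n) (\<lambda>\<omega>. complex_of_real (real (Suc n)) * (e (\<lambda>y. h y / real (Suc n)) \<omega> - 1))"
      unfolding aeq_def
    proof eventually_elim
      case (elim \<omega>)
      have "L2_norm \<mu> (\<lambda>y. h y / real (Suc n)) = ?s n * L2_norm \<mu> h" using L2_norm_cmult[of \<mu> "?s n" h] by simp
      then show ?case unfolding gaussian_exponential_def elim c_def by (simp add: power_mult_distrib power_divide del: of_nat_Suc)
    qed
    show "(\<lambda>\<omega>. complex_of_real (real (Suc n)) * (e (\<lambda>y. h y / real (Suc n)) \<omega> - 1)) \<in> borel_measurable M" by measurable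
  qed measurable
qed

end

section \<open>Exponentials of a Poisson process\<close>

text \<open>The error \<open>d n\<close> does not depend on the finite set \<open>F\<close>. This
  makes \<open>p\<close> a Cauchy sequence and forces the net of finite subsets to the same
  limit.\<close>

lemma finite_subsets_net_limit:
  fixes G :: "'y set \<Rightarrow> real"
  assumes S: "\<And>n. finite (A n)" "\<And>n. A n \<subseteq> S" and d: "d \<longlonglongrightarrow> 0"
    and b: "\<And>n F. finite F \<Longrightarrow> A n \<subseteq> F \<Longrightarrow> F \<subseteq> S \<Longrightarrow> \<bar>G F - p n\<bar> \<le> d n"
  obtains q where "p \<longlonglongrightarrow> q" "(G \<longlongrightarrow> q) (finite_subsets_at_top S)"
proof -
  have pp: "\<bar>p m - p n\<bar> \<le> d m + d n" for m n
    using b[of "A m \<union> A n" m] b[of "A m \<union> A n" n] S by auto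
  have small: "\<exists>n0. \<forall>n\<ge>n0. d n < \<epsilon>" if "\<epsilon> > 0" for \<epsilon>
    using order_tendstoD(2)[OF d that] by (simp add: eventually_sequentially)
  have "Cauchy p"
  proof (rule metric_CauchyI)
    fix \<epsilon> :: real assume "\<epsilon> > 0"
    then obtain n0 where n0: "\<And>n. n \<ge> n0 \<Longrightarrow> d n < \<epsilon> / 2" using small[of "\<epsilon> / 2"] by auto
    show "\<exists>M. \<forall>m\<ge>M. \<forall>n\<ge>M. dist (p m) (p n) < \<epsilon>"
    proof (intro exI allI impI)
      fix m n assume "m \<ge> n0" "n \<ge> n0"
      then show "dist (p m) (p n) < \<epsilon>" using pp[of m n] n0[of m] n0[of n] by (simp add: dist_real_def)
    qed
  qed
  then obtain q where q: "p \<longlonglongrightarrow> q" using Cauchy_convergent_iff convergent_def by blast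
  have pq: "\<bar>p n - q\<bar> \<le> d n" for n
  proof (rule LIMSEQ_le)
    show "(\<lambda>m. \<bar>p n - p m\<bar>) \<longlonglongrightarrow> \<bar>p n - q\<bar>" by (intro tendsto_intros q)
    show "(\<lambda>m. d n + d m) \<longlonglongrightarrow> d n" using tendsto_add[OF tendsto_const d, of "d n"] by simp
  qed (use pp in auto)
  have "(G \<longlongrightarrow> q) (finite_subsets_at_top S)"
  proof (rule tendstoI)
    fix \<epsilon> :: real assume "\<epsilon> > 0"
    then obtain n where n: "d n < \<epsilon> / 2" using small[of "\<epsilon> / 2"] by auto
    show "\<forall>\<^sub>F F in finite_subsets_at_top S. dist (G F) q < \<epsilon>"
      unfolding eventually_finite_subsets_at_top
    proof (intro exI conjI allI impI)
      fix F assume "finite F \<and> A n \<subseteq> F \<and> F \<subseteq> S"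
      then have "\<bar>G F - p n\<bar> \<le> d n" using b by blast
      with n pq[of n] show "dist (G F) q < \<epsilon>" by (simp add: dist_real_def)
    qed (use S in auto)
  qed
  with q that show ?thesis by blast
qed

text \<open>A Lipschitz bound for finite products in terms of sums of absolute values only, hence
  uniform over the finite subsets of a set on which the functions are absolutely summable.\<close>

lemma prod_diff_le:
  fixes a b :: "'y \<Rightarrow> real"
  assumes "finite F"
  shows "\<bar>(\<Prod>y\<in>F. 1 + a y) - (\<Prod>y\<in>F. 1 + b y)\<bar> \<le> exp ((\<Sum>y\<in>F. \<bar>a y\<bar>) + (\<Sum>y\<in>F. \<bar>b y\<bar>)) * (\<Sum>y\<in>F. \<bar>a y - b y\<bar>)"
  using assms
proof induction
  case (insert z F)
  let ?A = "\<Prod>y\<in>F. 1 + a y" and ?B = "\<Prod>y\<in>F. 1 + b y"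
  let ?a = "\<Sum>y\<in>F. \<bar>a y\<bar>" and ?b = "\<Sum>y\<in>F. \<bar>b y\<bar>" and ?d = "\<Sum>y\<in>F. \<bar>a y - b y\<bar>"
  have e: "\<bar>1 + x\<bar> \<le> exp \<bar>x\<bar>" for x :: real
    using exp_ge_add_one_self[of "\<bar>x\<bar>"] by linarith
  have "\<bar>?B\<bar> \<le> (\<Prod>y\<in>F. exp \<bar>b y\<bar>)" unfolding abs_prod by (rule prod_mono) (auto intro: e)
  then have B: "\<bar>?B\<bar> \<le> exp ?b" using insert by (simp add: exp_sum)
  have nn: "0 \<le> ?a" "0 \<le> ?b" "0 \<le> ?d" by (auto intro: sum_nonneg)
  have "(1 + a z) * ?A - (1 + b z) * ?B = (1 + a z) * (?A - ?B) + (a z - b z) * ?B" by (simp add: algebra_simps)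
  then have "\<bar>(1 + a z) * ?A - (1 + b z) * ?B\<bar> \<le> \<bar>1 + a z\<bar> * \<bar>?A - ?B\<bar> + \<bar>a z - b z\<bar> * \<bar>?B\<bar>"
    using abs_triangle_ineq[of "(1 + a z) * (?A - ?B)" "(a z - b z) * ?B"] by (simp add: abs_mult)
  also have "\<dots> \<le> exp (\<bar>a z\<bar> + \<bar>b z\<bar>) * (exp (?a + ?b) * ?d) + \<bar>a z - b z\<bar> * exp (\<bar>a z\<bar> + ?a + \<bar>b z\<bar> + ?b)"
  proof (intro add_mono mult_mono insert.IH)
    show "\<bar>1 + a z\<bar> \<le> exp (\<bar>a z\<bar> + \<bar>b z\<bar>)" using e[of "a z"] by (rule order_trans) simp
    show "\<bar>?B\<bar> \<le> exp (\<bar>a z\<bar> + ?a + \<bar>b z\<bar> + ?b)" using B by (rule order_trans) (use nn in simp)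
  qed (use nn in auto)
  also have "\<dots> = exp ((\<bar>a z\<bar> + ?a) + (\<bar>b z\<bar> + ?b)) * (\<bar>a z - b z\<bar> + ?d)"
    by (simp add: exp_add algebra_simps)
  finally show ?case using insert by simp
qed simp

text \<open>Dominated convergence for the counting measure on \<open>S\<close> makes the
  approximation uniform over finite subsets. In this way finite products turn into the unconditional
  infinite product, and finite sums into the infinite sum.\<close>

lemma config_limits:
  fixes h :: "'y \<Rightarrow> real"
  assumes h: "(\<lambda>y. \<bar>h y\<bar>) summable_on S" and lim: "\<And>y. y \<in> S \<Longrightarrow> (\<lambda>n. f n y) \<longlonglongrightarrow> h y"
    and le: "\<And>n y. y \<in> S \<Longrightarrow> \<bar>f n y\<bar> \<le> 2 * \<bar>h y\<bar>" and fin: "\<And>n. finite {y \<in> S. f n y \<noteq> 0}"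
  shows "(\<lambda>n. \<Prod>y\<in>{y \<in> S. f n y \<noteq> 0}. 1 + f n y) \<longlonglongrightarrow> config_prod S (\<lambda>y. 1 + h y)"
    and "(\<lambda>n. \<Sum>y\<in>{y \<in> S. f n y \<noteq> 0}. f n y) \<longlonglongrightarrow> (\<Sum>\<^sub>\<infinity>y\<in>S. h y)"
proof -
  let ?A = "\<lambda>n. {y \<in> S. f n y \<noteq> 0}"
  define T where "T = (\<Sum>\<^sub>\<infinity>y\<in>S. \<bar>h y\<bar>)"
  define d where "d n = (LINT y|count_space S. \<bar>h y - f n y\<bar>)" for n
  have hi: "integrable (count_space S) h"
    using h abs_summable_equivalent[of h S] by (simp add: abs_summable_on_def)
  have fi: "integrable (count_space S) (f n)" for n
  proof (rule Bochner_Integration.integrable_bound)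
    show "integrable (count_space S) (\<lambda>y. 2 * h y)" using hi by simp
    show "AE y in count_space S. norm (f n y) \<le> norm (2 * h y)" using le by (auto simp: AE_count_space abs_mult)
  qed simp
  have d: "d \<longlonglongrightarrow> 0"
  proof -
    have "(\<lambda>n. LINT y|count_space S. \<bar>h y - f n y\<bar>) \<longlonglongrightarrow> (LINT y|count_space S. 0)"
    proof (rule integral_dominated_convergence[where w="\<lambda>y. 3 * \<bar>h y\<bar>"])
      show "integrable (count_space S) (\<lambda>y. 3 * \<bar>h y\<bar>)" using hi by simp
      show "AE y in count_space S. (\<lambda>n. \<bar>h y - f n y\<bar>) \<longlonglongrightarrow> 0"
        using lim by (auto simp: AE_count_space intro!: tendsto_eq_intros)
      have "\<bar>h y - f n y\<bar> \<le> 3 * \<bar>h y\<bar>" if "y \<in> S" for y n using le[OF that, of n] by linarith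
      then show "AE y in count_space S. norm \<bar>h y - f n y\<bar> \<le> 3 * \<bar>h y\<bar>" for n by (auto simp: AE_count_space)
    qed auto
    then show ?thesis by (simp add: d_def[abs_def])
  qed
  have dF: "(\<Sum>y\<in>F. \<bar>h y - f n y\<bar>) \<le> d n" if F: "finite F" "F \<subseteq> S" for F n
  proof -
    have "integrable (count_space S) (\<lambda>y. \<bar>h y - f n y\<bar>)" using hi fi by auto
    then have a: "Infinite_Set_Sum.abs_summable_on (\<lambda>y. \<bar>h y - f n y\<bar>) S" by (simp add: abs_summable_on_def)
    then have s: "(\<lambda>y. \<bar>h y - f n y\<bar>) summable_on S" using abs_summable_equivalent[of "\<lambda>y. \<bar>h y - f n y\<bar>" S] by simp
    have "(\<Sum>y\<in>F. \<bar>h y - f n y\<bar>) \<le> (\<Sum>\<^sub>\<infinity>y\<in>S. \<bar>h y - f n y\<bar>)" by (rule finite_sum_le_infsum[OF s F]) simp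
    also have "\<dots> = d n" using infsetsum_infsum[OF a] by (simp add: d_def infsetsum_def)
    finally show ?thesis .
  qed
  have TF: "(\<Sum>y\<in>F. \<bar>h y\<bar>) \<le> T" if F: "finite F" "F \<subseteq> S" for F
    unfolding T_def by (rule finite_sum_le_infsum[OF h F]) simp
  have fF: "(\<Sum>y\<in>F. \<bar>f n y\<bar>) \<le> 2 * T" if F: "finite F" "F \<subseteq> S" for F n
  proof -
    have "(\<Sum>y\<in>F. \<bar>f n y\<bar>) \<le> (\<Sum>y\<in>F. 2 * \<bar>h y\<bar>)" using le F by (intro sum_mono) auto
    also have "\<dots> \<le> 2 * T" using TF[OF F] by (simp add: sum_distrib_left[symmetric])
    finally show ?thesis .
  qed
  obtain q where q: "(\<lambda>n. \<Prod>y\<in>?A n. 1 + f n y) \<longlonglongrightarrow> q" "((\<lambda>F. \<Prod>y\<in>F. 1 + h y) \<longlongrightarrow> q) (finite_subsets_at_top S)"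
  proof (rule finite_subsets_net_limit[of ?A S "\<lambda>n. exp (3 * T) * d n"])
    show "(\<lambda>n. exp (3 * T) * d n) \<longlonglongrightarrow> 0" using tendsto_mult_left[OF d, of "exp (3 * T)"] by simp
    fix n F assume F: "finite F" "?A n \<subseteq> F" "F \<subseteq> S"
    have "(\<Prod>y\<in>?A n. 1 + f n y) = (\<Prod>y\<in>F. 1 + f n y)" using F by (intro prod.mono_neutral_left) auto
    then have "\<bar>(\<Prod>y\<in>F. 1 + h y) - (\<Prod>y\<in>?A n. 1 + f n y)\<bar>
        \<le> exp ((\<Sum>y\<in>F. \<bar>h y\<bar>) + (\<Sum>y\<in>F. \<bar>f n y\<bar>)) * (\<Sum>y\<in>F. \<bar>h y - f n y\<bar>)"
      using prod_diff_le[OF F(1), of h "f n"] by simp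
    \<comment> \<open>Of \<open>3 * T\<close>, one \<open>T\<close> bounds the sum for
      \<open>h\<close> and \<open>2 * T\<close> the sum for its approximant.\<close>
    also have "\<dots> \<le> exp (3 * T) * d n"
      using TF[OF F(1,3)] fF[OF F(1,3), of n] dF[OF F(1,3), of n] by (intro mult_mono) (auto intro: sum_nonneg)
    finally show "\<bar>(\<Prod>y\<in>F. 1 + h y) - (\<Prod>y\<in>?A n. 1 + f n y)\<bar> \<le> exp (3 * T) * d n" .
  qed (use fin in auto)
  have "config_prod S (\<lambda>y. 1 + h y) = q" unfolding config_prod_def by (rule tendsto_Lim[OF finite_subsets_at_top_neq_bot q(2)])
  with q(1) show "(\<lambda>n. \<Prod>y\<in>?A n. 1 + f n y) \<longlonglongrightarrow> config_prod S (\<lambda>y. 1 + h y)" by simp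
  obtain r where r: "(\<lambda>n. \<Sum>y\<in>?A n. f n y) \<longlonglongrightarrow> r" "(sum h \<longlongrightarrow> r) (finite_subsets_at_top S)"
  proof (rule finite_subsets_net_limit[of ?A S d "sum h" "\<lambda>n. \<Sum>y\<in>?A n. f n y"])
    show "d \<longlonglongrightarrow> 0" by (rule d)
    fix n F assume F: "finite F" "?A n \<subseteq> F" "F \<subseteq> S"
    have "(\<Sum>y\<in>?A n. f n y) = (\<Sum>y\<in>F. f n y)" using F by (intro sum.mono_neutral_left) auto
    then have "\<bar>sum h F - (\<Sum>y\<in>?A n. f n y)\<bar> \<le> (\<Sum>y\<in>F. \<bar>h y - f n y\<bar>)" by (simp add: sum_subtractf[symmetric] sum_abs)
    also have "\<dots> \<le> d n" by (rule dF[OF F(1,3)])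
    finally show "\<bar>sum h F - (\<Sum>y\<in>?A n. f n y)\<bar> \<le> d n" .
  qed (use fin in auto)
  have "(\<Sum>\<^sub>\<infinity>y\<in>S. h y) = r" by (rule infsumI) (use r(2) in \<open>simp add: has_sum_def\<close>)
  with r(1) show "(\<lambda>n. \<Sum>y\<in>?A n. f n y) \<longlonglongrightarrow> (\<Sum>\<^sub>\<infinity>y\<in>S. h y)" by simp
qed

section \<open>Counts and finite products over a Poisson configuration\<close>

locale poisson_points = prob_space M
  for M :: "'w measure" and \<mu> :: "'y measure" and N :: "'w \<Rightarrow> 'y set" +
  assumes process: "poisson_process \<mu> M N"
begin

lemma N_space: "\<omega> \<in> space M \<Longrightarrow> N \<omega> \<subseteq> space \<mu>"
  using process by (simp add: poisson_process_def)

lemma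
  assumes "A \<in> sets \<mu>" "emeasure \<mu> A < \<infinity>"
  shows finite_N: "AE \<omega> in M. finite (N \<omega> \<inter> A)"
    and count_meas: "(\<lambda>\<omega>. card (N \<omega> \<inter> A)) \<in> measurable M (count_space UNIV)"
    and count_law: "measure M {\<omega> \<in> space M. card (N \<omega> \<inter> A) = k} = exp (- measure \<mu> A) * measure \<mu> A ^ k / fact k"
  using process[unfolded poisson_process_def, THEN conjunct2, THEN conjunct2, THEN conjunct1, rule_format, OF assms] by simp_all

lemma indep_counts:
  fixes A :: "nat \<Rightarrow> 'y set"
  assumes "\<And>i. i < n \<Longrightarrow> A i \<in> sets \<mu>" "\<And>i. i < n \<Longrightarrow> emeasure \<mu> (A i) < \<infinity>" "disjoint_family_on A {..<n}"
  shows "indep_vars (\<lambda>_. count_space UNIV) (\<lambda>i \<omega>. card (N \<omega> \<inter> A i)) {..<n}"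
  by (rule process[unfolded poisson_process_def, THEN conjunct2, THEN conjunct2, THEN conjunct2, rule_format])
     (use assms in simp)

lemma count_pgf:
  assumes A: "A \<in> sets \<mu>" "emeasure \<mu> A < \<infinity>"
  shows "integrable M (\<lambda>\<omega>. a ^ card (N \<omega> \<inter> A))" "expectation (\<lambda>\<omega>. a ^ card (N \<omega> \<inter> A)) = exp ((a - 1) * measure \<mu> A :: real)"
proof -
  note [measurable] = count_meas[OF A]
  define m where "m = measure \<mu> A"
  have m: "m \<ge> 0" by (simp add: m_def)
  let ?K = "\<lambda>\<omega>. card (N \<omega> \<inter> A)"
  let ?p = "\<lambda>k. exp (- m) * m ^ k / fact k"
  have D: "distr M (count_space UNIV) ?K = density (count_space UNIV) (\<lambda>k. ennreal (?p k))"
  proof (rule measure_eqI_countable[where A=UNIV])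
    fix k :: nat
    have "emeasure (distr M (count_space UNIV) ?K) {k} = emeasure M {\<omega> \<in> space M. ?K \<omega> = k}"
      by (subst emeasure_distr) (auto intro!: arg_cong[where f="emeasure M"])
    also have "\<dots> = ennreal (?p k)" using count_law[OF A, of k] by (simp add: emeasure_eq_measure m_def)
    finally show "emeasure (distr M (count_space UNIV) ?K) {k} = emeasure (density (count_space UNIV) (\<lambda>k. ennreal (?p k))) {k}"
      by (simp add: emeasure_density nn_integral_count_space_indicator[symmetric])
  qed auto
  have s: "(\<lambda>k. ?p k * a ^ k) sums (exp (- m) * exp (m * a))"
    using sums_mult[OF exp_converges[of "m * a"], of "exp (- m)"] by (simp add: power_mult_distrib field_simps)
  have sn: "summable (\<lambda>k. norm (?p k * a ^ k))"
    using summable_mult[OF summable_exp_generic[of "m * \<bar>a\<bar>"], of "exp (- m)"] m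
    by (simp add: power_mult_distrib abs_mult power_abs field_simps)
  have i: "integrable (count_space UNIV) (\<lambda>k. ?p k * a ^ k)" using sn by (simp add: integrable_count_space_nat_iff)
  have "integrable (distr M (count_space UNIV) ?K) (\<lambda>k. a ^ k)"
    unfolding D by (subst integrable_density) (use m i in auto)
  then show "integrable M (\<lambda>\<omega>. a ^ card (N \<omega> \<inter> A))" by (simp add: integrable_distr_eq)
  have "expectation (\<lambda>\<omega>. a ^ card (N \<omega> \<inter> A)) = (LINT k|distr M (count_space UNIV) ?K. a ^ k)"
    by (simp add: integral_distr)
  also have "\<dots> = (LINT k|count_space UNIV. ?p k * a ^ k)"
    unfolding D by (subst integral_density) (use m in auto)
  also have "\<dots> = exp (- m) * exp (m * a)" using integral_count_space_nat[OF i] sums_unique[OF s] by simp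
  also have "\<dots> = exp ((a - 1) * m)" by (simp add: exp_add[symmetric] algebra_simps)
  finally show "expectation (\<lambda>\<omega>. a ^ card (N \<omega> \<inter> A)) = exp ((a - 1) * measure \<mu> A)" by (simp add: m_def)
qed

text \<open>
  Written with the counts of the level sets of \<open>h\<close>, the product of \<open>1 + h y\<close> over the points is
  measurable everywhere, not just almost everywhere.
\<close>

definition Z :: "('y \<Rightarrow> real) \<Rightarrow> 'w \<Rightarrow> real" where
  "Z h \<omega> = (\<Prod>c\<in>h ` space \<mu> - {0}. (1 + c) ^ card (N \<omega> \<inter> {y \<in> space \<mu>. h y = c}))"

definition e :: "('y \<Rightarrow> real) \<Rightarrow> 'w \<Rightarrow> complex" where
  "e h \<omega> = complex_of_real (Z h \<omega> * exp (- (LINT y|\<mu>. h y)))"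

lemma level_sets:
  assumes h: "step_fun \<mu> h" and c: "c \<noteq> 0"
  shows "{y \<in> space \<mu>. h y = c} \<in> sets \<mu>" "emeasure \<mu> {y \<in> space \<mu>. h y = c} < \<infinity>"
proof -
  note [measurable] = step_fun_measurable[OF h]
  show "{y \<in> space \<mu>. h y = c} \<in> sets \<mu>" by measurable
  have "emeasure \<mu> {y \<in> space \<mu>. h y = c} \<le> emeasure \<mu> {y \<in> space \<mu>. h y \<noteq> 0}"
    using c by (intro emeasure_mono) auto
  then show "emeasure \<mu> {y \<in> space \<mu>. h y = c} < \<infinity>" using step_fun_supp[OF h] by simp
qed

lemma step_range: "step_fun \<mu> h \<Longrightarrow> finite (h ` space \<mu>)"
  by (simp add: step_fun_def simple_function_def)

lemma Z_meas: "step_fun \<mu> h \<Longrightarrow> Z h \<in> borel_measurable M"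
  unfolding Z_def
proof (rule borel_measurable_prod)
  fix c assume h: "step_fun \<mu> h" and c: "c \<in> h ` space \<mu> - {0}"
  show "(\<lambda>\<omega>. (1 + c) ^ card (N \<omega> \<inter> {y \<in> space \<mu>. h y = c})) \<in> borel_measurable M"
    by (rule measurable_compose[OF count_meas]) (use level_sets[OF h, of c] c in auto)
qed

lemma finite_supp:
  assumes h: "step_fun \<mu> h"
  shows "AE \<omega> in M. finite {y \<in> N \<omega>. h y \<noteq> 0}"
proof -
  note [measurable] = step_fun_measurable[OF h]
  have "AE \<omega> in M. finite (N \<omega> \<inter> {y \<in> space \<mu>. h y \<noteq> 0})" by (rule finite_N[OF _ step_fun_supp[OF h]]) measurable
  with AE_space show ?thesis
  proof eventually_elim
    case (elim \<omega>)
    have "{y \<in> N \<omega>. h y \<noteq> 0} = N \<omega> \<inter> {y \<in> space \<mu>. h y \<noteq> 0}" using N_space[OF elim(1)] by auto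
    then show ?case using elim(2) by simp
  qed
qed

text \<open>Finiteness of the support is assumed because \<open>card\<close> and \<open>prod\<close>
  take default values on infinite sets, and these values need not match.\<close>

lemma Z_prod:
  assumes h: "step_fun \<mu> h" and \<omega>: "\<omega> \<in> space M" and fin: "finite {y \<in> N \<omega>. h y \<noteq> 0}"
  shows "Z h \<omega> = (\<Prod>y\<in>{y \<in> N \<omega>. h y \<noteq> 0}. 1 + h y)"
proof -
  let ?S = "{y \<in> N \<omega>. h y \<noteq> 0}" and ?T = "h ` space \<mu> - {0}"
  have "(\<Prod>y\<in>?S. 1 + h y) = (\<Prod>c\<in>?T. \<Prod>y\<in>{y \<in> ?S. h y = c}. 1 + h y)"
    using N_space[OF \<omega>] by (intro prod.group[symmetric] fin) (auto simp: step_range[OF h])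
  also have "\<dots> = (\<Prod>c\<in>?T. (1 + c) ^ card (N \<omega> \<inter> {y \<in> space \<mu>. h y = c}))"
  proof (rule prod.cong[OF refl])
    fix c assume c: "c \<in> ?T"
    have "{y \<in> ?S. h y = c} = N \<omega> \<inter> {y \<in> space \<mu>. h y = c}" using c N_space[OF \<omega>] by auto
    moreover have "(\<Prod>y\<in>{y \<in> ?S. h y = c}. 1 + h y) = (\<Prod>y\<in>{y \<in> ?S. h y = c}. 1 + c)" by (rule prod.cong) auto
    ultimately show "(\<Prod>y\<in>{y \<in> ?S. h y = c}. 1 + h y) = (1 + c) ^ card (N \<omega> \<inter> {y \<in> space \<mu>. h y = c})" by simp
  qed
  finally show ?thesis by (simp add: Z_def)
qed

text \<open>Pointwise \<open>(1 + h) * (1 + k) = 1 + (h + k + h * k)\<close>. After normalization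
  the term \<open>h * k\<close> becomes the exponent in the inner product of two
  exponentials.\<close>

lemma Z_mult:
  assumes h: "step_fun \<mu> h" and k: "step_fun \<mu> k"
  shows "AE \<omega> in M. Z h \<omega> * Z k \<omega> = Z (\<lambda>y. h y + k y + h y * k y) \<omega>"
proof -
  have hk: "step_fun \<mu> (\<lambda>y. h y + k y + h y * k y)" by (rule step_fun_compose[OF h k]) simp
  show ?thesis
    using AE_space finite_supp[OF h] finite_supp[OF k]
  proof eventually_elim
    case (elim \<omega>)
    let ?F = "{y \<in> N \<omega>. h y \<noteq> 0} \<union> {y \<in> N \<omega>. k y \<noteq> 0}"
    have F: "finite ?F" using elim by simp
    have fin: "finite {y \<in> N \<omega>. h y + k y + h y * k y \<noteq> 0}" by (rule finite_subset[OF _ F]) auto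
    have "Z h \<omega> = (\<Prod>y\<in>?F. 1 + h y)" "Z k \<omega> = (\<Prod>y\<in>?F. 1 + k y)"
      unfolding Z_prod[OF h elim(1,2)] Z_prod[OF k elim(1,3)] using F by (auto intro!: prod.mono_neutral_left)
    moreover have "Z (\<lambda>y. h y + k y + h y * k y) \<omega> = (\<Prod>y\<in>?F. 1 + (h y + k y + h y * k y))"
      unfolding Z_prod[OF hk elim(1) fin] using F by (intro prod.mono_neutral_left) auto
    ultimately show ?case by (simp add: prod.distrib[symmetric] algebra_simps)
  qed
qed

lemma step_fun_integrable: "step_fun \<mu> h \<Longrightarrow> integrable \<mu> h"
  by (rule integrableI_simple_bochner_integrable)
     (auto simp: step_fun_def Bochner_Integration.simple_bochner_integrable.simps)

text \<open>The exponential formula for Poisson processes: the counts of the level sets are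
  independent, each contributes its generating function at \<open>1 + c\<close>, and the exponents
  add up to the integral.\<close>

lemma Z_expectation:
  assumes h: "step_fun \<mu> h"
  shows "integrable M (Z h)" "expectation (Z h) = exp (LINT y|\<mu>. h y)"
proof -
  note [measurable] = step_fun_measurable[OF h]
  let ?T = "h ` space \<mu> - {0}" and ?L = "\<lambda>c. {y \<in> space \<mu>. h y = c}"
  have fT: "finite ?T" using step_range[OF h] by simp
  obtain f where "bij_betw f {0..<card ?T} ?T" using ex_bij_betw_nat_finite[OF fT] by blast
  then have f: "bij_betw f {..<card ?T} ?T" by (simp add: atLeast0LessThan)
  let ?n = "card ?T"
  have fi: "f i \<in> ?T" if "i < ?n" for i using bij_betwE[OF f] that by auto
  have L: "?L (f i) \<in> sets \<mu>" "emeasure \<mu> (?L (f i)) < \<infinity>" if "i < ?n" for i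
    using level_sets[OF h, of "f i"] fi[OF that] by auto
  have disj: "disjoint_family_on (\<lambda>i. ?L (f i)) {..<?n}"
    using bij_betw_imp_inj_on[OF f] by (auto simp: disjoint_family_on_def inj_on_def)
  have ind: "indep_vars (\<lambda>_. borel) (\<lambda>i \<omega>. (1 + f i) ^ card (N \<omega> \<inter> ?L (f i))) {..<?n}"
    by (rule indep_vars_compose2[OF indep_counts[OF L disj]]) auto
  have Zf: "Z h = (\<lambda>\<omega>. \<Prod>i<?n. (1 + f i) ^ card (N \<omega> \<inter> ?L (f i)))"
    unfolding Z_def[abs_def] prod.reindex_bij_betw[OF f, of "\<lambda>c. (1 + c) ^ card (N _ \<inter> ?L c)", symmetric] ..
  have pgf: "integrable M (\<lambda>\<omega>. (1 + f i) ^ card (N \<omega> \<inter> ?L (f i)))"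
    "expectation (\<lambda>\<omega>. (1 + f i) ^ card (N \<omega> \<inter> ?L (f i))) = exp (f i * measure \<mu> (?L (f i)))" if "i < ?n" for i
    using count_pgf[OF L[OF that], of "1 + f i"] by auto
  show "integrable M (Z h)"
    unfolding Zf by (rule indep_vars_integrable[OF _ ind]) (use pgf in auto)
  have "expectation (Z h) = (\<Prod>i<?n. expectation (\<lambda>\<omega>. (1 + f i) ^ card (N \<omega> \<inter> ?L (f i))))"
    unfolding Zf by (rule indep_vars_lebesgue_integral[OF _ ind]) (use pgf in auto)
  also have "\<dots> = (\<Prod>i<?n. exp (f i * measure \<mu> (?L (f i))))" by (rule prod.cong) (use pgf in auto)
  also have "\<dots> = exp (\<Sum>i<?n. f i * measure \<mu> (?L (f i)))" by (simp add: exp_sum)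
  also have "(\<Sum>i<?n. f i * measure \<mu> (?L (f i))) = (\<Sum>c\<in>?T. c * measure \<mu> (?L c))"
    by (rule sum.reindex_bij_betw[OF f])
  also have "\<dots> = (LINT y|\<mu>. h y)"
  proof -
    have "(LINT y|\<mu>. h y) = (LINT y|\<mu>. (\<Sum>c\<in>?T. c * indicator (?L c) y))"
    proof (rule Bochner_Integration.integral_cong[OF refl])
      fix y assume y: "y \<in> space \<mu>"
      have "(\<Sum>c\<in>?T. c * indicator (?L c) y) = (\<Sum>c\<in>?T. if c = h y then h y else 0)"
        using y by (intro sum.cong) (auto simp: indicator_def)
      then show "h y = (\<Sum>c\<in>?T. c * indicator (?L c) y)" using fT y by simp
    qed
    also have "\<dots> = (\<Sum>c\<in>?T. c * measure \<mu> (?L c))"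
      by (subst Bochner_Integration.integral_sum) (use level_sets[OF h] in \<open>auto simp: Int_def intro!: sum.cong arg_cong[where f="measure \<mu>"]\<close>)
    finally show ?thesis by simp
  qed
  finally show "expectation (Z h) = exp (LINT y|\<mu>. h y)" .
qed

lemma e_meas: "step_fun \<mu> h \<Longrightarrow> e h \<in> borel_measurable M"
  unfolding e_def[abs_def] using Z_meas[of h] by simp

lemma e_L2': 
  assumes h: "step_fun \<mu> h"
  shows "e h \<in> L2 M"
proof (rule L2_I[OF e_meas[OF h]])
  note [measurable] = e_meas[OF h]
  let ?k = "\<lambda>y. h y + h y + h y * h y"
  have k: "step_fun \<mu> ?k" by (rule step_fun_compose[OF h h]) simp
  note [measurable] = Z_meas[OF k]
  have ae: "AE \<omega> in M. (norm (e h \<omega>))\<^sup>2 = (exp (- (LINT y|\<mu>. h y)))\<^sup>2 * Z ?k \<omega>"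
    using Z_mult[OF h h] by eventually_elim (simp add: e_def norm_mult power_mult_distrib power2_eq_square[of "Z h _"] mult_ac)
  show "integrable M (\<lambda>\<omega>. (norm (e h \<omega>))\<^sup>2)"
    by (subst integrable_cong_AE[OF _ _ ae]) (use Z_expectation(1)[OF k] in auto)
qed

lemma e_prod:
  assumes h: "step_fun \<mu> h" and k: "step_fun \<mu> k"
  shows "aeq M (\<lambda>\<omega>. e h \<omega> * e k \<omega>) (\<lambda>\<omega>. complex_of_real (exp (LINT y|\<mu>. h y * k y)) * e (\<lambda>y. h y + k y + h y * k y) \<omega>)"
  using Z_mult[OF h k] unfolding aeq_def
proof eventually_elim
  case (elim \<omega>)
  have i: "integrable \<mu> h" "integrable \<mu> k" "integrable \<mu> (\<lambda>y. h y * k y)"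
    by (intro step_fun_integrable h k step_fun_integrable_mult)+
  have "(LINT y|\<mu>. h y + k y + h y * k y) = (LINT y|\<mu>. h y) + (LINT y|\<mu>. k y) + (LINT y|\<mu>. h y * k y)" using i by simp
  then have x: "exp (- (LINT y|\<mu>. h y)) * exp (- (LINT y|\<mu>. k y)) = exp (LINT y|\<mu>. h y * k y) * exp (- (LINT y|\<mu>. h y + k y + h y * k y))"
    by (simp add: exp_add[symmetric])
  have "e h \<omega> * e k \<omega> = complex_of_real ((Z h \<omega> * Z k \<omega>) * (exp (- (LINT y|\<mu>. h y)) * exp (- (LINT y|\<mu>. k y))))"
    by (simp add: e_def mult_ac)
  also have "\<dots> = complex_of_real (Z (\<lambda>y. h y + k y + h y * k y) \<omega> * (exp (LINT y|\<mu>. h y * k y) * exp (- (LINT y|\<mu>. h y + k y + h y * k y))))"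
    by (simp only: elim x)
  finally show ?case by (simp add: e_def mult_ac)
qed

lemma e_inner':
  assumes h: "step_fun \<mu> h" and k: "step_fun \<mu> k"
  shows "L2_inner M (e h) (e k) = complex_of_real (exp (LINT y|\<mu>. h y * k y))"
proof -
  have hk: "step_fun \<mu> (\<lambda>y. h y + k y + h y * k y)" by (rule step_fun_compose[OF h k]) simp
  note [measurable] = e_meas[OF h] e_meas[OF k] e_meas[OF hk]
  have "L2_inner M (e h) (e k) = (LINT \<omega>|M. e h \<omega> * e k \<omega>)" by (simp add: L2_inner_def e_def)
  also have "\<dots> = (LINT \<omega>|M. complex_of_real (exp (LINT y|\<mu>. h y * k y)) * e (\<lambda>y. h y + k y + h y * k y) \<omega>)"
    by (rule integral_cong_AE) (use e_prod[OF h k] in \<open>auto simp: aeq_def\<close>)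
  also have "\<dots> = complex_of_real (exp (LINT y|\<mu>. h y * k y)) * (LINT \<omega>|M. e (\<lambda>y. h y + k y + h y * k y) \<omega>)" by simp
  also have "(LINT \<omega>|M. e (\<lambda>y. h y + k y + h y * k y) \<omega>) = 1"
    using Z_expectation[OF hk] by (simp add: e_def exp_minus)
  finally show ?thesis by simp
qed

section \<open>Locality and totality of the Poisson exponentials\<close>

abbreviation ploc where "ploc \<equiv> poisson_loc \<mu> M N"

lemma ploc_gen: "{{\<omega> \<in> space M. card (N \<omega> \<inter> B) = k} | B k. B \<in> sets \<mu> \<and> B \<subseteq> A \<and> emeasure \<mu> B < \<infinity>} \<subseteq> sets M"
proof clarify
  fix B and k :: nat assume "B \<in> sets \<mu>" "emeasure \<mu> B < \<infinity>"
  note [measurable] = count_meas[OF this]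
  show "{\<omega> \<in> space M. card (N \<omega> \<inter> B) = k} \<in> sets M" by measurable
qed

lemma space_ploc: "space (ploc A) = space M"
  by (simp add: poisson_loc_def space_measure_of_conv)

lemma sets_ploc: "sets (ploc A) = sigma_sets (space M) {{\<omega> \<in> space M. card (N \<omega> \<inter> B) = k} | B k. B \<in> sets \<mu> \<and> B \<subseteq> A \<and> emeasure \<mu> B < \<infinity>}"
  unfolding poisson_loc_def by (rule sets_measure_of) auto

lemma subalg_ploc: "subalgebra M (ploc A)"
  unfolding subalgebra_def sets_ploc using space_ploc sets.sigma_sets_subset[OF ploc_gen] by blast

lemma ploc_mono: "A \<subseteq> B \<Longrightarrow> sets (ploc A) \<subseteq> sets (ploc B)"
  unfolding sets_ploc by (rule sigma_sets_mono') blast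

lemma count_ploc:
  assumes "B \<in> sets \<mu>" "B \<subseteq> A" "emeasure \<mu> B < \<infinity>"
  shows "(\<lambda>\<omega>. card (N \<omega> \<inter> B)) \<in> measurable (ploc A) (count_space UNIV)"
  unfolding measurable_count_space_eq2_countable
proof (intro conjI ballI)
  fix k
  have "(\<lambda>\<omega>. card (N \<omega> \<inter> B)) -` {k} \<inter> space (ploc A) = {\<omega> \<in> space M. card (N \<omega> \<inter> B) = k}" by (auto simp: space_ploc)
  then show "(\<lambda>\<omega>. card (N \<omega> \<inter> B)) -` {k} \<inter> space (ploc A) \<in> sets (ploc A)"
    unfolding sets_ploc using assms by (auto intro!: sigma_sets.Basic)
qed auto

lemma e_local':
  assumes h: "step_fun \<mu> h" and A: "\<And>y. y \<in> space \<mu> - A \<Longrightarrow> h y = 0"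
  shows "e h \<in> local_L2 M ploc A"
proof -
  have "Z h \<in> borel_measurable (ploc A)"
    unfolding Z_def[abs_def]
  proof (rule borel_measurable_prod)
    fix c assume c: "c \<in> h ` space \<mu> - {0}"
    have "{y \<in> space \<mu>. h y = c} \<subseteq> A" using c A by force
    then show "(\<lambda>\<omega>. (1 + c) ^ card (N \<omega> \<inter> {y \<in> space \<mu>. h y = c})) \<in> borel_measurable (ploc A)"
      by (intro measurable_compose[OF count_ploc]) (use level_sets[OF h, of c] c in auto)
  qed
  then have "e h \<in> borel_measurable (ploc A)" unfolding e_def[abs_def] by simp
  with e_L2'[OF h] show ?thesis unfolding local_L2_eq using aeq_refl by blast
qed

lemma e_zero': "aeq M (e (\<lambda>_. 0)) (\<lambda>_. 1)"
proof -
  have "(\<lambda>_. 0 :: real) ` space \<mu> - {0} = {}" by auto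
  then have "e (\<lambda>_. 0) \<omega> = 1" for \<omega> by (simp add: e_def Z_def)
  then show ?thesis by (simp add: aeq_def)
qed

lemma step_fun_indicator: "B \<in> sets \<mu> \<Longrightarrow> emeasure \<mu> B < \<infinity> \<Longrightarrow> step_fun \<mu> (\<lambda>y. c * indicator B y)"
proof -
  assume B: "B \<in> sets \<mu>" "emeasure \<mu> B < \<infinity>"
  have "emeasure \<mu> {y \<in> space \<mu>. c * indicator B y \<noteq> (0 :: real)} \<le> emeasure \<mu> B"
    using B by (intro emeasure_mono) (auto simp: indicator_def)
  also have "\<dots> < \<infinity>" by (rule B)
  finally show ?thesis using B unfolding step_fun_def by (intro conjI simple_function_mult simple_function_indicator) auto
qed

text \<open>The exponential of the function equal to -1/2 on \<open>B\<close> is a constant times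
  1/2 to the power of the count of \<open>B\<close>. This power is bounded, hence usable as a
  multiplier, and it determines the count, so its level sets are the generating events.\<close>

lemma e_total':
  assumes V: "closed_subspace M V"
    and eV: "\<And>h. step_fun \<mu> h \<Longrightarrow> (\<And>y. y \<in> space \<mu> - A \<Longrightarrow> h y = 0) \<Longrightarrow> e h \<in> V"
  shows "local_L2 M ploc A \<subseteq> V"
proof -
  define D where "D = {e h | h. step_fun \<mu> h \<and> (\<forall>y\<in>space \<mu> - A. h y = 0)}"
  let ?U = "cspan M D"
  have D: "D \<subseteq> L2 M" unfolding D_def using e_L2' by blast
  note U = cspan_closed[OF D]
  have eU: "e h \<in> ?U" if "step_fun \<mu> h" "\<And>y. y \<in> space \<mu> - A \<Longrightarrow> h y = 0" for h
    using subsetD[OF cspan_superset, of "e h" D M] that by (auto simp: D_def)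
  have one: "(\<lambda>_. 1) \<in> ?U" by (rule closed_subspace_aeq[OF U eU[OF step_fun_zero] e_zero']) auto
  have gen: "{{\<omega> \<in> space M. card (N \<omega> \<inter> B) = k} | B k. B \<in> sets \<mu> \<and> B \<subseteq> A \<and> emeasure \<mu> B < \<infinity>} \<subseteq> multiplier_sets M ?U"
  proof clarify
    fix B and n :: nat assume B: "B \<in> sets \<mu>" "B \<subseteq> A" "emeasure \<mu> B < \<infinity>"
    note [measurable] = count_meas[OF B(1,3)]
    let ?b = "\<lambda>y. (-1/2) * indicator B y :: real"
    have b: "step_fun \<mu> ?b" by (rule step_fun_indicator[OF B(1,3)])
    let ?f = "\<lambda>\<omega>. (1/2 :: real) ^ card (N \<omega> \<inter> B)"
    have bsupp: "{y \<in> X. ?b y \<noteq> 0} = X \<inter> B" for X by (auto simp: indicator_def)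
    have Zb: "AE \<omega> in M. Z ?b \<omega> = ?f \<omega>"
      using AE_space finite_N[OF B(1,3)]
    proof eventually_elim
      case (elim \<omega>)
      have "Z ?b \<omega> = (\<Prod>y\<in>N \<omega> \<inter> B. 1 + ?b y)" using Z_prod[OF b elim(1)] elim(2) unfolding bsupp by blast
      also have "\<dots> = (\<Prod>y\<in>N \<omega> \<inter> B. 1/2)" by (rule prod.cong) auto
      finally show ?case by simp
    qed
    have fm: "?f \<in> borel_measurable M" by (rule measurable_compose[OF count_meas[OF B(1,3)]]) simp
    have f: "?f \<in> multipliers M ?U"
    proof (rule multipliersI_cspan[OF D, where C=1])
      show "\<bar>?f \<omega>\<bar> \<le> 1" for \<omega> by (simp add: power_le_one power_abs[symmetric])
      fix g assume "g \<in> D"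
      then obtain k where k: "g = e k" "step_fun \<mu> k" "\<forall>y\<in>space \<mu> - A. k y = 0" by (auto simp: D_def)
      let ?k = "\<lambda>y. ?b y + k y + ?b y * k y"
      have sk: "step_fun \<mu> ?k" by (rule step_fun_compose[OF b k(2)]) simp
      have "e ?k \<in> ?U" by (rule eU[OF sk]) (use k(3) B(2) in \<open>auto simp: indicator_def\<close>)
      then have "(\<lambda>\<omega>. complex_of_real (exp (LINT y|\<mu>. ?b y) * exp (LINT y|\<mu>. ?b y * k y)) * e ?k \<omega>) \<in> ?U"
        by (rule closed_subspace_cmult[OF U])
      moreover have "aeq M (\<lambda>\<omega>. complex_of_real (exp (LINT y|\<mu>. ?b y) * exp (LINT y|\<mu>. ?b y * k y)) * e ?k \<omega>) (\<lambda>\<omega>. complex_of_real (?f \<omega>) * e k \<omega>)"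
        using e_prod[OF b k(2)] Zb unfolding aeq_def
      proof eventually_elim
        case (elim \<omega>)
        have "complex_of_real (?f \<omega>) = complex_of_real (exp (LINT y|\<mu>. ?b y)) * e ?b \<omega>"
          unfolding e_def elim(2) of_real_mult[symmetric] by (simp add: exp_minus)
        then have "complex_of_real (?f \<omega>) * e k \<omega> = complex_of_real (exp (LINT y|\<mu>. ?b y)) * (e ?b \<omega> * e k \<omega>)" by (simp only: mult.assoc)
        then show ?case unfolding elim(1) by (simp only: of_real_mult mult.assoc)
      qed
      ultimately show "(\<lambda>\<omega>. complex_of_real (?f \<omega>) * g \<omega>) \<in> ?U"
        unfolding k(1) by (rule closed_subspace_aeq[OF U]) (use e_meas[OF k(2)] in measurable)
    qed (rule fm, simp)
    have "?f -` {(1/2) ^ n} \<inter> space M \<in> multiplier_sets M ?U"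
      by (rule multiplier_sets_limit[OF U f, where c="\<lambda>_. 1"]) auto
    also have "?f -` {(1/2) ^ n} \<inter> space M = {\<omega> \<in> space M. card (N \<omega> \<inter> B) = n}"
      by (auto simp: power_divide)
    finally show "{\<omega> \<in> space M. card (N \<omega> \<inter> B) = n} \<in> multiplier_sets M ?U" .
  qed
  have "local_L2 M ploc A \<subseteq> ?U"
    by (rule local_L2_subset_multiplier[OF U one _ gen]) (simp add: poisson_loc_def)
  also have "?U \<subseteq> V" by (rule cspan_minimal[OF V]) (use eV in \<open>auto simp: D_def\<close>)
  finally show ?thesis .
qed

sublocale E: exp_system M \<mu> ploc e
proof
  fix A B :: "'y set" and h k :: "'y \<Rightarrow> real"
  show "subalgebra M (ploc A)" by (rule subalg_ploc)
  show "A \<subseteq> B \<Longrightarrow> sets (ploc A) \<subseteq> sets (ploc B)" by (rule ploc_mono)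
  show "aeq M (e (\<lambda>_. 0)) (\<lambda>_. 1)" by (rule e_zero')
  show "e h \<in> local_L2 M ploc A" if "step_fun \<mu> h" "\<And>y. y \<in> space \<mu> - A \<Longrightarrow> h y = 0" by (rule e_local'[OF that])
  show "real_valued M (e h)" by (simp add: real_valued_def e_def)
  show "aeq M (e (\<lambda>y. h y + k y)) (\<lambda>\<omega>. e h \<omega> * e k \<omega>)" if hk: "step_fun \<mu> h" "step_fun \<mu> k" "\<And>y. y \<in> space \<mu> \<Longrightarrow> h y * k y = 0"
  proof -
    have "(LINT y|\<mu>. h y * k y) = (LINT y|\<mu>. 0)" by (rule Bochner_Integration.integral_cong) (use hk(3) in auto)
    \<comment> \<open>The two functions agree on \<open>space \<mu>\<close> only, and
      \<open>e\<close> sees nothing else.\<close>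
    moreover have "e (\<lambda>y. h y + k y + h y * k y) \<omega> = e (\<lambda>y. h y + k y) \<omega>" for \<omega>
    proof -
      have "(\<lambda>y. h y + k y + h y * k y) ` space \<mu> = (\<lambda>y. h y + k y) ` space \<mu>" by (rule image_cong) (use hk(3) in auto)
      moreover have "{y \<in> space \<mu>. h y + k y + h y * k y = c} = {y \<in> space \<mu>. h y + k y = c}" for c using hk(3) by auto
      moreover have "(LINT y|\<mu>. h y + k y + h y * k y) = (LINT y|\<mu>. h y + k y)"
        by (rule Bochner_Integration.integral_cong) (use hk(3) in auto)
      ultimately show ?thesis unfolding e_def Z_def by simp
    qed
    ultimately show ?thesis using aeq_sym[OF e_prod[OF hk(1,2)]] by simp
  qed
  show "L2_inner M (e h) (e k) = complex_of_real (exp (LINT y|\<mu>. h y * k y))" if "step_fun \<mu> h" "step_fun \<mu> k"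
    by (rule e_inner'[OF that])
  show "local_L2 M ploc A \<subseteq> V" if "closed_subspace M V" "\<And>h. step_fun \<mu> h \<Longrightarrow> (\<And>y. y \<in> space \<mu> - A \<Longrightarrow> h y = 0) \<Longrightarrow> e h \<in> V" for V
    by (rule e_total'[OF that])
qed

section \<open>Sums and products over the configuration for integrable functions\<close>

lemma sum_le_prod_plus1:
  fixes a :: "'y \<Rightarrow> real"
  assumes "finite F" "\<And>y. y \<in> F \<Longrightarrow> 0 \<le> a y"
  shows "(\<Sum>y\<in>F. a y) \<le> (\<Prod>y\<in>F. 1 + a y)"
proof -
  have "1 + (\<Sum>y\<in>F. a y) \<le> (\<Prod>y\<in>F. 1 + a y)"
    using assms
  proof induction
    case (insert z F)
    have "1 + (a z + sum a F) \<le> (1 + a z) * (1 + sum a F)"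
      using insert by (simp add: algebra_simps sum_nonneg)
    also have "\<dots> \<le> (1 + a z) * (\<Prod>y\<in>F. 1 + a y)" using insert by (intro mult_left_mono) auto
    finally show ?case using insert by simp
  qed simp
  then show ?thesis by simp
qed

text \<open>A sum of absolute values is at most the product of the numbers increased by 1, and the
  mean of such a product is controlled by the exponential formula. Fatou's lemma passes from step
  functions to \<open>h\<close>.\<close>

lemma AE_summable:
  fixes h :: "'y \<Rightarrow> real"
  assumes h: "integrable \<mu> h"
  shows "AE \<omega> in M. (\<lambda>y. \<bar>h y\<bar>) summable_on N \<omega>"
proof -
  note [measurable] = borel_measurable_integrable[OF h]
  obtain f where f: "\<And>n. step_fun \<mu> (f n)" "\<And>y. y \<in> space \<mu> \<Longrightarrow> (\<lambda>n. f n y) \<longlonglongrightarrow> h y"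
    "\<And>n y. y \<in> space \<mu> \<Longrightarrow> \<bar>f n y\<bar> \<le> 2 * \<bar>h y\<bar>"
    using step_fun_approx[OF _ disjI2[OF h]] by auto
  have a: "step_fun \<mu> (\<lambda>y. \<bar>f n y\<bar>)" for n by (rule step_fun_compose[OF f(1) f(1), where p="\<lambda>x _. \<bar>x\<bar>"]) simp
  let ?Z = "\<lambda>n \<omega>. Z (\<lambda>y. \<bar>f n y\<bar>) \<omega>"
  note [measurable] = Z_meas[OF a]
  have Z0: "0 \<le> ?Z n \<omega>" for n \<omega> unfolding Z_def by (intro prod_nonneg) auto
  have "(\<integral>\<^sup>+\<omega>. liminf (\<lambda>n. ennreal (?Z n \<omega>)) \<partial>M) \<le> liminf (\<lambda>n. \<integral>\<^sup>+\<omega>. ennreal (?Z n \<omega>) \<partial>M)"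
    by (rule nn_integral_liminf) auto
  also have "\<dots> \<le> ennreal (exp (LINT y|\<mu>. 2 * \<bar>h y\<bar>))"
  proof (rule Liminf_le)
    show "eventually (\<lambda>n. (\<integral>\<^sup>+\<omega>. ennreal (?Z n \<omega>) \<partial>M) \<le> ennreal (exp (LINT y|\<mu>. 2 * \<bar>h y\<bar>))) sequentially"
    proof (intro always_eventually allI)
      fix n
      have "(\<integral>\<^sup>+\<omega>. ennreal (?Z n \<omega>) \<partial>M) = ennreal (exp (LINT y|\<mu>. \<bar>f n y\<bar>))"
        using nn_integral_eq_integral[OF Z_expectation(1)[OF a[of n]]] Z_expectation(2)[OF a[of n]]
        by (simp add: Z0)
      also have "\<dots> \<le> ennreal (exp (LINT y|\<mu>. 2 * \<bar>h y\<bar>))"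
        by (intro ennreal_leI, simp only: exp_le_cancel_iff, rule integral_mono[OF step_fun_integrable[OF a[of n]]])
           (use f(3) h in auto)
      finally show "(\<integral>\<^sup>+\<omega>. ennreal (?Z n \<omega>) \<partial>M) \<le> ennreal (exp (LINT y|\<mu>. 2 * \<bar>h y\<bar>))" .
    qed
  qed simp
  also have "\<dots> < \<infinity>" by simp
  finally have "AE \<omega> in M. liminf (\<lambda>n. ennreal (?Z n \<omega>)) \<noteq> \<infinity>"
    by (intro nn_integral_PInf_AE) auto
  moreover have "AE \<omega> in M. \<forall>n. finite {y \<in> N \<omega>. \<bar>f n y\<bar> \<noteq> 0}"
    unfolding AE_all_countable using finite_supp[OF a] by blast
  ultimately show ?thesis using AE_space
  proof eventually_elim
    case (elim \<omega>)
    then obtain L where L: "liminf (\<lambda>n. ennreal (?Z n \<omega>)) = ennreal L" "0 \<le> L" by (cases "liminf (\<lambda>n. ennreal (?Z n \<omega>))") auto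
    have "(\<Sum>y\<in>F. \<bar>h y\<bar>) \<le> L" if F: "F \<subseteq> N \<omega>" "finite F" for F
    proof -
      have FS: "F \<subseteq> space \<mu>" using F N_space[OF elim(3)] by blast
      have "(\<lambda>n. ennreal (\<Sum>y\<in>F. \<bar>f n y\<bar>)) \<longlonglongrightarrow> ennreal (\<Sum>y\<in>F. \<bar>h y\<bar>)"
        using FS by (intro tendsto_ennrealI tendsto_sum tendsto_rabs f(2)) auto
      from lim_imp_Liminf[OF _ this] have "ennreal (\<Sum>y\<in>F. \<bar>h y\<bar>) = liminf (\<lambda>n. ennreal (\<Sum>y\<in>F. \<bar>f n y\<bar>))" by simp
      also have "\<dots> \<le> liminf (\<lambda>n. ennreal (?Z n \<omega>))"
      proof (rule Liminf_mono, intro always_eventually allI ennreal_leI)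
        fix n
        let ?S = "{y \<in> N \<omega>. \<bar>f n y\<bar> \<noteq> 0}"
        have fin: "finite ?S" using elim(2) by blast
        have "(\<Sum>y\<in>F. \<bar>f n y\<bar>) \<le> (\<Sum>y\<in>F \<union> ?S. \<bar>f n y\<bar>)" using F fin by (intro sum_mono2) auto
        also have "\<dots> \<le> (\<Prod>y\<in>F \<union> ?S. 1 + \<bar>f n y\<bar>)" using F fin by (intro sum_le_prod_plus1) auto
        also have "\<dots> = (\<Prod>y\<in>?S. 1 + \<bar>f n y\<bar>)" using F fin by (intro prod.mono_neutral_right) auto
        also have "\<dots> = ?Z n \<omega>" by (rule Z_prod[OF a elim(3) fin, symmetric])
        finally show "(\<Sum>y\<in>F. \<bar>f n y\<bar>) \<le> ?Z n \<omega>" .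
      qed
      finally show ?thesis unfolding L(1) using L(2) by (simp add: ennreal_le_iff)
    qed
    then show ?case by (intro nonneg_bdd_above_summable_on) (auto simp: bdd_above_def)
  qed
qed

lemma AE_limits:
  fixes h :: "'y \<Rightarrow> real"
  assumes h: "integrable \<mu> h" and f: "\<And>n. step_fun \<mu> (f n)" "\<And>y. y \<in> space \<mu> \<Longrightarrow> (\<lambda>n. f n y) \<longlonglongrightarrow> h y"
    "\<And>n y. y \<in> space \<mu> \<Longrightarrow> \<bar>f n y\<bar> \<le> 2 * \<bar>h y\<bar>"
  shows "AE \<omega> in M. (\<lambda>n. e (f n) \<omega>) \<longlonglongrightarrow> complex_of_real (config_prod (N \<omega>) (\<lambda>y. 1 + h y) * exp (- (LINT y|\<mu>. h y)))"
    and "AE \<omega> in M. (\<lambda>n. complex_of_real ((\<Sum>y\<in>{y \<in> N \<omega>. f n y \<noteq> 0}. f n y) - (LINT y|\<mu>. f n y)))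
       \<longlonglongrightarrow> complex_of_real ((\<Sum>\<^sub>\<infinity>y\<in>N \<omega>. h y) - (LINT y|\<mu>. h y))"
proof -
  note [measurable] = borel_measurable_integrable[OF h] step_fun_measurable[OF f(1)]
  have I: "(\<lambda>n. LINT y|\<mu>. f n y) \<longlonglongrightarrow> (LINT y|\<mu>. h y)"
    by (rule integral_dominated_convergence[where w="\<lambda>y. 2 * \<bar>h y\<bar>"]) (use h f in auto)
  have "AE \<omega> in M. \<forall>n. finite {y \<in> N \<omega>. f n y \<noteq> 0}"
    unfolding AE_all_countable using finite_supp[OF f(1)] by blast
  with AE_space AE_summable[OF h] have *: "AE \<omega> in M. \<omega> \<in> space M \<and> (\<lambda>y. \<bar>h y\<bar>) summable_on N \<omega> \<and> (\<forall>n. finite {y \<in> N \<omega>. f n y \<noteq> 0})"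
    by eventually_elim simp
  have lim: "y \<in> N \<omega> \<Longrightarrow> (\<lambda>n. f n y) \<longlonglongrightarrow> h y" "y \<in> N \<omega> \<Longrightarrow> \<bar>f n y\<bar> \<le> 2 * \<bar>h y\<bar>" if "\<omega> \<in> space M" for \<omega> n y
    using N_space[OF that] f(2,3) by blast+
  show "AE \<omega> in M. (\<lambda>n. e (f n) \<omega>) \<longlonglongrightarrow> complex_of_real (config_prod (N \<omega>) (\<lambda>y. 1 + h y) * exp (- (LINT y|\<mu>. h y)))"
    using *
  proof eventually_elim
    case (elim \<omega>)
    then have \<omega>: "\<omega> \<in> space M" and s: "(\<lambda>y. \<bar>h y\<bar>) summable_on N \<omega>" and fin: "\<And>n. finite {y \<in> N \<omega>. f n y \<noteq> 0}" by auto
    show ?case unfolding e_def Z_prod[OF f(1) \<omega> fin]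
      by (intro tendsto_intros I config_limits(1)[OF s lim[OF \<omega>] fin])
  qed
  show "AE \<omega> in M. (\<lambda>n. complex_of_real ((\<Sum>y\<in>{y \<in> N \<omega>. f n y \<noteq> 0}. f n y) - (LINT y|\<mu>. f n y)))
       \<longlonglongrightarrow> complex_of_real ((\<Sum>\<^sub>\<infinity>y\<in>N \<omega>. h y) - (LINT y|\<mu>. h y))"
    using *
  proof eventually_elim
    case (elim \<omega>)
    then have \<omega>: "\<omega> \<in> space M" and s: "(\<lambda>y. \<bar>h y\<bar>) summable_on N \<omega>" and fin: "\<And>n. finite {y \<in> N \<omega>. f n y \<noteq> 0}" by auto
    show ?case by (intro tendsto_intros I config_limits(2)[OF s lim[OF \<omega>] fin])
  qed
qed

lemma prod_deriv_0:
  fixes h :: "'y \<Rightarrow> real"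
  assumes "finite F"
  shows "((\<lambda>x. \<Prod>y\<in>F. 1 + x * h y) has_field_derivative (\<Sum>y\<in>F. h y)) (at 0)"
  using assms
proof induction
  case (insert z F)
  have "((\<lambda>x. (1 + x * h z) * (\<Prod>y\<in>F. 1 + x * h y)) has_field_derivative (h z * (\<Prod>y\<in>F. 1 + 0 * h y) + (\<Sum>y\<in>F. h y) * (1 + 0 * h z))) (at 0)"
    by (rule DERIV_mult[OF _ insert.IH]) (auto intro!: derivative_eq_intros)
  then show ?case using insert by simp
qed simp

text \<open>Derivative at 0 of a finite product times the normalizing factor: the centred sum of
  \<open>h\<close>, which is the Poisson counterpart of \<open>W h\<close>.\<close>

lemma e_deriv:
  assumes h: "step_fun \<mu> h"
  shows "AE \<omega> in M. (\<lambda>n. complex_of_real (real (Suc n)) * (e (\<lambda>y. h y / real (Suc n)) \<omega> - 1))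
     \<longlonglongrightarrow> complex_of_real ((\<Sum>y\<in>{y \<in> N \<omega>. h y \<noteq> 0}. h y) - (LINT y|\<mu>. h y))"
  using AE_space finite_supp[OF h]
proof eventually_elim
  case (elim \<omega>)
  let ?F = "{y \<in> N \<omega>. h y \<noteq> 0}" and ?I = "LINT y|\<mu>. h y"
  let ?g = "\<lambda>x. (\<Prod>y\<in>?F. 1 + x * h y) * exp (- (x * ?I))"
  let ?s = "\<lambda>n. 1 / real (Suc n)"
  have "(?g has_field_derivative ((\<Sum>y\<in>?F. h y) * exp (- (0 * ?I)) + (- ?I) * (\<Prod>y\<in>?F. 1 + 0 * h y))) (at 0)"
    by (rule DERIV_mult[OF prod_deriv_0[OF elim(2)]]) (auto intro!: derivative_eq_intros)
  then have "((\<lambda>x. (?g x - 1) / x) \<longlongrightarrow> (\<Sum>y\<in>?F. h y) - ?I) (at 0)" by (simp add: has_field_derivative_iff)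
  moreover have "filterlim ?s (at 0) sequentially"
    unfolding filterlim_at using LIMSEQ_Suc[OF lim_1_over_n] by auto
  ultimately have lim: "(\<lambda>n. (?g (?s n) - 1) / ?s n) \<longlonglongrightarrow> (\<Sum>y\<in>?F. h y) - ?I" by (rule filterlim_compose)
  have X: "complex_of_real (real (Suc n)) * (e (\<lambda>y. h y / real (Suc n)) \<omega> - 1) = complex_of_real ((?g (?s n) - 1) / ?s n)" for n
  proof -
    have st: "step_fun \<mu> (\<lambda>y. h y / real (Suc n))" by (rule step_fun_compose[OF h h, where p="\<lambda>x _. x / real (Suc n)"]) simp
    have eq: "{y \<in> N \<omega>. h y / real (Suc n) \<noteq> 0} = ?F" by auto
    have "Z (\<lambda>y. h y / real (Suc n)) \<omega> = (\<Prod>y\<in>?F. 1 + ?s n * h y)"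
      using Z_prod[OF st elim(1)] elim(2) unfolding eq by simp
    then have "e (\<lambda>y. h y / real (Suc n)) \<omega> = complex_of_real (?g (?s n))" by (simp add: e_def del: of_nat_Suc)
    then show ?thesis by (simp del: of_nat_Suc)
  qed
  show ?case unfolding X using tendsto_of_real[OF lim, where 'a=complex] .
qed

end

section \<open>Levy measures and partitions of the base\<close>

text \<open>Away from 0 the integrand is bounded below, so the sets given by
  \<open>\<bar>t\<bar> \<ge> 1 / real (Suc n)\<close> have finite measure; together with the null
  set \<open>{0}\<close> they exhaust the line.\<close>

lemma sigma_finite_levy:
  fixes \<Lambda> :: "real measure"
  assumes sets: "sets \<Lambda> = sets borel" and 0: "emeasure \<Lambda> {0} = 0"
    and fin: "(\<integral>\<^sup>+ t. ennreal (t\<^sup>2 / (1 + t\<^sup>2)) \<partial>\<Lambda>) < \<infinity>"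
  shows "sigma_finite_measure \<Lambda>"
proof
  define C where "C n = {t :: real. \<bar>t\<bar> \<ge> 1 / real (Suc n)}" for n
  have [measurable_cong]: "sets \<Lambda> = sets borel" by (rule sets)
  have sp: "space \<Lambda> = UNIV" using sets_eq_imp_space_eq[OF sets] by simp
  have Cm: "C n \<in> sets \<Lambda>" for n unfolding C_def sets by measurable
  have "emeasure \<Lambda> (C n) \<noteq> \<infinity>" for n
  proof -
    define \<delta> where "\<delta> = 1 / real (Suc n)"
    define c where "c = \<delta>\<^sup>2 / (1 + \<delta>\<^sup>2)"
    have \<delta>: "\<delta> > 0" by (simp add: \<delta>_def)
    then have c: "c > 0" by (simp add: c_def add_pos_nonneg)
    have ct: "c \<le> t\<^sup>2 / (1 + t\<^sup>2)" if "t \<in> C n" for t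
    proof -
      have "\<delta> \<le> \<bar>t\<bar>" using that by (simp add: C_def \<delta>_def)
      then have "\<delta>\<^sup>2 \<le> t\<^sup>2" using power_mono[of \<delta> "\<bar>t\<bar>" 2] \<delta> by simp
      then have "\<delta>\<^sup>2 * (1 + t\<^sup>2) \<le> t\<^sup>2 * (1 + \<delta>\<^sup>2)" by (simp add: algebra_simps)
      then show ?thesis unfolding c_def by (simp add: field_simps add_pos_nonneg)
    qed
    have "ennreal c * emeasure \<Lambda> (C n) = (\<integral>\<^sup>+ t. ennreal c * indicator (C n) t \<partial>\<Lambda>)"
      using Cm by (simp add: nn_integral_cmult_indicator)
    also have "\<dots> \<le> (\<integral>\<^sup>+ t. ennreal (t\<^sup>2 / (1 + t\<^sup>2)) \<partial>\<Lambda>)"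
      by (intro nn_integral_mono) (auto split: split_indicator intro!: ennreal_leI ct)
    finally have "ennreal c * emeasure \<Lambda> (C n) < \<infinity>" using fin by simp
    then show ?thesis using c by (auto simp: ennreal_mult_less_top)
  qed
  moreover have "(\<Union>n. C n) \<union> {0} = space \<Lambda>"
  proof -
    have "t \<in> (\<Union>n. C n)" if t: "t \<noteq> 0" for t
    proof -
      obtain n where "inverse (real (Suc n)) < \<bar>t\<bar>" using reals_Archimedean[of "\<bar>t\<bar>"] t by (auto simp del: of_nat_Suc)
      then have "t \<in> C n" by (simp add: C_def inverse_eq_divide)
      then show ?thesis by blast
    qed
    then show ?thesis using sp by auto
  qed
  ultimately show "\<exists>A. countable A \<and> A \<subseteq> sets \<Lambda> \<and> \<Union>A = space \<Lambda> \<and> (\<forall>a\<in>A. emeasure \<Lambda> a \<noteq> \<infinity>)"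
    using Cm 0 sets by (intro exI[of _ "insert {0} (range C)"]) auto
qed

section \<open>Partitions of the base into sets of small measure\<close>

lemma small_neighbourhood:
  assumes T: "second_countable T" "t1_space T" and \<rho>: "finite_measure \<rho>" "space \<rho> = topspace T" "\<And>U. openin T U \<Longrightarrow> U \<in> sets \<rho>"
    and x: "x \<in> topspace T" "measure \<rho> {x} = 0" and \<delta>: "\<delta> > 0"
    and B: "countable \<B>" "\<And>V. V \<in> \<B> \<Longrightarrow> openin T V" "\<And>U x. openin T U \<Longrightarrow> x \<in> U \<Longrightarrow> \<exists>V\<in>\<B>. x \<in> V \<and> V \<subseteq> U"
  shows "\<exists>V\<in>\<B>. x \<in> V \<and> measure \<rho> V \<le> \<delta>"
proof -
  interpret finite_measure \<rho> by fact
  let ?B = "{V \<in> \<B>. x \<in> V}"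
  have ne: "?B \<noteq> {}" using B(3)[OF openin_topspace x(1)] by blast
  have cB: "countable ?B" using B(1) by (rule countable_subset[rotated]) auto
  define v where "v = from_nat_into ?B"
  have v: "v n \<in> \<B>" "x \<in> v n" for n using from_nat_into[OF ne, of n] by (auto simp: v_def)
  have rv: "range v = ?B" unfolding v_def by (rule range_from_nat_into[OF ne cB])
  \<comment> \<open>In a T1 space the basic neighbourhoods of \<open>x\<close> intersect in
    \<open>{x}\<close>. Finite intersections make them decrease, so their measures tend to that of
    \<open>{x}\<close>, which is 0.\<close>
  define w where "w n = (\<Inter>i\<le>n. v i)" for n
  have wo: "openin T (w n)" for n unfolding w_def by (intro openin_Inter) (auto intro: B(2) v)
  have xw: "x \<in> w n" for n using v by (auto simp: w_def)
  have "(\<Inter>n. w n) = {x}"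
  proof (intro equalityI subsetI)
    fix y assume y: "y \<in> (\<Inter>n. w n)"
    show "y \<in> {x}"
    proof (rule ccontr)
      assume "y \<notin> {x}"
      have yT: "y \<in> topspace T" using y openin_subset[OF wo[of 0]] by blast
      have "closedin T {y}" using T(2) yT by (simp add: t1_space_closedin_singleton)
      then have o: "openin T (topspace T - {y})" by (rule openin_diff[OF openin_topspace])
      have "x \<in> topspace T - {y}" using x(1) \<open>y \<notin> {x}\<close> by simp
      from B(3)[OF o this] obtain V where V: "V \<in> \<B>" "x \<in> V" "V \<subseteq> topspace T - {y}" by (elim bexE conjE)
      have "V \<in> range v" unfolding rv using V by simp
      then obtain n where "v n = V" by (elim rangeE) simp
      then show False using y V by (auto simp: w_def)
    qed
  qed (use xw in auto)
  moreover have "(\<lambda>n. measure \<rho> (w n)) \<longlonglongrightarrow> measure \<rho> (\<Inter>n. w n)"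
  proof (rule finite_Lim_measure_decseq)
    show "range w \<subseteq> sets \<rho>" using \<rho>(3)[OF wo] by (simp add: image_subset_iff)
    show "decseq w" unfolding decseq_def w_def by (intro allI impI INF_superset_mono) auto
  qed
  ultimately have "(\<lambda>n. measure \<rho> (w n)) \<longlonglongrightarrow> 0" using x(2) by simp
  then have "eventually (\<lambda>n. measure \<rho> (w n) < \<delta>) sequentially" using \<delta> by (rule order_tendstoD)
  then obtain n where n: "measure \<rho> (w n) < \<delta>" by (auto simp: eventually_sequentially)
  obtain V where V: "V \<in> \<B>" "x \<in> V" "V \<subseteq> w n" using B(3)[OF wo xw] by blast
  have "measure \<rho> V \<le> measure \<rho> (w n)" by (rule finite_measure_mono[OF V(3) \<rho>(3)[OF wo]])
  with n V show ?thesis by force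
qed

text \<open>Second countability gives a countable cover by small basic sets. Finitely many of them,
  made disjoint, leave a remainder of small measure, which becomes the last piece.\<close>

lemma small_partition:
  assumes \<nu>: "standard_borel \<nu>" and \<rho>: "finite_measure \<rho>" "sets \<rho> = sets \<nu>" "\<And>x. x \<in> space \<nu> \<Longrightarrow> measure \<rho> {x} = 0" and \<delta>: "\<delta> > 0"
  shows "\<exists>(A :: nat \<Rightarrow> 'x set) n. (\<forall>i<n. A i \<in> sets \<nu>) \<and> disjoint_family_on A {..<n} \<and> (\<Union>i<n. A i) = space \<nu> \<and> (\<forall>i<n. measure \<rho> (A i) \<le> \<delta>)"
proof (cases "space \<nu> = {}")
  case True
  then show ?thesis by (intro exI[of _ "\<lambda>_. {}"] exI[of _ 0]) (auto simp: disjoint_family_on_def)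
next
  case False
  interpret finite_measure \<rho> by fact
  obtain T where T: "completely_metrizable_space T" "second_countable T" "topspace T = space \<nu>"
    "sets \<nu> = sigma_sets (topspace T) {U. openin T U}" using \<nu> by (auto simp: standard_borel_def)
  have t1: "t1_space T"
    using T(1) by (intro Hausdorff_imp_t1_space metrizable_imp_Hausdorff_space completely_metrizable_imp_metrizable_space)
  have sp: "space \<rho> = space \<nu>" by (rule sets_eq_imp_space_eq[OF \<rho>(2)])
  have op: "U \<in> sets \<rho>" if "openin T U" for U unfolding \<rho>(2) T(4) using that by (intro sigma_sets.Basic) simp
  from T(2)[unfolded second_countable_def] obtain \<B> where B0: "countable \<B> \<and> (\<forall>V\<in>\<B>. openin T V) \<and>
      (\<forall>U x. openin T U \<and> x \<in> U \<longrightarrow> (\<exists>V\<in>\<B>. x \<in> V \<and> V \<subseteq> U))" ..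
  then have B: "countable \<B>" "\<And>V. V \<in> \<B> \<Longrightarrow> openin T V" "\<And>U x. openin T U \<Longrightarrow> x \<in> U \<Longrightarrow> \<exists>V\<in>\<B>. x \<in> V \<and> V \<subseteq> U"
    by simp_all
  let ?B = "{V \<in> \<B>. measure \<rho> V \<le> \<delta>}"
  have cov: "\<exists>V\<in>?B. x \<in> V" if "x \<in> space \<nu>" for x
  proof -
    have "\<exists>V\<in>\<B>. x \<in> V \<and> measure \<rho> V \<le> \<delta>"
      by (rule small_neighbourhood[OF T(2) t1 \<rho>(1) _ op _ \<rho>(3)[OF that] \<delta> B]) (simp_all add: sp T(3) that)
    then show ?thesis by (elim bexE conjE) (intro bexI CollectI conjI)
  qed
  have ne: "?B \<noteq> {}" using False cov by blast
  have cB: "countable ?B" using B(1) by (rule countable_subset[rotated]) auto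
  define v where "v = from_nat_into ?B"
  have v: "v n \<in> sets \<nu>" "measure \<rho> (v n) \<le> \<delta>" for n
    using from_nat_into[OF ne, of n] op[OF B(2)] \<rho>(2) by (auto simp: v_def)
  have rv: "range v = ?B" unfolding v_def by (rule range_from_nat_into[OF ne cB])
  have Uv: "(\<Union>n. v n) = space \<nu>"
  proof
    show "(\<Union>n. v n) \<subseteq> space \<nu>" using v(1)[THEN sets.sets_into_space] by (simp add: UN_least)
    show "space \<nu> \<subseteq> (\<Union>n. v n)" unfolding rv using cov by auto
  qed
  let ?r = "\<lambda>n. space \<nu> - (\<Union>i<n. v i)"
  have "(\<lambda>n. measure \<rho> (?r n)) \<longlonglongrightarrow> measure \<rho> (\<Inter>n. ?r n)"
    by (rule finite_Lim_measure_decseq) (use v(1) in \<open>auto simp: decseq_def \<rho>(2)\<close>)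
  also have "(\<Inter>n. ?r n) = {}" using Uv by auto
  finally have "(\<lambda>n. measure \<rho> (?r n)) \<longlonglongrightarrow> 0" by simp
  then have "eventually (\<lambda>n. measure \<rho> (?r n) < \<delta>) sequentially" using \<delta> by (rule order_tendstoD)
  then obtain n where n: "measure \<rho> (?r n) < \<delta>" by (auto simp: eventually_sequentially)
  \<comment> \<open>Index \<open>n\<close> carries the remainder, so there are \<open>Suc n\<close>
    pieces.\<close>
  define A where "A i = (if i < n then disjointed v i else ?r n)" for i
  have Un: "(\<Union>i<n. disjointed v i) = (\<Union>i<n. v i)" unfolding lessThan_atLeast0 by (rule finite_UN_disjointed_eq)
  have As: "A i \<in> sets \<nu>" for i
    using v(1) by (auto simp: A_def disjointed_def)
  have "disjoint_family_on A {..<Suc n}"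
    unfolding disjoint_family_on_def
  proof (intro ballI impI)
    fix i j assume ij: "i \<in> {..<Suc n}" "j \<in> {..<Suc n}" "i \<noteq> j"
    have "disjointed v i \<inter> ?r n = {}" if "i < n" for i using Un that by blast
    then show "A i \<inter> A j = {}"
      using ij disjoint_family_disjointed[of v] by (auto simp: A_def disjoint_family_on_def less_Suc_eq)
  qed
  moreover have "(\<Union>i<Suc n. A i) = space \<nu>"
  proof -
    have "(\<Union>i<Suc n. A i) = (\<Union>i<n. disjointed v i) \<union> ?r n" by (auto simp: A_def less_Suc_eq)
    then show ?thesis unfolding Un using Uv by blast
  qed
  moreover have "measure \<rho> (A i) \<le> \<delta>" for i
  proof (cases "i < n")
    case True
    have "measure \<rho> (disjointed v i) \<le> measure \<rho> (v i)" by (rule finite_measure_mono[OF disjointed_subset]) (simp add: \<rho>(2) v)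
    then show ?thesis using v(2)[of i] True by (simp add: A_def)
  qed (use n in \<open>simp add: A_def\<close>)
  ultimately show ?thesis using As by blast
qed

section \<open>The first chaos of the noise, and exponentials of general functions\<close>

context gaussian_noise
begin

lemma e_norm: "h \<in> L2 \<mu> \<Longrightarrow> (L2_norm M (e h))\<^sup>2 = exp ((L2_norm \<mu> h)\<^sup>2)"
proof -
  assume h: "h \<in> L2 \<mu>"
  have "complex_of_real ((L2_norm M (e h))\<^sup>2) = complex_of_real (exp (LINT y|\<mu>. h y * h y))"
    unfolding L2_inner_self[symmetric] by (rule e_inner_gen[OF h h])
  then have "(L2_norm M (e h))\<^sup>2 = exp (LINT y|\<mu>. h y * h y)" by (simp only: of_real_eq_iff)
  also have "(LINT y|\<mu>. h y * h y) = (L2_norm \<mu> h)\<^sup>2" unfolding L2_norm_sq by (simp add: power2_eq_square)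
  finally show ?thesis .
qed

text \<open>Read off from the squared norms of the difference quotients of the exponential, which
  are difference quotients at 0 of \<open>exp (?c * x)\<close> with step
  \<open>?s n\<close>.\<close>

lemma W_norm:
  assumes h: "h \<in> L2 \<mu>"
  shows "L2_norm M (\<lambda>\<omega>. complex_of_real (W h \<omega>)) = L2_norm \<mu> h"
proof -
  let ?c = "(L2_norm \<mu> h)\<^sup>2"
  let ?s = "\<lambda>n. (1 / real (Suc n))\<^sup>2"
  let ?F = "\<lambda>n \<omega>. complex_of_real (real (Suc n)) * (e (\<lambda>y. h y / real (Suc n)) \<omega> - 1)"
  have one: "(\<lambda>_. 1 :: complex) \<in> L2 M" by (rule E.H_L2[OF E.const_H])
  have n1: "L2_norm M (\<lambda>_. 1 :: complex) = 1" using prob_space by (simp add: L2_norm_def)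
  have "(L2_norm M (?F n))\<^sup>2 = (exp (?c * ?s n) - exp 0) / ?s n" for n
  proof -
    let ?h = "\<lambda>y. h y / real (Suc n)"
    have hn: "?h \<in> L2 \<mu>" using L2_cmult[OF h, of "1 / real (Suc n)"] by simp
    have nh: "(L2_norm \<mu> ?h)\<^sup>2 = ?c * ?s n" using L2_norm_cmult[of \<mu> "1 / real (Suc n)" h] by (simp add: power_divide)
    have "L2_inner M (e ?h) (\<lambda>_. 1) = L2_inner M (e ?h) (e (\<lambda>_. 0))"
      by (rule L2_inner_cong[OF aeq_refl aeq_sym[OF E.e_zero]]) (rule e_meas[OF hn] e_meas[OF L2_zero] borel_measurable_const)+
    also have "\<dots> = 1" unfolding e_inner_gen[OF hn L2_zero] by simp
    finally have "L2_inner M (e ?h) (\<lambda>_. 1) = 1" .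
    then have "(L2_norm M (\<lambda>\<omega>. e ?h \<omega> - 1))\<^sup>2 = exp (?c * ?s n) - 1"
      using L2_norm_diff_sq[OF e_L2_gen[OF hn] one] e_norm[OF hn] unfolding nh n1 by simp
    then show ?thesis unfolding L2_norm_cmult power_mult_distrib by (simp add: power_divide del: of_nat_Suc)
  qed
  moreover have "(\<lambda>n. (exp (?c * ?s n) - exp 0) / ?s n) \<longlonglongrightarrow> ?c"
  proof -
    have "((\<lambda>x. exp (?c * x)) has_field_derivative ?c) (at 0)" by (auto intro!: derivative_eq_intros)
    then have "((\<lambda>x. (exp (?c * x) - exp 0) / x) \<longlongrightarrow> ?c) (at 0)" by (simp add: has_field_derivative_iff)
    moreover have "filterlim ?s (at 0) sequentially"
    proof (rule filterlim_atI)
      have "?s \<longlonglongrightarrow> 0\<^sup>2" by (rule tendsto_power[OF LIMSEQ_Suc[OF lim_1_over_n]])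
      then show "?s \<longlonglongrightarrow> 0" unfolding zero_power2 .
    qed simp
    ultimately show ?thesis by (rule filterlim_compose)
  qed
  ultimately have "(L2_norm M (\<lambda>\<omega>. complex_of_real (W h \<omega>)))\<^sup>2 = ?c"
    using LIMSEQ_unique[OF tendsto_power[OF L2_lim_norm[OF W_deriv[OF h]], of 2]] by simp
  then show ?thesis by (simp add: power2_eq_iff_nonneg)
qed

abbreviation Wc where "Wc h \<equiv> (\<lambda>\<omega>. complex_of_real (W h \<omega>))"

lemma Wc_L2: "h \<in> L2 \<mu> \<Longrightarrow> Wc h \<in> L2 M"
  by (rule L2_limD(2)[OF W_deriv])

lemma Wc_HT:
  assumes h: "h \<in> L2 \<mu>"
  shows "Wc h \<in> E.HT"
proof -
  have "Wc h \<in> borel_measurable (gloc (space \<mu>))" using W_gloc[OF h, of "space \<mu>"] by simp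
  then show ?thesis unfolding local_L2_eq using Wc_L2[OF h] aeq_refl by blast
qed

lemma Wc_lin: "h \<in> L2 \<mu> \<Longrightarrow> k \<in> L2 \<mu> \<Longrightarrow>
    aeq M (Wc (\<lambda>y. a * h y + b * k y)) (\<lambda>\<omega>. complex_of_real a * Wc h \<omega> + complex_of_real b * Wc k \<omega>)"
  using W_lin[of h k a b] unfolding aeq_def by (auto elim!: eventually_mono)

lemma Wc_lim:
  assumes f: "L2_lim \<mu> f h"
  shows "L2_lim M (\<lambda>n. Wc (f n)) (Wc h)"
proof -
  note L = L2_limD[OF f]
  have "L2_norm M (\<lambda>\<omega>. Wc (f n) \<omega> - Wc h \<omega>) = L2_norm \<mu> (\<lambda>y. f n y - h y)" for n
  proof -
    have d: "(\<lambda>y. f n y - h y) \<in> L2 \<mu>" by (rule L2_diff[OF L(1,2)])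
    have "aeq M (\<lambda>\<omega>. Wc (f n) \<omega> - Wc h \<omega>) (Wc (\<lambda>y. f n y - h y))"
      using aeq_sym[OF Wc_lin[OF L(1,2), of 1 n "-1"]] by simp
    then have "L2_norm M (\<lambda>\<omega>. Wc (f n) \<omega> - Wc h \<omega>) = L2_norm M (Wc (\<lambda>y. f n y - h y))"
      by (rule L2_norm_cong) (intro L2_measurable L2_diff Wc_L2 L d)+
    then show ?thesis by (simp add: W_norm[OF d])
  qed
  then show ?thesis using L Wc_L2 by (simp add: L2_lim_def)
qed

lemma e_cong:
  assumes "h \<in> L2 \<mu>" "k \<in> L2 \<mu>" "\<And>y. y \<in> space \<mu> \<Longrightarrow> h y = k y"
  shows "aeq M (e h) (e k)"
proof -
  have "aeq \<mu> h k" using assms(3) by (simp add: aeq_def)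
  from L2_norm_diff_aeq[OF this] have "L2_lim \<mu> (\<lambda>_. h) k" using assms by (simp add: L2_lim_def)
  from L2_lim_unique[OF L2_lim_const[OF e_L2_gen[OF assms(1)]] e_lim[OF this]] show ?thesis .
qed

lemma L2_restr:
  assumes h: "h \<in> L2 \<mu>" and A: "A \<in> sets \<mu>"
  shows "restr h A \<in> L2 \<mu>"
proof (rule L2_I)
  note [measurable] = L2_measurable[OF h] A
  show m: "restr h A \<in> borel_measurable \<mu>" by measurable
  show "integrable \<mu> (\<lambda>y. (norm (restr h A y))\<^sup>2)"
    by (rule Bochner_Integration.integrable_bound[OF L2_integrable_sq[OF h]]) (use m in auto)
qed

end

section \<open>The isometry on exponentials and on the first chaos\<close>

locale gaussian_poisson = G: gaussian_noise G \<mu> W + Q: poisson_points Q \<mu> N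
  for G :: "'g measure" and \<mu> :: "'y measure" and W and Q :: "'q measure" and N
begin

sublocale P: exp_pair_deriv G \<mu> "gaussian_loc \<mu> G W" "gaussian_exponential \<mu> W" Q "poisson_loc \<mu> Q N" Q.e "\<lambda>h \<omega>. complex_of_real (W h \<omega>)"
proof -
  interpret exp_pair G \<mu> "gaussian_loc \<mu> G W" "gaussian_exponential \<mu> W" Q "poisson_loc \<mu> Q N" Q.e
    by (intro exp_pair.intro G.E.exp_system_axioms Q.E.exp_system_axioms)
  show "exp_pair_deriv G \<mu> (gaussian_loc \<mu> G W) (gaussian_exponential \<mu> W) Q (poisson_loc \<mu> Q N) Q.e (\<lambda>h \<omega>. complex_of_real (W h \<omega>))"
    by unfold_locales (rule G.W_deriv[OF step_fun_L2])
qed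

text \<open>Along step functions bounded by \<open>2 * \<bar>h y\<bar>\<close> the Gaussian
  exponentials converge in L2 and the Poisson ones almost everywhere, so the limits correspond.
  Membership in L2 serves the first convergence, integrability the second.\<close>

lemma \<Phi>_exponential:
  assumes h: "h \<in> L2 \<mu>" "integrable \<mu> h"
  shows "aeq Q (P.\<Phi> (G.e h)) (\<lambda>\<omega>. complex_of_real (config_prod (N \<omega>) (\<lambda>y. 1 + h y) * exp (- (LINT y|\<mu>. h y))))"
proof -
  obtain f where f: "\<And>n. step_fun \<mu> (f n)" "\<And>y. y \<in> space \<mu> \<Longrightarrow> (\<lambda>n. f n y) \<longlonglongrightarrow> h y"
    "\<And>n y. y \<in> space \<mu> \<Longrightarrow> \<bar>f n y\<bar> \<le> 2 * \<bar>h y\<bar>"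
    using step_fun_approx[OF L2_measurable[OF h(1)] disjI2[OF h(2)]] by blast
  have l: "L2_lim \<mu> f h"
    by (rule L2_lim_dominated[where w="\<lambda>y. 2 * \<bar>h y\<bar>"])
       (use f step_fun_measurable[OF f(1)] L2_measurable[OF h(1)] L2_cmult[OF L2_norm_fun[OF h(1)], of 2] in auto)
  have L: "L2_lim Q (\<lambda>n. P.\<Phi> (G.e (f n))) (P.\<Phi> (G.e h))"
    by (rule bounded_map_lim[OF P.\<Phi>_bounded G.E.HT_closed G.E.e_HT[OF f(1)] G.e_lim[OF l]])
  have lim: "AE \<omega> in Q. (\<lambda>n. Q.e (f n) \<omega>) \<longlonglongrightarrow> complex_of_real (config_prod (N \<omega>) (\<lambda>y. 1 + h y) * exp (- (LINT y|\<mu>. h y)))"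
    by (rule Q.AE_limits(1)[OF h(2)]; fact f)
  have "AE \<omega> in Q. \<forall>n. P.\<Phi> (G.e (f n)) \<omega> = Q.e (f n) \<omega>"
    unfolding AE_all_countable using P.\<Phi>_e[OF f(1)] by (simp add: aeq_def)
  then have "AE \<omega> in Q. (\<lambda>n. P.\<Phi> (G.e (f n)) \<omega>) \<longlonglongrightarrow> complex_of_real (config_prod (N \<omega>) (\<lambda>y. 1 + h y) * exp (- (LINT y|\<mu>. h y)))"
    using lim by eventually_elim simp
  with L show ?thesis by (rule L2_lim_AE_unique)
qed

text \<open>Both sides are derivatives at 0 of corresponding exponentials, and the bounded linear
  map \<Phi> passes to the limit of the difference quotients.\<close>

lemma \<Phi>_W_step:
  assumes h: "step_fun \<mu> h"
  shows "aeq Q (P.\<Phi> (G.Wc h)) (\<lambda>\<omega>. complex_of_real ((\<Sum>y\<in>{y \<in> N \<omega>. h y \<noteq> 0}. h y) - (LINT y|\<mu>. h y)))"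
proof -
  let ?c = "\<lambda>n. complex_of_real (real (Suc n))"
  let ?h = "\<lambda>n y. h y / real (Suc n)"
  note hn = P.step_fun_scale[OF h]
  have m: "(\<lambda>\<omega>. ?c n * (G.e (?h n) \<omega> - 1)) \<in> G.E.HT" for n
    by (intro closed_subspace_cmult[OF G.E.HT_closed] closed_subspace_diff[OF G.E.HT_closed] G.E.e_HT G.E.const_H hn)
  have L: "L2_lim Q (\<lambda>n. P.\<Phi> (\<lambda>\<omega>. ?c n * (G.e (?h n) \<omega> - 1))) (P.\<Phi> (G.Wc h))"
    by (rule bounded_map_lim[OF P.\<Phi>_bounded G.E.HT_closed m G.W_deriv[OF step_fun_L2[OF h]]])
  have "aeq Q (P.\<Phi> (\<lambda>\<omega>. ?c n * (G.e (?h n) \<omega> - 1))) (\<lambda>\<omega>. ?c n * (Q.e (?h n) \<omega> - 1))" for n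
  proof -
    have "aeq Q (P.\<Phi> (\<lambda>\<omega>. ?c n * G.e (?h n) \<omega> + (- ?c n) * 1)) (\<lambda>\<omega>. ?c n * P.\<Phi> (G.e (?h n)) \<omega> + (- ?c n) * P.\<Phi> (\<lambda>_. 1) \<omega>)"
      by (rule bounded_map_lin[OF P.\<Phi>_bounded G.E.e_HT[OF hn] G.E.const_H])
    also have "aeq Q \<dots> (\<lambda>\<omega>. ?c n * Q.e (?h n) \<omega> + (- ?c n) * 1)"
      by (rule aeq_lin[OF P.\<Phi>_e[OF hn]]) (use P.unity_\<Phi> in \<open>simp add: unity_preserving_def\<close>)
    finally show ?thesis by (simp add: right_diff_distrib del: of_nat_Suc)
  qed
  then have "AE \<omega> in Q. \<forall>n. P.\<Phi> (\<lambda>\<omega>. ?c n * (G.e (?h n) \<omega> - 1)) \<omega> = ?c n * (Q.e (?h n) \<omega> - 1)"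
    unfolding AE_all_countable by (simp add: aeq_def)
  then have "AE \<omega> in Q. (\<lambda>n. P.\<Phi> (\<lambda>\<omega>. ?c n * (G.e (?h n) \<omega> - 1)) \<omega>) \<longlonglongrightarrow> complex_of_real ((\<Sum>y\<in>{y \<in> N \<omega>. h y \<noteq> 0}. h y) - (LINT y|\<mu>. h y))"
    using Q.e_deriv[OF h] by eventually_elim simp
  with L show ?thesis by (rule L2_lim_AE_unique)
qed

lemma \<Phi>_W:
  assumes h: "h \<in> L2 \<mu>" "integrable \<mu> h"
  shows "aeq Q (P.\<Phi> (G.Wc h)) (\<lambda>\<omega>. complex_of_real ((\<Sum>\<^sub>\<infinity>y\<in>N \<omega>. h y) - (LINT y|\<mu>. h y)))"
proof -
  obtain f where f: "\<And>n. step_fun \<mu> (f n)" "\<And>y. y \<in> space \<mu> \<Longrightarrow> (\<lambda>n. f n y) \<longlonglongrightarrow> h y"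
    "\<And>n y. y \<in> space \<mu> \<Longrightarrow> \<bar>f n y\<bar> \<le> 2 * \<bar>h y\<bar>"
    using step_fun_approx[OF L2_measurable[OF h(1)] disjI2[OF h(2)]] by blast
  have l: "L2_lim \<mu> f h"
    by (rule L2_lim_dominated[where w="\<lambda>y. 2 * \<bar>h y\<bar>"])
       (use f step_fun_measurable[OF f(1)] L2_measurable[OF h(1)] L2_cmult[OF L2_norm_fun[OF h(1)], of 2] in auto)
  have L: "L2_lim Q (\<lambda>n. P.\<Phi> (G.Wc (f n))) (P.\<Phi> (G.Wc h))"
    by (rule bounded_map_lim[OF P.\<Phi>_bounded G.E.HT_closed G.Wc_HT[OF step_fun_L2[OF f(1)]] G.Wc_lim[OF l]])
  have lim: "AE \<omega> in Q. (\<lambda>n. complex_of_real ((\<Sum>y\<in>{y \<in> N \<omega>. f n y \<noteq> 0}. f n y) - (LINT y|\<mu>. f n y)))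
      \<longlonglongrightarrow> complex_of_real ((\<Sum>\<^sub>\<infinity>y\<in>N \<omega>. h y) - (LINT y|\<mu>. h y))"
    by (rule Q.AE_limits(2)[OF h(2)]; fact f)
  have "AE \<omega> in Q. \<forall>n. P.\<Phi> (G.Wc (f n)) \<omega> = complex_of_real ((\<Sum>y\<in>{y \<in> N \<omega>. f n y \<noteq> 0}. f n y) - (LINT y|\<mu>. f n y))"
    unfolding AE_all_countable using \<Phi>_W_step[OF f(1)] by (simp add: aeq_def)
  then have "AE \<omega> in Q. (\<lambda>n. P.\<Phi> (G.Wc (f n)) \<omega>) \<longlonglongrightarrow> complex_of_real ((\<Sum>\<^sub>\<infinity>y\<in>N \<omega>. h y) - (LINT y|\<mu>. h y))"
    using lim by eventually_elim simp
  with L show ?thesis by (rule L2_lim_AE_unique)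
qed

text \<open>The Poisson factors are the images of the Gaussian ones, so the multiplicativity of
  \<Phi> transfers the factorization, and a single induction serves both sides.\<close>

lemma exponential_partition:
  assumes h: "h \<in> L2 \<mu>" and \<P>: "finite \<P>" "\<P> \<subseteq> sets \<mu>" "disjoint \<P>"
  shows "aeq G (G.e (restr h (\<Union>\<P>))) (\<lambda>\<omega>. \<Prod>A\<in>\<P>. G.e (restr h A) \<omega>) \<and>
    aeq Q (P.\<Phi> (G.e (restr h (\<Union>\<P>)))) (\<lambda>\<omega>. \<Prod>A\<in>\<P>. P.\<Phi> (G.e (restr h A)) \<omega>)"
  using \<P>
proof (induction)
  case empty
  have "restr h (\<Union>{}) = (\<lambda>_. 0)" by auto
  moreover have "aeq Q (P.\<Phi> (G.e (\<lambda>_. 0))) (\<lambda>_. 1)"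
    using P.\<Phi>_e[OF step_fun_zero] Q.E.e_zero by (rule aeq_trans)
  ultimately show ?case using G.E.e_zero by simp
next
  case (insert A \<P>)
  let ?B = "\<Union>\<P>"
  have A: "A \<in> sets \<mu>" and B: "?B \<in> sets \<mu>" using insert by (auto intro: sets.finite_Union)
  have d: "A \<inter> ?B = {}" using insert.prems(2) insert.hyps(2) by (auto simp: disjoint_def)
  have IH: "aeq G (G.e (restr h ?B)) (\<lambda>\<omega>. \<Prod>A\<in>\<P>. G.e (restr h A) \<omega>)"
    "aeq Q (P.\<Phi> (G.e (restr h ?B))) (\<lambda>\<omega>. \<Prod>A\<in>\<P>. P.\<Phi> (G.e (restr h A)) \<omega>)"
    using insert by (auto simp: disjoint_def)
  note hA = G.L2_restr[OF h A] and hB = G.L2_restr[OF h B]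
  have hAB: "restr h (\<Union>(insert A \<P>)) \<in> L2 \<mu>" by (rule G.L2_restr[OF h]) (use A B in simp)
  have eA: "G.e (restr h A) \<in> G.E.H A" by (rule G.e_local_gen[OF hA]) auto
  have eB: "G.e (restr h ?B) \<in> G.E.H (space \<mu> - A)" by (rule G.e_local_gen[OF hB]) (use d in auto)
  have eAB: "G.e (restr h (\<Union>(insert A \<P>))) \<in> G.E.HT" by (rule G.e_local_gen[OF hAB]) auto
  have eq: "restr h (\<Union>(insert A \<P>)) = (\<lambda>y. restr h A y + restr h ?B y)" using d by (auto simp: fun_eq_iff)
  have "(LINT y|\<mu>. restr h A y * restr h ?B y) = (LINT y|\<mu>. 0)"
    by (rule Bochner_Integration.integral_cong) (use d in auto)
  then have m: "aeq G (G.e (restr h (\<Union>(insert A \<P>)))) (\<lambda>\<omega>. G.e (restr h A) \<omega> * G.e (restr h ?B) \<omega>)"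
    using aeq_sym[OF G.e_prod[OF hA hB]] unfolding eq by simp
  have "aeq G (G.e (restr h (\<Union>(insert A \<P>)))) (\<lambda>\<omega>. \<Prod>A\<in>insert A \<P>. G.e (restr h A) \<omega>)"
    using aeq_trans[OF m aeq_mult[OF aeq_refl IH(1)]] insert.hyps by simp
  moreover have "aeq Q (P.\<Phi> (G.e (restr h (\<Union>(insert A \<P>))))) (\<lambda>\<omega>. \<Prod>A\<in>insert A \<P>. P.\<Phi> (G.e (restr h A)) \<omega>)"
    using aeq_trans[OF bounded_map_aeq[OF P.\<Phi>_bounded G.E.HT_closed eAB G.E.prod_H_compl[OF A eA eB] m]
        aeq_trans[OF P.\<Phi>_mult[OF A eA eB] aeq_mult[OF aeq_refl IH(2)]]] insert.hyps by simp
  ultimately show ?case by blast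
qed

text \<open>The second claim is stated for any representative \<open>F\<close> of the image, so that
  it applies to the explicit Poisson formula.\<close>

lemma multiplicative_exponentials:
  assumes h: "h \<in> L2 \<mu>"
  shows "multiplicative_functional \<mu> G (gaussian_loc \<mu> G W) (G.e h)"
    and "aeq Q F (P.\<Phi> (G.e h)) \<Longrightarrow> multiplicative_functional \<mu> Q (poisson_loc \<mu> Q N) F"
proof -
  have 1: "aeq G (G.e h) (\<lambda>\<omega>. \<Prod>A\<in>\<P>. G.e (restr h A) \<omega>) \<and> aeq Q (P.\<Phi> (G.e h)) (\<lambda>\<omega>. \<Prod>A\<in>\<P>. P.\<Phi> (G.e (restr h A)) \<omega>)"
    if \<P>: "finite \<P>" "\<P> \<subseteq> sets \<mu>" "partition_on (space \<mu>) \<P>" for \<P>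
  proof -
    have U: "\<Union>\<P> = space \<mu>" "disjoint \<P>" using \<P>(3) by (auto simp: partition_on_def)
    note hs = G.L2_restr[OF h sets.top]
    have c: "aeq G (G.e h) (G.e (restr h (space \<mu>)))" by (rule G.e_cong[OF h hs]) simp
    have HT: "G.e h \<in> G.E.HT" "G.e (restr h (space \<mu>)) \<in> G.E.HT" by (rule G.e_local_gen[OF h] G.e_local_gen[OF hs]; simp)+
    show ?thesis
      using exponential_partition[OF h \<P>(1,2) U(2)] aeq_trans[OF c]
        aeq_trans[OF bounded_map_aeq[OF P.\<Phi>_bounded G.E.HT_closed HT c]] unfolding U by blast
  qed
  have eA: "G.e (restr h A) \<in> G.E.H A" if "A \<in> sets \<mu>" for A by (rule G.e_local_gen[OF G.L2_restr[OF h that]]) auto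
  show "multiplicative_functional \<mu> G (gaussian_loc \<mu> G W) (G.e h)"
    unfolding multiplicative_functional_def
  proof (intro allI impI exI conjI ballI)
    fix \<P> A assume \<P>: "finite \<P> \<and> \<P> \<subseteq> sets \<mu> \<and> partition_on (space \<mu>) \<P>"
    show "aeq G (G.e h) (\<lambda>\<omega>. \<Prod>A\<in>\<P>. G.e (restr h A) \<omega>)" using 1 \<P> by blast
    assume "A \<in> \<P>"
    then show "G.e (restr h A) \<in> local_functionals G (gaussian_loc \<mu> G W) A" using eA \<P> by (auto simp: local_L2_def)
  qed
  show "multiplicative_functional \<mu> Q (poisson_loc \<mu> Q N) F" if F: "aeq Q F (P.\<Phi> (G.e h))"
    unfolding multiplicative_functional_def
  proof (intro allI impI exI conjI ballI)
    fix \<P> A assume \<P>: "finite \<P> \<and> \<P> \<subseteq> sets \<mu> \<and> partition_on (space \<mu>) \<P>"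
    show "aeq Q F (\<lambda>\<omega>. \<Prod>A\<in>\<P>. P.\<Phi> (G.e (restr h A)) \<omega>)" using 1 \<P> aeq_trans[OF F] by blast
    assume "A \<in> \<P>"
    then show "P.\<Phi> (G.e (restr h A)) \<in> local_functionals Q (poisson_loc \<mu> Q N) A"
      using P.\<Phi>_loc[OF _ eA] \<P> by (auto simp: local_L2_def)
  qed
qed

section \<open>Agreement on the first chaos\<close>

lemma first_chaos_lin:
  assumes T: "surjective_isometry G G.E.HT Q Q.E.HT T"
    and h: "h \<in> L2 \<mu>" "aeq Q (T (G.Wc h)) (P.\<Phi> (G.Wc h))" and k: "k \<in> L2 \<mu>" "aeq Q (T (G.Wc k)) (P.\<Phi> (G.Wc k))"
  shows "aeq Q (T (G.Wc (\<lambda>y. a * h y + b * k y))) (P.\<Phi> (G.Wc (\<lambda>y. a * h y + b * k y)))"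
proof -
  note V = closed_subspace_equalizer[OF P.isometry_bounded[OF T] P.\<Phi>_bounded G.E.HT_closed]
  have "(\<lambda>\<omega>. complex_of_real a * G.Wc h \<omega> + complex_of_real b * G.Wc k \<omega>) \<in> {f \<in> G.E.HT. aeq Q (T f) (P.\<Phi> f)}"
    by (rule closed_subspace_lin[OF V]) (use h k G.Wc_HT in auto)
  from closed_subspace_aeq[OF V this aeq_sym[OF G.Wc_lin[OF h(1) k(1)]]] show ?thesis
    using L2_measurable[OF G.Wc_L2[OF L2_lin[OF h(1) k(1)]]] by blast
qed

lemma first_chaos_lim:
  assumes T: "surjective_isometry G G.E.HT Q Q.E.HT T"
    and f: "L2_lim \<mu> f h" "\<And>n. aeq Q (T (G.Wc (f n))) (P.\<Phi> (G.Wc (f n)))"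
  shows "aeq Q (T (G.Wc h)) (P.\<Phi> (G.Wc h))"
proof -
  note V = closed_subspace_equalizer[OF P.isometry_bounded[OF T] P.\<Phi>_bounded G.E.HT_closed]
  have "G.Wc h \<in> {f \<in> G.E.HT. aeq Q (T f) (P.\<Phi> f)}"
    by (rule closed_subspace_lim[OF V _ G.Wc_lim[OF f(1)]]) (use f(2) G.Wc_HT L2_limD(1)[OF f(1)] in auto)
  then show ?thesis by simp
qed

lemma first_chaos_step:
  assumes T: "surjective_isometry G G.E.HT Q Q.E.HT T" and h: "step_fun \<mu> h"
    and ind: "\<And>B. B \<in> sets \<mu> \<Longrightarrow> emeasure \<mu> B < \<infinity> \<Longrightarrow> aeq Q (T (G.Wc (indicator B))) (P.\<Phi> (G.Wc (indicator B)))"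
  shows "aeq Q (T (G.Wc h)) (P.\<Phi> (G.Wc h))"
proof -
  let ?T = "h ` space \<mu> - {0}" and ?L = "\<lambda>c. {y \<in> space \<mu>. h y = c}"
  have fT: "finite ?T" using Q.step_range[OF h] by simp
  have ind2: "(indicator (?L c) :: _ \<Rightarrow> real) \<in> L2 \<mu>" if "c \<in> ?T" for c
    using step_fun_L2[OF Q.step_fun_indicator[OF Q.level_sets[OF h], of c 1]] that by simp
  have 0: "G.Wc (\<lambda>y. \<Sum>c\<in>F. c * indicator (?L c) y) \<in> G.E.HT \<and> (\<lambda>y. \<Sum>c\<in>F. c * indicator (?L c) y) \<in> L2 \<mu> \<and>
     aeq Q (T (G.Wc (\<lambda>y. \<Sum>c\<in>F. c * indicator (?L c) y))) (P.\<Phi> (G.Wc (\<lambda>y. \<Sum>c\<in>F. c * indicator (?L c) y)))"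
    if "finite F" "F \<subseteq> ?T" for F
    using that
  proof induction
    case empty
    have z: "(\<lambda>_. 0) \<in> L2 \<mu>" "step_fun \<mu> (\<lambda>_. 0)" by (simp_all add: step_fun_zero)
    have a: "aeq Q (T (G.Wc (indicator {}))) (P.\<Phi> (G.Wc (indicator {})))" by (rule ind) auto
    have "(indicator {} :: _ \<Rightarrow> real) = (\<lambda>_. 0)" by (auto simp: indicator_def)
    from a[unfolded this] G.Wc_HT[OF z(1)] z(1) show ?case by simp
  next
    case (insert c F)
    then have IH: "(\<lambda>y. \<Sum>c\<in>F. c * indicator (?L c) y) \<in> L2 \<mu>"
      "aeq Q (T (G.Wc (\<lambda>y. \<Sum>c\<in>F. c * indicator (?L c) y))) (P.\<Phi> (G.Wc (\<lambda>y. \<Sum>c\<in>F. c * indicator (?L c) y)))" by auto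
    have c: "c \<in> ?T" using insert by simp
    have eq: "(\<lambda>y. \<Sum>c\<in>insert c F. c * indicator (?L c) y) = (\<lambda>y. c * indicator (?L c) y + 1 * (\<Sum>c\<in>F. c * indicator (?L c) y))"
      unfolding sum.insert[OF insert.hyps] by simp
    have "(\<lambda>y. \<Sum>c\<in>insert c F. c * indicator (?L c) y) \<in> L2 \<mu>" unfolding eq by (rule L2_lin[OF ind2[OF c] IH(1)])
    moreover have "aeq Q (T (G.Wc (indicator (?L c)))) (P.\<Phi> (G.Wc (indicator (?L c))))"
      by (rule ind) (use Q.level_sets[OF h, of c] c in auto)
    from first_chaos_lin[OF T ind2[OF c] this IH, of c 1]
    have "aeq Q (T (G.Wc (\<lambda>y. \<Sum>c\<in>insert c F. c * indicator (?L c) y))) (P.\<Phi> (G.Wc (\<lambda>y. \<Sum>c\<in>insert c F. c * indicator (?L c) y)))"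
      unfolding eq .
    ultimately show ?case using G.Wc_HT by blast
  qed
  have heq: "(\<Sum>c\<in>?T. c * indicator (?L c) y) = h y" if y: "y \<in> space \<mu>" for y
  proof -
    have "(\<Sum>c\<in>?T. c * indicator (?L c) y) = (\<Sum>c\<in>?T. if c = h y then h y else 0)"
      using y by (intro sum.cong) (auto simp: indicator_def)
    then show ?thesis using fT y by simp
  qed
  have "aeq \<mu> (\<lambda>y. \<Sum>c\<in>?T. c * indicator (?L c) y) h" using heq by (simp add: aeq_def)
  \<comment> \<open>The sum equals \<open>h\<close> on \<open>space \<mu>\<close> only; a constant
    sequence leads from one to the other.\<close>
  from L2_norm_diff_aeq[OF this] have "L2_lim \<mu> (\<lambda>_ y. \<Sum>c\<in>?T. c * indicator (?L c) y) h"
    using 0[OF fT order_refl] step_fun_L2[OF h] by (simp add: L2_lim_def)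
  then show ?thesis by (rule first_chaos_lim[OF T]) (use 0[OF fT order_refl] in blast)
qed

end

section \<open>Processes over a product base\<close>

lemma indicator_L2:
  assumes "B \<in> sets M" "emeasure M B < \<infinity>"
  shows "(indicator B :: 'a \<Rightarrow> real) \<in> L2 M"
proof (rule L2_I)
  have "(\<lambda>y. (norm (indicator B y :: real))\<^sup>2) = indicator B" by (auto simp: indicator_def)
  then show "integrable M (\<lambda>y. (norm (indicator B y :: real))\<^sup>2)" using assms by simp
qed (use assms in simp)

text \<open>The Levy process is present through its configuration \<open>N\<close> of jumps, a
  Poisson process on the product base.\<close>

locale gaussian_levy =
  fixes \<nu> :: "'x measure" and \<Lambda> :: "real measure" and G :: "'g measure" and W and Q :: "'q measure" and N
  assumes borel: "standard_borel \<nu>" and fin: "finite_measure \<nu>" and cont: "continuous_measure \<nu>"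
    and sets_\<Lambda>: "sets \<Lambda> = sets borel" and sf: "sigma_finite_measure \<Lambda>"
    and noise: "gaussian_white_noise (\<nu> \<Otimes>\<^sub>M \<Lambda>) G W" and points: "poisson_process (\<nu> \<Otimes>\<^sub>M \<Lambda>) Q N"
begin

sublocale gaussian_poisson G "\<nu> \<Otimes>\<^sub>M \<Lambda>" W Q N
proof (intro gaussian_poisson.intro gaussian_noiseI[OF noise] poisson_points.intro poisson_points_axioms.intro points)
  show "prob_space Q" using points by (simp add: poisson_process_def)
qed

sublocale V: finite_measure \<nu> by (rule fin)
sublocale L: sigma_finite_measure \<Lambda> by (rule sf)
sublocale VL: pair_sigma_finite \<nu> \<Lambda> ..

abbreviation \<mu> where "\<mu> \<equiv> \<nu> \<Otimes>\<^sub>M \<Lambda>"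

lemma space_\<Lambda>: "space \<Lambda> = UNIV"
  using sets_eq_imp_space_eq[OF sets_\<Lambda>] by simp

lemma cylinder: "A \<in> sets \<nu> \<Longrightarrow> A \<times> UNIV \<in> sets \<mu>"
  using sets.top[of \<Lambda>] by (intro pair_measureI) (simp_all add: space_\<Lambda>)

lemma special_isomorphism_fst:
  "special_isomorphism \<nu> G G.E.HT (\<lambda>A. G.E.\<xi> (A \<times> UNIV)) Q Q.E.HT (\<lambda>A. Q.E.\<xi> (A \<times> UNIV)) P.\<Phi>"
  unfolding special_isomorphism_def
  by (intro conjI ballI Hilbert_factorization_fst[OF G.E.Hilbert_factorization_\<xi> sf space_\<Lambda>]
      Hilbert_factorization_fst[OF Q.E.Hilbert_factorization_\<xi> sf space_\<Lambda>] P.\<Phi>_surj_isometry P.conjugate_\<Phi> cylinder)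

lemma poisson_exponential_eq:
  assumes "integrable \<mu> h"
  shows "poisson_exponential \<nu> \<Lambda> N h = (\<lambda>\<omega>. complex_of_real (config_prod (N \<omega>) (\<lambda>y. 1 + h y) * exp (- (LINT y|\<mu>. h y))))"
proof -
  have "(\<lambda>(x, t). 1 + h (x, t)) = (\<lambda>y. 1 + h y)" by auto
  then show ?thesis unfolding poisson_exponential_def VL.integral_fst'[OF assms] by simp
qed

lemma integrable_indicator_times:
  fixes f :: "real \<Rightarrow> real"
  assumes A: "A \<in> sets \<nu>" and f: "integrable \<Lambda> f"
  shows "integrable \<mu> (\<lambda>(x, t). indicator A x * f t)"
    and "(LINT y|\<mu>. (\<lambda>(x, t). indicator A x * f t) y) = measure \<nu> A * (LINT t|\<Lambda>. f t)"
proof -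
  note [measurable] = A borel_measurable_integrable[OF f]
  show I: "integrable \<mu> (\<lambda>(x, t). indicator A x * f t)"
  proof (rule VL.Fubini_integrable)
    show "(\<lambda>(x, t). indicator A x * f t) \<in> borel_measurable \<mu>" by measurable
    have "integrable \<nu> (\<lambda>x. indicator A x * (LINT t|\<Lambda>. \<bar>f t\<bar>))"
      by (intro integrable_mult_left integrable_real_indicator A) (simp add: V.emeasure_finite less_top[symmetric])
    then show "integrable \<nu> (\<lambda>x. LINT t|\<Lambda>. norm (case (x, t) of (x, t) \<Rightarrow> indicator A x * f t))"
      by (simp add: abs_mult)
    show "AE x in \<nu>. integrable \<Lambda> (\<lambda>t. case (x, t) of (x, t) \<Rightarrow> indicator A x * f t)"
      using f by simp
  qed
  show "(LINT y|\<mu>. (\<lambda>(x, t). indicator A x * f t) y) = measure \<nu> A * (LINT t|\<Lambda>. f t)"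
    using VL.integral_fst'[OF I] A by simp
qed

lemma values_L2:
  fixes f :: "real \<Rightarrow> real"
  assumes A: "A \<in> sets \<nu>" and f: "f \<in> L2 \<Lambda>"
  shows "(\<lambda>(x, t). indicator A x * f t) \<in> L2 \<mu>"
proof (rule L2_I)
  note [measurable] = A L2_measurable[OF f]
  show "(\<lambda>(x, t). indicator A x * f t) \<in> borel_measurable \<mu>" by measurable
  have "(\<lambda>y. (norm ((\<lambda>(x, t). indicator A x * f t) y))\<^sup>2) = (\<lambda>(x, t). indicator A x * (norm (f t))\<^sup>2)"
    by (auto simp: fun_eq_iff indicator_def)
  then show "integrable \<mu> (\<lambda>y. (norm ((\<lambda>(x, t). indicator A x * f t) y))\<^sup>2)"
    using integrable_indicator_times(1)[OF A L2_integrable_sq[OF f]] by simp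
qed

lemma identical_on_values_\<Phi>: "identical_on_values \<nu> \<Lambda> W Q N P.\<Phi>"
  unfolding identical_on_values_def
proof (intro ballI impI)
  fix f :: "real \<Rightarrow> real" and A assume f: "f \<in> L2 \<Lambda>" "integrable \<Lambda> f" and A: "A \<in> sets \<nu>"
  show "aeq Q (P.\<Phi> (G.Wc (\<lambda>(x, t). indicator A x * f t)))
     (\<lambda>\<omega>. complex_of_real ((\<Sum>\<^sub>\<infinity>(x, t)\<in>N \<omega>. indicator A x * f t) - measure \<nu> A * (LINT t|\<Lambda>. f t)))"
    using \<Phi>_W[OF values_L2[OF A f(1)] integrable_indicator_times(1)[OF A f(2)]]
    unfolding integrable_indicator_times(2)[OF A f(2)] .
qed

text \<open>The indicator of a rectangle is the value \<open>indicator D\<close> carried by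
  \<open>A\<close>, and \<open>identical_on_values\<close> prescribes one and the same image for
  \<open>T\<close> and \<Phi>.\<close>

lemma agree_rectangle:
  assumes T: "identical_on_values \<nu> \<Lambda> W Q N T" and A: "A \<in> sets \<nu>" and D: "D \<in> sets \<Lambda>" "emeasure \<Lambda> D < \<infinity>"
  shows "aeq Q (T (G.Wc (indicator (A \<times> D)))) (P.\<Phi> (G.Wc (indicator (A \<times> D))))"
proof -
  have eq: "indicator (A \<times> D) = (\<lambda>(x, t). indicator A x * indicator D t :: real)" by (auto simp: indicator_def fun_eq_iff)
  have f: "(indicator D :: real \<Rightarrow> real) \<in> L2 \<Lambda>" "integrable \<Lambda> (indicator D :: real \<Rightarrow> real)"
    using indicator_L2[OF D] D by simp_all
  show ?thesis unfolding eq
    using aeq_trans[OF T[unfolded identical_on_values_def, rule_format, OF f(1) A f(2)]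
        aeq_sym[OF identical_on_values_\<Phi>[unfolded identical_on_values_def, rule_format, OF f(1) A f(2)]]] .
qed

text \<open>Dynkin's argument starting from rectangles. Everything is cut down to
  \<open>space \<nu> \<times> C\<close>, which has finite measure, so that indicators of complements
  stay in L2 and are reached by linearity.\<close>

lemma agree_indicator_finite:
  assumes T: "surjective_isometry G G.E.HT Q Q.E.HT T" "identical_on_values \<nu> \<Lambda> W Q N T"
    and C: "C \<in> sets \<Lambda>" "emeasure \<Lambda> C < \<infinity>" and B: "B \<in> sets \<mu>"
  shows "aeq Q (T (G.Wc (indicator (B \<inter> space \<nu> \<times> C)))) (P.\<Phi> (G.Wc (indicator (B \<inter> space \<nu> \<times> C))))"
proof -
  let ?E = "space \<nu> \<times> C"
  let ?I = "\<lambda>B. indicator (B \<inter> ?E) :: 'x \<times> real \<Rightarrow> real"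
  let ?P = "\<lambda>B. aeq Q (T (G.Wc (?I B))) (P.\<Phi> (G.Wc (?I B)))"
  have E: "?E \<in> sets \<mu>" using C by simp
  have fE: "emeasure \<mu> ?E < \<infinity>"
    unfolding L.emeasure_pair_measure_Times[OF sets.top C(1)]
    using C(2) V.emeasure_finite[of "space \<nu>"]
    by (metis ennreal_mult_eq_top_iff infinity_ennreal_def less_top)
  have L: "?I B \<in> L2 \<mu>" if "B \<in> sets \<mu>" for B
  proof (rule indicator_L2)
    show "emeasure \<mu> (B \<inter> ?E) < \<infinity>" by (rule le_less_trans[OF emeasure_mono fE]) (use E in auto)
  qed (use that E in simp)
  have empty: "?P {}" using agree_rectangle[OF T(2) sets.empty_sets C] by simp
  have sg: "sets \<mu> = sigma_sets (space \<nu> \<times> space \<Lambda>) {A \<times> D | A D. A \<in> sets \<nu> \<and> D \<in> sets \<Lambda>}" by (rule sets_pair_measure)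
  from B[unfolded sg] show "?P B"
  proof (induction rule: sigma_sets_induct_disjoint[OF Int_stable_pair_measure_generator pair_measure_closed, consumes 1])
    case (1 S)
    then obtain A D where S: "S = A \<times> D" "A \<in> sets \<nu>" "D \<in> sets \<Lambda>" by blast
    have "S \<inter> ?E = A \<times> (D \<inter> C)" using S sets.sets_into_space by blast
    moreover have "emeasure \<Lambda> (D \<inter> C) < \<infinity>" by (rule le_less_trans[OF emeasure_mono C(2)]) (use C in auto)
    ultimately show ?case using agree_rectangle[OF T(2) S(2), of "D \<inter> C"] S(3) C(1) by simp
  next
    case 2
    then show ?case by (rule empty)
  next
    case (3 S)
    then have S: "S \<in> sets \<mu>" unfolding sg by blast
    have eq: "?I (space \<nu> \<times> space \<Lambda> - S) = (\<lambda>y. 1 * indicator ?E y + (- 1) * ?I S y)"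
      using C sets.sets_into_space[OF C(1)] by (auto simp: indicator_def fun_eq_iff)
    show ?case unfolding eq
      by (rule first_chaos_lin[OF T(1) indicator_L2[OF E fE] agree_rectangle[OF T(2) sets.top C] L[OF S] 3(2)])
  next
    case (4 S)
    then have S: "S i \<in> sets \<mu>" for i unfolding sg by blast
    let ?f = "\<lambda>n. ?I (\<Union>i<n. S i)"
    have 0: "?P (\<Union>i<n. S i)" for n
    proof (induction n)
      case 0
      have "(\<Union>i<0. S i) = {}" by simp
      then show ?case using empty by (simp only:)
    next
      case (Suc n)
      have "S n \<inter> S i = {}" if "i < n" for i
        using 4(1) that by (simp add: disjoint_family_on_def)
      then have "S n \<inter> (\<Union>i<n. S i) = {}" by blast
      then have eq: "?I (\<Union>i<Suc n. S i) = (\<lambda>y. 1 * ?I (\<Union>i<n. S i) y + 1 * ?I (S n) y)"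
        by (auto simp: indicator_def fun_eq_iff less_Suc_eq)
      show ?case unfolding eq
        by (rule first_chaos_lin[OF T(1) L Suc L[OF S] 4(3)]) (use S in auto)
    qed
    have "L2_lim \<mu> ?f (?I (\<Union>i. S i))"
    proof (rule L2_lim_dominated[OF _ _ indicator_L2[OF E fE]])
      show "AE y in \<mu>. (\<lambda>n. ?f n y) \<longlonglongrightarrow> ?I (\<Union>i. S i) y"
      proof (rule AE_I2, rule tendsto_eventually)
        fix y show "\<forall>\<^sub>F n in sequentially. ?f n y = ?I (\<Union>i. S i) y"
        proof (cases "\<exists>i. y \<in> S i")
          case True
          then obtain i where "y \<in> S i" by blast
          then have "?f n y = ?I (\<Union>i. S i) y" if "n \<ge> Suc i" for n using that by (auto simp: indicator_def)
          then show ?thesis unfolding eventually_sequentially by blast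
        qed (simp add: indicator_def)
      qed
    qed (use S E in \<open>auto simp: indicator_def\<close>)
    then show ?case by (rule first_chaos_lim[OF T(1) _ 0])
  qed
qed

text \<open>Sigma-finiteness of \<Lambda> removes the restriction to a strip of finite measure by an
  L2 limit.\<close>

lemma agree_indicator:
  assumes T: "surjective_isometry G G.E.HT Q Q.E.HT T" "identical_on_values \<nu> \<Lambda> W Q N T"
    and B: "B \<in> sets \<mu>" "emeasure \<mu> B < \<infinity>"
  shows "aeq Q (T (G.Wc (indicator B))) (P.\<Phi> (G.Wc (indicator B)))"
proof -
  obtain C :: "nat \<Rightarrow> real set" where C: "range C \<subseteq> sets \<Lambda>" "(\<Union>i. C i) = space \<Lambda>" "\<And>i. emeasure \<Lambda> (C i) \<noteq> \<infinity>" "incseq C"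
    using L.sigma_finite_incseq by metis
  have Cs: "C n \<in> sets \<Lambda>" for n using C(1) by blast
  have Cf: "emeasure \<Lambda> (C n) < \<infinity>" for n using C(3)[of n] by (simp add: less_top[symmetric])
  let ?f = "\<lambda>n. indicator (B \<inter> space \<nu> \<times> C n) :: 'x \<times> real \<Rightarrow> real"
  have "L2_lim \<mu> ?f (indicator B)"
  proof (rule L2_lim_dominated[OF _ _ indicator_L2[OF B]])
    show "AE y in \<mu>. (\<lambda>n. ?f n y) \<longlonglongrightarrow> indicator B y"
    proof (rule AE_I2, rule tendsto_eventually)
      fix y assume y: "y \<in> space \<mu>"
      then have "snd y \<in> (\<Union>i. C i)" unfolding C(2) by (auto simp: space_pair_measure)
      then obtain i where i: "snd y \<in> C i" by blast
      have "?f n y = indicator B y" if "n \<ge> i" for n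
        using incseqD[OF C(4) that] i y by (cases y) (auto simp: indicator_def space_pair_measure)
      then show "\<forall>\<^sub>F n in sequentially. ?f n y = indicator B y" unfolding eventually_sequentially by blast
    qed
    show "?f n \<in> borel_measurable \<mu>" for n using B Cs[of n] by measurable
  qed (use B in \<open>auto simp: indicator_def\<close>)
  then show ?thesis
    by (rule first_chaos_lim[OF T(1) _ agree_indicator_finite[OF T Cs Cf B(1)]])
qed

text \<open>The measure \<rho> gives to \<open>A\<close> the squared norm of \<open>h\<close> over
  \<open>A \<times> UNIV\<close>. It is finite because \<open>h\<close> is square-integrable and has
  no atoms because \<nu> has none, so \<open>space \<nu>\<close> can be cut into \<rho>-small
  sets.\<close>

lemma small_cylinders:
  assumes h: "step_fun \<mu> h" and \<delta>: "\<delta> > 0"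
  shows "\<exists>(A :: nat \<Rightarrow> ('x \<times> real) set) n. (\<forall>i<n. A i \<in> (\<lambda>A. A \<times> UNIV) ` sets \<nu>) \<and> disjoint_family_on A {..<n}
       \<and> (\<Union>i<n. A i) = space \<mu> \<and> (\<forall>i<n. (LINT y|\<mu>. restr h (A i) y * restr h (A i) y) \<le> \<delta>)"
proof -
  note [measurable] = step_fun_measurable[OF h]
  let ?r = "\<lambda>A y. restr h (A \<times> UNIV) y * restr h (A \<times> UNIV) y"
  define \<rho> where "\<rho> = distr (density \<mu> (\<lambda>y. ennreal (h y * h y))) \<nu> fst"
  have sets: "sets \<rho> = sets \<nu>" by (simp add: \<rho>_def)
  have em: "emeasure \<rho> A = ennreal (LINT y|\<mu>. ?r A y)" if A: "A \<in> sets \<nu>" for A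
  proof -
    have m: "fst -` A \<inter> space \<mu> \<in> sets \<mu>" using A by measurable
    have i: "integrable \<mu> (?r A)"
    proof (rule Bochner_Integration.integrable_bound[OF step_fun_integrable_mult[OF h h]])
      have [measurable]: "A \<times> UNIV \<in> sets \<mu>" by (rule cylinder[OF A])
      show "?r A \<in> borel_measurable \<mu>" by measurable
    qed auto
    have "emeasure \<rho> A = (\<integral>\<^sup>+ y. ennreal (h y * h y) * indicator (fst -` A \<inter> space \<mu>) y \<partial>\<mu>)"
      unfolding \<rho>_def using A m by (simp add: emeasure_distr emeasure_density)
    also have "\<dots> = (\<integral>\<^sup>+ y. ennreal (?r A y) \<partial>\<mu>)"
      by (rule nn_integral_cong) (auto simp: indicator_def)
    also have "\<dots> = ennreal (LINT y|\<mu>. ?r A y)" by (rule nn_integral_eq_integral[OF i]) simp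
    finally show ?thesis .
  qed
  have me: "measure \<rho> A = (LINT y|\<mu>. ?r A y)" if "A \<in> sets \<nu>" for A
    using em[OF that] by (simp add: measure_def)
  have fin: "finite_measure \<rho>"
    by (rule finite_measureI) (use em[OF sets.top] sets_eq_imp_space_eq[OF sets] in simp)
  have "measure \<rho> {x} = 0" if "x \<in> space \<nu>" for x
  proof -
    have x: "{x} \<in> sets \<nu>" "emeasure \<nu> {x} = 0" using cont that by (auto simp: continuous_measure_def)
    \<comment> \<open>\<Lambda> may have infinite mass; the product with a null set is 0 all the
      same.\<close>
    have "emeasure \<mu> ({x} \<times> UNIV) = 0"
      using L.emeasure_pair_measure_Times[OF x(1) sets.top] x(2) by (simp add: space_\<Lambda>)
    then have "AE y in \<mu>. y \<notin> {x} \<times> UNIV" using cylinder[OF x(1)] by (intro AE_not_in null_setsI)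
    then show ?thesis unfolding me[OF x(1)] by (intro integral_eq_zero_AE) (auto elim!: eventually_mono)
  qed
  from small_partition[OF borel fin sets this \<delta>] obtain A :: "nat \<Rightarrow> 'x set" and n where
    A: "\<And>i. i < n \<Longrightarrow> A i \<in> sets \<nu>" "disjoint_family_on A {..<n}" "(\<Union>i<n. A i) = space \<nu>" "\<And>i. i < n \<Longrightarrow> measure \<rho> (A i) \<le> \<delta>"
    by auto
  have "disjoint_family_on (\<lambda>i. A i \<times> (UNIV :: real set)) {..<n}" using A(2) by (auto simp: disjoint_family_on_def)
  moreover have "(\<Union>i<n. A i \<times> (UNIV :: real set)) = space \<mu>"
    unfolding space_pair_measure space_\<Lambda> A(3)[symmetric] by auto
  ultimately show ?thesis using A(1,4) me by (intro exI[of _ "\<lambda>i. A i \<times> UNIV"] exI[of _ n]) auto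
qed

lemma \<Phi>_unique_values:
  assumes 1: "unity_preserving Q T"
    and T: "special_isomorphism \<nu> G G.E.HT (\<lambda>A. G.E.\<xi> (A \<times> UNIV)) Q Q.E.HT (\<lambda>A. Q.E.\<xi> (A \<times> UNIV)) T"
    and v: "identical_on_values \<nu> \<Lambda> W Q N T" and F: "F \<in> G.E.HT"
  shows "aeq Q (T F) (P.\<Phi> F)"
proof (rule P.\<Phi>_unique[where \<B>="(\<lambda>A. A \<times> UNIV) ` sets \<nu>", OF _ _ _ _ _ _ _ _ small_cylinders F])
  show i: "surjective_isometry G G.E.HT Q Q.E.HT T" using T by (simp add: special_isomorphism_def)
  show "aeq Q (T (\<lambda>_. 1)) (\<lambda>_. 1)" using 1 by (simp add: unity_preserving_def)
  show "aeq Q (T (G.Wc h)) (P.\<Phi> (G.Wc h))" if "step_fun \<mu> h" for h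
    by (rule first_chaos_step[OF i that agree_indicator[OF i v]])
  show "(\<lambda>A. A \<times> UNIV) ` sets \<nu> \<subseteq> sets \<mu>" using cylinder by blast
  show "{} \<in> (\<lambda>A. A \<times> (UNIV :: real set)) ` sets \<nu>" by (rule image_eqI[of _ _ "{}"]) auto
  show "space \<mu> - A \<in> (\<lambda>A. A \<times> UNIV) ` sets \<nu>" if A: "A \<in> (\<lambda>A. A \<times> UNIV) ` sets \<nu>" for A
  proof -
    obtain B where B: "A = B \<times> UNIV" "B \<in> sets \<nu>" using A by blast
    show ?thesis by (rule image_eqI[of _ _ "space \<nu> - B"]) (use B in \<open>auto simp: space_pair_measure space_\<Lambda>\<close>)
  qed
  show "A \<union> B \<in> (\<lambda>A. A \<times> (UNIV :: real set)) ` sets \<nu>"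
    if A: "A \<in> (\<lambda>A. A \<times> UNIV) ` sets \<nu>" "B \<in> (\<lambda>A. A \<times> UNIV) ` sets \<nu>" for A B
  proof -
    obtain C D where C: "A = C \<times> UNIV" "C \<in> sets \<nu>" "B = D \<times> UNIV" "D \<in> sets \<nu>" using A by blast
    show ?thesis by (rule image_eqI[of _ _ "C \<union> D"]) (use C in auto)
  qed
  show "conjugate_algebra G.E.HT Q Q.E.HT T (G.E.\<xi> A) = Q.E.\<xi> A" if A: "A \<in> (\<lambda>A. A \<times> UNIV) ` sets \<nu>" for A
    using T A by (auto simp: special_isomorphism_def)
qed

end

theorem theorem6:
  fixes \<nu> :: "'x measure" and \<Lambda> :: "real measure"
    and G :: "'g measure" and W :: "('x \<times> real \<Rightarrow> real) \<Rightarrow> 'g \<Rightarrow> real"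
    and Q :: "'q measure" and \<eta> :: "('x \<Rightarrow> real) \<Rightarrow> 'q \<Rightarrow> real" and N :: "'q \<Rightarrow> ('x \<times> real) set"
  assumes "standard_borel \<nu>" and "finite_measure \<nu>" and "continuous_measure \<nu>"
    and "sets \<Lambda> = sets borel" and "emeasure \<Lambda> {0} = 0"
    and "(\<integral>\<^sup>+ t. ennreal (t\<^sup>2 / (1 + t\<^sup>2)) \<partial>\<Lambda>) < \<infinity>"
    and "homogeneous_levy_process 0 0 \<Lambda> \<nu> Q \<eta>"
    and "jump_configuration \<Lambda> \<nu> Q \<eta> N"
    and "gaussian_white_noise (\<nu> \<Otimes>\<^sub>M \<Lambda>) G W"
  defines "\<mu> \<equiv> \<nu> \<Otimes>\<^sub>M \<Lambda>"
  defines "H\<^sub>G \<equiv> local_L2 G (gaussian_loc \<mu> G W) (space \<mu>)"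
    and "\<xi>\<^sub>G \<equiv> generated_factorization (space \<mu>) G (gaussian_loc \<mu> G W)"
    and "H\<^sub>Q \<equiv> local_L2 Q (poisson_loc \<mu> Q N) (space \<mu>)"
    and "\<xi>\<^sub>Q \<equiv> generated_factorization (space \<mu>) Q (poisson_loc \<mu> Q N)"
  shows "\<exists>\<Phi>.
    unity_preserving Q \<Phi>
    \<and> special_isomorphism \<nu> G H\<^sub>G (\<lambda>A. \<xi>\<^sub>G (A \<times> UNIV)) Q H\<^sub>Q (\<lambda>A. \<xi>\<^sub>Q (A \<times> UNIV)) \<Phi>
    \<and> (\<forall>h\<in>L2 \<mu>. integrable \<mu> h \<longrightarrow>
         multiplicative_functional \<mu> G (gaussian_loc \<mu> G W) (gaussian_exponential \<mu> W h)
         \<and> multiplicative_functional \<mu> Q (poisson_loc \<mu> Q N) (poisson_exponential \<nu> \<Lambda> N h)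
         \<and> aeq Q (\<Phi> (gaussian_exponential \<mu> W h)) (poisson_exponential \<nu> \<Lambda> N h))
    \<and> real_isomorphism G H\<^sub>G Q H\<^sub>Q \<Phi>
    \<and> identical_on_values \<nu> \<Lambda> W Q N \<Phi>
    \<and> special_isomorphism \<mu> G H\<^sub>G \<xi>\<^sub>G Q H\<^sub>Q \<xi>\<^sub>Q \<Phi>
    \<and> (\<forall>T. unity_preserving Q T
         \<and> special_isomorphism \<nu> G H\<^sub>G (\<lambda>A. \<xi>\<^sub>G (A \<times> UNIV)) Q H\<^sub>Q (\<lambda>A. \<xi>\<^sub>Q (A \<times> UNIV)) T
         \<and> real_isomorphism G H\<^sub>G Q H\<^sub>Q T
         \<and> identical_on_values \<nu> \<Lambda> W Q N T
         \<longrightarrow> (\<forall>F\<in>H\<^sub>G. aeq Q (T F) (\<Phi> F)))"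
proof -
  interpret gaussian_levy \<nu> \<Lambda> G W Q N
  proof (rule gaussian_levy.intro)
    \<comment> \<open>\<Lambda> may have infinite mass near 0; sigma-finiteness is what the product
      measure and Fubini's theorem require of it.\<close>
    show "sigma_finite_measure \<Lambda>" by (rule sigma_finite_levy[OF assms(4-6)])
    show "poisson_process (\<nu> \<Otimes>\<^sub>M \<Lambda>) Q N" using assms(8) by (simp add: jump_configuration_def)
  qed fact+
  have exp: "multiplicative_functional (\<nu> \<Otimes>\<^sub>M \<Lambda>) G (gaussian_loc (\<nu> \<Otimes>\<^sub>M \<Lambda>) G W) (gaussian_exponential (\<nu> \<Otimes>\<^sub>M \<Lambda>) W h)
      \<and> multiplicative_functional (\<nu> \<Otimes>\<^sub>M \<Lambda>) Q (poisson_loc (\<nu> \<Otimes>\<^sub>M \<Lambda>) Q N) (poisson_exponential \<nu> \<Lambda> N h)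
      \<and> aeq Q (P.\<Phi> (gaussian_exponential (\<nu> \<Otimes>\<^sub>M \<Lambda>) W h)) (poisson_exponential \<nu> \<Lambda> N h)"
    if h: "h \<in> L2 (\<nu> \<Otimes>\<^sub>M \<Lambda>)" "integrable (\<nu> \<Otimes>\<^sub>M \<Lambda>) h" for h
  proof -
    have e: "aeq Q (P.\<Phi> (gaussian_exponential (\<nu> \<Otimes>\<^sub>M \<Lambda>) W h)) (poisson_exponential \<nu> \<Lambda> N h)"
      unfolding poisson_exponential_eq[OF h(2)] by (rule \<Phi>_exponential[OF h])
    show ?thesis
      by (intro conjI e multiplicative_exponentials(1)[OF h(1)] multiplicative_exponentials(2)[OF h(1) aeq_sym[OF e]])
  qed
  show ?thesis
    unfolding assms(10-14)
    by (rule exI[of _ P.\<Phi>]) (intro conjI allI impI ballI P.unity_\<Phi> special_isomorphism_fst exp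
        P.real_isomorphism_\<Phi> identical_on_values_\<Phi> P.special_isomorphism_\<Phi>; auto intro: exp \<Phi>_unique_values)
qed

end
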